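(* Let $k\geq 2$ be an integer. The problem $\textsc{Hom}(C_{2k+1})$ is NP-hard on graphs of radius $k+1$ (and hence on graphs of diameter at most $2k+2$), and, unless the Exponential Time Hypothesis fails, it cannot be solved in time $2^{o(n)}\cdot n^{\mathcal{O}(1)}$ on such $n$-vertex graphs.
   Context: All graphs are finite and simple. $C_{2k+1}$ is the cycle on $2k+1$ vertices. For a fixed graph $H$, in the problem $\textsc{Hom}(H)$ the input is a graph $G$ and the question is whether there is a homomorphism from $G$ to $H$, i.e., a mapping $\varphi: V(G)\to V(H)$ with $\varphi(u)\varphi(v)\in E(H)$ for every edge $uv\in E(G)$. The radius of $G$ is the minimum $r$ such that some vertex $z$ has distance at most $r$ to every vertex of $G$; the diameter is the maximum distance between two vertices. *)

theory Defs
  imports "Graph_Theory.Graph_Theory" "HOL-Library.Landau_Symbols"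
begin

section \<open>Deterministic multi-tape Turing machines\<close>

datatype move = Move_Left | Stay | Move_Right

text \<open>
  The states of a machine are \<open>0, \<dots>, states M\<close>, with initial state \<open>0\<close> and halting state
  \<open>states M\<close>; the tape symbols are the numbers below \<open>syms M\<close>, where \<open>0\<close> is the blank and
  \<open>1\<close>, \<open>2\<close> stand for the bits \<open>False\<close>, \<open>True\<close>. Tapes are infinite in both directions.
\<close>

record tm =
  tapes :: nat
  syms :: nat
  states :: nat
  delta :: "nat \<Rightarrow> nat list \<Rightarrow> nat \<times> (nat \<times> move) list"

definition wf_tm :: "tm \<Rightarrow> bool" where
  "wf_tm M \<longleftrightarrow> tapes M \<ge> 1 \<and> syms M \<ge> 3 \<and>
     (\<forall>q rs q' as. q < states M \<and> length rs = tapes M \<and> set rs \<subseteq> {..<syms M} \<and>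
        delta M q rs = (q', as) \<longrightarrow>
        q' \<le> states M \<and> length as = tapes M \<and> fst ` set as \<subseteq> {..<syms M})"

type_synonym tape = "(int \<Rightarrow> nat) \<times> int"
type_synonym config = "nat \<times> tape list"

fun act :: "nat \<times> move \<Rightarrow> tape \<Rightarrow> tape" where
  "act (s, d) (t, h) =
     (t(h := s), case d of Move_Left \<Rightarrow> h - 1 | Stay \<Rightarrow> h | Move_Right \<Rightarrow> h + 1)"

fun tm_step :: "tm \<Rightarrow> config \<Rightarrow> config" where
  "tm_step M (q, ts) =
     (if q < states M
      then let (q', as) = delta M q (map (\<lambda>(t, h). t h) ts) in (q', map2 act as ts)
      else (q, ts))"

definition tape_of :: "bool list \<Rightarrow> int \<Rightarrow> nat" where
  "tape_of w i = (if 0 \<le> i \<and> i < int (length w) then (if w ! nat i then 2 else 1) else 0)"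

definition init_config :: "tm \<Rightarrow> bool list \<Rightarrow> config" where
  "init_config M x = (0, (tape_of x, 0) # replicate (tapes M - 1) (\<lambda>_. 0, 0))"

text \<open>
  The input is on the first tape, the output on the last one. A halted configuration does not
  change any more, so this says that \<open>M\<close> halts after at most \<open>t\<close> steps with output \<open>y\<close>.
\<close>

definition computes_within :: "tm \<Rightarrow> bool list \<Rightarrow> bool list \<Rightarrow> nat \<Rightarrow> bool" where
  "computes_within M x y t \<longleftrightarrow>
     (\<exists>ts. (tm_step M ^^ t) (init_config M x) = (states M, ts) \<and> fst (last ts) = tape_of y)"


section \<open>P, NP and NP-hardness\<close>

definition poly_time_computable :: "(bool list \<Rightarrow> bool list) \<Rightarrow> bool" where
  "poly_time_computable f \<longleftrightarrow>
     (\<exists>M c. wf_tm M \<and> (\<forall>x. computes_within M x (f x) (length x ^ c + c)))"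

definition class_P :: "bool list set set" where
  "class_P = {L. poly_time_computable (\<lambda>x. [x \<in> L])}"

definition pair_words :: "bool list \<Rightarrow> bool list \<Rightarrow> bool list" where
  "pair_words x y = concat (map (\<lambda>b. [True, b]) x) @ [False] @ y"

definition class_NP :: "bool list set set" where
  "class_NP = {L. \<exists>R \<in> class_P. \<exists>c. \<forall>x.
     x \<in> L \<longleftrightarrow> (\<exists>y. length y \<le> length x ^ c + c \<and> pair_words x y \<in> R)}"

text \<open>
  A decision problem is given by an encoding of its instances as words, a set \<open>D\<close> of instances to
  which it is restricted, and the predicate \<open>Q\<close> to be decided. A reduction to the restricted
  problem only produces (encodings of) instances in \<open>D\<close>, and an algorithm solving it need not
  behave sensibly, or even halt, on words that do not encode an instance in \<open>D\<close>.
\<close>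

definition NP_hard_on :: "('i \<Rightarrow> bool list) \<Rightarrow> 'i set \<Rightarrow> ('i \<Rightarrow> bool) \<Rightarrow> bool" where
  "NP_hard_on enc D Q \<longleftrightarrow>
     (\<forall>L \<in> class_NP. \<exists>f. poly_time_computable f \<and>
        (\<forall>x. \<exists>I \<in> D. f x = enc I \<and> (x \<in> L \<longleftrightarrow> Q I)))"

definition solvable_in_time ::
  "('i \<Rightarrow> bool list) \<Rightarrow> 'i set \<Rightarrow> ('i \<Rightarrow> bool) \<Rightarrow> ('i \<Rightarrow> real) \<Rightarrow> bool" where
  "solvable_in_time enc D Q T \<longleftrightarrow>
     (\<exists>M. wf_tm M \<and> (\<forall>I \<in> D. \<exists>t. real t \<le> T I \<and> computes_within M (enc I) [Q I] t))"

text \<open>Solvability in time $2^{o(n)} \cdot n^{O(1)}$, where $n$ is given by \<open>size_of\<close>.\<close>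

definition subexp_solvable ::
  "('i \<Rightarrow> bool list) \<Rightarrow> 'i set \<Rightarrow> ('i \<Rightarrow> bool) \<Rightarrow> ('i \<Rightarrow> nat) \<Rightarrow> bool" where
  "subexp_solvable enc D Q size_of \<longleftrightarrow>
     (\<exists>(f :: nat \<Rightarrow> real) (c :: nat) (T :: nat \<Rightarrow> real).
        f \<in> o(\<lambda>n. real n) \<and> T \<in> O(\<lambda>n. 2 powr f n * real n ^ c) \<and>
        solvable_in_time enc D Q (\<lambda>I. T (size_of I)))"


section \<open>3-SAT and the Exponential Time Hypothesis\<close>

text \<open>
  The literal \<open>(True, v)\<close> is the variable with index \<open>v\<close>, and \<open>(False, v)\<close> is its negation.
  An instance \<open>(n, F)\<close> of 3-SAT is a formula \<open>F\<close> over the \<open>n\<close> variables with indices below \<open>n\<close>.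
\<close>

type_synonym literal = "bool \<times> nat"
type_synonym cnf = "literal list list"

definition satisfiable :: "cnf \<Rightarrow> bool" where
  "satisfiable F \<longleftrightarrow> (\<exists>a :: nat \<Rightarrow> bool. \<forall>C \<in> set F. \<exists>(b, v) \<in> set C. a v = b)"

definition sat3_instances :: "(nat \<times> cnf) set" where
  "sat3_instances = {(n, F). \<forall>C \<in> set F. length C \<le> 3 \<and> (\<forall>(b, v) \<in> set C. v < n)}"

fun enc_literal :: "literal \<Rightarrow> bool list" where
  "enc_literal (b, v) = True # b # replicate v True @ [False]"

definition enc_clause :: "literal list \<Rightarrow> bool list" where
  "enc_clause C = concat (map enc_literal C) @ [False]"

fun enc_cnf :: "nat \<times> cnf \<Rightarrow> bool list" where
  "enc_cnf (n, F) = replicate n True @ [False] @ concat (map enc_clause F)"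

text \<open>
  For some $\delta > 0$, 3-SAT with $n$ variables and $m$ clauses cannot be solved in time
  $2^{\delta n} \cdot (n + m)^{O(1)}$.
\<close>

definition ETH :: bool where
  "ETH \<longleftrightarrow> (\<exists>\<delta> > (0 :: real). \<not> (\<exists>c :: nat.
     solvable_in_time enc_cnf sat3_instances (\<lambda>(n, F). satisfiable F)
       (\<lambda>(n, F). real c * 2 powr (\<delta> * real n) * real (n + length F + 1) ^ c)))"


section \<open>Graphs and homomorphisms\<close>

text \<open>Finite simple graphs are the \<open>pair_graph\<close>s: finite, symmetric and loop-free.\<close>

definition graph_dist :: "'a pair_pre_digraph \<Rightarrow> 'a \<Rightarrow> 'a \<Rightarrow> ereal" where
  "graph_dist G u v = wf_digraph.\<mu> (with_proj G) (\<lambda>_. 1) u v"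

definition graph_radius :: "'a pair_pre_digraph \<Rightarrow> ereal" where
  "graph_radius G = (INF z \<in> pverts G. SUP v \<in> pverts G. graph_dist G z v)"

definition graph_diameter :: "'a pair_pre_digraph \<Rightarrow> ereal" where
  "graph_diameter G = (SUP u \<in> pverts G. SUP v \<in> pverts G. graph_dist G u v)"

definition cycle_graph :: "nat \<Rightarrow> nat pair_pre_digraph" where
  "cycle_graph n = \<lparr> pverts = {..<n},
     parcs = {(i, j). i < n \<and> j < n \<and> (j = (i + 1) mod n \<or> i = (j + 1) mod n)} \<rparr>"

definition hom_exists :: "'a pair_pre_digraph \<Rightarrow> 'b pair_pre_digraph \<Rightarrow> bool" where
  "hom_exists H G \<longleftrightarrow> (\<exists>\<phi>. \<phi> ` pverts G \<subseteq> pverts H \<and>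
     (\<forall>(u, v) \<in> parcs G. (\<phi> u, \<phi> v) \<in> parcs H))"

text \<open>
  As inputs, graphs have vertex set \<open>{..<n}\<close>; they are encoded by \<open>n\<close> in unary followed by the
  rows of the adjacency matrix.
\<close>

definition input_graphs :: "nat pair_pre_digraph set" where
  "input_graphs = {G. pair_graph G \<and> (\<exists>n. pverts G = {..<n})}"

definition num_verts :: "'a pair_pre_digraph \<Rightarrow> nat" where
  "num_verts G = card (pverts G)"

definition enc_graph :: "nat pair_pre_digraph \<Rightarrow> bool list" where
  "enc_graph G = (let n = num_verts G in
     replicate n True @ [False] @ [(i, j) \<in> parcs G. i \<leftarrow> [0..<n], j \<leftarrow> [0..<n]])"

definition radius_graphs :: "nat \<Rightarrow> nat pair_pre_digraph set" where
  "radius_graphs r = {G \<in> input_graphs. graph_radius G = ereal (real r)}"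

definition diameter_at_most_graphs :: "nat \<Rightarrow> nat pair_pre_digraph set" where
  "diameter_at_most_graphs d = {G \<in> input_graphs. graph_diameter G \<le> ereal (real d)}"

end

theory Submission
  imports Defs
begin

text \<open>
  A 3-CNF formula is turned into a graph of 3-colourings and then into a graph of radius \<open>k + 1\<close> all of
  whose vertices hang on a common centre, such that 3-colourings correspond to homomorphisms into the
  odd cycle; the number of vertices is linear in the number of variables and clauses. With the
  Cook-Levin theorem this gives NP-hardness.

  For the lower bound under the Exponential Time Hypothesis, the sparsification lemma is needed: by
  branching on a set of literals contained in many clauses, which is either satisfied itself or forces
  all its extensions to be satisfied, a formula on \<open>n\<close> variables becomes a disjunction of
  $2^{\epsilon n}$ formulas with $O(n)$ clauses. A subexponential algorithm for homomorphisms decides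
  each of them, so that 3-SAT could be solved in time $2^{\delta n}$ for every $\delta > 0$.

  Turing machines are obtained by compiling a small language over stacks, in which all functions
  given by arithmetical expressions with bounded sums can be evaluated in polynomial time.
\<close>


section \<open>A structured language over stacks\<close>

text \<open>A walk of length two from the centre ends at the image of the centre or two steps to
  either side of it; these three places, distinct as 2k+1 \<ge> 5, are the colours. A walk of length
  2k-1 in the odd cycle cannot be closed, because a closed walk of odd length has to wind round it,
  but it can join any two different places. So a subdivided edge of this length says that the
  colours of its ends differ, and its inner vertices are within k-1 of an end, hence within k+1 of
  the centre.

  What shapes the rest is that every reduction has to be a concrete Turing machine. Each word to be
  produced is therefore described by its length and a predicate for its bits, and one compilation of
  bounded arithmetic yields the programs. The branching tree may have exponentially many leaves, so
  it is searched depth first with a worklist of polynomial length, and the given homomorphism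
  algorithm is run as a subroutine at the leaves. The two branches gain at least 1 and at least g,
  of order lo^2, in a potential bounded by O(lo n); for large lo this makes the tree small.\<close>

datatype com = Skip | Push nat nat | Pop nat | Seq com com | Switch nat "nat => com"
  | While nat "nat => bool" com

type_synonym regs = "nat => nat list"

text \<open>Stacks contain positive symbols only, so that the value \<open>0\<close> signals an empty stack.\<close>

definition peek :: "nat list => nat" where
  "peek xs = (case xs of [] => 0 | x # _ => x)"

lemma peek_simps [simp]: "peek [] = 0" "peek (x # xs) = x"
  by (simp_all add: peek_def)

text \<open>\<open>run c s t s'\<close>: started in \<open>s\<close>, the program \<open>c\<close> stops in \<open>s'\<close> after at most \<open>t\<close> machine steps.\<close>

inductive run :: "com => regs => nat => regs => bool" where
  run_Skip: "run Skip s 1 s"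
| run_Push: "run (Push r a) s 2 (s(r := a # s r))"
| run_Pop: "run (Pop r) s 1 (s(r := tl (s r)))"
| run_Seq: "run c s t s' ==> run d s' t' s'' ==> run (Seq c d) s (1 + t + t') s''"
| run_Switch: "run (f (peek (s r))) s t s' ==> run (Switch r f) s (1 + t) s'"
| run_While_False: "\<not> P (peek (s r)) ==> run (While r P c) s 1 s"
| run_While_True: "P (peek (s r)) ==> run c s t s' ==> run (While r P c) s' t' s'' ==>
    run (While r P c) s (1 + t + t') s''"
| run_weaken: "run c s t s' ==> t \<le> t' ==> run c s t' s'"

primrec wf_com :: "nat => nat => com => bool" where
  "wf_com n S Skip = True"
| "wf_com n S (Push r a) = (r < n \<and> 0 < a \<and> a < S)"
| "wf_com n S (Pop r) = (r < n)"
| "wf_com n S (Seq c d) = (wf_com n S c \<and> wf_com n S d)"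
| "wf_com n S (Switch r f) = (r < n \<and> (\<forall>a<S. wf_com n S (f a)))"
| "wf_com n S (While r P c) = (r < n \<and> wf_com n S c)"


section \<open>Simulation by Turing machines\<close>

text \<open>
  A control state is a continuation, i.e. the list of programs still to be executed, together with
  a flag for the second half of a push. Register \<open>r < n\<close> is tape \<open>r\<close>, growing to the left with the
  head on the top symbol. The empty continuation copies register \<open>0\<close> to the output tape \<open>n\<close>.
\<close>

type_synonym ctrl = "bool \<times> com list"

definition idle :: "nat list => (nat \<times> move) list" where
  "idle rs = map (\<lambda>a. (a, Stay)) rs"

fun control :: "nat => ctrl => nat list => ctrl option \<times> (nat \<times> move) list" where
  "control n (b, []) rs = (if rs ! 0 = 0 then (None, idle rs)
     else (Some (False, []), (idle rs)[0 := (0, Move_Right), n := (rs ! 0, Move_Right)]))"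
| "control n (b, Skip # K) rs = (Some (False, K), idle rs)"
| "control n (b, Push r a # K) rs =
     (if b then (Some (False, K), (idle rs)[r := (a, Stay)])
      else (Some (True, Push r a # K), (idle rs)[r := (rs ! r, Move_Left)]))"
| "control n (b, Pop r # K) rs = (Some (False, K), (idle rs)[r := (0, Move_Right)])"
| "control n (b, Seq c d # K) rs = (Some (False, c # d # K), idle rs)"
| "control n (b, Switch r f # K) rs = (Some (False, f (rs ! r) # K), idle rs)"
| "control n (b, While r P c # K) rs =
     (Some (False, if P (rs ! r) then c # While r P c # K else K), idle rs)"

text \<open>A machine needs finitely many states, whereas continuations form an infinite type. This
  finite set contains every continuation that can occur before \<open>K\<close> is reached when
  \<open>c\<close> is started on top of \<open>K\<close>. \<open>Switch\<close> follows only the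
  symbols below \<open>S\<close>, because its branches are indexed by all numbers.\<close>

primrec conts :: "nat => com => com list => com list set" where
  "conts S Skip K = {Skip # K}"
| "conts S (Push r a) K = {Push r a # K}"
| "conts S (Pop r) K = {Pop r # K}"
| "conts S (Seq c d) K = insert (Seq c d # K) (conts S c (d # K) \<union> conts S d K)"
| "conts S (Switch r f) K = insert (Switch r f # K) (\<Union>a<S. conts S (f a) K)"
| "conts S (While r P c) K = insert (While r P c # K) (conts S c (While r P c # K))"

lemma finite_conts: "finite (conts S c K)"
  by (induction c arbitrary: K) auto

lemma self_in_conts: "c # K \<in> conts S c K"
  by (cases c) auto

text \<open>Control stays inside the program until it leaves to \<open>K\<close>. The bound on
  \<open>rs\<close> enters at \<open>Switch\<close>, where only the branches for symbols below
  \<open>S\<close> have been collected.\<close>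

lemma conts_control:
  assumes "K' \<in> conts S c K" "control n (b, K') rs = (Some (b', K''), as)"
    "set rs \<subseteq> {..<S}" "length rs = Suc n" "wf_com n S c"
  shows "K'' \<in> insert K (conts S c K)"
  using assms
proof (induction c arbitrary: K)
  case (Seq c1 c2)
  from Seq.prems(1) consider "K' = Seq c1 c2 # K" | "K' \<in> conts S c1 (c2 # K)" | "K' \<in> conts S c2 K"
    by auto
  then show ?case
  proof cases
    case 1
    then show ?thesis using Seq.prems by (auto simp: self_in_conts)
  next
    case 2
    then have "K'' \<in> insert (c2 # K) (conts S c1 (c2 # K))" using Seq by simp
    then show ?thesis using self_in_conts by auto
  next
    case 3
    then show ?thesis using Seq by auto
  qed
next
  case (Switch r f)
  from Switch.prems(1) consider "K' = Switch r f # K" | a where "a < S" "K' \<in> conts S (f a) K"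
    by auto
  then show ?case
  proof cases
    case 1
    have "rs ! r < S" using Switch.prems by (auto simp: subset_iff)
    then show ?thesis using 1 Switch.prems self_in_conts[of "f (rs ! r)" K S] by auto
  next
    case 2
    then have "K'' \<in> insert K (conts S (f a) K)"
      using Switch.IH[of "f a" K] Switch.prems by auto
    then show ?thesis using 2 by auto
  qed
next
  case (While r P c)
  from While.prems(1) consider "K' = While r P c # K" | "K' \<in> conts S c (While r P c # K)"
    by auto
  then show ?case
  proof cases
    case 1
    then show ?thesis using While.prems self_in_conts by (auto split: if_splits)
  next
    case 2
    then have "K'' \<in> insert (While r P c # K) (conts S c (While r P c # K))" using While by simp
    then show ?thesis by auto
  qed
qed (auto split: if_splits)

lemma wf_conts:
  "K' \<in> conts S c K ==> wf_com n S c ==> \<forall>d\<in>set K. wf_com n S d ==> d \<in> set K' ==> wf_com n S d"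
proof (induction c arbitrary: K)
  case (Seq c1 c2)
  then show ?case by auto
next
  case (While r P c)
  then show ?case using While.IH[of "While r P c # K"] by auto
qed auto

text \<open>The machine before its states are numbered: control states are the continuations
  themselves, and \<open>None\<close> is the halting state.\<close>

fun cstep :: "nat => ctrl option \<times> tape list => ctrl option \<times> tape list" where
  "cstep n (None, ts) = (None, ts)"
| "cstep n (Some q, ts) =
     (let (q', as) = control n q (map (\<lambda>(t, h). t h) ts) in (q', map2 act as ts))"

definition syms_tape :: "nat list => int => nat" where
  "syms_tape xs i = (if 0 \<le> i \<and> i < int (length xs) then xs ! nat i else 0)"

definition stack_tape :: "nat list => int => tape" where
  "stack_tape xs h = (\<lambda>i. syms_tape xs (i - h), h)"

text \<open>Stack heads drift while the program runs, so their positions are existentially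
  quantified. The output tape is pinned to cell 0 instead, because \<open>computes_within\<close>
  compares the whole tape with \<open>tape_of y\<close>.\<close>

definition sim :: "nat => nat => regs => nat list => tape list => bool" where
  "sim n S s out ts \<longleftrightarrow> length ts = Suc n \<and> (\<forall>r<n. \<exists>h. ts ! r = stack_tape (s r) h) \<and>
     (\<forall>r<n. set (s r) \<subseteq> {1..<S}) \<and> ts ! n = (syms_tape out, int (length out))"

lemma head_stack_tape: "(case stack_tape xs h of (t, h) => t h) = peek xs"
  by (cases xs) (auto simp: stack_tape_def syms_tape_def)

lemma act_pop: "act (0, Move_Right) (stack_tape xs h) = stack_tape (tl xs) (h + 1)"
proof -
  have "nat (i - h) - Suc 0 = nat (i - (1 + h))" for i by simp
  then show ?thesis
    by (cases xs) (auto simp: stack_tape_def syms_tape_def fun_eq_iff nth_Cons' add.commute)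
qed

text \<open>An action writes before it moves. So the first step rewrites the old top and moves left,
  the second writes the new symbol there, and \<open>Push\<close> costs two steps.\<close>

lemma act_push: "act (a, Stay) (act (peek xs, Move_Left) (stack_tape xs h)) = stack_tape (a # xs) (h - 1)"
proof -
  have "nat (i - h + 1) - 1 = nat (i - h)" for i by simp
  then show ?thesis
    by (cases xs) (auto simp: stack_tape_def syms_tape_def fun_eq_iff nth_Cons' algebra_simps nat_add_distrib)
qed

lemma act_idle: "act (case x of (t, h) => t h, Stay) x = x"
  by (cases x) auto

lemma act_out:
  "act (a, Move_Right) (syms_tape xs, int (length xs)) = (syms_tape (xs @ [a]), int (length (xs @ [a])))"
  by (auto simp: syms_tape_def fun_eq_iff nth_append)

lemma length_idle [simp]: "length (idle rs) = length rs"
  by (simp add: idle_def)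

lemma map2_idle: "map2 act (idle (map (\<lambda>(t, h). t h) ts)) ts = ts"
  by (rule nth_equalityI) (auto simp: idle_def act_idle)

lemma map2_idle_update:
  "i < length ts ==> map2 act ((idle (map (\<lambda>(t, h). t h) ts))[i := x]) ts = ts[i := act x (ts ! i)]"
  by (rule nth_equalityI) (auto simp: idle_def nth_list_update act_idle)

lemma sim_head: "sim n S s out ts ==> r < n ==> map (\<lambda>(t, h). t h) ts ! r = peek (s r)"
  by (metis head_stack_tape less_SucI nth_map sim_def)

definition reaches :: "nat => ctrl option \<times> tape list => nat => ctrl option \<times> tape list => bool" where
  "reaches n x t y \<longleftrightarrow> (\<exists>t'\<le>t. (cstep n ^^ t') x = y)"

lemma reaches_trans: "reaches n x t y ==> reaches n y t' z ==> reaches n x (t + t') z"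
proof -
  assume "reaches n x t y" "reaches n y t' z"
  then obtain u u' where "u \<le> t" "u' \<le> t'" "(cstep n ^^ u) x = y" "(cstep n ^^ u') y = z"
    by (auto simp: reaches_def)
  then show ?thesis unfolding reaches_def
    by (intro exI[of _ "u' + u"]) (simp add: funpow_add)
qed

lemma reaches_step: "cstep n x = y ==> reaches n x 1 y"
  unfolding reaches_def by (rule exI[of _ 1]) simp

lemma reaches_mono: "reaches n x t y ==> t \<le> t' ==> reaches n x t' y"
  unfolding reaches_def using order_trans by blast

lemma sim_pop:
  assumes "sim n S s out ts" "r < n"
  shows "sim n S (s(r := tl (s r))) out (ts[r := act (0, Move_Right) (ts ! r)])"
proof -
  obtain h where "ts ! r = stack_tape (s r) h" using assms by (auto simp: sim_def)
  then have "act (0, Move_Right) (ts ! r) = stack_tape (tl (s r)) (h + 1)"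
    by (simp only: act_pop)
  moreover have "set (s r) \<subseteq> {1..<S}" using assms by (auto simp: sim_def)
  then have "set (tl (s r)) \<subseteq> {1..<S}" by (cases "s r") auto
  ultimately show ?thesis
    using assms unfolding sim_def by (auto simp: nth_list_update simp del: act.simps)
qed

lemma sim_push:
  assumes "sim n S s out ts" "r < n" "0 < a" "a < S"
  shows "sim n S (s(r := a # s r)) out
    (ts[r := act (a, Stay) (act (peek (s r), Move_Left) (ts ! r))])"
proof -
  obtain h where "ts ! r = stack_tape (s r) h" using assms by (auto simp: sim_def)
  then have "act (a, Stay) (act (peek (s r), Move_Left) (ts ! r)) = stack_tape (a # s r) (h - 1)"
    by (simp only: act_push)
  then show ?thesis
    using assms unfolding sim_def by (auto simp: nth_list_update simp del: act.simps)
qed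

text \<open>The continuation \<open>K\<close> is arbitrary so that the first half of a
  \<open>Seq\<close> or the body of a \<open>While\<close> can be run with the remainder waiting on
  top of \<open>K\<close>.\<close>

lemma run_reaches:
  "run c s t s' ==> wf_com n S c ==> sim n S s out ts ==> 0 < S ==>
    \<exists>ts'. sim n S s' out ts' \<and> reaches n (Some (False, c # K), ts) t (Some (False, K), ts')"
proof (induction arbitrary: ts K rule: run.induct)
  case (run_Skip s)
  then show ?case by (auto simp: map2_idle intro!: exI[of _ ts] reaches_step[unfolded One_nat_def])
next
  case (run_Push r a s)
  define ts1 where "ts1 = ts[r := act (peek (s r), Move_Left) (ts ! r)]"
  have r: "r < n" "r < length ts" using run_Push by (auto simp: sim_def)
  have 1: "cstep n (Some (False, Push r a # K), ts) = (Some (True, Push r a # K), ts1)"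
    using r sim_head[OF run_Push(2) r(1)] by (simp add: map2_idle_update ts1_def del: nth_map)
  have 2: "cstep n (Some (True, Push r a # K), ts1) = (Some (False, K), ts1[r := act (a, Stay) (ts1 ! r)])"
    using r by (subst cstep.simps, subst control.simps) (auto simp: map2_idle_update ts1_def)
  have 3: "ts1[r := act (a, Stay) (ts1 ! r)] = ts[r := act (a, Stay) (act (peek (s r), Move_Left) (ts ! r))]"
    using r by (simp add: ts1_def)
  have "reaches n (Some (False, Push r a # K), ts) (1 + 1)
      (Some (False, K), ts[r := act (a, Stay) (act (peek (s r), Move_Left) (ts ! r))])"
    using reaches_trans[OF reaches_step[OF 1] reaches_step[OF 2]] 3 by simp
  moreover have "sim n S (s(r := a # s r)) out
      (ts[r := act (a, Stay) (act (peek (s r), Move_Left) (ts ! r))])"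
    using run_Push by (intro sim_push) auto
  ultimately show ?case by (metis one_add_one)
next
  case (run_Pop r s)
  have r: "r < n" "r < length ts" using run_Pop by (auto simp: sim_def)
  have "cstep n (Some (False, Pop r # K), ts) = (Some (False, K), ts[r := act (0, Move_Right) (ts ! r)])"
    using r by (simp add: map2_idle_update)
  then show ?case using sim_pop[OF run_Pop(2) r(1)] reaches_step by blast
next
  case (run_Seq c s t s' d t' s'')
  have 0: "reaches n (Some (False, Seq c d # K), ts) 1 (Some (False, c # d # K), ts)"
    by (rule reaches_step) (simp add: map2_idle)
  obtain ts1 where 1: "sim n S s' out ts1" "reaches n (Some (False, c # d # K), ts) t (Some (False, d # K), ts1)"
    using run_Seq.IH(1)[of ts "d # K"] run_Seq.prems by auto
  obtain ts2 where 2: "sim n S s'' out ts2" "reaches n (Some (False, d # K), ts1) t' (Some (False, K), ts2)"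
    using run_Seq.IH(2)[OF _ 1(1), of K] run_Seq.prems by auto
  show ?case using reaches_trans[OF reaches_trans[OF 0 1(2)] 2(2)] 2(1) by blast
next
  case (run_Switch f s r t s')
  have r: "r < n" using run_Switch by simp
  have "peek (s r) < S" using run_Switch.prems r by (cases "s r") (auto simp: sim_def)
  then have wf: "wf_com n S (f (peek (s r)))" using run_Switch by simp
  have 0: "reaches n (Some (False, Switch r f # K), ts) 1 (Some (False, f (peek (s r)) # K), ts)"
    by (rule reaches_step) (simp add: map2_idle sim_head[OF run_Switch.prems(2) r])
  obtain ts1 where 1: "sim n S s' out ts1"
    "reaches n (Some (False, f (peek (s r)) # K), ts) t (Some (False, K), ts1)"
    using run_Switch.IH[OF wf] run_Switch.prems by blast
  show ?case using reaches_trans[OF 0 1(2)] 1(1) by blast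
next
  case (run_While_False P s r c)
  then have "cstep n (Some (False, While r P c # K), ts) = (Some (False, K), ts)"
    by (simp add: map2_idle sim_head[of n S s out])
  then show ?case using run_While_False reaches_step by blast
next
  case (run_While_True P s r c t s' t' s'')
  have 0: "reaches n (Some (False, While r P c # K), ts) 1 (Some (False, c # While r P c # K), ts)"
    using run_While_True by (intro reaches_step) (simp add: map2_idle sim_head[of n S s out])
  obtain ts1 where 1: "sim n S s' out ts1"
    "reaches n (Some (False, c # While r P c # K), ts) t (Some (False, While r P c # K), ts1)"
    using run_While_True.IH(1)[of ts "While r P c # K"] run_While_True.prems by auto
  obtain ts2 where 2: "sim n S s'' out ts2" "reaches n (Some (False, While r P c # K), ts1) t' (Some (False, K), ts2)"
    using run_While_True.IH(2)[OF _ 1(1), of K] run_While_True.prems by auto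
  show ?case using reaches_trans[OF reaches_trans[OF 0 1(2)] 2(2)] 2(1) by blast
next
  case (run_weaken c s t s' t')
  then show ?case using reaches_mono by blast
qed

lemma copy_output:
  assumes "sim n S s out ts" "n \<ge> 1"
  shows "\<exists>ts'. length ts' = Suc n \<and> fst (ts' ! n) = syms_tape (out @ s 0) \<and>
    reaches n (Some (False, []), ts) (length (s 0) + 1) (None, ts')"
  using assms
proof (induction "s 0" arbitrary: s out ts)
  case Nil
  then have "cstep n (Some (False, []), ts) = (None, ts)"
    by (simp add: map2_idle sim_head[of n S s out])
  then have "reaches n (Some (False, []), ts) (length (s 0) + 1) (None, ts)"
    using reaches_step Nil by (metis One_nat_def add.left_neutral list.size(3))
  then show ?case using Nil by (auto simp: sim_def intro!: exI[of _ ts])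
next
  case (Cons a xs)
  have len: "length ts = Suc n" using Cons.prems by (simp add: sim_def)
  define ts1 where "ts1 = ts[0 := act (0, Move_Right) (ts ! 0), n := act (a, Move_Right) (ts ! n)]"
  have hd: "map (\<lambda>(t, h). t h) ts ! 0 = a"
    using Cons.prems Cons.hyps(2) sim_head[of n S s out ts 0] by simp (metis peek_simps(2))
  have "set (s 0) \<subseteq> {1..<S}" using Cons.prems by (simp add: sim_def)
  then have "a \<noteq> 0" using Cons.hyps(2)[symmetric] by simp
  then have "cstep n (Some (False, []), ts) = (Some (False, []), map2 act ((idle (map (\<lambda>(t, h). t h) ts))
      [0 := (0, Move_Right), n := (a, Move_Right)]) ts)"
    using hd by simp
  also have "map2 act ((idle (map (\<lambda>(t, h). t h) ts))[0 := (0, Move_Right), n := (a, Move_Right)]) ts = ts1"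
    by (rule nth_equalityI)
      (use len Cons.prems(2) in \<open>auto simp: ts1_def idle_def nth_list_update act_idle\<close>)
  finally have 1: "reaches n (Some (False, []), ts) 1 (Some (False, []), ts1)" by (rule reaches_step)
  have "sim n S (s(0 := tl (s 0))) (out @ [a]) ts1"
    using sim_pop[OF Cons.prems(1), of 0] Cons.prems(2) act_out[of a out] len Cons.prems(1)
    unfolding sim_def ts1_def by (auto simp: nth_list_update)
  from Cons.hyps(1)[OF _ this] obtain ts' where "length ts' = Suc n" "fst (ts' ! n) = syms_tape ((out @ [a]) @ xs)"
    and 2: "reaches n (Some (False, []), ts1) (length xs + 1) (None, ts')"
    using Cons.prems(2) Cons.hyps(2)[symmetric] by auto
  then show ?case using reaches_trans[OF 1 2] Cons.hyps(2)[symmetric] by auto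
qed

definition bit_sym :: "bool => nat" where "bit_sym b = (if b then 2 else 1)"

lemma tape_of_eq: "tape_of w = syms_tape (map bit_sym w)"
  by (auto simp: tape_of_def syms_tape_def bit_sym_def fun_eq_iff)

definition input_regs :: "bool list => regs" where
  "input_regs x = (\<lambda>_. [])(0 := map bit_sym x)"

lemma control_wf:
  assumes "control n (b, K) rs = (q', as)" "\<forall>d\<in>set K. wf_com n S d" "length rs = Suc n"
    "set rs \<subseteq> {..<S}" "n \<ge> 1" "S > 0"
  shows "length as = Suc n \<and> fst ` set as \<subseteq> {..<S}"
proof -
  have idle: "fst ` set (idle rs) \<subseteq> {..<S}" using assms by (auto simp: idle_def)
  have upd: "fst ` set (xs[i := x]) \<subseteq> {..<S}" if "fst ` set xs \<subseteq> {..<S}" "fst x < S"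
    for xs :: "(nat \<times> move) list" and i x
    using set_update_subset_insert[of xs i x] that by auto
  have nth: "rs ! i < S" if "i < Suc n" for i using that assms by (auto simp: subset_iff)
  show ?thesis
  proof (cases K)
    case Nil
    then show ?thesis using assms(1,3,5,6) idle nth
      upd[OF upd[OF idle, of "(0, Move_Right)" 0], of "(rs ! 0, Move_Right)" n]
      by (auto split: if_splits simp del: subset_iff image_subset_iff)
  next
    case (Cons c K')
    have upd': "a < S" if "(a, d) \<in> set ((idle rs)[i := x])" "fst x < S" for a d i x
      using upd[OF idle, of x i] that by force
    show ?thesis using Cons assms(1-3,5,6) idle nth
      by (cases c) (auto dest: upd' split: if_splits)
  qed
qed

theorem com_to_tm:
  assumes wf: "wf_com n S c" and n: "n \<ge> 1" and S: "S \<ge> 3"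
  shows "\<exists>M. wf_tm M \<and> (\<forall>x y t s'. run c (input_regs x) t s' \<and> s' 0 = map bit_sym y \<longrightarrow>
    computes_within M x y (t + length y + 1))"
proof -
  \<comment> \<open>The empty continuation, in which the output is copied, is not in
    \<open>conts\<close> and has to be added.\<close>
  define Q :: "ctrl set" where "Q = UNIV \<times> insert [] (conts S c [])"
  have finQ: "finite Q" unfolding Q_def by (intro finite_cartesian_product finite.insertI finite_conts) simp
  define q0 :: ctrl where "q0 = (False, [c])"
  have q0: "q0 \<in> Q" by (simp add: Q_def q0_def self_in_conts)
  \<comment> \<open>The start state comes first in the enumeration, because a machine starts in
    state 0; the index one past the end is left for halting.\<close>
  obtain l where l: "set l = Q - {q0}" "distinct l"
    using finQ finite_distinct_list[of "Q - {q0}"] by auto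
  define qs where "qs = q0 # l"
  have qs: "set qs = Q" "distinct qs" using l q0 by (auto simp: qs_def)
  define idx where "idx q = (case q of None => length qs | Some q => (THE i. i < length qs \<and> qs ! i = q))" for q
  have idx: "idx (Some (qs ! i)) = i" if "i < length qs" for i
  proof -
    have "(THE j. j < length qs \<and> qs ! j = qs ! i) = i"
      by (rule the_equality) (use that nth_eq_iff_index_eq[OF qs(2), of _ i] in auto)
    then show ?thesis by (simp add: idx_def)
  qed
  have idx_less: "idx (Some q) < length qs" "qs ! idx (Some q) = q" if "q \<in> Q" for q
  proof -
    have "q \<in> set qs" using that qs(1) by blast
    then obtain i where i: "i < length qs" "qs ! i = q" unfolding in_set_conv_nth by blast
    have "idx (Some q) = i" using idx[OF i(1)] unfolding i(2) .
    then show "idx (Some q) < length qs" "qs ! idx (Some q) = q" using i by simp_all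
  qed
  define M where "M = \<lparr>tapes = Suc n, syms = S, states = length qs,
    delta = \<lambda>i rs. map_prod idx id (control n (qs ! i) rs)\<rparr>"
  have closed: "q' \<in> Q" if "q \<in> Q" "control n q rs = (Some q', as)" "length rs = Suc n" "set rs \<subseteq> {..<S}"
    for q q' rs as
  proof (cases q)
    case [simp]: (Pair b K)
    obtain b' K' where q': "q' = (b', K')" by force
    show ?thesis
    proof (cases "K = []")
      case True
      then show ?thesis using that q' by (auto simp: Q_def split: if_splits)
    next
      case False
      then have "K \<in> conts S c []" using that by (auto simp: Q_def)
      from conts_control[OF this, of n b rs b' K' as] show ?thesis using that wf q' by (auto simp: Q_def)
    qed
  qed
  have wf_Q: "wf_com n S d" if "(b, K) \<in> Q" "d \<in> set K" for b K d
    using that wf_conts[of K S c "[]" n d] wf by (auto simp: Q_def)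
  have ctl: "length as = Suc n \<and> fst ` set as \<subseteq> {..<S}"
    if "q \<in> Q" "control n q rs = (q', as)" "length rs = Suc n" "set rs \<subseteq> {..<S}" for q q' rs as
  proof -
    obtain b K where [simp]: "q = (b, K)" by force
    show ?thesis using control_wf[of n b K rs q' as S] that n S wf_Q[of b K] by auto
  qed
  have wfM: "wf_tm M"
    unfolding wf_tm_def
  proof (intro conjI allI impI)
    fix q rs q' as
    assume asm: "q < states M \<and> length rs = tapes M \<and> set rs \<subseteq> {..<syms M} \<and> delta M q rs = (q', as)"
    obtain p bs where p: "control n (qs ! q) rs = (p, bs)" by force
    have q': "q' = idx p" "as = bs" using asm p by (auto simp: M_def)
    have qQ: "qs ! q \<in> Q" using asm qs by (auto simp: M_def)
    show "q' \<le> states M"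
    proof (cases p)
      case None
      then show ?thesis by (simp add: q' M_def idx_def)
    next
      case (Some a)
      then show ?thesis using closed[of "qs ! q" rs a bs] p asm qQ idx_less(1)[of a] q'
        by (auto simp: M_def)
    qed
    show "length as = tapes M" "fst ` set as \<subseteq> {..<syms M}"
      using ctl[OF qQ p] asm q' by (auto simp: M_def)
  qed (use n S in \<open>auto simp: M_def\<close>)
  define ok where "ok ts \<longleftrightarrow> length ts = Suc n \<and> (\<forall>(t, h)\<in>set ts. \<forall>i. t i < S)" for ts :: "tape list"
  \<comment> \<open>Numbering the states commutes with a step as long as the state is in
    \<open>Q\<close> and all cells hold symbols below \<open>S\<close>; both conditions are
    preserved.\<close>
  have transfer: "(\<forall>q'. fst (cstep n (q, ts)) = Some q' \<longrightarrow> q' \<in> Q) \<and> ok (snd (cstep n (q, ts))) \<and>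
      tm_step M (idx q, ts) = (idx (fst (cstep n (q, ts))), snd (cstep n (q, ts)))"
    if q: "\<forall>q'. q = Some q' \<longrightarrow> q' \<in> Q" and ts: "ok ts" for q ts
  proof (cases q)
    case None
    then show ?thesis using ts by (simp add: M_def idx_def)
  next
    case (Some p)
    define rs where "rs = map (\<lambda>(t, h). t h) ts"
    have rs: "length rs = Suc n" "set rs \<subseteq> {..<S}" using ts by (auto simp: rs_def ok_def)
    obtain q' as where q': "control n p rs = (q', as)" by force
    have pQ: "p \<in> Q" using q Some by simp
    have as: "length as = Suc n" "fst ` set as \<subseteq> {..<S}" using ctl[OF pQ q' rs] by auto
    have "ok (map2 act as ts)"
      unfolding ok_def
    proof (intro conjI ballI)
      fix x assume "x \<in> set (map2 act as ts)"
      then obtain u v where "(u, v) \<in> set (zip as ts)" "x = act u v" by auto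
      then have "u \<in> set as" "v \<in> set ts" by (auto dest: set_zip_leftD set_zip_rightD)
      moreover obtain a d t h where "u = (a, d)" "v = (t, h)" by (metis surj_pair)
      ultimately show "case x of (t, h) => \<forall>i. t i < S"
        using as ts \<open>x = act u v\<close> by (auto simp: ok_def subset_iff)
    qed (use as ts in \<open>auto simp: ok_def\<close>)
    then show ?thesis using Some q' closed[OF pQ _ rs] idx_less[OF pQ]
      by (auto simp: M_def rs_def[symmetric])
  qed
  have iter: "(\<forall>q'. fst ((cstep n ^^ t) (q, ts)) = Some q' \<longrightarrow> q' \<in> Q) \<and> ok (snd ((cstep n ^^ t) (q, ts))) \<and>
      (tm_step M ^^ t) (idx q, ts) = (idx (fst ((cstep n ^^ t) (q, ts))), snd ((cstep n ^^ t) (q, ts)))"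
    if q: "\<forall>q'. q = Some q' \<longrightarrow> q' \<in> Q" and ts: "ok ts" for q ts t
  proof (induction t)
    case (Suc t)
    obtain q1 ts1 where 1: "(cstep n ^^ t) (q, ts) = (q1, ts1)" by force
    have "(cstep n ^^ Suc t) (q, ts) = cstep n (q1, ts1)"
      "(tm_step M ^^ Suc t) (idx q, ts) = tm_step M (idx q1, ts1)"
      using Suc by (simp_all add: 1)
    then show ?case using transfer[of q1 ts1] Suc by (simp add: 1)
  qed (use q ts in auto)
  have halt: "(tm_step M ^^ t) (states M, ts) = (states M, ts)" for t ts
    by (induction t) auto
  have "computes_within M x y (t + length y + 1)"
    if r: "run c (input_regs x) t s'" "s' 0 = map bit_sym y" for x y t s'
  proof -
    define ts where "ts = (tape_of x, 0::int) # replicate n (\<lambda>_. 0, 0)"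
    have init: "init_config M x = (idx (Some q0), ts)"
      using idx[of 0] by (auto simp: init_config_def M_def ts_def qs_def)
    have st0: "stack_tape [] 0 = (\<lambda>_. 0, 0)" "(syms_tape [], 0) = (\<lambda>_. 0, 0::int)"
      by (auto simp: stack_tape_def syms_tape_def fun_eq_iff)
    have "\<exists>h. ts ! r = stack_tape (input_regs x r) h" if "r < n" for r
      using that st0 by (cases r) (auto simp: ts_def input_regs_def tape_of_eq stack_tape_def intro: exI[of _ 0])
    moreover have "ts ! n = (syms_tape [], int (length []))" using st0 n by (simp add: ts_def nth_Cons')
    ultimately have sim: "sim n S (input_regs x) [] ts"
      using S by (auto simp: sim_def ts_def input_regs_def bit_sym_def split: if_splits)
    have ok: "ok ts" using S by (auto simp: ok_def ts_def tape_of_def)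
    obtain ts1 where 1: "sim n S s' [] ts1" "reaches n (Some q0, ts) t (Some (False, []), ts1)"
      using run_reaches[OF r(1) wf sim, of "[]"] S by (auto simp: q0_def)
    obtain ts2 where 2: "length ts2 = Suc n" "fst (ts2 ! n) = syms_tape (s' 0)"
      "reaches n (Some (False, []), ts1) (length (s' 0) + 1) (None, ts2)"
      using copy_output[OF 1(1) n] by auto
    obtain t' where t': "t' \<le> t + (length y + 1)" "(cstep n ^^ t') (Some q0, ts) = (None, ts2)"
      using reaches_trans[OF 1(2) 2(3)] r(2) by (auto simp: reaches_def)
    have "(tm_step M ^^ t') (init_config M x) = (states M, ts2)"
      using iter[of "Some q0" ts t'] t' q0 ok init by (simp add: idx_def M_def)
    \<comment> \<open>A halted configuration is stationary, which pads the run to the stated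
      bound.\<close>
    then have "(tm_step M ^^ (t + length y + 1 - t' + t')) (init_config M x) = (states M, ts2)"
      by (simp add: funpow_add halt)
    moreover have "fst (last ts2) = tape_of y"
    proof -
      have "ts2 \<noteq> []" using 2(1) by auto
      then show ?thesis using 2(1,2) r(2) by (simp add: tape_of_eq last_conv_nth)
    qed
    ultimately show ?thesis using t'(1) by (auto simp: computes_within_def)
  qed
  then show ?thesis using wfM by blast
qed

section \<open>Arithmetical definability\<close>

text \<open>Few constructors keep the compiler small: products, comparisons, quantifiers, division
  and composition are all derived from \<open>Sum\<close> and truncated \<open>Sub\<close>. For a
  fixed expression the value is polynomial in the lengths of the words and the variables, so numbers
  can be kept in unary.\<close>

datatype aexp = Const nat | Var nat | Len nat | Bit nat aexp | Add aexp aexp | Sub aexp aexp | Sum aexp aexp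

primrec val :: "aexp => (nat => bool list) => (nat => nat) => nat" where
  "val (Const c) R \<sigma> = c"
| "val (Var i) R \<sigma> = \<sigma> i"
| "val (Len r) R \<sigma> = length (R r)"
| "val (Bit r a) R \<sigma> = of_bool (val a R \<sigma> < length (R r) \<and> R r ! val a R \<sigma>)"
| "val (Add a b) R \<sigma> = val a R \<sigma> + val b R \<sigma>"
| "val (Sub a b) R \<sigma> = val a R \<sigma> - val b R \<sigma>"
| "val (Sum a b) R \<sigma> = (\<Sum>i<val a R \<sigma>. val b R (case_nat i \<sigma>))"

primrec wf_exp :: "nat => aexp => bool" where
  "wf_exp b (Const c) = True"
| "wf_exp b (Var i) = True"
| "wf_exp b (Len r) = (r < b)"
| "wf_exp b (Bit r a) = (r < b \<and> wf_exp b a)"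
| "wf_exp b (Add e f) = (wf_exp b e \<and> wf_exp b f)"
| "wf_exp b (Sub e f) = (wf_exp b e \<and> wf_exp b f)"
| "wf_exp b (Sum e f) = (wf_exp b e \<and> wf_exp b f)"

primrec rename :: "(nat => nat) => aexp => aexp" where
  "rename f (Const c) = Const c"
| "rename f (Var i) = Var (f i)"
| "rename f (Len r) = Len r"
| "rename f (Bit r a) = Bit r (rename f a)"
| "rename f (Add a b) = Add (rename f a) (rename f b)"
| "rename f (Sub a b) = Sub (rename f a) (rename f b)"
| "rename f (Sum a b) = Sum (rename f a) (rename (case_nat 0 (\<lambda>n. Suc (f n))) b)"

lemma val_rename: "val (rename f e) R \<sigma> = val e R (\<lambda>i. \<sigma> (f i))"
proof (induction e arbitrary: f \<sigma>)
  case (Sum e1 e2)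
  have "(\<lambda>k. case_nat i \<sigma> (case_nat 0 (\<lambda>n. Suc (f n)) k)) = case_nat i (\<lambda>k. \<sigma> (f k))" for i
    by (auto simp: fun_eq_iff split: nat.split)
  then show ?case using Sum by simp
qed auto

lemma wf_rename: "wf_exp b (rename f e) = wf_exp b e"
  by (induction e arbitrary: f) auto

text \<open>
  The arguments of a definable function are the contents of the registers below \<open>b\<close> and an
  environment for the de Bruijn-indexed numerical variables.
\<close>

definition definable :: "nat => ((nat => bool list) => (nat => nat) => nat) => bool" where
  "definable b f \<longleftrightarrow> (\<exists>e. wf_exp b e \<and> (\<forall>R \<sigma>. val e R \<sigma> = f R \<sigma>))"

abbreviation definableP :: "nat => ((nat => bool list) => (nat => nat) => bool) => bool" where
  "definableP b P \<equiv> definable b (\<lambda>R \<sigma>. of_bool (P R \<sigma>))"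

named_theorems def_intros

lemma def_const [def_intros]: "definable b (\<lambda>R \<sigma>. c)"
  unfolding definable_def by (rule exI[of _ "Const c"]) simp

lemma def_var [def_intros]: "definable b (\<lambda>R \<sigma>. \<sigma> n)"
  unfolding definable_def by (rule exI[of _ "Var n"]) simp

lemma def_len [def_intros]: "r < b ==> definable b (\<lambda>R \<sigma>. length (R r))"
  unfolding definable_def by (rule exI[of _ "Len r"]) simp

lemma def_add [def_intros]: "definable b f ==> definable b g ==> definable b (\<lambda>R \<sigma>. f R \<sigma> + g R \<sigma>)"
  unfolding definable_def by (metis val.simps(5) wf_exp.simps(5))

lemma def_sub [def_intros]: "definable b f ==> definable b g ==> definable b (\<lambda>R \<sigma>. f R \<sigma> - g R \<sigma>)"
  unfolding definable_def by (metis val.simps(6) wf_exp.simps(6))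

definition bit_at :: "bool list => nat => bool" where
  "bit_at xs i \<longleftrightarrow> i < length xs \<and> xs ! i"

lemma def_bit [def_intros]:
  "r < b ==> definable b f ==> definableP b (\<lambda>R \<sigma>. bit_at (R r) (f R \<sigma>))"
  unfolding definable_def bit_at_def by (metis val.simps(4) wf_exp.simps(4))

text \<open>The index becomes variable 0 and the other variables are shifted. With the premise
  written in terms of \<open>\<sigma> 0\<close> and the shifted environment, higher-order
  unification reads the body off an ordinary bounded sum, so that \<open>intro def_intros\<close>
  can descend into it.\<close>

lemma def_sum [def_intros]:
  assumes "definable b f" "definable b (\<lambda>R \<sigma>. g R (\<sigma> 0) (\<lambda>n. \<sigma> (Suc n)))"
  shows "definable b (\<lambda>R \<sigma>. \<Sum>i<f R \<sigma>. g R i \<sigma>)"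
proof -
  obtain e e' where e: "wf_exp b e" "\<And>R \<sigma>. val e R \<sigma> = f R \<sigma>"
    "wf_exp b e'" "\<And>R \<sigma>. val e' R \<sigma> = g R (\<sigma> 0) (\<lambda>n. \<sigma> (Suc n))"
    using assms unfolding definable_def by blast
  show ?thesis unfolding definable_def by (rule exI[of _ "Sum e e'"]) (simp add: e)
qed

lemma def_weaken:
  assumes "definable b f"
  shows "definable b (\<lambda>R \<sigma>. f R (\<lambda>n. \<sigma> (Suc n)))"
  using assms unfolding definable_def by (metis val_rename wf_rename)

lemma def_mult [def_intros]:
  assumes "definable b f" "definable b g"
  shows "definable b (\<lambda>R \<sigma>. f R \<sigma> * g R \<sigma>)"
proof -
  have "definable b (\<lambda>R \<sigma>. \<Sum>i<f R \<sigma>. g R \<sigma>)"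
    by (rule def_sum[OF assms(1) def_weaken[OF assms(2)]])
  then show ?thesis by simp
qed

lemma definable_cong: "definable b f ==> (\<And>R \<sigma>. g R \<sigma> = f R \<sigma>) ==> definable b g"
  unfolding definable_def by metis

lemma def_not [def_intros]: "definableP b P ==> definableP b (\<lambda>R \<sigma>. \<not> P R \<sigma>)"
  by (rule definable_cong[OF def_sub[OF def_const[of b 1]]]) auto

lemma def_conj [def_intros]:
  "definableP b P ==> definableP b Q ==> definableP b (\<lambda>R \<sigma>. P R \<sigma> \<and> Q R \<sigma>)"
  by (rule definable_cong[OF def_mult, of b "\<lambda>R \<sigma>. of_bool (P R \<sigma>)" "\<lambda>R \<sigma>. of_bool (Q R \<sigma>)"]) auto

lemma def_disj [def_intros]:
  "definableP b P ==> definableP b Q ==> definableP b (\<lambda>R \<sigma>. P R \<sigma> \<or> Q R \<sigma>)"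
  by (rule definable_cong[OF def_not[OF def_conj[OF def_not def_not]]]) auto

lemma def_imp [def_intros]:
  "definableP b P ==> definableP b Q ==> definableP b (\<lambda>R \<sigma>. P R \<sigma> \<longrightarrow> Q R \<sigma>)"
  by (rule definable_cong[OF def_disj[OF def_not]]) auto

text \<open>In truncated subtraction, 1 - (1 - (g - f)) is the sign of g - f.\<close>

lemma def_less [def_intros]:
  "definable b f ==> definable b g ==> definableP b (\<lambda>R \<sigma>. f R \<sigma> < g R \<sigma>)"
  by (rule definable_cong[OF def_sub[OF def_const[of b 1] def_sub[OF def_const[of b 1] def_sub[of b g f]]]]) auto

lemma def_le [def_intros]:
  "definable b f ==> definable b g ==> definableP b (\<lambda>R \<sigma>. f R \<sigma> \<le> g R \<sigma>)"
  by (rule definable_cong[OF def_not[OF def_less[of b g f]]]) auto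

lemma def_eq [def_intros]:
  "definable b f ==> definable b g ==> definableP b (\<lambda>R \<sigma>. f R \<sigma> = g R \<sigma>)"
  by (rule definable_cong[OF def_conj[OF def_le[of b f g] def_le[of b g f]]]) auto

lemma def_if [def_intros]:
  "definableP b P ==> definable b f ==> definable b g ==>
    definable b (\<lambda>R \<sigma>. if P R \<sigma> then f R \<sigma> else g R \<sigma>)"
  by (rule definable_cong[OF def_add[OF def_mult[of b "\<lambda>R \<sigma>. of_bool (P R \<sigma>)" f]
        def_mult[of b "\<lambda>R \<sigma>. of_bool (\<not> P R \<sigma>)" g]]]) (auto intro: def_not)

lemma def_ex [def_intros]:
  assumes "definable b f" "definableP b (\<lambda>R \<sigma>. P R (\<sigma> 0) (\<lambda>n. \<sigma> (Suc n)))"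
  shows "definableP b (\<lambda>R \<sigma>. \<exists>i<f R \<sigma>. P R i \<sigma>)"
  by (rule definable_cong[OF def_less[OF def_const[of b 0] def_sum[OF assms]]])
    (auto simp: sum_eq_0_iff simp flip: neq0_conv)

lemma def_all [def_intros]:
  assumes "definable b f" "definableP b (\<lambda>R \<sigma>. P R (\<sigma> 0) (\<lambda>n. \<sigma> (Suc n)))"
  shows "definableP b (\<lambda>R \<sigma>. \<forall>i<f R \<sigma>. P R i \<sigma>)"
  by (rule definable_cong[OF def_not[OF def_ex[OF assms(1) def_not[OF assms(2)]]]]) auto

text \<open>Composition without a substitution on expressions: in a sum over the i up to f, the
  indicator of i = f leaves the single term h f. A definability result can thus be reused under
  arbitrary arguments, without unfolding the definition again.\<close>

lemma def_comp1:
  assumes "definable b (\<lambda>R \<sigma>. h R (\<sigma> 0))" "definable b f"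
  shows "definable b (\<lambda>R \<sigma>. h R (f R \<sigma>))"
proof -
  have "definable b (\<lambda>R \<sigma>. \<Sum>i<f R \<sigma> + 1. of_bool (i = f R \<sigma>) * h R i)"
    by (intro def_intros assms def_weaken[OF assms(2)])
  then show ?thesis by (rule definable_cong) simp
qed

lemma def_comp2:
  assumes "definable b (\<lambda>R \<sigma>. h R (\<sigma> 0) (\<sigma> 1))" "definable b f" "definable b g"
  shows "definable b (\<lambda>R \<sigma>. h R (f R \<sigma>) (g R \<sigma>))"
proof -
  have "definable b (\<lambda>R \<sigma>. \<Sum>j<g R \<sigma> + 1. \<Sum>i<f R \<sigma> + 1. of_bool (i = f R \<sigma>) * (of_bool (j = g R \<sigma>) * h R i j))"
    using assms(1)
    by (intro def_intros assms def_weaken[OF assms(2)] def_weaken[OF assms(3)]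
      def_weaken[OF def_weaken[OF assms(2)]] def_weaken[OF def_weaken[OF assms(3)]]) simp_all
  then show ?thesis by (rule definable_cong) (simp add: sum_distrib_left[symmetric] flip: mult.assoc)
qed

lemma def_comp3:
  assumes h: "definable b (\<lambda>R \<sigma>. h R (\<sigma> 0) (\<sigma> 1) (\<sigma> 2))"
    and "definable b f" "definable b g" "definable b k"
  shows "definable b (\<lambda>R \<sigma>. h R (f R \<sigma>) (g R \<sigma>) (k R \<sigma>))"
proof -
  note w = def_weaken[OF def_weaken[OF def_weaken[OF assms(2)]]] def_weaken[OF def_weaken[OF def_weaken[OF assms(3)]]]
    def_weaken[OF def_weaken[OF def_weaken[OF assms(4)]]] def_weaken[OF assms(2)] def_weaken[OF assms(3)]
    def_weaken[OF assms(4)] def_weaken[OF def_weaken[OF assms(2)]] def_weaken[OF def_weaken[OF assms(3)]]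
    def_weaken[OF def_weaken[OF assms(4)]]
  have "definable b (\<lambda>R \<sigma>. \<Sum>l<k R \<sigma> + 1. \<Sum>j<g R \<sigma> + 1. \<Sum>i<f R \<sigma> + 1.
      of_bool (i = f R \<sigma>) * (of_bool (j = g R \<sigma>) * (of_bool (l = k R \<sigma>) * h R i j l)))"
    using h by (intro def_intros assms w) (simp_all add: numeral_2_eq_2)
  then show ?thesis by (rule definable_cong) (simp add: sum_distrib_left[symmetric] flip: mult.assoc)
qed

lemma def_div [def_intros]:
  assumes "definable b f" "definable b g"
  shows "definable b (\<lambda>R \<sigma>. f R \<sigma> div g R \<sigma>)"
proof -
  \<comment> \<open>For positive y, x div y counts the q with (q + 1) * y \<le> x.\<close>
  have eq: "x div y = (if y = 0 then 0 else \<Sum>q<x. of_bool (q * y + y \<le> x))" for x y :: nat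
  proof (cases "y = 0")
    case False
    then have "{q. q < x \<and> q * y + y \<le> x} = {..<x div y}"
      by (auto simp: less_eq_div_iff_mult_less_eq Suc_le_eq[symmetric] simp del: Suc_le_eq)
        (metis add.commute div_le_dividend le_trans less_eq_div_iff_mult_less_eq mult_Suc neq0_conv Suc_le_eq)
    then show ?thesis using False
      by (simp add: of_bool_def sum.If_cases Int_def lessThan_def conj_commute flip: sum.inter_filter)
  qed simp
  have "definable b (\<lambda>R \<sigma>. if g R \<sigma> = 0 then 0 else \<Sum>q<f R \<sigma>. of_bool (q * g R \<sigma> + g R \<sigma> \<le> f R \<sigma>))"
    by (intro def_intros assms assms[THEN def_weaken])
  then show ?thesis by (rule definable_cong) (rule eq)
qed

lemma def_mod [def_intros]:
  assumes "definable b f" "definable b g"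
  shows "definable b (\<lambda>R \<sigma>. f R \<sigma> mod g R \<sigma>)"
  by (rule definable_cong[OF def_sub[OF assms(1) def_mult[OF assms(2) def_div[OF assms]]]])
    (simp add: minus_mult_div_eq_mod)

lemma def_power [def_intros]:
  assumes "definable b f"
  shows "definable b (\<lambda>R \<sigma>. f R \<sigma> ^ c)"
  by (induction c) (auto intro!: def_intros assms)

text \<open>Any function on finitely many values is definable by cases; in this way the transition
  function of an arbitrary machine enters an expression.\<close>

lemma def_table:
  assumes "definable b f"
  shows "definable b (\<lambda>R \<sigma>. if f R \<sigma> < c then g (f R \<sigma>) else 0)"
proof (induction c)
  case (Suc c)
  have "definable b (\<lambda>R \<sigma>. if f R \<sigma> = c then g c else if f R \<sigma> < c then g (f R \<sigma>) else 0)"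
    by (intro def_intros assms Suc)
  then show ?case by (rule definable_cong) (auto simp: less_Suc_eq)
qed (simp add: def_const)

section \<open>Polynomial bounds\<close>

text \<open>The base is at least 2, so constants and sums are absorbed by raising the exponent
  alone.\<close>

definition polyb :: "(nat => nat) => bool" where
  "polyb f \<longleftrightarrow> (\<exists>c. \<forall>M. f M \<le> (M + 2) ^ c)"

named_theorems polyb_intros

lemma polyb_const [polyb_intros]: "polyb (\<lambda>M. k)"
proof -
  have "k \<le> (M + 2) ^ k" for M
    using less_exp[of k] power_mono[of 2 "M + 2" k] by linarith
  then show ?thesis unfolding polyb_def by blast
qed

lemma polyb_id [polyb_intros]: "polyb (\<lambda>M. M)"
  unfolding polyb_def by (rule exI[of _ 1]) simp

lemma polyb_mult [polyb_intros]: "polyb f ==> polyb g ==> polyb (\<lambda>M. f M * g M)"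
  unfolding polyb_def by (metis mult_le_mono power_add)

lemma polyb_add [polyb_intros]:
  assumes "polyb f" "polyb g" shows "polyb (\<lambda>M. f M + g M)"
proof -
  obtain c d where c: "\<And>M. f M \<le> (M + 2) ^ c" and d: "\<And>M. g M \<le> (M + 2) ^ d"
    using assms unfolding polyb_def by blast
  have "f M + g M \<le> (M + 2) ^ (c + d + 1)" for M
  proof -
    have "(M + 2) ^ c \<le> (M + 2) ^ (c + d)" "(M + 2) ^ d \<le> (M + 2) ^ (c + d)"
      by (auto intro!: power_increasing)
    then have "f M + g M \<le> 2 * (M + 2) ^ (c + d)" using c[of M] d[of M] by linarith
    also have "\<dots> \<le> (M + 2) * (M + 2) ^ (c + d)" by (intro mult_right_mono) auto
    finally show ?thesis by simp
  qed
  then show ?thesis unfolding polyb_def by blast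
qed

lemma polyb_Suc [polyb_intros]: "polyb f ==> polyb (\<lambda>M. Suc (f M))"
  using polyb_add[OF _ polyb_const[of 1]] by simp

lemma polyb_power [polyb_intros]: "polyb f ==> polyb (\<lambda>M. f M ^ k)"
  by (induction k) (auto intro!: polyb_intros)

lemma polyb_mono: "polyb g ==> (\<And>M. f M \<le> g M) ==> polyb f"
  unfolding polyb_def using order_trans by blast

lemma polyb_compose:
  assumes "polyb f" "polyb g" shows "polyb (\<lambda>M. f (g M))"
proof -
  obtain c where c: "\<And>M. f M \<le> (M + 2) ^ c" using assms unfolding polyb_def by blast
  have "polyb (\<lambda>M. (g M + 2) ^ c)" by (intro polyb_intros assms)
  then show ?thesis by (rule polyb_mono) (rule c)
qed

section \<open>Evaluation of definable functions by programs\<close>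

definition pos_regs :: "regs => bool" where
  "pos_regs s \<longleftrightarrow> (\<forall>r. 0 \<notin> set (s r))"

lemma pos_regsD: "pos_regs s ==> 0 \<notin> set (s r)"
  by (simp add: pos_regs_def)

lemma run_cong: "run c s t s' ==> s' = s'' ==> run c s t s''"
  by simp

text \<open>States are indexed by the number of rounds still to come, matching a unary counter that
  is popped once per round.\<close>

lemma run_counted_loop:
  assumes "\<And>i. i < n ==> run c (st (Suc i)) T (st i)" "\<And>i. i < n ==> P (peek (st (Suc i) r))"
    "\<not> P (peek (st 0 r))"
  shows "run (While r P c) (st n) (n * (T + 1) + 1) (st 0)"
  using assms
proof (induction n)
  case 0
  then show ?case using run_While_False[of P "st 0" r c] by simp
next
  case (Suc n)
  have "run (While r P c) (st (Suc n)) (1 + T + (n * (T + 1) + 1)) (st 0)"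
    using run_While_True[of P "st (Suc n)" r c T "st n" "n * (T + 1) + 1" "st 0"] Suc by auto
  then show ?case by (rule run_weaken) simp
qed

abbreviation nonempty :: "nat => bool" where "nonempty \<equiv> \<lambda>a. a \<noteq> 0"

definition push_sym :: "nat => nat => com" where
  "push_sym r a = (if a = 0 then Skip else Push r a)"

definition clear :: "nat => com" where
  "clear r = While r nonempty (Pop r)"

definition move :: "nat => nat => com" where
  "move r u = While r nonempty (Switch r (\<lambda>a. Seq (Pop r) (push_sym u a)))"

text \<open>Reading a stack destroys it. Hence the symbols are moved to \<open>t\<close> and back,
  and the counting is done on the way back.\<close>

definition count_reg :: "nat => nat => nat => com" where
  "count_reg r d t = Seq (move r t)
     (While t nonempty (Switch t (\<lambda>a. Seq (Pop t) (Seq (push_sym r a) (Push d 1)))))"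

lemma run_clear: "0 \<notin> set (s r) ==> run (clear r) s (2 * length (s r) + 1) (s(r := []))"
proof (induction "s r" arbitrary: s)
  case Nil
  then show ?case using run_While_False[of nonempty s r] by (simp add: clear_def fun_upd_idem)
next
  case (Cons a xs)
  have "run (clear r) (s(r := xs)) (2 * length xs + 1) (s(r := []))"
    using Cons.hyps(1)[of "s(r := xs)"] Cons.hyps(2) Cons.prems by (simp flip: Cons.hyps(2))
  then have "run (clear r) s (1 + 1 + (2 * length xs + 1)) (s(r := []))"
    using run_While_True[of nonempty s r "Pop r" 1 "s(r := xs)"] run_Pop[of r s] Cons.prems
    unfolding clear_def by (simp flip: Cons.hyps(2))
  then show ?case by (simp flip: Cons.hyps(2))
qed

lemma run_move:
  "0 \<notin> set (s r) ==> r \<noteq> u ==> run (move r u) s (6 * length (s r) + 1) (s(r := [], u := rev (s r) @ s u))"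
proof (induction "s r" arbitrary: s)
  case Nil
  then show ?case using run_While_False[of nonempty s r] by (simp add: move_def fun_upd_idem)
next
  case (Cons a xs)
  define s1 where "s1 = s(r := xs, u := a # s u)"
  have a: "a \<noteq> 0" using Cons by (metis list.set_intros(1))
  have 1: "run (Seq (Pop r) (push_sym u a)) s (1 + 1 + 2) s1"
    using run_Seq[OF run_Pop[of r s] run_Push[of u a]] Cons.prems a by (simp add: s1_def push_sym_def flip: Cons.hyps(2))
  have 2: "run (Switch r (\<lambda>a. Seq (Pop r) (push_sym u a))) s (1 + (1 + 1 + 2)) s1"
    by (rule run_Switch) (use 1 in \<open>simp flip: Cons.hyps(2)\<close>)
  have 3: "run (move r u) s1 (6 * length xs + 1) (s(r := [], u := rev (a # xs) @ s u))"
    using Cons.hyps(1)[of s1] Cons.prems by (simp add: s1_def fun_upd_twist flip: Cons.hyps(2))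
  have "run (move r u) s (1 + (1 + (1 + 1 + 2)) + (6 * length xs + 1)) (s(r := [], u := rev (a # xs) @ s u))"
    unfolding move_def
    by (rule run_While_True[OF _ 2]) (use 3 a in \<open>auto simp: move_def simp flip: Cons.hyps(2)\<close>)
  then show ?case by (rule run_weaken[THEN run_cong]) (simp_all flip: Cons.hyps(2))
qed

lemma run_count_back:
  "0 \<notin> set (s t) ==> r \<noteq> t ==> r \<noteq> d ==> d \<noteq> t ==>
   run (While t nonempty (Switch t (\<lambda>a. Seq (Pop t) (Seq (push_sym r a) (Push d 1))))) s (9 * length (s t) + 1)
     (s(t := [], r := rev (s t) @ s r, d := replicate (length (s t)) 1 @ s d))"
  (is "_ ==> _ ==> _ ==> _ ==> run ?w _ _ _")
proof (induction "s t" arbitrary: s)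
  case Nil
  then show ?case using run_While_False[of nonempty s t] by (simp add: fun_upd_idem)
next
  case (Cons a xs)
  define s1 where "s1 = s(t := xs, r := a # s r, d := 1 # s d)"
  have a: "a \<noteq> 0" using Cons by (metis list.set_intros(1))
  have 1: "run (Seq (Pop t) (Seq (push_sym r a) (Push d 1))) s (1 + 1 + (1 + 2 + 2)) s1"
    using run_Seq[OF run_Pop[of t s] run_Seq[OF run_Push[of r a] run_Push[of d 1]]] Cons.prems a
    by (simp add: s1_def push_sym_def flip: Cons.hyps(2))
  have 2: "run (Switch t (\<lambda>a. Seq (Pop t) (Seq (push_sym r a) (Push d 1)))) s (1 + (1 + 1 + (1 + 2 + 2))) s1"
    by (rule run_Switch) (use 1 in \<open>simp flip: Cons.hyps(2)\<close>)
  let ?s = "s(t := [], r := rev (a # xs) @ s r, d := replicate (length (a # xs)) 1 @ s d)"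
  have "run ?w s1 (9 * length xs + 1) (s1(t := [], r := rev xs @ s1 r, d := replicate (length xs) 1 @ s1 d))"
    using Cons.hyps(1)[of s1] Cons.prems by (simp add: s1_def flip: Cons.hyps(2))
  also have "s1(t := [], r := rev xs @ s1 r, d := replicate (length xs) 1 @ s1 d) = ?s"
    using Cons.prems by (auto simp: s1_def fun_eq_iff replicate_app_Cons_same)
  finally have 3: "run ?w s1 (9 * length xs + 1) ?s" .
  have "run ?w s (1 + (1 + (1 + 1 + (1 + 2 + 2))) + (9 * length xs + 1)) ?s"
    by (rule run_While_True[OF _ 2 3]) (use a in \<open>simp flip: Cons.hyps(2)\<close>)
  then show ?case by (rule run_weaken[THEN run_cong]) (simp_all flip: Cons.hyps(2))
qed

lemma run_count_reg:
  assumes "0 \<notin> set (s r)" "s t = []" "r \<noteq> t" "r \<noteq> d" "d \<noteq> t"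
  shows "run (count_reg r d t) s (15 * length (s r) + 3) (s(d := replicate (length (s r)) 1 @ s d))"
proof -
  define s1 where "s1 = s(r := [], t := rev (s r))"
  have 1: "run (move r t) s (6 * length (s r) + 1) s1"
    using run_move[of s r t] assms by (simp add: s1_def)
  have eq: "s1(t := [], r := rev (s1 t) @ s1 r, d := replicate (length (s1 t)) 1 @ s1 d) =
      s(d := replicate (length (s r)) 1 @ s d)"
    using assms by (auto simp: s1_def fun_eq_iff)
  have "run (count_reg r d t) s (1 + (6 * length (s r) + 1) + (9 * length (s1 t) + 1))
      (s(d := replicate (length (s r)) 1 @ s d))"
    unfolding count_reg_def eq[symmetric]
    by (rule run_Seq[OF 1 run_count_back]) (use assms in \<open>auto simp: s1_def\<close>)
  then show ?thesis by (rule run_weaken) (simp add: s1_def)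
qed

primrec pushes :: "nat => nat => com" where
  "pushes d 0 = Skip"
| "pushes d (Suc c) = Seq (pushes d c) (Push d 1)"

lemma run_pushes: "run (pushes d c) s (3 * c + 1) (s(d := replicate c 1 @ s d))"
proof (induction c)
  case 0
  then show ?case using run_Skip[of s] by (simp add: fun_upd_idem)
next
  case (Suc c)
  have "run (pushes d (Suc c)) s (1 + (3 * c + 1) + 2) (s(d := replicate (Suc c) 1 @ s d))"
    unfolding pushes.simps by (rule run_cong[OF run_Seq[OF Suc run_Push]]) (simp add: fun_eq_iff)
  then show ?case by (rule run_weaken) simp
qed

text \<open>\<open>Bit\<close> shifts as many symbols of \<open>r\<close> to \<open>t + 1\<close> as
  the index says, inspects the top and shifts them back; on an empty stack the shift does nothing,
  so an index beyond the word reads False. In \<open>Sub\<close>, popping the empty stack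
  \<open>t\<close> does nothing either, which is truncation.\<close>

primrec compile :: "aexp => (nat => nat) => nat => nat => com" where
  "compile (Const c) \<rho> d t = pushes d c"
| "compile (Var i) \<rho> d t = count_reg (\<rho> i) d t"
| "compile (Len r) \<rho> d t = count_reg r d t"
| "compile (Bit r a) \<rho> d t = Seq (compile a \<rho> t (t + 1)) (Seq
     (While t nonempty (Seq (Pop t) (Switch r (\<lambda>x. if x = 0 then Skip else Seq (Pop r) (Push (t + 1) x)))))
     (Seq (Switch r (\<lambda>x. if x = 2 then Push d 1 else Skip)) (move (t + 1) r)))"
| "compile (Add a b) \<rho> d t = Seq (compile a \<rho> d t) (compile b \<rho> d t)"
| "compile (Sub a b) \<rho> d t = Seq (compile a \<rho> t (t + 1)) (Seq (compile b \<rho> (t + 1) (t + 2))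
     (Seq (While (t + 1) nonempty (Seq (Pop (t + 1)) (Pop t))) (move t d)))"
| "compile (Sum a b) \<rho> d t = Seq (compile a \<rho> t (t + 1))
     (While t nonempty (Seq (Pop t) (compile b (case_nat t \<rho>) d (t + 1))))"

definition reg_bits :: "regs => nat => bool list" where
  "reg_bits s r = map (\<lambda>x. x = 2) (s r)"

text \<open>\<open>\<rho>\<close> assigns registers to variables. None of them may be the target
  \<open>d\<close>, which grows while a sum is being evaluated. \<open>M\<close> bounds words and
  variables alike, so that costs are functions of one argument.\<close>

definition eval_pre ::
  "nat => (nat => nat) => nat => nat => regs => (nat => bool list) => (nat => nat) => nat => bool" where
  "eval_pre b \<rho> d t s R \<sigma> M \<longleftrightarrow> b \<le> d \<and> d < t \<and> pos_regs s \<and> (\<forall>r\<ge>t. s r = []) \<and>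
     (\<forall>i. \<rho> i < t \<and> \<rho> i \<noteq> d \<and> length (s (\<rho> i)) = \<sigma> i \<and> \<sigma> i \<le> M) \<and>
     (\<forall>r<b. R r = reg_bits s r \<and> length (s r) \<le> M)"

text \<open>
  The value of an expression is added, in unary, to register \<open>d\<close>. The registers from \<open>t\<close> on serve
  as scratch space, and the counter of a loop doubles as the register of the summation variable.
\<close>

definition evaluates :: "nat => aexp => (nat => nat) => bool" where
  "evaluates b e p \<longleftrightarrow> (\<forall>\<rho> d t s R \<sigma> M. eval_pre b \<rho> d t s R \<sigma> M \<longrightarrow>
     run (compile e \<rho> d t) s (p M) (s(d := replicate (val e R \<sigma>) 1 @ s d)) \<and> val e R \<sigma> \<le> p M)"

lemma evaluatesD:
  assumes "evaluates b e p" "eval_pre b \<rho> d t s R \<sigma> M"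
  shows "run (compile e \<rho> d t) s (p M) (s(d := replicate (val e R \<sigma>) 1 @ s d))" "val e R \<sigma> \<le> p M"
  using assms unfolding evaluates_def by blast+

lemma pos_regs_update: "pos_regs s ==> 0 \<notin> set xs ==> pos_regs (s(r := xs))"
  by (simp add: pos_regs_def)

lemma eval_pre_temp:
  assumes "eval_pre b \<rho> d t s R \<sigma> M" "t \<le> d'" "d' < t'" "\<forall>r\<ge>t'. s' r = []" "pos_regs s'"
    "\<forall>r<t. s' r = s r"
  shows "eval_pre b \<rho> d' t' s' R \<sigma> M"
proof -
  have "b < t" using assms by (simp add: eval_pre_def)
  then have "\<forall>r<b. s' r = s r" using assms by simp
  then show ?thesis using assms \<open>b < t\<close> unfolding eval_pre_def reg_bits_def
    by (auto intro: less_trans less_le_trans) (meson le_less_trans less_imp_neq order.strict_trans1)+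
qed

lemma evaluates_count:
  assumes "0 \<notin> set (s r)" "s t = []" "r < t" "r \<noteq> d" "d < t" "length (s r) \<le> M"
  shows "run (count_reg r d t) s (15 * M + 3) (s(d := replicate (length (s r)) 1 @ s d))"
  by (rule run_weaken[OF run_count_reg]) (use assms in auto)

lemma evaluates_Bit:
  assumes a: "evaluates b a p" and r: "r < b"
  shows "evaluates b (Bit r a) (\<lambda>M. p M + (p M * 9 + 1) + (6 * M + 1) + 7)"
  unfolding evaluates_def
proof (intro allI impI conjI)
  fix \<rho> d t s R \<sigma> M assume pre: "eval_pre b \<rho> d t s R \<sigma> M"
  define v where "v = val a R \<sigma>"
  define xs where "xs = s r"
  have rt: "r < t" "r \<noteq> t" "r \<noteq> d" "d < t" "r \<noteq> t + 1" and R: "R r = reg_bits s r" and M: "length xs \<le> M"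
    and pos: "pos_regs s" and emp: "s t = []" "s (t + 1) = []" "\<forall>r\<ge>t. s r = []"
    using pre r by (auto simp: eval_pre_def xs_def)
  have pre': "eval_pre b \<rho> t (t + 1) s R \<sigma> M"
    by (rule eval_pre_temp[OF pre]) (use emp pos in auto)
  \<comment> \<open>With i rounds left, the first v - i symbols of the word lie in reverse on
    \<open>t + 1\<close>.\<close>
  define st where "st i = s(t := replicate i 1, r := drop (v - i) xs, t + 1 := rev (take (v - i) xs))" for i
  have 1: "run (compile a \<rho> t (t + 1)) s (p M) (st v)" and v: "v \<le> p M"
    using evaluatesD[OF a pre'] rt emp by (auto simp: v_def st_def xs_def fun_upd_idem fun_upd_twist)
  have zero: "0 \<notin> set xs" using pos by (simp add: xs_def pos_regs_def)
  have 2: "run (While t nonempty (Seq (Pop t) (Switch r (\<lambda>x. if x = 0 then Skip else Seq (Pop r) (Push (t + 1) x)))))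
      (st v) (v * (8 + 1) + 1) (st 0)"
  proof (rule run_counted_loop)
    fix i assume i: "i < v"
    define s1 where "s1 = (st (Suc i))(t := replicate i 1)"
    have pop: "run (Pop t) (st (Suc i)) 1 s1"
      using run_Pop[of t "st (Suc i)"] rt by (simp add: s1_def st_def)
    have s1r: "s1 r = drop (v - Suc i) xs" using rt by (simp add: s1_def st_def)
    have sw: "run (Switch r (\<lambda>x. if x = 0 then Skip else Seq (Pop r) (Push (t + 1) x))) s1 (1 + 4) (st i)"
    proof (rule run_Switch)
      show "run (if peek (s1 r) = 0 then Skip else Seq (Pop r) (Push (t + 1) (peek (s1 r)))) s1 4 (st i)"
      proof (cases "v - Suc i < length xs")
        case True
        have d: "drop (v - Suc i) xs = xs ! (v - Suc i) # drop (v - i) xs"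
          using Cons_nth_drop_Suc[OF True] i by (simp add: Suc_diff_Suc)
        have tk: "take (v - i) xs = take (v - Suc i) xs @ [xs ! (v - Suc i)]"
          using take_Suc_conv_app_nth[OF True] i by (simp add: Suc_diff_Suc)
        have nz: "xs ! (v - Suc i) \<noteq> 0" using zero nth_mem[OF True] by metis
        have "run (Seq (Pop r) (Push (t + 1) (xs ! (v - Suc i)))) s1 4
           ((s1(r := tl (s1 r)))(t + 1 := xs ! (v - Suc i) # (s1(r := tl (s1 r))) (t + 1)))"
          by (rule run_weaken[OF run_Seq[OF run_Pop run_Push]]) simp
        moreover have "(s1(r := tl (s1 r)))(t + 1 := xs ! (v - Suc i) # (s1(r := tl (s1 r))) (t + 1)) = st i"
          using rt by (auto simp: fun_eq_iff s1_def st_def d tk)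
        ultimately have "run (Seq (Pop r) (Push (t + 1) (xs ! (v - Suc i)))) s1 4 (st i)" by (rule run_cong)
        then show ?thesis using nz by (simp add: s1r d)
      next
        case False
        then have "s1 = st i" using rt by (auto simp: fun_eq_iff s1_def st_def)
        moreover have "peek (s1 r) = 0" using False by (simp add: s1r)
        ultimately show ?thesis using run_weaken[OF run_Skip, of 4 s1] by simp
      qed
    qed
    show "run (Seq (Pop t) (Switch r (\<lambda>x. if x = 0 then Skip else Seq (Pop r) (Push (t + 1) x)))) (st (Suc i)) 8 (st i)"
      by (rule run_weaken[OF run_Seq[OF pop sw]]) simp
    show "nonempty (peek (st (Suc i) t))" using rt by (simp add: st_def)
  next
    show "\<not> nonempty (peek (st 0 t))" using rt by (simp add: st_def)
  qed
  define w where "w = val (Bit r a) R \<sigma>"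
  have w: "w = of_bool (peek (drop v xs) = 2)"
    by (cases "v < length xs") (auto simp: w_def R reg_bits_def xs_def v_def peek_def
      simp flip: Cons_nth_drop_Suc)
  define s2 where "s2 = (st 0)(d := replicate w 1 @ s d)"
  have 3: "run (Switch r (\<lambda>x. if x = 2 then Push d 1 else Skip)) (st 0) (1 + 2) s2"
  proof (rule run_Switch)
    have [simp]: "st 0 r = drop v xs" "st 0 d = s d" using rt by (auto simp: st_def)
    show "run (if peek (st 0 r) = 2 then Push d 1 else Skip) (st 0) 2 s2"
      using run_Push[of d 1 "st 0"] run_weaken[OF run_Skip, of 2 "st 0"] w
      by (auto simp: s2_def fun_upd_idem)
  qed
  have 4: "run (move (t + 1) r) s2 (6 * length (s2 (t + 1)) + 1) (s2(t + 1 := [], r := rev (s2 (t + 1)) @ s2 r))"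
    by (rule run_move) (use rt zero in \<open>auto simp: s2_def st_def dest: in_set_takeD\<close>)
  have eq: "s2(t + 1 := [], r := rev (s2 (t + 1)) @ s2 r) = s(d := replicate w 1 @ s d)"
    using rt emp by (auto simp: fun_eq_iff s2_def st_def xs_def)
  have len: "length (s2 (t + 1)) \<le> M" using rt M by (simp add: s2_def st_def)
  have "run (compile (Bit r a) \<rho> d t) s (1 + p M + (1 + (v * (8 + 1) + 1) + (1 + (1 + 2) + (6 * length (s2 (t + 1)) + 1))))
      (s(d := replicate w 1 @ s d))"
    unfolding compile.simps by (rule run_Seq[OF 1 run_Seq[OF 2 run_Seq[OF 3 4[unfolded eq]]]])
  moreover have "1 + p M + (1 + (v * (8 + 1) + 1) + (1 + (1 + 2) + (6 * length (s2 (t + 1)) + 1)))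
      \<le> p M + (p M * 9 + 1) + (6 * M + 1) + 7"
    using v len by simp
  ultimately show "run (compile (Bit r a) \<rho> d t) s (p M + (p M * 9 + 1) + (6 * M + 1) + 7) (s(d := replicate (val (Bit r a) R \<sigma>) 1 @ s d))"
    unfolding w_def by (rule run_weaken)
  show "val (Bit r a) R \<sigma> \<le> p M + (p M * 9 + 1) + (6 * M + 1) + 7"
    by (simp add: of_bool_def)
qed

lemma evaluates_Sub:
  assumes a: "evaluates b x p" and b: "evaluates b y q"
  shows "evaluates b (Sub x y) (\<lambda>M. p M + q M + (q M * 4 + 1) + (6 * p M + 1) + 3)"
  unfolding evaluates_def
proof (intro allI impI conjI)
  fix \<rho> d t s R \<sigma> M assume pre: "eval_pre b \<rho> d t s R \<sigma> M"
  define v w where "v = val x R \<sigma>" and "w = val y R \<sigma>"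
  have rt: "d < t" and pos: "pos_regs s" and emp: "s t = []" "s (t + 1) = []" "\<forall>r\<ge>t. s r = []"
    using pre by (auto simp: eval_pre_def)
  have pre1: "eval_pre b \<rho> t (t + 1) s R \<sigma> M"
    by (rule eval_pre_temp[OF pre]) (use emp pos in auto)
  have 1: "run (compile x \<rho> t (t + 1)) s (p M) (s(t := replicate v 1))" and v: "v \<le> p M"
    using evaluatesD[OF a pre1] emp by (auto simp: v_def)
  have pre2: "eval_pre b \<rho> (t + 1) (t + 2) (s(t := replicate v 1)) R \<sigma> M"
    by (rule eval_pre_temp[OF pre]) (use emp pos in \<open>auto intro!: pos_regs_update\<close>)
  define st where "st i = s(t := replicate (v - (w - i)) 1, t + 1 := replicate i 1)" for i
  have 2: "run (compile y \<rho> (t + 1) (t + 2)) (s(t := replicate v 1)) (q M) (st w)" and w: "w \<le> q M"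
    using evaluatesD[OF b pre2] emp by (auto simp: w_def st_def)
  have 3: "run (While (t + 1) nonempty (Seq (Pop (t + 1)) (Pop t))) (st w) (w * (3 + 1) + 1) (st 0)"
  proof (rule run_counted_loop)
    fix i assume i: "i < w"
    define s1 where "s1 = (st (Suc i))(t + 1 := replicate i 1)"
    have p1: "run (Pop (t + 1)) (st (Suc i)) 1 s1"
      using run_Pop[of "t + 1" "st (Suc i)"] by (simp add: s1_def st_def)
    have tl: "tl (replicate n (1::nat)) = replicate (n - 1) 1" for n by (cases n) auto
    have p2: "run (Pop t) s1 1 (st i)"
      using run_Pop[of t s1] i by (simp add: s1_def st_def tl fun_upd_twist[of t])
    show "run (Seq (Pop (t + 1)) (Pop t)) (st (Suc i)) 3 (st i)"
      by (rule run_weaken[OF run_Seq[OF p1 p2]]) simp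
    show "nonempty (peek (st (Suc i) (t + 1)))" by (simp add: st_def)
  next
    show "\<not> nonempty (peek (st 0 (t + 1)))" by (simp add: st_def)
  qed
  have 4: "run (move t d) (st 0) (6 * length (st 0 t) + 1) ((st 0)(t := [], d := rev (st 0 t) @ st 0 d))"
    by (rule run_move) (use rt in \<open>auto simp: st_def\<close>)
  have eq: "(st 0)(t := [], d := rev (st 0 t) @ st 0 d) = s(d := replicate (v - w) 1 @ s d)"
    using rt emp by (auto simp: fun_eq_iff st_def)
  have "run (compile (Sub x y) \<rho> d t) s (1 + p M + (1 + q M + (1 + (w * (3 + 1) + 1) + (6 * length (st 0 t) + 1))))
      (s(d := replicate (v - w) 1 @ s d))"
    unfolding compile.simps by (rule run_Seq[OF 1 run_Seq[OF 2 run_Seq[OF 3 4[unfolded eq]]]])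
  moreover have "1 + p M + (1 + q M + (1 + (w * (3 + 1) + 1) + (6 * length (st 0 t) + 1)))
      \<le> p M + q M + (q M * 4 + 1) + (6 * p M + 1) + 3"
    using v w by (simp add: st_def)
  ultimately show "run (compile (Sub x y) \<rho> d t) s (p M + q M + (q M * 4 + 1) + (6 * p M + 1) + 3) (s(d := replicate (val (Sub x y) R \<sigma>) 1 @ s d))"
    unfolding v_def w_def val.simps by (rule run_weaken)
  show "val (Sub x y) R \<sigma> \<le> p M + q M + (q M * 4 + 1) + (6 * p M + 1) + 3"
    using v by (simp add: v_def)
qed

lemma evaluates_Sum:
  assumes a: "evaluates b x p" and b: "evaluates b y q" and q: "mono q"
  shows "evaluates b (Sum x y) (\<lambda>M. p M + (p M * (q (M + p M) + 3) + 1) + 1)"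
  unfolding evaluates_def
proof (intro allI impI conjI)
  fix \<rho> d t s R \<sigma> M assume pre: "eval_pre b \<rho> d t s R \<sigma> M"
  define v where "v = val x R \<sigma>"
  \<comment> \<open>Inside the loop the summation index is a further variable, bounded by p
    M.\<close>
  define M' where "M' = M + p M"
  have rt: "d < t" "b \<le> d" and pos: "pos_regs s" and emp: "s t = []" "\<forall>r\<ge>t. s r = []"
    using pre by (auto simp: eval_pre_def)
  have pre1: "eval_pre b \<rho> t (t + 1) s R \<sigma> M"
    by (rule eval_pre_temp[OF pre]) (use emp pos in auto)
  \<comment> \<open>The counter runs downwards and, after the pop, equals the index, so the partial
    sums grow from the upper end.\<close>
  define S where "S i = (\<Sum>j\<in>{i..<v}. val y R (case_nat j \<sigma>))" for i
  define st where "st i = s(t := replicate i 1, d := replicate (S i) 1 @ s d)" for i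
  have 1: "run (compile x \<rho> t (t + 1)) s (p M) (st v)" and v: "v \<le> p M"
    using evaluatesD[OF a pre1] emp rt by (auto simp: v_def st_def S_def fun_upd_idem)
  have ev: "run (compile y (case_nat t \<rho>) d (t + 1)) ((st (Suc i))(t := replicate i 1)) (q M') (st i)"
    "val y R (case_nat i \<sigma>) \<le> q M'" if i: "i < v" for i
  proof -
    let ?s = "(st (Suc i))(t := replicate i 1)"
    have s: "?s r = s r" if "r \<noteq> t" "r \<noteq> d" for r using that by (simp add: st_def)
    have "pos_regs ?s" using pos by (auto simp: st_def pos_regs_def)
    moreover have "\<forall>r\<ge>t + 1. ?s r = []" using emp rt by (auto simp: st_def)
    moreover have "case_nat t \<rho> k < t + 1 \<and> case_nat t \<rho> k \<noteq> d \<and>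
        length (?s (case_nat t \<rho> k)) = case_nat i \<sigma> k \<and> case_nat i \<sigma> k \<le> M'" for k
    proof (cases k)
      case 0
      then show ?thesis using rt v i by (simp add: st_def M'_def)
    next
      case (Suc k)
      have "\<rho> k < t \<and> \<rho> k \<noteq> d \<and> length (s (\<rho> k)) = \<sigma> k \<and> \<sigma> k \<le> M"
        using pre unfolding eval_pre_def by blast
      then show ?thesis using Suc s[of "\<rho> k"] by (auto simp: M'_def)
    qed
    moreover have "R r = reg_bits ?s r \<and> length (?s r) \<le> M'" if "r < b" for r
      using pre s[of r] that by (auto simp: eval_pre_def M'_def reg_bits_def)
    ultimately have pre2: "eval_pre b (case_nat t \<rho>) d (t + 1) ?s R (case_nat i \<sigma>) M'"
      using rt less_SucI[of d t] unfolding eval_pre_def Suc_eq_plus1 by blast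
    have Si: "S i = val y R (case_nat i \<sigma>) + S (Suc i)"
      using i by (simp add: S_def sum.atLeast_Suc_lessThan)
    have "?s(d := replicate (val y R (case_nat i \<sigma>)) 1 @ ?s d) = st i"
      using rt by (auto simp: fun_eq_iff st_def Si replicate_add)
    then show "run (compile y (case_nat t \<rho>) d (t + 1)) ?s (q M') (st i)" "val y R (case_nat i \<sigma>) \<le> q M'"
      using evaluatesD[OF b pre2] by simp_all
  qed
  have 2: "run (While t nonempty (Seq (Pop t) (compile y (case_nat t \<rho>) d (t + 1)))) (st v) (v * ((q M' + 2) + 1) + 1) (st 0)"
  proof (rule run_counted_loop)
    fix i assume i: "i < v"
    have p1: "run (Pop t) (st (Suc i)) 1 ((st (Suc i))(t := replicate i 1))"
      using run_Pop[of t "st (Suc i)"] rt by (simp add: st_def)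
    show "run (Seq (Pop t) (compile y (case_nat t \<rho>) d (t + 1))) (st (Suc i)) (q M' + 2) (st i)"
      by (rule run_weaken[OF run_Seq[OF p1 ev(1)[OF i]]]) simp
    show "nonempty (peek (st (Suc i) t))" using rt by (simp add: st_def)
  next
    show "\<not> nonempty (peek (st 0 t))" using rt by (simp add: st_def)
  qed
  have S0: "S 0 = val (Sum x y) R \<sigma>" by (simp add: S_def v_def atLeast0LessThan)
  have st0: "st 0 = s(d := replicate (val (Sum x y) R \<sigma>) 1 @ s d)"
    using emp by (simp add: st_def S0 fun_upd_idem)
  have "v * ((q M' + 2) + 1) \<le> p M * (q M' + 3)"
    by (rule order_trans[OF _ mult_le_mono1[OF v, of "q M' + 3"]]) (simp add: algebra_simps)
  then show "run (compile (Sum x y) \<rho> d t) s (p M + (p M * (q (M + p M) + 3) + 1) + 1)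
      (s(d := replicate (val (Sum x y) R \<sigma>) 1 @ s d))"
    unfolding compile.simps st0[symmetric]
    by (intro run_weaken[OF run_Seq[OF 1 2]]) (simp add: M'_def)
  have "S 0 \<le> (\<Sum>j\<in>{0..<v}. q M')" unfolding S_def by (rule sum_mono) (use ev(2) in auto)
  also have "\<dots> \<le> p M * q M'" using v by simp
  finally have "val (Sum x y) R \<sigma> \<le> p M * q M'" by (simp only: S0)
  then show "val (Sum x y) R \<sigma> \<le> p M + (p M * (q (M + p M) + 3) + 1) + 1"
    unfolding M'_def by (simp add: distrib_left)
qed

lemma evaluates_mono: "evaluates b e p ==> (\<And>M. p M \<le> q M) ==> evaluates b e q"
  unfolding evaluates_def by (meson order_trans run_weaken)

lemma polyb_monoE:
  assumes "polyb p" obtains q where "polyb q" "mono q" "\<And>M. p M \<le> q M"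
proof -
  obtain c where "\<And>M. p M \<le> (M + 2) ^ c" using assms unfolding polyb_def by blast
  moreover have "polyb (\<lambda>M. (M + 2) ^ c)" by (intro polyb_intros)
  moreover have "mono (\<lambda>M :: nat. (M + 2) ^ c)" by (auto intro!: monoI power_mono)
  ultimately show ?thesis using that by blast
qed

lemma evaluates_exists: "wf_exp b e ==> \<exists>p. polyb p \<and> evaluates b e p"
proof (induction e)
  case (Const c)
  have "evaluates b (Const c) (\<lambda>M. 3 * c + 1)"
    unfolding evaluates_def using run_pushes by auto
  then show ?case using polyb_const by blast
next
  case (Var i)
  have "evaluates b (Var i) (\<lambda>M. 15 * M + 3)"
    unfolding evaluates_def
  proof (intro allI impI conjI)
    fix \<rho> d t s R \<sigma> M assume pre: "eval_pre b \<rho> d t s R \<sigma> M"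
    then have i: "length (s (\<rho> i)) = \<sigma> i" "\<sigma> i \<le> M" "\<rho> i < t" "\<rho> i \<noteq> d"
      unfolding eval_pre_def by blast+
    moreover have "run (count_reg (\<rho> i) d t) s (15 * M + 3) (s(d := replicate (length (s (\<rho> i))) 1 @ s d))"
      using pre pos_regsD[of s] i by (intro evaluates_count) (auto simp: eval_pre_def)
    ultimately show "run (compile (Var i) \<rho> d t) s (15 * M + 3) (s(d := replicate (val (Var i) R \<sigma>) 1 @ s d))"
      "val (Var i) R \<sigma> \<le> 15 * M + 3" by auto
  qed
  moreover have "polyb (\<lambda>M. 15 * M + 3)" by (intro polyb_intros)
  ultimately show ?case by blast
next
  case (Len r)
  have "evaluates b (Len r) (\<lambda>M. 15 * M + 3)"
    unfolding evaluates_def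
  proof (intro allI impI conjI)
    fix \<rho> d t s R \<sigma> M assume pre: "eval_pre b \<rho> d t s R \<sigma> M"
    then have "length (R r) = length (s r)" "length (s r) \<le> M"
      using Len by (auto simp: eval_pre_def reg_bits_def)
    moreover have "run (count_reg r d t) s (15 * M + 3) (s(d := replicate (length (s r)) 1 @ s d))"
      using pre pos_regsD[of s] Len by (intro evaluates_count) (auto simp: eval_pre_def)
    ultimately show "run (compile (Len r) \<rho> d t) s (15 * M + 3) (s(d := replicate (val (Len r) R \<sigma>) 1 @ s d))"
      "val (Len r) R \<sigma> \<le> 15 * M + 3" by auto
  qed
  moreover have "polyb (\<lambda>M. 15 * M + 3)" by (intro polyb_intros)
  ultimately show ?case by blast
next
  case (Bit r a)
  then obtain p where p: "polyb p" "evaluates b a p" by auto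
  have "polyb (\<lambda>M. p M + (p M * 9 + 1) + (6 * M + 1) + 7)" by (intro polyb_intros p)
  then show ?case using evaluates_Bit[OF p(2), of r] Bit.prems by auto
next
  case (Add x y)
  then obtain p q where p: "polyb p" "evaluates b x p" "polyb q" "evaluates b y q" by auto
  have "evaluates b (Add x y) (\<lambda>M. p M + q M + 1)"
    unfolding evaluates_def
  proof (intro allI impI conjI)
    fix \<rho> d t s R \<sigma> M assume pre: "eval_pre b \<rho> d t s R \<sigma> M"
    define s1 where "s1 = s(d := replicate (val x R \<sigma>) 1 @ s d)"
    have pre1: "eval_pre b \<rho> d t s1 R \<sigma> M"
      using pre unfolding eval_pre_def s1_def by (auto simp: pos_regs_def reg_bits_def)
    have "run (compile (Add x y) \<rho> d t) s (1 + p M + q M) (s1(d := replicate (val y R \<sigma>) 1 @ s1 d))"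
      unfolding compile.simps
      by (rule run_Seq[OF evaluatesD(1)[OF p(2) pre, folded s1_def] evaluatesD(1)[OF p(4) pre1]])
    moreover have "replicate (val y R \<sigma>) 1 @ replicate (val x R \<sigma>) (1::nat) = replicate (val x R \<sigma> + val y R \<sigma>) 1"
      by (simp add: add.commute flip: replicate_add)
    ultimately show "run (compile (Add x y) \<rho> d t) s (p M + q M + 1) (s(d := replicate (val (Add x y) R \<sigma>) 1 @ s d))"
      by (simp add: s1_def flip: append_assoc)
    show "val (Add x y) R \<sigma> \<le> p M + q M + 1"
      using evaluatesD(2)[OF p(2) pre] evaluatesD(2)[OF p(4) pre] by simp
  qed
  moreover have "polyb (\<lambda>M. p M + q M + 1)" by (intro polyb_intros p)
  ultimately show ?case by blast
next
  case (Sub x y)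
  then obtain p q where p: "polyb p" "evaluates b x p" "polyb q" "evaluates b y q" by auto
  have "polyb (\<lambda>M. p M + q M + (q M * 4 + 1) + (6 * p M + 1) + 3)" by (intro polyb_intros p)
  then show ?case using evaluates_Sub[OF p(2,4)] by blast
next
  case (Sum x y)
  then obtain p q' where p: "polyb p" "evaluates b x p" "polyb q'" "evaluates b y q'" by auto
  obtain q where q: "polyb q" "mono q" "\<And>M. q' M \<le> q M" using polyb_monoE[OF p(3)] by blast
  have "polyb (\<lambda>M. q (M + p M))" by (rule polyb_compose[OF q(1)]) (intro polyb_intros p)
  then have "polyb (\<lambda>M. p M + (p M * (q (M + p M) + 3) + 1) + 1)" by (intro polyb_intros p)
  then show ?case using evaluates_Sum[OF p(2) evaluates_mono[OF p(4) q(3)] q(2)] by blast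
qed

section \<open>Scratch space and the assignment of computed words\<close>

lemma wf_move: "r < n ==> u < n ==> wf_com n S (move r u)"
  by (simp add: move_def push_sym_def)

lemma wf_clear: "r < n ==> wf_com n S (clear r)"
  by (simp add: clear_def)

lemma wf_count_reg: "r < n ==> d < n ==> t < n ==> S \<ge> 3 ==> wf_com n S (count_reg r d t)"
  by (simp add: count_reg_def wf_move push_sym_def)

lemma wf_pushes: "d < n ==> S \<ge> 3 ==> wf_com n S (pushes d c)"
  by (induction c) auto

text \<open>An operator hands at most \<open>t + 2\<close> on to its arguments, hence two scratch
  registers per unit of \<open>size\<close>.\<close>

lemma wf_compile:
  "wf_exp b e ==> b \<le> n ==> \<forall>i. \<rho> i < n ==> d < n ==> t + 2 * size e + 2 \<le> n ==> S \<ge> 3 ==>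
    wf_com n S (compile e \<rho> d t)"
proof (induction e arbitrary: \<rho> d t)
  case (Sum x y)
  have "\<forall>i. case_nat t \<rho> i < n" using Sum.prems by (auto split: nat.split)
  then show ?case using Sum by simp
qed (simp_all add: wf_pushes wf_count_reg wf_move)

text \<open>The new word is collected in \<open>b + 2\<close>, since \<open>e\<close> may refer to
  the old content of \<open>r\<close>. It is pushed from the last bit to the first and so lies in
  the right order; the two moves to \<open>r\<close> reverse it twice.\<close>

definition assign :: "nat => nat => aexp => aexp => com" where
  "assign b r l e = Seq (compile l (\<lambda>_. b) (b + 1) (b + 2))
     (Seq (While (b + 1) nonempty (Seq (Pop (b + 1))
        (Seq (compile e (case_nat (b + 1) (\<lambda>_. b)) (b + 3) (b + 4))
          (Seq (Switch (b + 3) (\<lambda>x. if x = 0 then Push (b + 2) 1 else Push (b + 2) 2)) (clear (b + 3))))))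
     (Seq (clear r) (Seq (move (b + 2) (b + 3)) (move (b + 3) r))))"

lemma run_assign:
  assumes l: "evaluates b l p" and e: "evaluates b e q" and q: "mono q" and r: "r < b"
    and s: "\<forall>r\<ge>b. s r = []" "pos_regs s" "\<forall>r<b. length (s r) \<le> M"
  shows "run (assign b r l e) s
    (p M + (p M * (3 * q (M + p M) + 10) + 1) + (2 * M + 1) + 2 * (6 * p M + 1) + 4)
    (s(r := map (\<lambda>i. bit_sym (val e (reg_bits s) (case_nat i (\<lambda>_. 0)) > 0))
      [0..<val l (reg_bits s) (\<lambda>_. 0)]))"
proof -
  define R where "R = reg_bits s"
  define n where "n = val l R (\<lambda>_. 0)"
  define M' where "M' = M + p M"
  define v where "v i = val e R (case_nat i (\<lambda>_. 0))" for i
  define ys where "ys i = map (\<lambda>i. bit_sym (v i > 0)) [i..<n]" for i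
  define st where "st i = s(b + 1 := replicate i 1, b + 2 := ys i)" for i
  \<comment> \<open>The empty register \<open>b\<close> stands for every variable that is not bound
    by the loop and gives it the value 0.\<close>
  have pre: "eval_pre b (\<lambda>_. b) (b + 1) (b + 2) s R (\<lambda>_. 0) M"
    using s by (auto simp: eval_pre_def R_def)
  have n: "n \<le> p M" using evaluatesD(2)[OF l pre] by (simp add: n_def)
  have 1: "run (compile l (\<lambda>_. b) (b + 1) (b + 2)) s (p M) (st n)"
    using evaluatesD(1)[OF l pre] s by (simp add: st_def ys_def n_def fun_upd_idem)
  have [simp]: "bit_sym x \<noteq> 0" "0 \<noteq> bit_sym x" for x by (auto simp: bit_sym_def)
  have ys0: "0 \<notin> set (ys i)" for i by (auto simp: ys_def)
  let ?Q = "3 * q M' + 9"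
  have 2: "run (While (b + 1) nonempty (Seq (Pop (b + 1))
        (Seq (compile e (case_nat (b + 1) (\<lambda>_. b)) (b + 3) (b + 4))
          (Seq (Switch (b + 3) (\<lambda>x. if x = 0 then Push (b + 2) 1 else Push (b + 2) 2)) (clear (b + 3))))))
      (st n) (n * (?Q + 1) + 1) (st 0)"
  proof (rule run_counted_loop)
    fix i assume i: "i < n"
    define s1 where "s1 = (st (Suc i))(b + 1 := replicate i 1)"
    have p1: "run (Pop (b + 1)) (st (Suc i)) 1 s1"
      using run_Pop[of "b + 1" "st (Suc i)"] by (simp add: s1_def st_def)
    have "case_nat (b + 1) (\<lambda>_. b) k < b + 4 \<and> case_nat (b + 1) (\<lambda>_. b) k \<noteq> b + 3 \<and>
        length (s1 (case_nat (b + 1) (\<lambda>_. b) k)) = case_nat i (\<lambda>_. 0) k \<and> case_nat i (\<lambda>_. 0) k \<le> M'" for k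
      using i n s by (cases k) (auto simp: s1_def st_def M'_def)
    moreover have "pos_regs s1" using s ys0 by (auto simp: s1_def st_def pos_regs_def)
    moreover have "\<forall>r\<ge>b + 4. s1 r = []" using s by (simp add: s1_def st_def)
    moreover have "R r = reg_bits s1 r \<and> length (s1 r) \<le> M'" if "r < b" for r
      using that s by (auto simp: s1_def st_def R_def reg_bits_def M'_def trans_le_add1)
    ultimately have pre1: "eval_pre b (case_nat (b + 1) (\<lambda>_. b)) (b + 3) (b + 4) s1 R (case_nat i (\<lambda>_. 0)) M'"
      unfolding eval_pre_def by (simp add: le_add1)
    define s2 where "s2 = s1(b + 3 := replicate (v i) 1)"
    have p2: "run (compile e (case_nat (b + 1) (\<lambda>_. b)) (b + 3) (b + 4)) s1 (q M') s2"
      using evaluatesD(1)[OF e pre1] s by (simp add: s2_def v_def s1_def st_def)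
    have vq: "v i \<le> q M'" using evaluatesD(2)[OF e pre1] by (simp add: v_def)
    define s3 where "s3 = s2(b + 2 := ys i)"
    have ysi: "ys i = bit_sym (v i > 0) # ys (Suc i)" using i by (simp add: ys_def upt_conv_Cons)
    have p3: "run (Switch (b + 3) (\<lambda>x. if x = 0 then Push (b + 2) 1 else Push (b + 2) 2)) s2 (1 + 2) s3"
    proof (rule run_Switch)
      have "s2 (b + 3) = replicate (v i) 1" "s2 (b + 2) = ys (Suc i)"
        by (simp_all add: s2_def s1_def st_def)
      then show "run (if peek (s2 (b + 3)) = 0 then Push (b + 2) 1 else Push (b + 2) 2) s2 2 s3"
        using run_Push[of "b + 2" 1 s2] run_Push[of "b + 2" 2 s2]
        by (cases "v i") (auto simp: s3_def ysi bit_sym_def)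
    qed
    have p4: "run (clear (b + 3)) s3 (2 * length (s3 (b + 3)) + 1) (s3(b + 3 := []))"
      by (rule run_clear) (simp add: s3_def s2_def)
    have eq: "s3(b + 3 := []) = st i"
      using s by (auto simp: fun_eq_iff s3_def s2_def s1_def st_def)
    have len: "length (s3 (b + 3)) = v i" by (simp add: s3_def s2_def)
    show "run (Seq (Pop (b + 1))
        (Seq (compile e (case_nat (b + 1) (\<lambda>_. b)) (b + 3) (b + 4))
          (Seq (Switch (b + 3) (\<lambda>x. if x = 0 then Push (b + 2) 1 else Push (b + 2) 2)) (clear (b + 3)))))
        (st (Suc i)) ?Q (st i)"
      by (rule run_weaken[OF run_Seq[OF p1 run_Seq[OF p2 run_Seq[OF p3 p4[unfolded eq]]]]])
        (use vq len in simp)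
    show "nonempty (peek (st (Suc i) (b + 1)))" by (simp add: st_def)
  next
    show "\<not> nonempty (peek (st 0 (b + 1)))" by (simp add: st_def)
  qed
  have 3: "run (clear r) (st 0) (2 * M + 1) ((st 0)(r := []))"
    by (rule run_weaken[OF run_clear]) (use r s in \<open>auto simp: st_def pos_regs_def\<close>)
  define s4 where "s4 = (st 0)(r := [])"
  have len: "length (ys 0) \<le> p M" using n by (simp add: ys_def)
  define s5 where "s5 = s4(b + 2 := [], b + 3 := rev (ys 0))"
  have s4: "s4 (b + 2) = ys 0" "s4 (b + 3) = []" using r s by (auto simp: s4_def st_def)
  have 4: "run (move (b + 2) (b + 3)) s4 (6 * p M + 1) s5"
    by (rule run_weaken[of _ _ "6 * length (s4 (b + 2)) + 1"])
      (use run_move[of s4 "b + 2" "b + 3"] len ys0 s4 in \<open>auto simp: s5_def\<close>)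
  have s5: "s5 (b + 3) = rev (ys 0)" "s5 r = []" using r by (auto simp: s5_def s4_def)
  have 5: "run (move (b + 3) r) s5 (6 * p M + 1) (s5(b + 3 := [], r := ys 0))"
    by (rule run_weaken[of _ _ "6 * length (s5 (b + 3)) + 1"])
      (use run_move[of s5 "b + 3" r] len ys0 s5 r in auto)
  have eq: "s5(b + 3 := [], r := ys 0) = s(r := ys 0)"
    using s r by (auto simp: fun_eq_iff s5_def s4_def st_def)
  have "n * (?Q + 1) \<le> p M * (3 * q M' + 10)"
    by (rule order_trans[OF _ mult_le_mono1[OF n, of "3 * q M' + 10"]]) (simp add: algebra_simps)
  then have "run (assign b r l e) s
    (p M + (p M * (3 * q M' + 10) + 1) + (2 * M + 1) + 2 * (6 * p M + 1) + 4) (s(r := ys 0))"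
    unfolding assign_def
    by (intro run_weaken[OF run_Seq[OF 1 run_Seq[OF 2 run_Seq[OF 3[folded s4_def] run_Seq[OF 4 5[unfolded eq]]]]]])
      simp
  then show ?thesis by (simp add: ys_def v_def n_def R_def M'_def)
qed

lemma evaluates_le:
  assumes "evaluates b l p" "\<forall>r\<ge>b. s r = []" "pos_regs s" "\<forall>r<b. length (s r) \<le> M"
  shows "val l (reg_bits s) (\<lambda>_. 0) \<le> p M"
proof -
  have "eval_pre b (\<lambda>_. b) (b + 1) (b + 2) s (reg_bits s) (\<lambda>_. 0) M"
    using assms by (auto simp: eval_pre_def)
  from evaluatesD(2)[OF assms(1) this] show ?thesis .
qed

theorem assign_exists:
  assumes "definable b l" "definableP b P" "r < b"
  shows "\<exists>c p N. polyb p \<and> mono p \<and> (\<forall>n\<ge>N. \<forall>S\<ge>3. wf_com n S c) \<and>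
    (\<forall>s M. (\<forall>r\<ge>b. s r = []) \<and> pos_regs s \<and> (\<forall>r<b. length (s r) \<le> M) \<longrightarrow>
      run c s (p M) (s(r := map (\<lambda>i. bit_sym (P (reg_bits s) (case_nat i (\<lambda>_. 0))))
        [0..<l (reg_bits s) (\<lambda>_. 0)])) \<and> l (reg_bits s) (\<lambda>_. 0) \<le> p M)"
proof -
  obtain el ep where el: "wf_exp b el" "\<And>R \<sigma>. val el R \<sigma> = l R \<sigma>"
    and ep: "wf_exp b ep" "\<And>R \<sigma>. val ep R \<sigma> = of_bool (P R \<sigma>)"
    using assms unfolding definable_def by blast
  obtain p q' where p: "polyb p" "evaluates b el p" "polyb q'" "evaluates b ep q'"
    using evaluates_exists[OF el(1)] evaluates_exists[OF ep(1)] by blast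
  obtain q where q: "polyb q" "mono q" "\<And>M. q' M \<le> q M" using polyb_monoE[OF p(3)] by blast
  note ev = evaluates_mono[OF p(4) q(3)]
  define c where "c = assign b r el ep"
  define N where "N = b + 2 * size el + 2 * size ep + 10"
  have "wf_com n S c" if "n \<ge> N" "S \<ge> 3" for n S
  proof -
    have "\<forall>i. case_nat (b + 1) (\<lambda>_. b) i < n" using that by (auto simp: N_def split: nat.split)
    then show ?thesis using that assms(3)
      wf_compile[OF el(1), of n "\<lambda>_. b" "b + 1" "b + 2" S]
      wf_compile[OF ep(1), of n "case_nat (b + 1) (\<lambda>_. b)" "b + 3" "b + 4" S]
      by (simp add: c_def assign_def N_def wf_move wf_clear)
  qed
  moreover
  have "polyb (\<lambda>M. q (M + p M))" by (rule polyb_compose[OF q(1)]) (intro polyb_intros p)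
  then have "polyb (\<lambda>M. p M + (p M * (3 * q (M + p M) + 10) + 1) + (2 * M + 1) + 2 * (6 * p M + 1) + 4)"
    by (intro polyb_intros p)
  then obtain p' where p': "polyb p'" "mono p'"
    "\<And>M. p M + (p M * (3 * q (M + p M) + 10) + 1) + (2 * M + 1) + 2 * (6 * p M + 1) + 4 \<le> p' M"
    using polyb_monoE by blast
  moreover have "run c s (p' M) (s(r := map (\<lambda>i. bit_sym (P (reg_bits s) (case_nat i (\<lambda>_. 0))))
        [0..<l (reg_bits s) (\<lambda>_. 0)])) \<and> l (reg_bits s) (\<lambda>_. 0) \<le> p' M"
    if "\<forall>r\<ge>b. s r = []" "pos_regs s" "\<forall>r<b. length (s r) \<le> M" for s M
    using run_weaken[OF run_assign[OF p(2) ev q(2) assms(3) that] p'(3)]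
      evaluates_le[OF p(2) that] p'(3)[of M] by (simp add: c_def el ep)
  ultimately have "polyb p' \<and> mono p' \<and> (\<forall>n\<ge>N. \<forall>S\<ge>3. wf_com n S c) \<and>
    (\<forall>s M. (\<forall>r\<ge>b. s r = []) \<and> pos_regs s \<and> (\<forall>r<b. length (s r) \<le> M) \<longrightarrow>
      run c s (p' M) (s(r := map (\<lambda>i. bit_sym (P (reg_bits s) (case_nat i (\<lambda>_. 0))))
        [0..<l (reg_bits s) (\<lambda>_. 0)])) \<and> l (reg_bits s) (\<lambda>_. 0) \<le> p' M)"
    by simp
  then show ?thesis by (intro exI)
qed

lemma polyb_to_power:
  assumes "polyb p" shows "\<exists>c. \<forall>n. p n \<le> n ^ c + c"
proof -
  obtain c where c: "\<And>M. p M \<le> (M + 2) ^ c" using assms unfolding polyb_def by blast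
  \<comment> \<open>The exponent 2c suffices for n \<ge> 2, where n + 2 \<le> n^2, and the summand
    3^c covers n \<le> 1.\<close>
  define d where "d = max (2 * c) (3 ^ c)"
  have "(n + 2) ^ c \<le> n ^ d + d" for n
  proof (cases "n \<le> 1")
    case True
    then have "(n + 2) ^ c \<le> 3 ^ c" by (intro power_mono) auto
    then show ?thesis by (simp add: d_def)
  next
    case False
    then have "n + 2 \<le> 2 * n" "2 * n \<le> n * n" by simp_all
    then have "n + 2 \<le> n ^ 2" unfolding power2_eq_square by (rule order_trans)
    then have "(n + 2) ^ c \<le> n ^ (2 * c)" using power_mono[of "n + 2" "n ^ 2" c] by (simp add: power_mult)
    also have "\<dots> \<le> n ^ d" using False by (intro power_increasing) (auto simp: d_def)
    finally show ?thesis by simp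
  qed
  then show ?thesis using c order_trans by blast
qed

lemma reg_bits_input: "reg_bits (input_regs x) = (\<lambda>_. [])(0 := x)"
proof -
  have "(bit_sym b = 2) = b" for b by (simp add: bit_sym_def)
  then have "map ((\<lambda>b. b = 2) \<circ> bit_sym) x = x" by (intro map_idI) simp
  then show ?thesis by (auto simp: fun_eq_iff reg_bits_def input_regs_def)
qed

lemma computes_within_mono:
  assumes "computes_within M x y t" "t \<le> t'"
  shows "computes_within M x y t'"
proof -
  have halt: "(tm_step M ^^ t) (states M, ts) = (states M, ts)" for t ts by (induction t) auto
  obtain ts where ts: "(tm_step M ^^ t) (init_config M x) = (states M, ts)" "fst (last ts) = tape_of y"
    using assms(1) unfolding computes_within_def by blast
  then have "(tm_step M ^^ (t' - t + t)) (init_config M x) = (states M, ts)"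
    by (simp add: funpow_add halt)
  then show ?thesis using assms(2) ts(2) by (auto simp: computes_within_def)
qed

text \<open>The reduction for NP-hardness comes from this: only the length and the bit predicate of
  its output have to be exhibited, and no program is written for it.\<close>

theorem definable_poly_time:
  assumes "definable 1 l" "definableP 1 P"
  shows "poly_time_computable (\<lambda>x. map (\<lambda>i. P ((\<lambda>_. [])(0 := x)) (case_nat i (\<lambda>_. 0)))
    [0..<l ((\<lambda>_. [])(0 := x)) (\<lambda>_. 0)])"
proof -
  obtain c p N where c: "polyb p" "\<forall>n\<ge>N. \<forall>S\<ge>3. wf_com n S c"
    "\<And>s M. (\<forall>r\<ge>1. s r = []) \<and> pos_regs s \<and> (\<forall>r<1. length (s r) \<le> M) ==>
      run c s (p M) (s(0 := map (\<lambda>i. bit_sym (P (reg_bits s) (case_nat i (\<lambda>_. 0))))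
        [0..<l (reg_bits s) (\<lambda>_. 0)])) \<and> l (reg_bits s) (\<lambda>_. 0) \<le> p M"
    using assign_exists[OF assms, of 0] by auto
  define y where "y x = map (\<lambda>i. P ((\<lambda>_. [])(0 := x)) (case_nat i (\<lambda>_. 0)))
    [0..<l ((\<lambda>_. [])(0 := x)) (\<lambda>_. 0)]" for x
  have "\<exists>M. wf_tm M \<and> (\<forall>x y t s'. run c (input_regs x) t s' \<and> s' 0 = map bit_sym y \<longrightarrow>
      computes_within M x y (t + length y + 1))"
    using c(2) by (intro com_to_tm[of "max N 1" 3]) auto
  then obtain M where M: "wf_tm M"
    "\<And>x y t s'. run c (input_regs x) t s' \<and> s' 0 = map bit_sym y ==> computes_within M x y (t + length y + 1)"
    by blast
  have "polyb (\<lambda>M. p M + p M + 1)" by (intro polyb_intros c)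
  then obtain d where d: "\<And>n. p n + p n + 1 \<le> n ^ d + d" using polyb_to_power by blast
  have "computes_within M x (y x) (length x ^ d + d)" for x
  proof -
    have pre: "(\<forall>r\<ge>1. input_regs x r = []) \<and> pos_regs (input_regs x) \<and> (\<forall>r<1. length (input_regs x r) \<le> length x)"
      by (auto simp: input_regs_def pos_regs_def bit_sym_def)
    note r = c(3)[OF pre, unfolded reg_bits_input]
    have "computes_within M x (y x) (p (length x) + length (y x) + 1)"
      by (rule M(2)) (use r in \<open>auto simp: y_def\<close>)
    moreover have "length (y x) \<le> p (length x)" using r by (simp add: y_def)
    ultimately show ?thesis using d[of "length x"] by (elim computes_within_mono) linarith
  qed
  then show ?thesis using M(1) unfolding poly_time_computable_def y_def by blast
qed

section \<open>Distances, radius and diameter\<close>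

definition reach_in :: "'a pair_pre_digraph => nat => 'a => 'a => bool" where
  "reach_in G n u v \<longleftrightarrow> (\<exists>p. pre_digraph.awalk (with_proj G) u p v \<and> length p \<le> n)"

context pair_graph
begin

lemma graph_dist_eq: "graph_dist G u v = (INF p\<in>{p. awalk u p v}. ereal (real (length p)))"
  unfolding graph_dist_def \<mu>_def awalk_cost_def by (simp add: sum_list_triv)

lemma graph_dist_le: "reach_in G n u v ==> graph_dist G u v \<le> ereal (real n)"
  unfolding graph_dist_eq reach_in_def by (auto intro!: INF_lower2)

lemma graph_dist_ge:
  assumes "\<And>p. awalk u p v ==> n \<le> length p"
  shows "ereal (real n) \<le> graph_dist G u v"
  unfolding graph_dist_eq by (rule INF_greatest) (use assms in auto)

lemma reach_in_if_graph_dist_less: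
  assumes "graph_dist G u v < ereal (real (Suc n))"
  shows "reach_in G n u v"
proof -
  obtain p where "awalk u p v" "real (length p) < real (Suc n)"
    using assms unfolding graph_dist_eq INF_less_iff by auto
  then show ?thesis unfolding reach_in_def by (intro exI[of _ p]) auto
qed

lemma reach_in_refl: "u \<in> pverts G ==> reach_in G n u u"
  unfolding reach_in_def by (rule exI[of _ "[]"]) (simp add: awalk_Nil_iff)

lemma reach_in_trans: "reach_in G n u v ==> reach_in G m v w ==> reach_in G (n + m) u w"
  unfolding reach_in_def by (metis add_mono awalk_appendI length_append)

lemma reach_in_arc: "(u, v) \<in> parcs G ==> reach_in G 1 u v"
  unfolding reach_in_def by (rule exI[of _ "[(u, v)]"]) (auto simp: awalk_simps in_arcsD2)

lemma reach_in_step: "reach_in G n u v ==> (v, w) \<in> parcs G ==> reach_in G (Suc n) u w"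
  using reach_in_trans[OF _ reach_in_arc] by fastforce

lemma reach_in_sym: "reach_in G n u v ==> reach_in G n v u"
proof -
  have "length (rev_path p) = length p" for p :: "('a \<times> 'a) list" by (induction p) auto
  then show "reach_in G n u v ==> reach_in G n v u" unfolding reach_in_def by (metis awalk_rev_path)
qed

text \<open>A function that drops by at most one along every arc certifies a lower bound on
  distances.\<close>

lemma reach_in_lipschitz:
  fixes h :: "'a => nat"
  assumes "\<And>a b. (a, b) \<in> parcs G ==> h a \<le> Suc (h b)" "awalk u p v"
  shows "h u \<le> h v + length p"
  using assms(2)
proof (induction p arbitrary: u)
  case (Cons e p)
  then have "e \<in> parcs G" "u = fst e" "awalk (snd e) p v" by (auto simp: awalk_simps)
  then show ?case using Cons.IH[of "snd e"] assms(1)[of "fst e" "snd e"] by auto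
qed (simp add: awalk_Nil_iff)

lemma graph_radius_eqI:
  assumes "z \<in> pverts G" "\<And>v. v \<in> pverts G ==> reach_in G r z v"
    and "\<And>u. u \<in> pverts G ==> \<exists>v\<in>pverts G. \<forall>p. awalk u p v \<longrightarrow> r \<le> length p"
  shows "graph_radius G = ereal (real r)"
proof (rule antisym)
  have "(SUP v\<in>pverts G. graph_dist G z v) \<le> ereal (real r)"
    by (rule SUP_least) (use assms(2) graph_dist_le in blast)
  then show "graph_radius G \<le> ereal (real r)"
    unfolding graph_radius_def by (rule INF_lower2[OF assms(1)])
  show "ereal (real r) \<le> graph_radius G"
    unfolding graph_radius_def
  proof (rule INF_greatest)
    fix u assume "u \<in> pverts G"
    then obtain v where "v \<in> pverts G" "ereal (real r) \<le> graph_dist G u v"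
      using assms(3) graph_dist_ge by meson
    then show "ereal (real r) \<le> (SUP v\<in>pverts G. graph_dist G u v)" by (rule SUP_upper2)
  qed
qed

lemma graph_diameter_le:
  assumes "graph_radius G = ereal (real r)"
  shows "graph_diameter G \<le> ereal (real (2 * r))"
proof -
  \<comment> \<open>Since the infimum is below r + 1, some z undercuts r + 1, and integrality of
    walk lengths turns this into the bound r.\<close>
  have "(INF z\<in>pverts G. SUP v\<in>pverts G. graph_dist G z v) < ereal (real (Suc r))"
    using assms by (simp add: graph_radius_def)
  then obtain z where z: "z \<in> pverts G" "(SUP v\<in>pverts G. graph_dist G z v) < ereal (real (Suc r))"
    unfolding INF_less_iff by blast
  have w: "reach_in G r z v" if "v \<in> pverts G" for v
    by (rule reach_in_if_graph_dist_less) (rule le_less_trans[OF SUP_upper[OF that] z(2)])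
  show ?thesis unfolding graph_diameter_def
  proof (intro SUP_least)
    fix u v assume "u \<in> pverts G" "v \<in> pverts G"
    then have "reach_in G (r + r) u v" by (intro reach_in_trans[OF reach_in_sym[OF w] w])
    then have "graph_dist G u v \<le> ereal (real (r + r))" by (rule graph_dist_le)
    then show "graph_dist G u v \<le> ereal (real (2 * r))" unfolding mult_2 .
  qed
qed

end

lemma radius_subset_diameter: "radius_graphs r \<subseteq> diameter_at_most_graphs (2 * r)"
  unfolding radius_graphs_def diameter_at_most_graphs_def input_graphs_def
  using pair_graph.graph_diameter_le by auto

section \<open>From 3-colourings to homomorphisms into odd cycles\<close>

text \<open>
  A 3-colouring instance has vertices \<open>x < nv\<close>, each with two (not necessarily new) edges to
  \<open>e x 0\<close> and \<open>e x 1\<close>.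
\<close>

definition colourable3 :: "nat => (nat => nat => nat) => bool" where
  "colourable3 nv e \<longleftrightarrow> (\<exists>\<chi>. (\<forall>x<nv. \<chi> x < (3::nat)) \<and> (\<forall>x<nv. \<forall>r<2. \<chi> x \<noteq> \<chi> (e x r)))"

text \<open>
  Vertex \<open>4kx + s\<close> is slot \<open>s\<close> of block \<open>x\<close>. In a block \<open>x < nv\<close>, slot \<open>0\<close> is the vertex \<open>x\<close>
  itself, slot \<open>1\<close> joins it to the centre, and slots \<open>2..2k-1\<close> and \<open>2k..4k-3\<close> subdivide its two
  edges into paths of length \<open>2k-1\<close>. Block \<open>nv\<close> contains the centre in slot \<open>0\<close> and two pendant
  paths of length \<open>k+1\<close>, which make the radius exactly \<open>k+1\<close>. All other slots are leaves at the centre.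
\<close>

definition parent :: "nat => nat => nat => nat" where
  "parent k nv u = (if u div (4 * k) < nv then
       if u mod (4 * k) = 0 then u + 1
       else if u mod (4 * k) = 1 then 4 * k * nv
       else if u mod (4 * k) = 2 \<or> u mod (4 * k) = 2 * k then 4 * k * (u div (4 * k))
       else if u mod (4 * k) < 4 * k - 2 then u - 1 else 4 * k * nv
     else if u mod (4 * k) \<le> 1 \<or> u mod (4 * k) = k + 2 \<or> 2 * k + 2 < u mod (4 * k) then 4 * k * nv
     else u - 1)"

text \<open>The last inner vertex of a subdivided edge has a second forward neighbour, the other end
  of the edge. Everywhere else \<open>link\<close> repeats \<open>parent\<close>, so that two
  functions describe all edges.\<close>

definition link :: "nat => nat => (nat => nat => nat) => nat => nat" where
  "link k nv e u = (if u div (4 * k) < nv \<and> u mod (4 * k) = 2 * k - 1 then 4 * k * e (u div (4 * k)) 0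
     else if u div (4 * k) < nv \<and> u mod (4 * k) = 4 * k - 3 then 4 * k * e (u div (4 * k)) 1
     else parent k nv u)"

text \<open>The centre is its own parent; the condition u \<noteq> v removes this loop.\<close>

definition joined :: "nat => nat => (nat => nat => nat) => nat => nat => bool" where
  "joined k nv e u v \<longleftrightarrow> u \<noteq> v \<and> (parent k nv u = v \<or> parent k nv v = u \<or> link k nv e u = v \<or> link k nv e v = u)"

definition hom_graph :: "nat => nat => (nat => nat => nat) => nat pair_pre_digraph" where
  "hom_graph k nv e = \<lparr>pverts = {..<4 * k * (nv + 1)},
     parcs = {(u, v). u < 4 * k * (nv + 1) \<and> v < 4 * k * (nv + 1) \<and> joined k nv e u v}\<rparr>"

lemma pair_graph_hom_graph: "pair_graph (hom_graph k nv e)"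
proof -
  have "finite {(u, v). u < 4 * k * (nv + 1) \<and> v < 4 * k * (nv + 1) \<and> joined k nv e u v}"
    by (rule finite_subset[of _ "{..<4 * k * (nv + 1)} \<times> {..<4 * k * (nv + 1)}"]) auto
  then show ?thesis
    by unfold_locales (auto simp: hom_graph_def joined_def symmetric_def intro!: symI)
qed

lemma hom_graph_input: "hom_graph k nv e \<in> input_graphs"
  using pair_graph_hom_graph by (auto simp: input_graphs_def hom_graph_def)

lemma parent_slot:
  assumes "s < 4 * k"
  shows "parent k nv (4 * k * x + s) = (if x < nv then
       if s = 0 then 4 * k * x + 1
       else if s = 1 then 4 * k * nv
       else if s = 2 \<or> s = 2 * k then 4 * k * x
       else if s < 4 * k - 2 then 4 * k * x + (s - 1) else 4 * k * nv
     else if s \<le> 1 \<or> s = k + 2 \<or> 2 * k + 2 < s then 4 * k * nv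
     else 4 * k * x + (s - 1))"
proof -
  have d: "(4 * k * x + s) div (4 * k) = x" "(4 * k * x + s) mod (4 * k) = s" using assms by simp_all
  have e: "s \<noteq> 0 ==> 4 * k * x + s - 1 = 4 * k * x + (s - 1)" by simp
  show ?thesis unfolding parent_def d by (intro if_cong refl e) auto
qed

lemma link_slot:
  assumes "s < 4 * k"
  shows "link k nv e (4 * k * x + s) = (if x < nv \<and> s = 2 * k - 1 then 4 * k * e x 0
     else if x < nv \<and> s = 4 * k - 3 then 4 * k * e x 1 else parent k nv (4 * k * x + s))"
proof -
  have d: "(4 * k * x + s) div (4 * k) = x" "(4 * k * x + s) mod (4 * k) = s" using assms by simp_all
  show ?thesis unfolding link_def d by (rule refl)
qed

lemma slot_less: "x \<le> nv ==> s < 4 * k ==> 4 * k * x + s < 4 * k * (nv + 1)" for x nv s k :: nat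
  using mult_le_mono2[of x nv "4 * k"] unfolding distrib_left by linarith

lemma slot_eq_iff: "s < 4 * k ==> t < 4 * k ==> 4 * k * x + s = 4 * k * y + t \<longleftrightarrow> x = y \<and> s = t" for x y s t k :: nat
proof
  assume s: "s < 4 * k" "t < 4 * k" and eq: "4 * k * x + s = 4 * k * y + t"
  have "(4 * k * x + s) div (4 * k) = x" "(4 * k * x + s) mod (4 * k) = s"
    "(4 * k * y + t) div (4 * k) = y" "(4 * k * y + t) mod (4 * k) = t" using s by simp_all
  then show "x = y \<and> s = t" using eq by metis
qed simp

lemma slotE:
  fixes u k nv :: nat
  assumes "u < 4 * k * (nv + 1)"
  obtains x s where "u = 4 * k * x + s" "s < 4 * k" "x \<le> nv"
proof
  have k: "0 < 4 * k" using assms by (cases k) auto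
  show "u = 4 * k * (u div (4 * k)) + u mod (4 * k)" by simp
  show "u mod (4 * k) < 4 * k" using k by simp
  have "u div (4 * k) < nv + 1" using assms by (metis div_less_iff_less_mult k mult.commute)
  then show "u div (4 * k) \<le> nv" by simp
qed

text \<open>The edges in coordinates (block, slot), free of division, which makes the case
  distinctions below linear arithmetic.\<close>

definition slot_edge :: "nat => nat => (nat => nat => nat) => nat => nat => nat => nat => bool" where
  "slot_edge k nv e x s y t \<longleftrightarrow> (if x < nv then
       if s = 0 then (y, t) = (x, 1)
       else if s = 1 then (y, t) = (nv, 0)
       else if s = 2 \<or> s = 2 * k then (y, t) = (x, 0)
       else if s < 4 * k - 2 then (y, t) = (x, s - 1) else (y, t) = (nv, 0)
     else if s \<le> 1 \<or> s = k + 2 \<or> 2 * k + 2 < s then (y, t) = (nv, 0)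
     else (y, t) = (x, s - 1)) \<or>
     x < nv \<and> s = 2 * k - 1 \<and> (y, t) = (e x 0, 0) \<or> x < nv \<and> s = 4 * k - 3 \<and> (y, t) = (e x 1, 0)"

lemma slot_edge_iff:
  assumes "k \<ge> 2" "s < 4 * k" "t < 4 * k"
  shows "parent k nv (4 * k * x + s) = 4 * k * y + t \<or> link k nv e (4 * k * x + s) = 4 * k * y + t \<longleftrightarrow>
    slot_edge k nv e x s y t"
proof -
  have 0: "4 * k * a = 4 * k * y + t \<longleftrightarrow> (y, t) = (a, 0)" for a
    using slot_eq_iff[of 0 k t a y] assms by auto
  have 1: "4 * k * a + 1 = 4 * k * y + t \<longleftrightarrow> (y, t) = (a, 1)" for a
    using slot_eq_iff[of 1 k t a y] assms by auto
  have 2: "4 * k * a + (s - 1) = 4 * k * y + t \<longleftrightarrow> (y, t) = (a, s - 1)" for a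
    using slot_eq_iff[of "s - 1" k t a y] assms by auto
  have "2 * k - 1 \<noteq> 4 * k - 3" using assms by auto
  then show ?thesis
    unfolding link_slot[OF assms(2)] parent_slot[OF assms(2)] slot_edge_def
    by (simp only: if_distrib[of "\<lambda>a. a = 4 * k * y + t"] 0 1 2) auto
qed

lemma arc_hom_graphI:
  assumes "k \<ge> 2" "x \<le> nv" "s < 4 * k" "y \<le> nv" "t < 4 * k" "(x, s) \<noteq> (y, t)" "slot_edge k nv e x s y t"
  shows "(4 * k * x + s, 4 * k * y + t) \<in> parcs (hom_graph k nv e)"
    "(4 * k * y + t, 4 * k * x + s) \<in> parcs (hom_graph k nv e)"
  using assms slot_less[of x nv s k] slot_less[of y nv t k] slot_eq_iff[of s k t x y]
    slot_edge_iff[OF assms(1,3,5), of nv x y e]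
  by (auto simp: hom_graph_def joined_def)

lemma arc_hom_graphE:
  assumes "k \<ge> 2" "(u, v) \<in> parcs (hom_graph k nv e)"
  obtains x s y t where "x \<le> nv" "s < 4 * k" "y \<le> nv" "t < 4 * k" "u = 4 * k * x + s" "v = 4 * k * y + t"
    "(x, s) \<noteq> (y, t)" "slot_edge k nv e x s y t \<or> slot_edge k nv e y t x s"
proof -
  have "u < 4 * k * (nv + 1)" "v < 4 * k * (nv + 1)" and j: "joined k nv e u v"
    using assms by (auto simp: hom_graph_def)
  then obtain x s y t where xs: "u = 4 * k * x + s" "s < 4 * k" "x \<le> nv" "v = 4 * k * y + t" "t < 4 * k" "y \<le> nv"
    using slotE[of u k nv] slotE[of v k nv] by metis
  have "slot_edge k nv e x s y t \<or> slot_edge k nv e y t x s"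
    using j slot_edge_iff[OF assms(1) xs(2,5), of nv x y e] slot_edge_iff[OF assms(1) xs(5,2), of nv y x e]
    unfolding joined_def xs(1,4) by blast
  then show ?thesis using that[OF xs(3,2,6,5,1,4)] j unfolding joined_def xs(1,4) by auto
qed

text \<open>A vertex of the colouring instance is two steps from the centre, and an inner vertex of
  a subdivided edge is within k - 1 of one of its ends. Conversely, every vertex lies outside one of
  the two pendant paths and is at least k + 1 away from the end of that path.\<close>

lemma hom_graph_radius:
  assumes k: "k \<ge> 2" and e: "\<And>x r. x < nv ==> r < 2 ==> e x r < nv"
  shows "hom_graph k nv e \<in> radius_graphs (k + 1)"
proof -
  let ?G = "hom_graph k nv e" and ?z = "4 * k * nv + 0"
  interpret pair_graph ?G by (rule pair_graph_hom_graph)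
  have verts: "4 * k * x + s \<in> pverts ?G" if "x \<le> nv" "s < 4 * k" for x s
    using slot_less[OF that] by (simp add: hom_graph_def)
  have z: "reach_in ?G 0 ?z ?z" by (rule reach_in_refl) (use verts[of nv 0] k in simp)
  have up: "reach_in ?G (Suc n) ?z (4 * k * x + s)"
    if "reach_in ?G n ?z (4 * k * y + t)" "x \<le> nv" "s < 4 * k" "y \<le> nv" "t < 4 * k" "(x, s) \<noteq> (y, t)"
      "slot_edge k nv e x s y t" for n x s y t
    using reach_in_step[OF that(1) arc_hom_graphI(2)[OF k that(2-7)]] .
  have down: "reach_in ?G (Suc n) ?z (4 * k * x + s)"
    if "reach_in ?G n ?z (4 * k * y + t)" "x \<le> nv" "s < 4 * k" "y \<le> nv" "t < 4 * k" "(y, t) \<noteq> (x, s)"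
      "slot_edge k nv e y t x s" for n x s y t
    using reach_in_step[OF that(1) arc_hom_graphI(1)[OF k that(4,5,2,3,6,7)]] .
  have mono: "reach_in ?G n u v ==> n \<le> m ==> reach_in ?G m u v" for n m u v
    unfolding reach_in_def using order_trans by blast
  have pend: "reach_in ?G i ?z (4 * k * nv + (a * (k + 1) + i))" if "1 \<le> i" "i \<le> k + 1" "a < 2" for i a
    using that
  proof (induction i)
    case (Suc i)
    have a: "a = 0 \<or> a = 1" using Suc by auto
    show ?case
    proof (cases "i = 0")
      case True
      have "reach_in ?G (Suc 0) ?z (4 * k * nv + (a * (k + 1) + 1))"
        by (rule up[OF z]) (use a k in \<open>auto simp: slot_edge_def\<close>)
      then show ?thesis using True by simp
    next
      case False
      show ?thesis by (rule up[OF Suc.IH]) (use a k Suc.prems False in \<open>auto simp: slot_edge_def\<close>)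
    qed
  qed simp
  have mid: "reach_in ?G (Suc 0) ?z (4 * k * x + 1)" if "x < nv" for x
    by (rule up[OF z]) (use that k in \<open>auto simp: slot_edge_def\<close>)
  have vx: "reach_in ?G (Suc (Suc 0)) ?z (4 * k * x + 0)" if "x < nv" for x
    by (rule up[OF mid[OF that]]) (use that k in \<open>auto simp: slot_edge_def\<close>)
  have path_up: "reach_in ?G (Suc (Suc i)) ?z (4 * k * x + (r * (2 * k - 2) + 1 + i))"
    if "x < nv" "r < 2" "1 \<le> i" "i \<le> 2 * k - 2" for x r i
    using that(3,4)
  proof (induction i)
    case (Suc i)
    have r: "r = 0 \<or> r = 1" using that by auto
    show ?case
    proof (cases "i = 0")
      case True
      have "reach_in ?G (Suc (Suc (Suc 0))) ?z (4 * k * x + (r * (2 * k - 2) + 2))"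
        by (rule up[OF vx[OF that(1)]]) (use r that k in \<open>auto simp: slot_edge_def\<close>)
      then show ?thesis using True by simp
    next
      case False
      show ?thesis by (rule up[OF Suc.IH]) (use r that k Suc.prems False in \<open>auto simp: slot_edge_def\<close>)
    qed
  qed simp
  have path_down: "reach_in ?G (Suc (Suc j)) ?z (4 * k * x + (r * (2 * k - 2) + 2 * k - j))"
    if "x < nv" "r < 2" "1 \<le> j" "j \<le> 2 * k - 2" for x r j
    using that(3,4)
  proof (induction j)
    case (Suc j)
    have r: "r = 0 \<or> r = 1" using that by auto
    have er: "e x 0 < nv" "e x 1 < nv" using e that by auto
    show ?case
    proof (cases "j = 0")
      case True
      have "reach_in ?G (Suc (Suc (Suc 0))) ?z (4 * k * x + (r * (2 * k - 2) + 2 * k - 1))"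
        by (rule up[OF vx[OF e[OF that(1,2)]]]) (use r that k er in \<open>auto simp: slot_edge_def\<close>)
      then show ?thesis using True by simp
    next
      case False
      show ?thesis
        by (rule down[OF Suc.IH]) (use r that k Suc.prems False in \<open>auto simp: slot_edge_def\<close>)
    qed
  qed simp
  have all: "reach_in ?G (k + 1) ?z v" if "v \<in> pverts ?G" for v
  proof -
    have "v < 4 * k * (nv + 1)" using that by (simp add: hom_graph_def)
    then obtain x s where v: "v = 4 * k * x + s" "s < 4 * k" "x \<le> nv" by (rule slotE)
    have leaf: "reach_in ?G (Suc 0) ?z (4 * k * x + s)" if "slot_edge k nv e x s nv 0" "(x, s) \<noteq> (nv, 0)"
      by (rule up[OF z]) (use that v k in auto)
    \<comment> \<open>The i-th inner vertex is i steps from one end and 2k - 1 - i from the other;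
      the smaller number is at most k - 1.\<close>
    have half: "reach_in ?G (k + 1) ?z (4 * k * x + (r * (2 * k - 2) + 1 + i))"
      if "x < nv" "r < 2" "1 \<le> i" "i \<le> 2 * k - 2" for r i
    proof (cases "i \<le> k - 1")
      case True
      then show ?thesis using mono[OF path_up[OF that]] k by simp
    next
      case False
      have "2 * k - (2 * k - 1 - i) = i + 1" using that k by simp
      then have "r * (2 * k - 2) + 2 * k - (2 * k - 1 - i) = r * (2 * k - 2) + 1 + i" using that k by simp
      then show ?thesis using mono[OF path_down[OF that(1,2), of "2 * k - 1 - i"], of "k + 1"] that False k by simp
    qed
    show ?thesis
    proof (cases "x < nv")
      case True
      consider "s = 0" | "s = 1" | "2 \<le> s" "s \<le> 2 * k - 1" | "2 * k \<le> s" "s \<le> 4 * k - 3" | "4 * k - 2 \<le> s"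
        using v by linarith
      then show ?thesis
      proof cases
        case 1
        then show ?thesis using mono[OF vx[OF True], of "k + 1"] k v by simp
      next
        case 2
        then show ?thesis using mono[OF mid[OF True], of "k + 1"] k v by simp
      next
        case 3
        then show ?thesis using half[of 0 "s - 1"] True v by simp
      next
        case 4
        moreover have "2 * k - 2 + 1 + (s - (2 * k - 1)) = s" using 4 k by simp
        ultimately show ?thesis using half[of 1 "s - (2 * k - 1)"] True v k by simp
      next
        case 5
        then have "slot_edge k nv e x s nv 0" using True k v by (auto simp: slot_edge_def)
        then show ?thesis using mono[OF leaf, of "k + 1"] True v by simp
      qed
    next
      case False
      then have x: "x = nv" using v by simp
      consider "s = 0" | "1 \<le> s" "s \<le> k + 1" | "k + 2 \<le> s" "s \<le> 2 * k + 2" | "2 * k + 2 < s"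
        by linarith
      then show ?thesis
      proof cases
        case 1
        then show ?thesis using mono[OF z, of "k + 1"] v x by simp
      next
        case 2
        then show ?thesis using mono[OF pend[of s 0], of "k + 1"] v x by simp
      next
        case 3
        moreover have "k + 1 + (s - (k + 1)) = s" using 3 by simp
        ultimately show ?thesis using mono[OF pend[of "s - (k + 1)" 1], of "k + 1"] v x by simp
      next
        case 4
        then show ?thesis using mono[OF leaf, of "k + 1"] x v k by (auto simp: slot_edge_def)
      qed
    qed
  qed
  have far: "\<exists>v\<in>pverts ?G. \<forall>p. awalk u p v \<longrightarrow> k + 1 \<le> length p" if "u \<in> pverts ?G" for u
  proof -
    have "u < 4 * k * (nv + 1)" using that by (simp add: hom_graph_def)
    then obtain x s where u: "u = 4 * k * x + s" "s < 4 * k" "x \<le> nv" by (rule slotE)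
    \<comment> \<open>The index of a pendant path that does not contain u.\<close>
    define a :: nat where "a = (if x = nv \<and> 1 \<le> s \<and> s \<le> k + 1 then 1 else 0)"
    \<comment> \<open>The distance to the end of this path, cut off at the value k + 1 that it has
      at the centre.\<close>
    define h where "h w = (if w div (4 * k) = nv \<and> a * (k + 1) < w mod (4 * k) \<and> w mod (4 * k) \<le> a * (k + 1) + (k + 1)
      then k + 1 - (w mod (4 * k) - a * (k + 1)) else k + 1)" for w
    have h: "h (4 * k * y + t) = (if y = nv \<and> a * (k + 1) < t \<and> t \<le> a * (k + 1) + (k + 1)
      then k + 1 - (t - a * (k + 1)) else k + 1)" if "t < 4 * k" for y t
      using that by (simp add: h_def)
    have a: "a = 0 \<or> a = 1" by (auto simp: a_def)
    have h_edge: "h (4 * k * x + s) \<le> Suc (h (4 * k * y + t)) \<and> h (4 * k * y + t) \<le> Suc (h (4 * k * x + s))"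
      if "x \<le> nv" "s < 4 * k" "y \<le> nv" "t < 4 * k" "slot_edge k nv e x s y t" for x s y t
    proof -
      have "e x 0 < nv" "e x 1 < nv" if "x < nv" using e that by auto
      then show ?thesis unfolding h[OF that(2)] h[OF that(4)] using a that(1,2,5) k
        by (auto simp: slot_edge_def split: if_splits)
    qed
    have lip: "h v \<le> Suc (h w)" if "(v, w) \<in> parcs ?G" for v w
      using arc_hom_graphE[OF k that] h_edge by metis
    define v where "v = 4 * k * nv + (a * (k + 1) + (k + 1))"
    have t: "a * (k + 1) + (k + 1) < 4 * k" using a k by auto
    have "h v = 0" using h[OF t] by (simp add: v_def)
    moreover have "h u = k + 1" unfolding u(1) h[OF u(2)] using a by (auto simp: a_def)
    ultimately have "k + 1 \<le> length p" if "awalk u p v" for p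
      using reach_in_lipschitz[of h u p v, OF lip that] by simp
    then show ?thesis using verts[OF _ t, of nv] by (auto simp: v_def)
  qed
  have "graph_radius ?G = ereal (real (k + 1))"
    by (rule graph_radius_eqI[OF _ all far]) (use verts[of nv 0] k in auto)
  then show ?thesis using hom_graph_input by (simp add: radius_graphs_def)
qed

section \<open>Walks in cycles and their lifts to the integers\<close>

lemma cycle_arcD:
  assumes "(a, b) \<in> parcs (cycle_graph L)"
  shows "\<exists>d. (d = 1 \<or> d = -1) \<and> int L dvd int b - int a - d"
proof -
  have step: "int L dvd int ((x + 1) mod L) - int x - 1" for x
  proof -
    have "int ((x + 1) mod L) - int x - 1 = - ((int x + 1) - (int x + 1) mod int L)"
      by (simp add: zmod_int add.commute)
    then show ?thesis by (metis dvd_minus_iff dvd_minus_mod)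
  qed
  from assms have "b = (a + 1) mod L \<or> a = (b + 1) mod L" by (auto simp: cycle_graph_def)
  then show ?thesis
  proof
    assume "b = (a + 1) mod L"
    then show ?thesis using step[of a] by auto
  next
    assume a: "a = (b + 1) mod L"
    have "int L dvd - (int a - int b - 1)" using step[of b] a by (simp only: dvd_minus_iff)
    then show ?thesis by (intro exI[of _ "-1"]) (simp add: algebra_simps)
  qed
qed

lemma cycle_arcI:
  assumes "0 < L" "int L dvd a - b - 1 \<or> int L dvd a - b + 1"
  shows "(nat (a mod int L), nat (b mod int L)) \<in> parcs (cycle_graph L)"
proof -
  have step: "nat (x mod int L) = (nat (y mod int L) + 1) mod L" if "int L dvd x - y - 1" for x y
  proof -
    have "x mod int L = (y + 1) mod int L" using that by (simp add: mod_eq_dvd_iff algebra_simps)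
    also have "\<dots> = (y mod int L + 1) mod int L" by (simp add: mod_add_left_eq)
    also have "\<dots> = int ((nat (y mod int L) + 1) mod L)" using assms(1) by (simp add: zmod_int add.commute)
    finally show ?thesis by simp
  qed
  have less: "nat (x mod int L) < L" for x using assms(1) by (simp add: nat_less_iff)
  from assms(2) show ?thesis
  proof
    assume "int L dvd a - b - 1"
    then show ?thesis using step less[of a] less[of b] by (simp add: cycle_graph_def)
  next
    assume "int L dvd a - b + 1"
    then have "int L dvd - (b - a - 1)" by (simp add: algebra_simps)
    then have "int L dvd b - a - 1" by (simp only: dvd_minus_iff)
    then show ?thesis using step less[of a] less[of b] by (simp add: cycle_graph_def)
  qed
qed

text \<open>The walk is lifted to the integers: d is the sum of its steps, each 1 or -1, and so has
  the parity of n and at most its size.\<close>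

lemma cycle_walk:
  assumes "\<And>i. i < n ==> (w i, w (Suc i)) \<in> parcs (cycle_graph L)"
  shows "\<exists>d. \<bar>d\<bar> \<le> int n \<and> even (d - int n) \<and> int L dvd int (w n) - int (w 0) - d"
  using assms
proof (induction n)
  case 0
  show ?case by (rule exI[of _ 0]) simp
next
  case (Suc n)
  obtain d where d: "\<bar>d\<bar> \<le> int n" "even (d - int n)" "int L dvd int (w n) - int (w 0) - d"
    using Suc by auto
  obtain c where c: "c = 1 \<or> c = -1" "int L dvd int (w (Suc n)) - int (w n) - c"
    using cycle_arcD[OF Suc.prems[of n]] by auto
  have "int L dvd (int (w n) - int (w 0) - d) + (int (w (Suc n)) - int (w n) - c)"
    using d(3) c(2) by (rule dvd_add)
  then have "int L dvd int (w (Suc n)) - int (w 0) - (d + c)" by (simp add: algebra_simps)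
  then show ?case using d c by (intro exI[of _ "d + c"]) auto
qed

text \<open>
  The walk of length \<open>2k-1\<close> from \<open>p\<close> to \<open>q\<close> takes the long way round the cycle, with one detour
  if the distance between \<open>p\<close> and \<open>q\<close> is \<open>4\<close>.
\<close>

definition detour :: "nat => int => int => nat => int" where
  "detour k p q i = (let n = 2 * int k + 1 - \<bar>q - p\<bar>; c = (if p < q then -1 else 1) in
     if int i \<le> n then p + c * int i else p + c * n + (int i - n) mod 2)"

lemma detour_0: "\<bar>q - p\<bar> \<le> 4 ==> k \<ge> 2 ==> detour k p q 0 = p"
  by (simp add: detour_def Let_def)

lemma detour_Suc: "detour k p q (Suc i) - detour k p q i = 1 \<or> detour k p q (Suc i) - detour k p q i = -1"
proof -
  define n where "n = 2 * int k + 1 - \<bar>q - p\<bar>"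
  have "(int i + 1 - n) mod 2 = 1 - (int i - n) mod 2" "(int i - n) mod 2 = 0 \<or> (int i - n) mod 2 = 1"
    by presburger+
  then show ?thesis
    unfolding detour_def Let_def n_def[symmetric]
    by (cases "int i < n"; cases "int i = n") (auto simp: algebra_simps split: if_splits)
qed

text \<open>The long way round misses q by exactly one full turn; at distance 4 the two remaining
  steps cancel.\<close>

lemma detour_end:
  assumes "k \<ge> 2" "\<bar>q - p\<bar> = 2 \<or> \<bar>q - p\<bar> = 4"
  shows "int (2 * k + 1) dvd detour k p q (2 * k - 1) - q"
proof -
  have "detour k p q (2 * k - 1) = p + (if p < q then -1 else 1) * (2 * int k + 1 - \<bar>q - p\<bar>)"
    using assms by (auto simp: detour_def Let_def)
  then have "detour k p q (2 * k - 1) - q = (if p < q then -1 else 1) * int (2 * k + 1)"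
    using assms(2) by auto
  then show ?thesis by auto
qed

lemma hom_graph_hom_imp_colourable:
  assumes k: "k \<ge> 2" and e: "\<And>x r. x < nv ==> r < 2 ==> e x r < nv"
    and hom: "hom_exists (cycle_graph (2 * k + 1)) (hom_graph k nv e)"
  shows "colourable3 nv e"
proof -
  define L where "L = 2 * k + 1"
  let ?G = "hom_graph k nv e"
  from hom obtain \<phi> where \<phi>: "\<phi> ` pverts ?G \<subseteq> pverts (cycle_graph L)"
    "\<forall>(u, v)\<in>parcs ?G. (\<phi> u, \<phi> v) \<in> parcs (cycle_graph L)"
    unfolding hom_exists_def L_def[symmetric] by (elim exE conjE)
  have arc: "(\<phi> u, \<phi> v) \<in> parcs (cycle_graph L)" if "(u, v) \<in> parcs ?G" for u v
    using bspec[OF \<phi>(2) that] by simp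
  have img: "\<phi> ` pverts ?G \<subseteq> {..<L}" using \<phi>(1) by (simp add: cycle_graph_def)
  have less: "\<phi> (4 * k * x) < L" if "x \<le> nv" for x
    using img slot_less[of x nv 0 k] that k by (auto simp: hom_graph_def)
  define z where "z = int (\<phi> (4 * k * nv + 0))"
  define p where "p x = int (\<phi> (4 * k * x + 0))" for x
  have distinct: "p x \<noteq> p (e x r)" if x: "x < nv" and r: "r < 2" for x r
  proof
    assume eq: "p x = p (e x r)"
    define w where "w i = (if i = 0 then 4 * k * x + 0 else if i = 2 * k - 1 then 4 * k * e x r + 0
      else 4 * k * x + (r * (2 * k - 2) + 1 + i))" for i
    have r': "r = 0 \<or> r = 1" using r by auto
    have er: "e x r < nv" using e x r by auto
    have "(w i, w (Suc i)) \<in> parcs ?G" if i: "i < 2 * k - 1" for i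
    proof -
      consider "i = 0" | "0 < i" "i < 2 * k - 2" | "0 < i" "i = 2 * k - 2" using i k by linarith
      then show ?thesis
      proof cases
        case 1
        have "w i = 4 * k * x + 0" "w (Suc i) = 4 * k * x + (r * (2 * k - 2) + 2)" using 1 k by (auto simp: w_def)
        moreover have "(4 * k * x + 0, 4 * k * x + (r * (2 * k - 2) + 2)) \<in> parcs ?G"
          by (rule arc_hom_graphI(2)[OF k]) (use x r' k in \<open>auto simp: slot_edge_def\<close>)
        ultimately show ?thesis by simp
      next
        case 2
        have "w i = 4 * k * x + (r * (2 * k - 2) + 1 + i)" "w (Suc i) = 4 * k * x + (r * (2 * k - 2) + 1 + Suc i)"
          using 2 k by (auto simp: w_def)
        moreover have "(4 * k * x + (r * (2 * k - 2) + 1 + i), 4 * k * x + (r * (2 * k - 2) + 1 + Suc i)) \<in> parcs ?G"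
          by (rule arc_hom_graphI(2)[OF k]) (use x r' k 2 in \<open>auto simp: slot_edge_def\<close>)
        ultimately show ?thesis by simp
      next
        case 3
        have "w i = 4 * k * x + (r * (2 * k - 2) + 1 + i)" "w (Suc i) = 4 * k * e x r + 0"
          using 3 k by (auto simp: w_def)
        moreover have "(4 * k * x + (r * (2 * k - 2) + 1 + i), 4 * k * e x r + 0) \<in> parcs ?G"
          by (rule arc_hom_graphI(1)[OF k]) (use x er r' k 3 in \<open>auto simp: slot_edge_def\<close>)
        ultimately show ?thesis by simp
      qed
    qed
    then obtain d where d: "\<bar>d\<bar> \<le> int (2 * k - 1)" "even (d - int (2 * k - 1))"
      "int L dvd int (\<phi> (w (2 * k - 1))) - int (\<phi> (w 0)) - d"
      using cycle_walk[of "2 * k - 1" "\<lambda>i. \<phi> (w i)" L] arc by blast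
    have "w 0 = 4 * k * x + 0" "w (2 * k - 1) = 4 * k * e x r + 0" using k by (auto simp: w_def)
    then have "int L dvd d" using d(3) eq by (simp add: p_def)
    \<comment> \<open>d is odd because 2k - 1 is. Being a nonzero multiple of L, it would need more
      than 2k - 1 steps.\<close>
    moreover have "d \<noteq> 0" using d(2) k by auto
    ultimately have "int L \<le> \<bar>d\<bar>" using dvd_imp_le_int[of d "int L"] by simp
    then show False using d(1) k by (simp add: L_def)
  qed
  have near: "\<exists>d. d \<in> {0, 2, -2} \<and> int L dvd p x - z - d" if x: "x < nv" for x
  proof -
    define w where "w i = (if i = 0 then 4 * k * nv + 0 else if i = 1 then 4 * k * x + 1 else 4 * k * x + 0)" for i :: nat
    have "(w i, w (Suc i)) \<in> parcs ?G" if "i < 2" for i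
    proof -
      have "(4 * k * nv + 0, 4 * k * x + 1) \<in> parcs ?G"
        by (rule arc_hom_graphI(2)[OF k]) (use x k in \<open>auto simp: slot_edge_def\<close>)
      moreover have "(4 * k * x + 1, 4 * k * x + 0) \<in> parcs ?G"
        by (rule arc_hom_graphI(2)[OF k]) (use x k in \<open>auto simp: slot_edge_def\<close>)
      moreover have "i = 0 \<or> i = 1" using that by auto
      ultimately show ?thesis by (auto simp: w_def)
    qed
    then obtain d where d: "\<bar>d\<bar> \<le> 2" "even (d - 2)" "int L dvd int (\<phi> (w 2)) - int (\<phi> (w 0)) - d"
      using cycle_walk[of 2 "\<lambda>i. \<phi> (w i)" L] arc by auto
    have "d \<in> {0, 2, -2}" using d(1,2) by auto
    then show ?thesis using d(3) by (auto simp: w_def p_def z_def)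
  qed
  \<comment> \<open>The three possible offsets from the image of the centre are the colours. An
    offset determines the image, so equal colours mean equal images.\<close>
  define \<chi> where "\<chi> x = (if int L dvd p x - z - 0 then 0 else if int L dvd p x - z - 2 then 1 else 2 :: nat)" for x
  have same: "p x = p y" if "x < nv" "y < nv" "\<chi> x = \<chi> y" for x y
  proof -
    define D :: "nat => int" where "D c = (if c = 0 then 0 else if c = 1 then 2 else -2)" for c
    have D: "int L dvd p x - z - D (\<chi> x)" if "x < nv" for x
      using near[OF that] by (auto simp: \<chi>_def D_def)
    have "int L dvd (p x - z - D (\<chi> x)) - (p y - z - D (\<chi> x))"
      using D[OF that(1)] D[OF that(2)] unfolding that(3) by (rule dvd_diff)
    then have "p x mod int L = p y mod int L" by (simp add: mod_eq_dvd_iff)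
    then show ?thesis using less[of x] less[of y] that by (simp add: p_def)
  qed
  have "\<chi> x < 3" for x by (simp add: \<chi>_def)
  then show ?thesis unfolding colourable3_def using same distinct e by blast
qed

lemma colourable_imp_hom_graph_hom:
  assumes k: "k \<ge> 2" and e: "\<And>x r. x < nv ==> r < 2 ==> e x r < nv"
    and col: "colourable3 nv e"
  shows "hom_exists (cycle_graph (2 * k + 1)) (hom_graph k nv e)"
proof -
  define L where "L = 2 * k + 1"
  let ?G = "hom_graph k nv e"
  obtain \<chi> where \<chi>: "\<And>x. x < nv ==> \<chi> x < (3::nat)" "\<And>x r. x < nv ==> r < 2 ==> \<chi> x \<noteq> \<chi> (e x r)"
    using col unfolding colourable3_def by blast
  \<comment> \<open>With the colours at 0, 2 and -2 on the integers, different colours are at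
    distance 2 or 4, as \<open>detour_end\<close> requires.\<close>
  define P :: "nat => int" where "P x = (if \<chi> x = 0 then 0 else if \<chi> x = 1 then 2 else -2)" for x
  have P3: "P x = 0 \<or> P x = 2 \<or> P x = -2" for x by (auto simp: P_def)
  have Pe: "\<bar>P (e x r) - P x\<bar> = 2 \<or> \<bar>P (e x r) - P x\<bar> = 4" if "x < nv" "r < 2" for x r
    using \<chi>(1)[of x] \<chi>(1)[of "e x r"] \<chi>(2)[OF that] e[OF that] that by (auto simp: P_def split: if_splits)
  have P4: "\<bar>P y - P x\<bar> \<le> 4" for x y using P3[of x] P3[of y] by auto
  \<comment> \<open>An integer lift of the homomorphism, with the centre at 0: slot 1 gets a common
    neighbour of the values at the vertex and at the centre, and pendant paths alternate between 0
    and 1.\<close>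
  define c where "c x s = (if x < nv then
      if s = 0 then P x else if s = 1 then (if P x = -2 then -1 else 1)
      else if s < 2 * k then detour k (P x) (P (e x 0)) (s - 1)
      else if s < 4 * k - 2 then detour k (P x) (P (e x 1)) (s - (2 * k - 1)) else 1
    else if s = 0 then 0 else if s \<le> k + 1 then int s mod 2
    else if s \<le> 2 * k + 2 then int (s - (k + 1)) mod 2 else 1)" for x s
  define f where "f u = c (u div (4 * k)) (u mod (4 * k))" for u
  define near where "near a b \<longleftrightarrow> int L dvd a - b - 1 \<or> int L dvd a - b + 1" for a b
  have near_sym: "near b a" if "near a b" for a b
  proof -
    have "a - b - 1 = - (b - a + 1)" "a - b + 1 = - (b - a - 1)" by simp_all
    then show ?thesis using that unfolding near_def by (metis dvd_minus_iff)
  qed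
  have nearI: "near a b" if "a - b = 1 \<or> a - b = -1" for a b using that by (auto simp: near_def)
  have fs: "f (4 * k * x + s) = c x s" if "s < 4 * k" for x s using that by (simp add: f_def)
  have det: "near (detour k p q (Suc i)) (detour k p q i)" for p q i by (rule nearI) (rule detour_Suc)
  have edge: "near (c x s) (c y t)"
    if x: "x \<le> nv" and s: "s < 4 * k" and ed: "slot_edge k nv e x s y t" "(x, s) \<noteq> (y, t)" for x s y t
  proof -
    have z: "c nv 0 = 0" by (simp add: c_def)
    show ?thesis
    proof (cases "x < nv")
      case True
      have fx: "c x 0 = P x" using True by (simp add: c_def)
      have D0: "detour k (P x) (P y) 0 = P x" for y by (rule detour_0[OF P4 k])
      \<comment> \<open>The lift meets the other end of a subdivided edge only modulo L; all
        remaining edges join integers that differ by one.\<close>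
      have lk: "near (detour k (P x) (P (e x r)) (2 * k - 2)) (c (e x r) 0)" if "r < 2" for r
      proof -
        have fe: "c (e x r) 0 = P (e x r)" using e[OF True that] by (simp add: c_def)
        define D where "D = detour k (P x) (P (e x r))"
        have S: "Suc (2 * k - 2) = 2 * k - 1" using k by simp
        have "D (2 * k - 1) - D (2 * k - 2) = 1 \<or> D (2 * k - 1) - D (2 * k - 2) = -1"
          using detour_Suc[of k _ _ "2 * k - 2"] unfolding S D_def by blast
        then have d: "D (2 * k - 2) = D (2 * k - 1) - 1 \<or> D (2 * k - 2) = D (2 * k - 1) + 1" by auto
        have dv: "int L dvd D (2 * k - 1) - P (e x r)"
          using detour_end[OF k Pe[OF True that]] by (simp add: D_def L_def)
        have "D (2 * k - 2) - P (e x r) + 1 = D (2 * k - 1) - P (e x r) \<or>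
            D (2 * k - 2) - P (e x r) - 1 = D (2 * k - 1) - P (e x r)" using d by auto
        then show ?thesis unfolding fe near_def D_def[symmetric] using dv by metis
      qed
      consider "s = 2 * k - 1" "(y, t) = (e x 0, 0)" | "s = 4 * k - 3" "(y, t) = (e x 1, 0)"
        | "s = 0" "(y, t) = (x, 1)" | "s = 1 \<or> 4 * k - 2 \<le> s" "(y, t) = (nv, 0)"
        | "s = 2" "(y, t) = (x, 0)" | "s = 2 * k" "(y, t) = (x, 0)"
        | "2 < s" "s < 2 * k" "(y, t) = (x, s - 1)" | "2 * k < s" "s < 4 * k - 2" "(y, t) = (x, s - 1)"
        using ed(1) True unfolding slot_edge_def
        by (cases s "2 * k" rule: linorder_cases) (auto split: if_splits)
      then show ?thesis
      proof cases
        case 1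
        then have "c x s = detour k (P x) (P (e x 0)) (2 * k - 2)"
          using True k by (auto simp: c_def numeral_2_eq_2)
        then show ?thesis using 1 lk[of 0] by simp
      next
        case 2
        have "4 * k - 3 - (2 * k - 1) = 2 * k - 2" using k by simp
        then have "c x s = detour k (P x) (P (e x 1)) (2 * k - 2)" using 2 True k by (auto simp: c_def)
        then show ?thesis using 2 lk[of 1] by simp
      next
        case 3
        then show ?thesis using P3[of x] True by (intro nearI) (auto simp: c_def)
      next
        case 4
        then show ?thesis using z True k by (intro nearI) (auto simp: c_def)
      next
        case 5
        then have "c x s = detour k (P x) (P (e x 0)) (Suc 0)" using True k by (auto simp: c_def)
        then show ?thesis using 5 det[of "P x" "P (e x 0)" 0] D0 fx by simp
      next
        case 6
        then have "c x s = detour k (P x) (P (e x 1)) (Suc 0)" using True k by (auto simp: c_def)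
        then show ?thesis using 6 det[of "P x" "P (e x 1)" 0] D0 fx by simp
      next
        case 7
        have S: "s - 1 = Suc (s - 2)" "s - 1 - 1 = s - 2" using 7 by simp_all
        have "c x s = detour k (P x) (P (e x 0)) (s - 1)" "c x (s - 1) = detour k (P x) (P (e x 0)) (s - 1 - 1)"
          using True 7 k unfolding c_def by auto
        then show ?thesis using det[of "P x" "P (e x 0)" "s - 2"] 7(3) unfolding S by simp
      next
        case 8
        have S: "s - (2 * k - 1) = Suc (s - 2 * k)" "s - 1 - (2 * k - 1) = s - 2 * k" using 8 k by simp_all
        have "c x s = detour k (P x) (P (e x 1)) (s - (2 * k - 1))"
          "c x (s - 1) = detour k (P x) (P (e x 1)) (s - 1 - (2 * k - 1))"
          using True 8 k unfolding c_def by auto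
        then show ?thesis using det[of "P x" "P (e x 1)" "s - 2 * k"] 8(3) unfolding S by simp
      qed
    next
      case False
      then have x: "x = nv" using x by simp
      have flip: "int (Suc i) mod 2 - int i mod 2 = 1 \<or> int (Suc i) mod 2 - int i mod 2 = -1" for i by presburger
      show ?thesis
      proof (cases "s \<le> 1 \<or> s = k + 2 \<or> 2 * k + 2 < s")
        case True
        then have yt: "y = nv" "t = 0" using ed(1) x by (auto simp: slot_edge_def)
        then have "c x s = 1" using True ed(2) x k by (auto simp: c_def)
        then show ?thesis using z yt by (intro nearI) simp
      next
        case False
        then have yt: "y = nv" "t = s - 1" using ed(1) x by (auto simp: slot_edge_def)
        define i where "i = (if s \<le> k + 1 then s - 1 else s - 1 - (k + 1))"
        have "c x s = int (Suc i) mod 2" "c nv (s - 1) = int i mod 2"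
          using False x k by (auto simp: c_def i_def Suc_diff_le algebra_simps)
        then show ?thesis using flip[of i] yt by (intro nearI) simp
      qed
    qed
  qed
  define \<phi> where "\<phi> u = nat (f u mod int L)" for u
  have "(\<phi> u, \<phi> v) \<in> parcs (cycle_graph L)" if uv: "(u, v) \<in> parcs ?G" for u v
  proof -
    obtain x s y t where xy: "x \<le> nv" "s < 4 * k" "y \<le> nv" "t < 4 * k" "u = 4 * k * x + s" "v = 4 * k * y + t"
      "(x, s) \<noteq> (y, t)" "slot_edge k nv e x s y t \<or> slot_edge k nv e y t x s"
      using arc_hom_graphE[OF k uv] by metis
    have "near (c x s) (c y t)"
      using xy(8) edge[OF xy(1,2) _ xy(7)] near_sym[OF edge[OF xy(3,4) _ xy(7)[symmetric]]] by blast
    then have "near (f u) (f v)" using fs xy by simp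
    then show ?thesis unfolding \<phi>_def near_def by (intro cycle_arcI) (auto simp: L_def)
  qed
  moreover have "\<phi> ` pverts ?G \<subseteq> {..<L}" by (auto simp: \<phi>_def L_def nat_less_iff)
  ultimately show ?thesis unfolding hom_exists_def L_def
    by (intro exI[of _ \<phi>]) (auto simp: cycle_graph_def)
qed

section \<open>From 3-CNF formulas to 3-colourings\<close>

text \<open>
  The literal \<open>2v + 1\<close> is the variable \<open>v\<close>, and \<open>2v\<close> is its negation; \<open>lit j i\<close> for \<open>i < 3\<close> are
  the literals of clause \<open>j\<close>.
\<close>

definition lit_true :: "(nat => bool) => nat => bool" where
  "lit_true \<alpha> l \<longleftrightarrow> \<alpha> (l div 2) = odd l"

definition sat3 :: "nat => (nat => nat => nat) => bool" where
  "sat3 m lit \<longleftrightarrow> (\<exists>\<alpha>. \<forall>j<m. \<exists>i<3. lit_true \<alpha> (lit j i))"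

text \<open>
  With new variables \<open>t = V + j\<close> for every clause and one further variable \<open>s = V + m\<close>, the clause
  \<open>(a, b, c)\<close> becomes the two not-all-equal clauses \<open>(a, b, t)\<close> and \<open>(\<not>t, c, s)\<close>.
\<close>

definition nae_lit :: "nat => nat => (nat => nat => nat) => nat => nat => nat" where
  "nae_lit V m lit q i = (if q mod 2 = 0
     then if i = 0 then lit (q div 2) 0 else if i = 1 then lit (q div 2) 1 else 2 * (V + q div 2) + 1
     else if i = 0 then 2 * (V + q div 2) else if i = 1 then lit (q div 2) 2 else 2 * (V + m) + 1)"

text \<open>The vertices below Q = 2(V + m + 1) are the literals, Q is a palette vertex joined to
  all of them, and Q + 1 + 3q + i is corner i of a triangle for the not-all-equal clause q, joined
  to its literal i. Each vertex emits just two edges: a literal to its negation and to Q, a corner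
  to the next corner and to its literal. The edge from Q to 0 is a repetition.\<close>

definition col_edge :: "nat => nat => (nat => nat => nat) => nat => nat => nat" where
  "col_edge V m lit x r = (if x < 2 * (V + m + 1) then
       if r = 0 then if x mod 2 = 0 then x + 1 else x - 1 else 2 * (V + m + 1)
     else if x = 2 * (V + m + 1) then 0
     else if r = 0 then if (x - 2 * (V + m + 1) - 1) mod 3 = 2 then x - 2 else x + 1
     else nae_lit V m lit ((x - 2 * (V + m + 1) - 1) div 3) ((x - 2 * (V + m + 1) - 1) mod 3))"

definition col_verts :: "nat => nat => nat" where
  "col_verts V m = 2 * (V + m + 1) + 1 + 6 * m"

lemma nae_lit_less:
  assumes "\<forall>j<m. \<forall>i<3. lit j i < 2 * V" "q < 2 * m"
  shows "nae_lit V m lit q i < 2 * (V + m + 1)"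
proof -
  have "q div 2 < m" using assms(2) by auto
  then show ?thesis using assms(1)[rule_format, of "q div 2" 0] assms(1)[rule_format, of "q div 2" 1]
      assms(1)[rule_format, of "q div 2" 2]
    by (auto simp: nae_lit_def)
qed

lemma clause_vertE:
  assumes "x < col_verts V m" "2 * (V + m + 1) < x"
  obtains q i where "x = 2 * (V + m + 1) + 1 + (3 * q + i)" "q < 2 * m" "i < 3"
proof
  define c where "c = x - 2 * (V + m + 1) - 1"
  have "3 * (c div 3) + c mod 3 = c" by simp
  then show "x = 2 * (V + m + 1) + 1 + (3 * (c div 3) + c mod 3)" using assms by (simp add: c_def)
  have "c < 6 * m" using assms by (auto simp: c_def col_verts_def)
  then show "c div 3 < 2 * m" by auto
qed simp

lemma col_edge_clause:
  assumes "i < 3"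
  shows "col_edge V m lit (2 * (V + m + 1) + 1 + (3 * q + i)) r =
    (if r = 0 then 2 * (V + m + 1) + 1 + (3 * q + (if i = 2 then 0 else i + 1)) else nae_lit V m lit q i)"
proof -
  have "(3 * q + i) mod 3 = i" "(3 * q + i) div 3 = q" using assms by auto
  then show ?thesis unfolding col_edge_def using assms by auto
qed

lemma col_edge_less:
  assumes "\<forall>j<m. \<forall>i<3. lit j i < 2 * V" "x < col_verts V m" "r < 2"
  shows "col_edge V m lit x r < col_verts V m"
proof (cases "x \<le> 2 * (V + m + 1)")
  case True
  then show ?thesis by (auto simp: col_edge_def col_verts_def; presburger)
next
  case False
  then obtain q i where x: "x = 2 * (V + m + 1) + 1 + (3 * q + i)" "q < 2 * m" "i < 3"
    using clause_vertE[OF assms(2)] by auto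
  have "nae_lit V m lit q i < col_verts V m"
    using nae_lit_less[OF assms(1) x(2), where i = i] by (simp add: col_verts_def)
  then show ?thesis unfolding x(1) col_edge_clause[OF x(3)] using x by (auto simp: col_verts_def)
qed

text \<open>Literals use only the two colours that differ from the colour of the palette vertex. If
  the three literals of a not-all-equal clause had the same colour, the triangle attached to them
  would be left with two colours.\<close>

lemma colourable_imp_sat:
  assumes lit: "\<forall>j<m. \<forall>i<3. lit j i < 2 * V"
    and "colourable3 (col_verts V m) (col_edge V m lit)"
  shows "sat3 m lit"
proof -
  define Q where "Q = 2 * (V + m + 1)"
  obtain \<chi> where \<chi>: "\<And>x. x < col_verts V m ==> \<chi> x < (3::nat)"
    "\<And>x r. x < col_verts V m ==> r < 2 ==> \<chi> x \<noteq> \<chi> (col_edge V m lit x r)"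
    using assms(2) unfolding colourable3_def by blast
  have Qv: "Q < col_verts V m" by (simp add: Q_def col_verts_def)
  have base: "\<chi> l < 3" "\<chi> l \<noteq> \<chi> Q" if "l < Q" for l
    using \<chi>(1)[of l] \<chi>(2)[of l 1] that Qv by (auto simp: col_edge_def Q_def)
  have flip: "\<chi> (2 * v) \<noteq> \<chi> (2 * v + 1)" if "2 * v < Q" for v
    using \<chi>(2)[of "2 * v" 0] that Qv by (auto simp: col_edge_def Q_def)
  have two: "\<chi> a = \<chi> b" if "a < Q" "b < Q" "c < Q" "\<chi> a \<noteq> \<chi> c" "\<chi> b \<noteq> \<chi> c" for a b c
    using base[OF that(1)] base[OF that(2)] base[OF that(3)] \<chi>(1)[OF Qv] that(4,5) by linarith
  have nae: "\<not> (\<chi> (nae_lit V m lit q 0) = d \<and> \<chi> (nae_lit V m lit q 1) = d \<and> \<chi> (nae_lit V m lit q 2) = d)"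
    if q: "q < 2 * m" for q d
  proof
    assume eq: "\<chi> (nae_lit V m lit q 0) = d \<and> \<chi> (nae_lit V m lit q 1) = d \<and> \<chi> (nae_lit V m lit q 2) = d"
    define c where "c i = \<chi> (2 * (V + m + 1) + 1 + (3 * q + i))" for i
    have x: "2 * (V + m + 1) + 1 + (3 * q + i) < col_verts V m" if "i < 3" for i
      using that q by (simp add: col_verts_def)
    have c: "c i < 3" "c i \<noteq> c (if i = 2 then 0 else i + 1)" "c i \<noteq> \<chi> (nae_lit V m lit q i)" if "i < 3" for i
      using \<chi>(1)[OF x[OF that]] \<chi>(2)[OF x[OF that], of 0] \<chi>(2)[OF x[OF that], of 1]
      unfolding col_edge_clause[OF that] by (simp_all add: c_def)
    have "nae_lit V m lit q 0 < Q" using nae_lit_less[OF lit q] by (simp add: Q_def)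
    then have "d < 3" using base(1) eq by blast
    then show False using c[of 0] c[of 1] c[of 2] eq by (simp add: numeral_2_eq_2)
  qed
  \<comment> \<open>Not-all-equal clauses cannot tell an assignment from its complement. The
    symmetry is broken by declaring that the colour of the literal s means false.\<close>
  define S where "S = 2 * (V + m) + 1"
  have S: "S < Q" by (simp add: S_def Q_def)
  define \<alpha> where "\<alpha> v \<longleftrightarrow> \<chi> (2 * v + 1) \<noteq> \<chi> S" for v
  have true: "lit_true \<alpha> l \<longleftrightarrow> \<chi> l \<noteq> \<chi> S" if l: "l < Q" for l
  proof (cases "odd l")
    case True
    then have "2 * (l div 2) + 1 = l" by simp
    then show ?thesis using True by (simp add: lit_true_def \<alpha>_def)
  next
    case False
    define v where "v = l div 2"
    have v: "l = 2 * v" "2 * v + 1 < Q" using False l unfolding v_def Q_def by presburger+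
    have "\<chi> l \<noteq> \<chi> (2 * v + 1)" using flip[of v] v by simp
    then have "\<chi> (2 * v + 1) = \<chi> S \<longleftrightarrow> \<chi> l \<noteq> \<chi> S"
      using two[of "2 * v" S "2 * v + 1"] v S by (metis add_lessD1)
    then show ?thesis using False by (simp add: lit_true_def \<alpha>_def v_def)
  qed
  have "\<exists>i<3. lit_true \<alpha> (lit j i)" if j: "j < m" for j
  proof (rule ccontr)
    assume "\<not> ?thesis"
    then have f: "\<chi> (lit j i) = \<chi> S" if "i < 3" for i
      using true[of "lit j i"] lit[rule_format, OF j that] that by (auto simp: Q_def)
    have "\<chi> (2 * (V + j) + 1) \<noteq> \<chi> S"
      using nae[of "2 * j" "\<chi> S"] f[of 0] f[of 1] j by (auto simp: nae_lit_def)
    then have "\<chi> (2 * (V + j)) = \<chi> S"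
      using two[of "2 * (V + j)" S "2 * (V + j) + 1"] flip[of "V + j"] j S by (auto simp: Q_def)
    moreover have "(2 * j + 1) div 2 = j" "(2 * j + 1) mod 2 = 1" by auto
    ultimately show False
      using nae[of "2 * j + 1" "\<chi> S"] f[of 2] j unfolding nae_lit_def by (simp add: S_def)
  qed
  then show ?thesis unfolding sat3_def by blast
qed

lemma sat_imp_colourable:
  assumes lit: "\<forall>j<m. \<forall>i<3. lit j i < 2 * V"
    and "sat3 m lit"
  shows "colourable3 (col_verts V m) (col_edge V m lit)"
proof -
  define Q where "Q = 2 * (V + m + 1)"
  obtain \<alpha> where \<alpha>: "\<And>j. j < m ==> \<exists>i<3. lit_true \<alpha> (lit j i)"
    using assms(2) unfolding sat3_def by blast
  \<comment> \<open>The variable t of a clause is true exactly if the first two literals are false,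
    and s is false. Then (a, b, t) is never constant, and (\<not>t, c, s) is constant only if the
    whole clause is false.\<close>
  define \<beta> where "\<beta> v = (if v < V then \<alpha> v else v < V + m \<and> \<not> lit_true \<alpha> (lit (v - V) 0) \<and> \<not> lit_true \<alpha> (lit (v - V) 1))" for v
  have \<beta>: "lit_true \<beta> (lit j i) = lit_true \<alpha> (lit j i)" if "j < m" "i < 3" for j i
  proof -
    have "lit j i div 2 < V" using lit[rule_format, OF that] by auto
    then show ?thesis by (simp add: lit_true_def \<beta>_def)
  qed
  define B where "B q i = lit_true \<beta> (nae_lit V m lit q i)" for q i
  have nae: "\<not> (B q 0 = B q 1 \<and> B q 1 = B q 2)" if q: "q < 2 * m" for q
  proof -
    define j where "j = q div 2"
    have j: "j < m" using q by (auto simp: j_def)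
    have t: "\<beta> (V + j) \<longleftrightarrow> \<not> lit_true \<alpha> (lit j 0) \<and> \<not> lit_true \<alpha> (lit j 1)"
      using j by (simp add: \<beta>_def)
    have s: "\<not> \<beta> (V + m)" by (simp add: \<beta>_def)
    have T: "lit_true \<beta> (2 * v + 1) \<longleftrightarrow> \<beta> v" "lit_true \<beta> (2 * v) \<longleftrightarrow> \<not> \<beta> v" for v
      by (auto simp: lit_true_def)
    obtain i where "i < 3" "lit_true \<alpha> (lit j i)" using \<alpha>[OF j] by blast
    then have "lit_true \<alpha> (lit j 0) \<or> lit_true \<alpha> (lit j 1) \<or> lit_true \<alpha> (lit j 2)"
      by (cases "i = 0"; cases "i = 1"; cases "i = 2") auto
    then show ?thesis
      using t s T[of "V + j"] T[of "V + m"] \<beta>[OF j, of 0] \<beta>[OF j, of 1] \<beta>[OF j, of 2]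
      unfolding B_def nae_lit_def j_def[symmetric] by (cases "q mod 2 = 0") auto
  qed
  \<comment> \<open>Two corners whose literals have different values each take the literal colour
    that their own literal lacks; the remaining corner takes colour 2.\<close>
  define col where "col q i = (if B q 0 \<noteq> B q 1 then if i = 2 then 2 else of_bool (\<not> B q i)
      else if i = 1 then 2 else of_bool (\<not> B q i) :: nat)" for q i
  define \<chi> where "\<chi> x = (if x < Q then of_bool (lit_true \<beta> x) else if x = Q then 2
      else col ((x - Q - 1) div 3) ((x - Q - 1) mod 3))" for x
  have \<chi>_clause: "\<chi> (2 * (V + m + 1) + 1 + (3 * q + i)) = col q i" if "i < 3" for q i
  proof -
    have "(3 * q + i) mod 3 = i" "(3 * q + i) div 3 = q" using that by auto
    then show ?thesis by (simp add: \<chi>_def Q_def)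
  qed
  have "\<chi> x \<noteq> \<chi> (col_edge V m lit x r)" if x: "x < col_verts V m" and r: "r < 2" for x r
  proof -
    consider "x < Q" | "x = Q" | "Q < x" by linarith
    then show ?thesis
    proof cases
      case 1
      define y where "y = (if even x then x + 1 else x - 1)"
      have "even x ==> x + 1 < Q" using 1 unfolding Q_def by presburger
      moreover have "odd x ==> x - 1 < Q" using 1 by simp
      ultimately have y: "y < Q" by (simp add: y_def)
      have "y div 2 = x div 2 \<and> even y = odd x" unfolding y_def by presburger
      then have "lit_true \<beta> y \<noteq> lit_true \<beta> x" by (auto simp: lit_true_def)
      then have "\<chi> x \<noteq> \<chi> y" using 1 y by (simp add: \<chi>_def)
      moreover have "\<chi> x \<noteq> \<chi> Q" using 1 by (simp add: \<chi>_def of_bool_def)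
      moreover have "col_edge V m lit x r = (if r = 0 then y else Q)"
        using 1 unfolding col_edge_def y_def Q_def even_iff_mod_2_eq_zero by (rule if_P)
      ultimately show ?thesis by simp
    next
      case 2
      have "col_edge V m lit x r = 0" using 2 unfolding col_edge_def Q_def by simp
      moreover have "\<chi> 0 \<noteq> \<chi> Q" by (simp add: \<chi>_def Q_def of_bool_def)
      ultimately show ?thesis using 2 by simp
    next
      case 3
      then obtain q i where xi: "x = 2 * (V + m + 1) + 1 + (3 * q + i)" "q < 2 * m" "i < 3"
        using clause_vertE[OF x] by (auto simp: Q_def)
      have l: "\<chi> (nae_lit V m lit q i) = of_bool (B q i)"
        using nae_lit_less[OF lit xi(2), where i = i] by (simp add: \<chi>_def B_def Q_def)
      have i: "i = 0 \<or> i = 1 \<or> i = 2" using xi(3) by auto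
      have n: "\<chi> (2 * (V + m + 1) + 1 + (3 * q + (if i = 2 then 0 else i + 1))) = col q (if i = 2 then 0 else i + 1)"
        by (rule \<chi>_clause) (use xi(3) in auto)
      have "col q i \<noteq> of_bool (B q i)" "col q i \<noteq> col q (if i = 2 then 0 else i + 1)"
        using nae[OF xi(2)] i unfolding col_def by auto
      then show ?thesis unfolding xi(1) col_edge_clause[OF xi(3)] \<chi>_clause[OF xi(3)] using l n by auto
    qed
  qed
  moreover have "\<chi> x < 3" for x by (auto simp: \<chi>_def col_def)
  ultimately show ?thesis unfolding colourable3_def by blast
qed

section \<open>The reduction from 3-CNF formulas\<close>

definition cnf_graph :: "nat => nat => nat => (nat => nat => nat) => nat pair_pre_digraph" where
  "cnf_graph k V m lit = hom_graph k (col_verts V m) (col_edge V m lit)"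

definition cnf_verts :: "nat => nat => nat => nat" where
  "cnf_verts k V m = 4 * k * (col_verts V m + 1)"

text \<open>The bits of \<open>enc_graph\<close> by position: ones below the number of vertices, a
  zero at that position, where neither disjunct applies, and then the adjacency matrix by
  rows.\<close>

definition cnf_bit :: "nat => nat => nat => (nat => nat => nat) => nat => bool" where
  "cnf_bit k V m lit i \<longleftrightarrow> i < cnf_verts k V m \<or> cnf_verts k V m < i \<and>
     joined k (col_verts V m) (col_edge V m lit) ((i - cnf_verts k V m - 1) div cnf_verts k V m)
       ((i - cnf_verts k V m - 1) mod cnf_verts k V m)"

lemma cnf_graph_radius:
  assumes "k \<ge> 2" "\<forall>j<m. \<forall>i<3. lit j i < 2 * V"
  shows "cnf_graph k V m lit \<in> radius_graphs (k + 1)"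
  unfolding cnf_graph_def by (rule hom_graph_radius) (use assms col_edge_less[OF assms(2)] in auto)

lemma cnf_graph_hom_iff:
  assumes "k \<ge> 2" "\<forall>j<m. \<forall>i<3. lit j i < 2 * V"
  shows "hom_exists (cycle_graph (2 * k + 1)) (cnf_graph k V m lit) \<longleftrightarrow> sat3 m lit"
proof -
  have e: "col_edge V m lit x r < col_verts V m" if "x < col_verts V m" "r < 2" for x r
    using col_edge_less[OF assms(2) that] .
  show ?thesis unfolding cnf_graph_def
    using hom_graph_hom_imp_colourable[OF assms(1), of "col_verts V m" "col_edge V m lit"]
      colourable_imp_hom_graph_hom[OF assms(1), of "col_verts V m" "col_edge V m lit"] e
      colourable_imp_sat[OF assms(2)] sat_imp_colourable[OF assms(2)] by blast
qed

lemma num_verts_cnf_graph: "num_verts (cnf_graph k V m lit) = cnf_verts k V m"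
  by (simp add: num_verts_def cnf_graph_def hom_graph_def cnf_verts_def)

lemma matrix_list: "concat (map (\<lambda>i. map (f i) [0..<n]) [0..<m]) = map (\<lambda>i. f (i div n) (i mod n)) [0..<m * n]"
proof (induction m)
  case (Suc m)
  have "map (\<lambda>i. f (i div n) (i mod n)) [m * n..<Suc m * n] = map (f m) [0..<n]"
    by (rule nth_equalityI) (auto simp: div_mult_self3 add.commute)
  moreover have "[0..<Suc m * n] = [0..<m * n] @ [m * n..<Suc m * n]"
    by (metis add.commute mult_Suc upt_add_eq_append zero_le)
  ultimately show ?case using Suc by simp
qed simp

lemma enc_cnf_graph:
  "enc_graph (cnf_graph k V m lit) =
    map (cnf_bit k V m lit) [0..<cnf_verts k V m + 1 + cnf_verts k V m * cnf_verts k V m]"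
proof -
  define N where "N = cnf_verts k V m"
  define J where "J = joined k (col_verts V m) (col_edge V m lit)"
  let ?A = "parcs (cnf_graph k V m lit)"
  have A: "((i, j) \<in> ?A) = J i j" if "i < N" "j < N" for i j
    using that by (simp add: cnf_graph_def hom_graph_def N_def cnf_verts_def J_def)
  have "map (cnf_bit k V m lit) [0..<N + 1 + N * N] =
      map (cnf_bit k V m lit) [0..<N] @ map (cnf_bit k V m lit) [N..<N + 1] @ map (cnf_bit k V m lit) [N + 1..<N + 1 + N * N]"
    by (metis append_assoc le_add1 le0 map_append upt_add_eq_append)
  also have "map (cnf_bit k V m lit) [0..<N] = replicate N True"
    by (rule nth_equalityI) (auto simp: cnf_bit_def N_def)
  also have "map (cnf_bit k V m lit) [N..<N + 1] = [False]" by (simp add: cnf_bit_def N_def)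
  also have "map (cnf_bit k V m lit) [N + 1..<N + 1 + N * N] = map (\<lambda>i. J (i div N) (i mod N)) [0..<N * N]"
  proof -
    have "[N + 1..<N + 1 + N * N] = map (\<lambda>i. i + (N + 1)) [0..<N * N]"
      by (simp only: map_add_upt add.commute)
    then show ?thesis by (simp add: cnf_bit_def N_def[symmetric] J_def comp_def)
  qed
  also have "\<dots> = map (\<lambda>i. (i div N, i mod N) \<in> ?A) [0..<N * N]"
  proof (rule map_cong[OF refl])
    fix i assume "i \<in> set [0..<N * N]"
    then have "i div N < N" "i mod N < N"
      by (auto simp: less_mult_imp_div_less) (metis less_nat_zero_code mod_less_divisor mult_is_0 neq0_conv)
    then show "J (i div N) (i mod N) = ((i div N, i mod N) \<in> ?A)" using A by blast
  qed
  also have "\<dots> = concat (map (\<lambda>i. map (\<lambda>j. (i, j) \<in> ?A) [0..<N]) [0..<N])" by (simp add: matrix_list)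
  finally show ?thesis
    by (simp add: enc_graph_def num_verts_cnf_graph N_def[symmetric] Let_def)
qed

lemma def_cnf_verts:
  assumes "definable b (\<lambda>R \<sigma>. V R)" "definable b (\<lambda>R \<sigma>. m R)"
  shows "definable b (\<lambda>R \<sigma>. cnf_verts k (V R) (m R))" "definable b (\<lambda>R \<sigma>. col_verts (V R) (m R))"
  unfolding cnf_verts_def col_verts_def by (intro def_intros assms)+

lemma def_cnf_bit:
  assumes V: "definable b (\<lambda>R \<sigma>. V R)" and m: "definable b (\<lambda>R \<sigma>. m R)"
    and lit: "definable b (\<lambda>R \<sigma>. lit R (\<sigma> 0) (\<sigma> 1))"
  shows "definableP b (\<lambda>R \<sigma>. cnf_bit k (V R) (m R) (lit R) (\<sigma> 0))"
proof -
  note lit' = def_comp2[of b lit, OF lit]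
  have nae: "definable b (\<lambda>R \<sigma>. nae_lit (V R) (m R) (lit R) (\<sigma> 0) (\<sigma> 1))"
    unfolding nae_lit_def by (intro def_intros V m lit')
  note nae' = def_comp2[of b "\<lambda>R. nae_lit (V R) (m R) (lit R)", OF nae]
  have edge: "definable b (\<lambda>R \<sigma>. col_edge (V R) (m R) (lit R) (\<sigma> 0) (\<sigma> 1))"
    unfolding col_edge_def by (intro def_intros V m nae')
  note edge' = def_comp2[of b "\<lambda>R. col_edge (V R) (m R) (lit R)", OF edge]
  note nv = def_cnf_verts[OF V m]
  have par: "definable b (\<lambda>R \<sigma>. parent k (col_verts (V R) (m R)) (\<sigma> 0))"
    unfolding parent_def by (intro def_intros nv)
  note par' = def_comp1[of b "\<lambda>R. parent k (col_verts (V R) (m R))", OF par]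
  have link: "definable b (\<lambda>R \<sigma>. link k (col_verts (V R) (m R)) (col_edge (V R) (m R) (lit R)) (\<sigma> 0))"
    unfolding link_def by (intro def_intros nv par' edge')
  note link' = def_comp1[of b "\<lambda>R. link k (col_verts (V R) (m R)) (col_edge (V R) (m R) (lit R))", OF link]
  show ?thesis unfolding cnf_bit_def joined_def by (intro def_intros nv par' link')
qed

section \<open>The Cook-Levin theorem\<close>

subsection \<open>Runs of Turing machines\<close>

text \<open>A halted machine is continued by idling steps, so that every run can be described up to
  a common time.\<close>

definition full_delta :: "tm => nat => nat list => nat \<times> (nat \<times> move) list" where
  "full_delta M q rs = (if q < states M then delta M q rs else (q, idle rs))"

text \<open>The displacement of the head increased by one, to stay within the natural
  numbers.\<close>

definition shift :: "move => nat" where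
  "shift d = (case d of Move_Left => 0 | Stay => 1 | Move_Right => 2)"

lemma tm_step_full_delta:
  "tm_step M (q, ts) = (let (q', as) = full_delta M q (map (\<lambda>(t, h). t h) ts) in (q', map2 act as ts))"
  by (simp add: full_delta_def map2_idle)

locale tm_run =
  fixes M :: tm and z :: "bool list"
  assumes wf: "wf_tm M"
begin

definition conf where "conf \<tau> = (tm_step M ^^ \<tau>) (init_config M z)"
definition qs where "qs \<tau> = fst (conf \<tau>)"
definition cells where "cells \<tau> j = fst (snd (conf \<tau>) ! j)"
definition pos where "pos \<tau> j = snd (snd (conf \<tau>) ! j)"
definition reads where "reads \<tau> = map (\<lambda>j. cells \<tau> j (pos \<tau> j)) [0..<tapes M]"
definition next_q where "next_q \<tau> = fst (full_delta M (qs \<tau>) (reads \<tau>))"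
definition acts where "acts \<tau> = snd (full_delta M (qs \<tau>) (reads \<tau>))"

lemma invariant:
  "length (snd (conf \<tau>)) = tapes M \<and> qs \<tau> \<le> states M \<and> (\<forall>j<tapes M. \<forall>i. cells \<tau> j i < syms M) \<and>
     (\<forall>j<tapes M. \<bar>pos \<tau> j\<bar> \<le> int \<tau>)"
  and step: "qs (Suc \<tau>) = next_q \<tau>"
    "j < tapes M ==> cells (Suc \<tau>) j = (cells \<tau> j)(pos \<tau> j := fst (acts \<tau> ! j))"
    "j < tapes M ==> pos (Suc \<tau>) j = pos \<tau> j + int (shift (snd (acts \<tau> ! j))) - 1"
proof -
  have k: "tapes M \<ge> 1" and S: "syms M \<ge> 3" using wf by (auto simp: wf_tm_def)
  have heads: "map (\<lambda>(t, h). t h) (snd (conf \<tau>)) = reads \<tau>" if "length (snd (conf \<tau>)) = tapes M" for \<tau>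
    by (rule nth_equalityI) (use that in \<open>auto simp: reads_def cells_def pos_def split_beta\<close>)
  have next_conf: "conf (Suc \<tau>) = (next_q \<tau>, map2 act (acts \<tau>) (snd (conf \<tau>)))"
    if "length (snd (conf \<tau>)) = tapes M" for \<tau>
  proof -
    have "conf (Suc \<tau>) = tm_step M (qs \<tau>, snd (conf \<tau>))" by (simp add: conf_def qs_def)
    then show ?thesis unfolding tm_step_full_delta heads[OF that] next_q_def acts_def by (simp add: split_beta)
  qed
  have acts: "length (acts \<tau>) = tapes M" "next_q \<tau> \<le> states M" "\<And>j. j < tapes M ==> fst (acts \<tau> ! j) < syms M"
    if "length (snd (conf \<tau>)) = tapes M" "qs \<tau> \<le> states M" "\<forall>j<tapes M. \<forall>i. cells \<tau> j i < syms M" for \<tau>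
  proof -
    have rs: "length (reads \<tau>) = tapes M" "set (reads \<tau>) \<subseteq> {..<syms M}"
      using that by (auto simp: reads_def)
    have "length (acts \<tau>) = tapes M \<and> next_q \<tau> \<le> states M \<and> fst ` set (acts \<tau>) \<subseteq> {..<syms M}"
    proof (cases "qs \<tau> < states M")
      case True
      then have "delta M (qs \<tau>) (reads \<tau>) = (next_q \<tau>, acts \<tau>)"
        by (simp add: next_q_def acts_def full_delta_def)
      then show ?thesis using wf True rs unfolding wf_tm_def by blast
    next
      case False
      then show ?thesis using that rs by (auto simp: next_q_def acts_def full_delta_def idle_def)
    qed
    then show "length (acts \<tau>) = tapes M" "next_q \<tau> \<le> states M" "\<And>j. j < tapes M ==> fst (acts \<tau> ! j) < syms M"
      by (auto simp: image_subset_iff)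
  qed
  have upd: "cells (Suc \<tau>) j = (cells \<tau> j)(pos \<tau> j := fst (acts \<tau> ! j)) \<and>
      pos (Suc \<tau>) j = pos \<tau> j + int (shift (snd (acts \<tau> ! j))) - 1"
    if "length (snd (conf \<tau>)) = tapes M" "length (acts \<tau>) = tapes M" "j < tapes M" for \<tau> j
  proof -
    have "snd (conf (Suc \<tau>)) ! j = act (acts \<tau> ! j) (snd (conf \<tau>) ! j)"
      using that by (simp add: next_conf)
    moreover obtain a d where "acts \<tau> ! j = (a, d)" by force
    moreover obtain t h where "snd (conf \<tau>) ! j = (t, h)" by force
    ultimately show ?thesis by (auto simp: cells_def pos_def shift_def split: move.split)
  qed
  show inv: "length (snd (conf \<tau>)) = tapes M \<and> qs \<tau> \<le> states M \<and> (\<forall>j<tapes M. \<forall>i. cells \<tau> j i < syms M) \<and>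
     (\<forall>j<tapes M. \<bar>pos \<tau> j\<bar> \<le> int \<tau>)" for \<tau>
  proof (induction \<tau>)
    case 0
    have "snd (conf 0) = (tape_of z, 0) # replicate (tapes M - 1) (\<lambda>_. 0, 0)" "qs 0 = 0"
      by (simp_all add: conf_def qs_def init_config_def)
    then show ?case using k S by (auto simp: cells_def pos_def nth_Cons' tape_of_def)
  next
    case (Suc \<tau>)
    note a = acts[of \<tau>] upd[of \<tau>]
    have "\<bar>pos (Suc \<tau>) j\<bar> \<le> int (Suc \<tau>)" if j: "j < tapes M" for j
    proof -
      have "shift (snd (acts \<tau> ! j)) \<le> 2" by (simp add: shift_def split: move.split)
      moreover have "\<bar>pos \<tau> j\<bar> \<le> int \<tau>" using Suc j by blast
      moreover have "pos (Suc \<tau>) j = pos \<tau> j + int (shift (snd (acts \<tau> ! j))) - 1" using Suc a j by blast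
      ultimately show ?thesis by linarith
    qed
    moreover have "qs (Suc \<tau>) = next_q \<tau>" using Suc by (simp add: qs_def next_conf)
    moreover have "length (snd (conf (Suc \<tau>))) = tapes M" using Suc a by (simp add: next_conf)
    ultimately show ?case using Suc a by auto
  qed
  show "qs (Suc \<tau>) = next_q \<tau>" using inv by (simp add: qs_def next_conf)
  show "j < tapes M ==> cells (Suc \<tau>) j = (cells \<tau> j)(pos \<tau> j := fst (acts \<tau> ! j))"
    "j < tapes M ==> pos (Suc \<tau>) j = pos \<tau> j + int (shift (snd (acts \<tau> ! j))) - 1"
    using upd[of \<tau> j] inv[of \<tau>] acts[of \<tau>] by auto
qed

lemma init: "qs 0 = 0" "pos 0 j = 0" if "j < tapes M" for j
  using that by (auto simp: qs_def pos_def conf_def init_config_def nth_Cons')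

lemma init_cells: "cells 0 0 = tape_of z" "0 < j ==> j < tapes M ==> cells 0 j = (\<lambda>_. 0)"
  by (auto simp: cells_def conf_def init_config_def nth_Cons')

lemma output_cell:
  assumes "computes_within M z [b] t" "t \<le> T"
  shows "cells T (tapes M - 1) 0 = bit_sym b"
proof -
  obtain ts where "conf T = (states M, ts)" "fst (last ts) = tape_of [b]"
    using computes_within_mono[OF assms] unfolding computes_within_def conf_def by blast
  moreover have "length ts = tapes M" "tapes M \<ge> 1"
    using invariant[of T] wf \<open>conf T = (states M, ts)\<close> by (auto simp: wf_tm_def)
  moreover from this have "last ts = ts ! (tapes M - 1)" by (metis last_conv_nth list.size(3) not_one_le_zero)
  ultimately show ?thesis by (simp add: cells_def tape_of_def bit_sym_def)
qed

text \<open>The state and the symbols read on the first \<open>j\<close> tapes, coded as one number.\<close>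

primrec code where
  "code \<tau> 0 = qs \<tau>"
| "code \<tau> (Suc j) = code \<tau> j * syms M + cells \<tau> j (pos \<tau> j)"

lemma code_less: "j \<le> tapes M ==> code \<tau> j < (states M + 1) * syms M ^ j"
proof (induction j)
  case 0
  then show ?case using invariant[of \<tau>] by simp
next
  case (Suc j)
  have "cells \<tau> j (pos \<tau> j) < syms M" using invariant[of \<tau>] Suc by simp
  then have "code \<tau> (Suc j) < (code \<tau> j + 1) * syms M" by simp
  also have "\<dots> \<le> ((states M + 1) * syms M ^ j) * syms M" using Suc by (intro mult_right_mono) auto
  finally show ?case by (simp only: power_Suc2 mult.assoc)
qed

end

primrec decode :: "tm => nat => nat => nat \<times> nat list" where
  "decode M 0 a = (a, [])"
| "decode M (Suc j) a = (fst (decode M j (a div syms M)), snd (decode M j (a div syms M)) @ [a mod syms M])"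

lemma (in tm_run) decode_code:
  "j \<le> tapes M ==> decode M j (code \<tau> j) = (qs \<tau>, map (\<lambda>j. cells \<tau> j (pos \<tau> j)) [0..<j])"
proof (induction j)
  case (Suc j)
  have "cells \<tau> j (pos \<tau> j) < syms M" using invariant[of \<tau>] Suc by simp
  then show ?case using Suc by simp
qed simp

definition coded_delta :: "tm => nat => nat \<times> (nat \<times> move) list" where
  "coded_delta M a = full_delta M (fst (decode M (tapes M) a)) (snd (decode M (tapes M) a))"

lemma (in tm_run) coded_delta: "coded_delta M (code \<tau> (tapes M)) = (next_q \<tau>, acts \<tau>)"
  by (simp add: coded_delta_def decode_code next_q_def acts_def reads_def)

subsection \<open>The formula\<close>

definition table :: "nat => (nat => nat) => nat => nat" where
  "table c g a = (if a < c then g a else 0)"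

text \<open>A number with base-\<open>B\<close> digits, so that the coding is injective on arguments
  below \<open>B\<close>; the tag is the leading digit.\<close>

definition var_code :: "nat => nat => nat => nat => nat => nat => nat" where
  "var_code B g \<tau> j p s = (((g * B + \<tau>) * B + j) * B + p) * B + s"

definition codes :: "tm => nat" where
  "codes M = (states M + 1) * syms M ^ tapes M"

definition code_q :: "tm => nat => nat" where
  "code_q M = table (codes M) (\<lambda>a. fst (coded_delta M a))"

text \<open>The two arguments are flattened to one index, since a \<open>table\<close> has a single
  argument.\<close>

definition code_write :: "tm => nat => nat => nat" where
  "code_write M a j = table (codes M * tapes M)
     (\<lambda>i. fst (snd (coded_delta M (i div tapes M)) ! (i mod tapes M))) (a * tapes M + j)"

definition code_shift :: "tm => nat => nat => nat" where
  "code_shift M a j = table (codes M * tapes M)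
     (\<lambda>i. shift (snd (snd (coded_delta M (i div tapes M)) ! (i mod tapes M)))) (a * tapes M + j)"

text \<open>The layout of \<open>pair_words\<close>: a True before every bit of x and a False before
  the certificate, whose cells are left to the guess. Heads start on cell T + 1.\<close>

definition init_sym :: "bool list => nat => nat => nat" where
  "init_sym x T p = (if p < T + 1 then 0
     else if p - (T + 1) < 2 * length x then
       if (p - (T + 1)) mod 2 = 0 then 2 else if bit_at x ((p - (T + 1)) div 2) then 2 else 1
     else if p - (T + 1) = 2 * length x then 1 else 0)"

text \<open>
  The variables with tags \<open>0, \<dots>, 4\<close> say: the state at time \<open>\<tau>\<close> is \<open>s\<close>; the head of tape \<open>j\<close> is on cell
  \<open>p\<close>; cell \<open>p\<close> of tape \<open>j\<close> contains \<open>s\<close>; the symbol read on tape \<open>j\<close> is \<open>s\<close>; the state and the symbols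
  read on the first \<open>j\<close> tapes have code \<open>s\<close>. Cell \<open>p\<close> stands for position \<open>p - (T + 1)\<close>. Except for the
  guess of the certificate all clauses are Horn clauses, so that in every model the facts about the
  run on the guessed input hold, and the last clause forbids the output \<open>False\<close>.
\<close>

inductive horn ::
  "tm => nat => nat => nat => nat => bool list => nat => nat => nat => bool"
  for M Y T P B x where
  state_code: "\<tau> < T ==> q < codes M ==>
    horn M Y T P B x (2 * var_code B 0 \<tau> 0 0 q) (2 * var_code B 0 \<tau> 0 0 q) (2 * var_code B 4 \<tau> 0 0 q + 1)"
| read_cell: "\<tau> < T ==> j < tapes M ==> p < P ==> s < syms M ==>
    horn M Y T P B x (2 * var_code B 1 \<tau> j p 0) (2 * var_code B 2 \<tau> j p s) (2 * var_code B 3 \<tau> j 0 s + 1)"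
| code_reads: "\<tau> < T ==> j < tapes M ==> d < codes M ==> s < syms M ==>
    horn M Y T P B x (2 * var_code B 4 \<tau> j 0 d) (2 * var_code B 3 \<tau> j 0 s)
      (2 * var_code B 4 \<tau> (j + 1) 0 (d * syms M + s) + 1)"
| next_state: "\<tau> < T ==> d < codes M ==>
    horn M Y T P B x (2 * var_code B 4 \<tau> (tapes M) 0 d) (2 * var_code B 4 \<tau> (tapes M) 0 d)
      (2 * var_code B 0 (\<tau> + 1) 0 0 (code_q M d) + 1)"
| write_cell: "\<tau> < T ==> d < codes M ==> j < tapes M ==> p < P ==>
    horn M Y T P B x (2 * var_code B 4 \<tau> (tapes M) 0 d) (2 * var_code B 1 \<tau> j p 0)
      (2 * var_code B 2 (\<tau> + 1) j p (code_write M d j) + 1)"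
| move_head: "\<tau> < T ==> d < codes M ==> j < tapes M ==> 0 < p ==> p + 1 < P ==>
    horn M Y T P B x (2 * var_code B 4 \<tau> (tapes M) 0 d) (2 * var_code B 1 \<tau> j p 0)
      (2 * var_code B 1 (\<tau> + 1) j (p + code_shift M d j - 1) 0 + 1)"
| keep_cell: "\<tau> < T ==> j < tapes M ==> p < P ==> p' < P ==> s < syms M ==> p \<noteq> p' ==>
    horn M Y T P B x (2 * var_code B 1 \<tau> j p 0) (2 * var_code B 2 \<tau> j p' s)
      (2 * var_code B 2 (\<tau> + 1) j p' s + 1)"
| guess_cell: "T + 2 * length x + 2 \<le> p ==> p < T + 2 * length x + 2 + Y ==> p < P ==>
    horn M Y T P B x (2 * var_code B 2 0 0 p 1 + 1) (2 * var_code B 2 0 0 p 2 + 1) (2 * var_code B 2 0 0 p 0 + 1)"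
| blank_cell: "T + 2 * length x + 2 \<le> p ==> p + 1 < T + 2 * length x + 2 + Y ==> p < P ==>
    horn M Y T P B x (2 * var_code B 2 0 0 p 0) (2 * var_code B 2 0 0 p 0) (2 * var_code B 2 0 0 (p + 1) 0 + 1)"
| start_state: "horn M Y T P B x (2 * var_code B 0 0 0 0 0 + 1) (2 * var_code B 0 0 0 0 0 + 1) (2 * var_code B 0 0 0 0 0 + 1)"
| start_head: "j < tapes M ==> horn M Y T P B x (2 * var_code B 1 0 j (T + 1) 0 + 1) (2 * var_code B 1 0 j (T + 1) 0 + 1)
      (2 * var_code B 1 0 j (T + 1) 0 + 1)"
| start_blank: "0 < j ==> j < tapes M ==> p < P ==>
    horn M Y T P B x (2 * var_code B 2 0 j p 0 + 1) (2 * var_code B 2 0 j p 0 + 1) (2 * var_code B 2 0 j p 0 + 1)"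
| start_input: "p < P ==> \<not> (T + 2 * length x + 2 \<le> p \<and> p < T + 2 * length x + 2 + Y) ==>
    horn M Y T P B x (2 * var_code B 2 0 0 p (init_sym x T p) + 1) (2 * var_code B 2 0 0 p (init_sym x T p) + 1)
      (2 * var_code B 2 0 0 p (init_sym x T p) + 1)"
| no_reject: "horn M Y T P B x (2 * var_code B 2 T (tapes M - 1) (T + 1) 1) (2 * var_code B 2 T (tapes M - 1) (T + 1) 1)
      (2 * var_code B 2 T (tapes M - 1) (T + 1) 1)"

text \<open>The rules of \<open>horn\<close> as a disjunction of bounded quantifiers. Definability
  is immediate in this form, while the rules serve the correctness proofs.\<close>

definition horn_formula ::
  "tm => nat => nat => nat => nat => bool list => nat => nat => nat => bool" where
  "horn_formula M Y T P B x a b c \<longleftrightarrow>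
     (\<exists>\<tau><T. \<exists>q<codes M. a = 2 * var_code B 0 \<tau> 0 0 q \<and> b = a \<and> c = 2 * var_code B 4 \<tau> 0 0 q + 1) \<or>
     (\<exists>\<tau><T. \<exists>j<tapes M. \<exists>p<P. \<exists>s<syms M. a = 2 * var_code B 1 \<tau> j p 0 \<and> b = 2 * var_code B 2 \<tau> j p s \<and>
        c = 2 * var_code B 3 \<tau> j 0 s + 1) \<or>
     (\<exists>\<tau><T. \<exists>j<tapes M. \<exists>d<codes M. \<exists>s<syms M. a = 2 * var_code B 4 \<tau> j 0 d \<and> b = 2 * var_code B 3 \<tau> j 0 s \<and>
        c = 2 * var_code B 4 \<tau> (j + 1) 0 (d * syms M + s) + 1) \<or>
     (\<exists>\<tau><T. \<exists>d<codes M. a = 2 * var_code B 4 \<tau> (tapes M) 0 d \<and> b = a \<and>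
        c = 2 * var_code B 0 (\<tau> + 1) 0 0 (code_q M d) + 1) \<or>
     (\<exists>\<tau><T. \<exists>d<codes M. \<exists>j<tapes M. \<exists>p<P. a = 2 * var_code B 4 \<tau> (tapes M) 0 d \<and> b = 2 * var_code B 1 \<tau> j p 0 \<and>
        c = 2 * var_code B 2 (\<tau> + 1) j p (code_write M d j) + 1) \<or>
     (\<exists>\<tau><T. \<exists>d<codes M. \<exists>j<tapes M. \<exists>p<P. 0 < p \<and> p + 1 < P \<and> a = 2 * var_code B 4 \<tau> (tapes M) 0 d \<and>
        b = 2 * var_code B 1 \<tau> j p 0 \<and> c = 2 * var_code B 1 (\<tau> + 1) j (p + code_shift M d j - 1) 0 + 1) \<or>
     (\<exists>\<tau><T. \<exists>j<tapes M. \<exists>p<P. \<exists>p'<P. \<exists>s<syms M. p \<noteq> p' \<and> a = 2 * var_code B 1 \<tau> j p 0 \<and>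
        b = 2 * var_code B 2 \<tau> j p' s \<and> c = 2 * var_code B 2 (\<tau> + 1) j p' s + 1) \<or>
     b = a \<and> c = a \<and> (a = 2 * var_code B 0 0 0 0 0 + 1 \<or>
       (\<exists>j<tapes M. a = 2 * var_code B 1 0 j (T + 1) 0 + 1) \<or>
       (\<exists>j<tapes M. \<exists>p<P. 0 < j \<and> a = 2 * var_code B 2 0 j p 0 + 1) \<or>
       (\<exists>p<P. \<not> (T + 2 * length x + 2 \<le> p \<and> p < T + 2 * length x + 2 + Y) \<and>
          a = 2 * var_code B 2 0 0 p (init_sym x T p) + 1) \<or>
       a = 2 * var_code B 2 T (tapes M - 1) (T + 1) 1) \<or>
     (\<exists>p<P. T + 2 * length x + 2 \<le> p \<and> p < T + 2 * length x + 2 + Y \<and> a = 2 * var_code B 2 0 0 p 1 + 1 \<and>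
        b = 2 * var_code B 2 0 0 p 2 + 1 \<and> c = 2 * var_code B 2 0 0 p 0 + 1) \<or>
     (\<exists>p<P. T + 2 * length x + 2 \<le> p \<and> p + 1 < T + 2 * length x + 2 + Y \<and> a = 2 * var_code B 2 0 0 p 0 \<and>
        b = a \<and> c = 2 * var_code B 2 0 0 (p + 1) 0 + 1)"

lemma horn_iff: "horn M Y T P B x a b c \<longleftrightarrow> horn_formula M Y T P B x a b c"
proof
  assume "horn M Y T P B x a b c"
  then show "horn_formula M Y T P B x a b c"
  proof cases
    case state_code
    show ?thesis unfolding horn_formula_def by (rule disjI1, use state_code in \<open>metis add_lessD1\<close>)
  next
    case read_cell
    show ?thesis unfolding horn_formula_def by (rule disjI2, rule disjI1, use read_cell in \<open>metis add_lessD1\<close>)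
  next
    case code_reads
    show ?thesis unfolding horn_formula_def by (rule disjI2, rule disjI2, rule disjI1, use code_reads in \<open>metis add_lessD1\<close>)
  next
    case next_state
    show ?thesis unfolding horn_formula_def by (rule disjI2, rule disjI2, rule disjI2, rule disjI1, use next_state in \<open>metis add_lessD1\<close>)
  next
    case write_cell
    show ?thesis unfolding horn_formula_def by (rule disjI2, rule disjI2, rule disjI2, rule disjI2, rule disjI1, use write_cell in \<open>metis add_lessD1\<close>)
  next
    case move_head
    show ?thesis unfolding horn_formula_def by (rule disjI2, rule disjI2, rule disjI2, rule disjI2, rule disjI2, rule disjI1, use move_head in \<open>metis add_lessD1\<close>)
  next
    case keep_cell
    show ?thesis unfolding horn_formula_def by (rule disjI2, rule disjI2, rule disjI2, rule disjI2, rule disjI2, rule disjI2, rule disjI1, use keep_cell in \<open>metis add_lessD1\<close>)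
  next
    case start_state
    show ?thesis unfolding horn_formula_def by (rule disjI2, rule disjI2, rule disjI2, rule disjI2, rule disjI2, rule disjI2, rule disjI2, rule disjI1, use start_state in \<open>metis add_lessD1\<close>)
  next
    case start_head
    show ?thesis unfolding horn_formula_def by (rule disjI2, rule disjI2, rule disjI2, rule disjI2, rule disjI2, rule disjI2, rule disjI2, rule disjI1, use start_head in \<open>metis add_lessD1\<close>)
  next
    case start_blank
    show ?thesis unfolding horn_formula_def by (rule disjI2, rule disjI2, rule disjI2, rule disjI2, rule disjI2, rule disjI2, rule disjI2, rule disjI1, use start_blank in \<open>metis add_lessD1\<close>)
  next
    case start_input
    show ?thesis unfolding horn_formula_def by (rule disjI2, rule disjI2, rule disjI2, rule disjI2, rule disjI2, rule disjI2, rule disjI2, rule disjI1, use start_input in \<open>metis add_lessD1\<close>)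
  next
    case no_reject
    show ?thesis unfolding horn_formula_def by (rule disjI2, rule disjI2, rule disjI2, rule disjI2, rule disjI2, rule disjI2, rule disjI2, rule disjI1, use no_reject in \<open>metis add_lessD1\<close>)
  next
    case guess_cell
    show ?thesis unfolding horn_formula_def by (rule disjI2, rule disjI2, rule disjI2, rule disjI2, rule disjI2, rule disjI2, rule disjI2, rule disjI2, rule disjI1, use guess_cell in \<open>metis add_lessD1\<close>)
  next
    case blank_cell
    show ?thesis unfolding horn_formula_def by (rule disjI2, rule disjI2, rule disjI2, rule disjI2, rule disjI2, rule disjI2, rule disjI2, rule disjI2, rule disjI2, use blank_cell in \<open>metis add_lessD1\<close>)
  qed
next
  assume "horn_formula M Y T P B x a b c"
  then show "horn M Y T P B x a b c"
    unfolding horn_formula_def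
    by (elim disjE exE conjE) (simp_all only: horn.intros not_False_eq_True)
qed

section \<open>Models of the formula and accepting runs\<close>

lemma pair_words_cell:
  "tape_of (pair_words x y) (int i) =
    (if i < 2 * length x then if i mod 2 = 0 then 2 else if x ! (i div 2) then 2 else 1
     else if i = 2 * length x then 1
     else if i < 2 * length x + 1 + length y then bit_sym (y ! (i - (2 * length x + 1)))
     else 0)"
proof -
  have len: "length (concat (map (\<lambda>b. [True, b]) x)) = 2 * length x" by (induction x) auto
  have nth: "concat (map (\<lambda>b. [True, b]) x) ! i = (even i \<or> x ! (i div 2))" if "i < 2 * length x" for i
    using that
  proof (induction x arbitrary: i)
    case (Cons b x)
    show ?case
    proof (cases "i < 2")
      case True
      then have "i = 0 \<or> i = 1" by auto
      then show ?thesis by auto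
    next
      case False
      then obtain i' where i': "i = Suc (Suc i')" by (metis add_2_eq_Suc le_add_diff_inverse not_less)
      then show ?thesis using Cons by simp
    qed
  qed simp
  define w where "w = pair_words x y"
  have "length w = 2 * length x + 1 + length y" by (simp add: w_def pair_words_def len)
  then have cell: "tape_of w (int i) = (if i < 2 * length x + 1 + length y then bit_sym (w ! i) else 0)"
    by (simp add: tape_of_def bit_sym_def)
  consider "i < 2 * length x" | "i = 2 * length x" | "2 * length x < i" by linarith
  then show ?thesis
  proof cases
    case 1
    then have "w ! i = (even i \<or> x ! (i div 2))" by (simp add: w_def pair_words_def nth_append len nth)
    then show ?thesis using 1 cell by (simp add: w_def bit_sym_def even_iff_mod_2_eq_zero)
  next
    case 2
    then have "w ! i = False" by (simp add: w_def pair_words_def nth_append len)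
    then show ?thesis using 2 cell by (simp add: w_def bit_sym_def)
  next
    case 3
    then have "w ! i = y ! (i - (2 * length x + 1))" by (simp add: w_def pair_words_def nth_append len nth_Cons')
    then show ?thesis using 3 cell by (simp add: w_def)
  qed
qed

definition clause_sat :: "(nat => bool) => (nat => nat => nat => bool) => bool" where
  "clause_sat \<alpha> H \<longleftrightarrow> (\<forall>a b c. H a b c \<longrightarrow> lit_true \<alpha> a \<or> lit_true \<alpha> b \<or> lit_true \<alpha> c)"

lemma lit_true_simps: "lit_true \<alpha> (2 * v + 1) = \<alpha> v" "lit_true \<alpha> (2 * v) = (\<not> \<alpha> v)"
  by (auto simp: lit_true_def)

lemma clause_satD: "clause_sat \<alpha> H ==> H a b c ==> lit_true \<alpha> a \<or> lit_true \<alpha> b \<or> lit_true \<alpha> c"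
  unfolding clause_sat_def by blast

lemma clause_sat_literals:
  assumes "clause_sat \<alpha> H"
  shows "H (2 * a + 1) (2 * b + 1) (2 * c + 1) ==> \<alpha> a \<or> \<alpha> b \<or> \<alpha> c"
    "H (2 * a) (2 * b) (2 * c + 1) ==> \<alpha> a ==> \<alpha> b ==> \<alpha> c"
    "H (2 * a + 1) (2 * a + 1) (2 * a + 1) ==> \<alpha> a"
    "H (2 * a) (2 * a) (2 * a) ==> \<not> \<alpha> a"
  using clause_satD[OF assms, of "2 * a + 1" "2 * b + 1" "2 * c + 1"]
    clause_satD[OF assms, of "2 * a" "2 * b" "2 * c + 1"]
    clause_satD[OF assms, of "2 * a + 1" "2 * a + 1" "2 * a + 1"]
    clause_satD[OF assms, of "2 * a" "2 * a" "2 * a"]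
  unfolding lit_true_simps by blast+

lemma slot_code_less:
  assumes "j < tapes M" "a < codes M" shows "a * tapes M + j < codes M * tapes M"
  using mult_le_mono1[of "a + 1" "codes M" "tapes M"] assms by simp

lemma code_write_shift:
  assumes "j < tapes M" "a < codes M"
  shows "code_write M a j = fst (snd (coded_delta M a) ! j)" "code_shift M a j = shift (snd (snd (coded_delta M a) ! j))"
  using slot_code_less[OF assms] assms by (simp_all add: code_write_def code_shift_def table_def)

lemma (in tm_run) code_less_codes: "j \<le> tapes M ==> code \<tau> j < codes M"
proof -
  assume j: "j \<le> tapes M"
  have "syms M ^ j \<le> syms M ^ tapes M" using j wf by (intro power_increasing) (auto simp: wf_tm_def)
  then have "(states M + 1) * syms M ^ j \<le> codes M" unfolding codes_def by (rule mult_left_mono) simp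
  then show ?thesis using code_less[OF j, of \<tau>] by linarith
qed

text \<open>The certificate is read off the guessed cells up to the first blank. By induction on
  time, every true fact about the run on it holds in the model. The model may contain further facts,
  which does no harm: since it lacks the output False at time T, the run does not have this output.
  \<open>P\<close> leaves room for heads moving T cells to either side and for the whole
  input.\<close>

lemma horn_sat_imp_accept:
  assumes wf: "wf_tm M" and sat: "clause_sat \<alpha> (horn M Y T P B x)" and P: "P = 2 * T + 2 * length x + Y + 5"
  shows "\<exists>y. length y \<le> Y \<and> (\<forall>b t. computes_within M (pair_words x y) [b] t \<and> t \<le> T \<longrightarrow> b)"
proof -
  note D = clause_sat_literals[OF sat]
  define n where "n = length x"
  let ?C = "\<lambda>p s. \<alpha> (var_code B 2 0 0 p s)"
  define o' where "o' = T + 2 * n + 2"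
  \<comment> \<open>The position of the first blank among the guessed cells, or Y if there is
    none.\<close>
  define len where "len = (LEAST i. i = Y \<or> ?C (o' + i) 0)"
  have len: "len = Y \<or> ?C (o' + len) 0" unfolding len_def by (rule LeastI[of _ Y]) simp
  have lenY: "len \<le> Y" unfolding len_def by (rule Least_le) simp
  have before: "\<not> ?C (o' + i) 0" if "i < len" for i using not_less_Least[of i] that unfolding len_def by blast
  define y where "y = map (\<lambda>i. ?C (o' + i) 2) [0..<len]"
  have ylen: "length y = len" by (simp add: y_def)
  interpret tm_run M "pair_words x y" by unfold_locales (rule wf)
  have k: "tapes M \<ge> 1" using wf by (simp add: wf_tm_def)
  have guess: "?C (o' + i) 1 \<or> ?C (o' + i) 2 \<or> ?C (o' + i) 0" if "i < Y" for i
  proof -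
    have "horn M Y T P B x (2 * var_code B 2 0 0 (o' + i) 1 + 1) (2 * var_code B 2 0 0 (o' + i) 2 + 1)
        (2 * var_code B 2 0 0 (o' + i) 0 + 1)"
        by (rule horn.guess_cell) (use that P in \<open>auto simp: o'_def n_def\<close>)
    from D(1)[OF this] show ?thesis .
  qed
  have blank: "?C (o' + i) 0" if "len \<le> i" "i < Y" for i
    using that
  proof (induction i)
    case 0
    then show ?case using len by auto
  next
    case (Suc i)
    show ?case
    proof (cases "len = Suc i")
      case True
      then show ?thesis using len Suc by auto
    next
      case False
      have "horn M Y T P B x (2 * var_code B 2 0 0 (o' + i) 0) (2 * var_code B 2 0 0 (o' + i) 0)
          (2 * var_code B 2 0 0 (o' + i + 1) 0 + 1)"
        by (rule horn.blank_cell) (use Suc.prems P in \<open>auto simp: o'_def n_def\<close>)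
      moreover have "?C (o' + i) 0" using Suc False by simp
      ultimately have "?C (o' + i + 1) 0" using D(2) by blast
      then show ?thesis by simp
    qed
  qed
  have facts: "\<alpha> (var_code B 0 \<tau> 0 0 (qs \<tau>)) \<and> (\<forall>j<tapes M. \<alpha> (var_code B 1 \<tau> j (nat (pos \<tau> j + int T + 1)) 0)) \<and>
      (\<forall>j<tapes M. \<forall>p<P. \<alpha> (var_code B 2 \<tau> j p (cells \<tau> j (int p - int T - 1))))"
    if "\<tau> \<le> T" for \<tau>
    using that
  proof (induction \<tau>)
    case 0
    have "horn M Y T P B x (2 * var_code B 0 0 0 0 0 + 1) (2 * var_code B 0 0 0 0 0 + 1) (2 * var_code B 0 0 0 0 0 + 1)"
      by (rule horn.start_state)
    from D(3)[OF this] have 1: "\<alpha> (var_code B 0 0 0 0 (qs 0))" using init[of 0] k by simp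
    have 2: "\<alpha> (var_code B 1 0 j (nat (pos 0 j + int T + 1)) 0)" if "j < tapes M" for j
    proof -
      have "horn M Y T P B x (2 * var_code B 1 0 j (T + 1) 0 + 1) (2 * var_code B 1 0 j (T + 1) 0 + 1) (2 * var_code B 1 0 j (T + 1) 0 + 1)"
        by (rule horn.start_head) (use that in \<open>auto\<close>)
      from D(3)[OF this] show ?thesis using init[OF that] by (simp add: nat_add_distrib)
    qed
    have 3: "\<alpha> (var_code B 2 0 j p (cells 0 j (int p - int T - 1)))" if j: "j < tapes M" and p: "p < P" for j p
    proof (cases "j = 0")
      case False
      have "horn M Y T P B x (2 * var_code B 2 0 j p 0 + 1) (2 * var_code B 2 0 j p 0 + 1) (2 * var_code B 2 0 j p 0 + 1)"
        by (rule horn.start_blank) (use that False in \<open>auto\<close>)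
      from D(3)[OF this] show ?thesis using init_cells(2)[of j] j False by simp
    next
      case j0: True
      show ?thesis
      proof (cases "o' \<le> p \<and> p < o' + Y")
        case False
        let ?v = "2 * var_code B 2 0 0 p (init_sym x T p) + 1"
        have "horn M Y T P B x ?v ?v ?v"
          by (rule horn.start_input) (use p False in \<open>auto simp: o'_def n_def\<close>)
        from D(3)[OF this] have "\<alpha> (var_code B 2 0 0 p (init_sym x T p))" .
        moreover have "cells 0 0 (int p - int T - 1) = init_sym x T p"
        proof -
          show ?thesis
          proof (cases "T + 1 \<le> p")
            case True
            define i where "i = p - (T + 1)"
            have eq: "int p - int T - 1 = int i" using True by (simp add: i_def)
            have i: "\<not> (2 * n + 1 \<le> i \<and> i < 2 * n + 1 + Y)" using True False by (auto simp: i_def o'_def)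
            then have "i < 2 * length x \<or> i = 2 * length x \<or> 2 * length x + 1 + length y \<le> i"
              using lenY ylen by (auto simp: n_def)
            moreover have "i < 2 * length x ==> bit_at x (i div 2) = x ! (i div 2)" by (auto simp: bit_at_def)
            moreover have "\<not> p < T + 1" using True by simp
            ultimately show ?thesis unfolding init_cells(1) eq pair_words_cell init_sym_def i_def[symmetric]
              by (elim disjE) simp_all
          next
            case False
            then show ?thesis unfolding init_cells(1) by (simp add: init_sym_def tape_of_def)
          qed
        qed
        ultimately show ?thesis using j0 by simp
      next
        case True
        define i where "i = p - o'"
        have i: "p = o' + i" "i < Y" using True by (auto simp: i_def)
        have c: "cells 0 0 (int p - int T - 1) = (if i < len then bit_sym (y ! i) else 0)"
        proof -
          have "int p - int T - 1 = int (2 * n + 1 + i)" using i by (simp add: o'_def)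
          then show ?thesis unfolding init_cells(1) using pair_words_cell[of x y "2 * n + 1 + i"] ylen by (simp add: n_def)
        qed
        show ?thesis
        proof (cases "i < len")
          case True
          have "y ! i = ?C p 2" using True i by (simp add: y_def)
          then show ?thesis using c True guess[OF i(2)] before[OF True] i j0 by (auto simp: bit_sym_def)
        next
          case False
          then show ?thesis using c blank[of i] i j0 by simp
        qed
      qed
    qed
    show ?case using 1 2 3 by blast
  next
    case (Suc \<tau>)
    then have \<tau>: "\<tau> < T" and IH: "\<alpha> (var_code B 0 \<tau> 0 0 (qs \<tau>))"
      "\<And>j. j < tapes M ==> \<alpha> (var_code B 1 \<tau> j (nat (pos \<tau> j + int T + 1)) 0)"
      "\<And>j p. j < tapes M ==> p < P ==> \<alpha> (var_code B 2 \<tau> j p (cells \<tau> j (int p - int T - 1)))" by auto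
    define hp where "hp j = nat (pos \<tau> j + int T + 1)" for j
    have hp: "int (hp j) - int T - 1 = pos \<tau> j" "0 < hp j" "hp j + 1 < P" if "j < tapes M" for j
    proof -
      have "\<bar>pos \<tau> j\<bar> \<le> int \<tau>" using invariant[of \<tau>] that by blast
      then show "int (hp j) - int T - 1 = pos \<tau> j" "0 < hp j" "hp j + 1 < P" using \<tau> P by (auto simp: hp_def)
    qed
    have sym: "cells \<tau> j i < syms M" if "j < tapes M" for j i using invariant[of \<tau>] that by blast
    have rd: "\<alpha> (var_code B 3 \<tau> j 0 (cells \<tau> j (pos \<tau> j)))" if j: "j < tapes M" for j
    proof -
      let ?s = "cells \<tau> j (pos \<tau> j)"
      have "horn M Y T P B x (2 * var_code B 1 \<tau> j (hp j) 0) (2 * var_code B 2 \<tau> j (hp j) ?s) (2 * var_code B 3 \<tau> j 0 ?s + 1)"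
        by (rule horn.read_cell) (use \<tau> j hp[OF j] sym[OF j] in \<open>auto\<close>)
      from D(2)[OF this] show ?thesis
        using IH(2)[OF j, folded hp_def] IH(3)[OF j, of "hp j"] hp[OF j] by simp
    qed
    have ac: "\<alpha> (var_code B 4 \<tau> j 0 (code \<tau> j))" if "j \<le> tapes M" for j
      using that
    proof (induction j)
      case 0
      have "horn M Y T P B x (2 * var_code B 0 \<tau> 0 0 (qs \<tau>)) (2 * var_code B 0 \<tau> 0 0 (qs \<tau>)) (2 * var_code B 4 \<tau> 0 0 (qs \<tau>) + 1)"
        by (rule horn.state_code) (use \<tau> code_less_codes[of 0 \<tau>] in \<open>auto\<close>)
      from D(2)[OF this] show ?case using IH(1) by simp
    next
      case (Suc j)
      let ?s = "cells \<tau> j (pos \<tau> j)"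
      have "horn M Y T P B x (2 * var_code B 4 \<tau> j 0 (code \<tau> j)) (2 * var_code B 3 \<tau> j 0 ?s)
          (2 * var_code B 4 \<tau> (j + 1) 0 (code \<tau> j * syms M + ?s) + 1)"
        by (rule horn.code_reads) (use \<tau> code_less_codes[of j \<tau>] sym[of j] Suc.prems in \<open>auto\<close>)
      from D(2)[OF this] show ?case using Suc rd[of j] by simp
    qed
    let ?d = "code \<tau> (tapes M)"
    have d: "?d < codes M" by (rule code_less_codes) simp
    have 1: "\<alpha> (var_code B 0 (Suc \<tau>) 0 0 (qs (Suc \<tau>)))"
    proof -
      have "horn M Y T P B x (2 * var_code B 4 \<tau> (tapes M) 0 ?d) (2 * var_code B 4 \<tau> (tapes M) 0 ?d)
          (2 * var_code B 0 (\<tau> + 1) 0 0 (code_q M ?d) + 1)"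
        by (rule horn.next_state) (use \<tau> d in \<open>auto\<close>)
      moreover have "code_q M ?d = qs (Suc \<tau>)" using d by (simp add: code_q_def table_def coded_delta step)
      ultimately show ?thesis using D(2) ac[of "tapes M"] by (metis Suc_eq_plus1 order_refl)
    qed
    have 2: "\<alpha> (var_code B 1 (Suc \<tau>) j (nat (pos (Suc \<tau>) j + int T + 1)) 0)" if j: "j < tapes M" for j
    proof -
      have "horn M Y T P B x (2 * var_code B 4 \<tau> (tapes M) 0 ?d) (2 * var_code B 1 \<tau> j (hp j) 0)
          (2 * var_code B 1 (\<tau> + 1) j (hp j + code_shift M ?d j - 1) 0 + 1)"
        by (rule horn.move_head) (use \<tau> d j hp[OF j] in \<open>auto\<close>)
      moreover have "hp j + code_shift M ?d j - 1 = nat (pos (Suc \<tau>) j + int T + 1)"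
      proof -
        have "pos (Suc \<tau>) j = pos \<tau> j + int (code_shift M ?d j) - 1"
          using code_write_shift(2)[OF j d] step(3)[OF j, of \<tau>] by (simp add: coded_delta)
        then show ?thesis using hp[OF j] by simp
      qed
      ultimately show ?thesis using D(2) ac[of "tapes M"] IH(2)[OF j, folded hp_def]
        by (metis Suc_eq_plus1 order_refl)
    qed
    have 3: "\<alpha> (var_code B 2 (Suc \<tau>) j p (cells (Suc \<tau>) j (int p - int T - 1)))" if j: "j < tapes M" and p: "p < P" for j p
    proof (cases "p = hp j")
      case True
      have "horn M Y T P B x (2 * var_code B 4 \<tau> (tapes M) 0 ?d) (2 * var_code B 1 \<tau> j (hp j) 0)
          (2 * var_code B 2 (\<tau> + 1) j (hp j) (code_write M ?d j) + 1)"
        by (rule horn.write_cell) (use \<tau> d j hp[OF j] in \<open>auto\<close>)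
      moreover have "cells (Suc \<tau>) j (int p - int T - 1) = code_write M ?d j"
        using code_write_shift(1)[OF j d] step(2)[OF j, of \<tau>] hp(1)[OF j] True by (simp add: coded_delta)
      ultimately show ?thesis using D(2) ac[of "tapes M"] IH(2)[OF j, folded hp_def] True
        by (metis Suc_eq_plus1 order_refl)
    next
      case False
      let ?s = "cells \<tau> j (int p - int T - 1)"
      have "horn M Y T P B x (2 * var_code B 1 \<tau> j (hp j) 0) (2 * var_code B 2 \<tau> j p ?s) (2 * var_code B 2 (\<tau> + 1) j p ?s + 1)"
        by (rule horn.keep_cell) (use \<tau> j p hp[OF j] False sym[OF j] in \<open>auto\<close>)
      moreover have "cells (Suc \<tau>) j (int p - int T - 1) = ?s"
        using step(2)[OF j, of \<tau>] hp(1)[OF j] False by auto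
      ultimately show ?thesis using D(2) IH(2)[OF j, folded hp_def] IH(3)[OF j p]
        by (metis Suc_eq_plus1)
    qed
    show ?case using 1 2 3 by blast
  qed
  have goal: "\<not> \<alpha> (var_code B 2 T (tapes M - 1) (T + 1) 1)"
  proof -
    let ?v = "2 * var_code B 2 T (tapes M - 1) (T + 1) 1"
    have "horn M Y T P B x ?v ?v ?v" by (rule horn.no_reject)
    from D(4)[OF this] show ?thesis .
  qed
  have "\<alpha> (var_code B 2 T (tapes M - 1) (T + 1) (cells T (tapes M - 1) 0))"
  proof -
    have "\<forall>j<tapes M. \<forall>p<P. \<alpha> (var_code B 2 T j p (cells T j (int p - int T - 1)))" using facts[of T] by blast
    from this[rule_format, of "tapes M - 1" "T + 1"] show ?thesis using k P by simp
  qed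
  then have "cells T (tapes M - 1) 0 \<noteq> 1" using goal by metis
  then have "b" if "computes_within M (pair_words x y) [b] t" "t \<le> T" for b t
    using output_cell[OF that] by (auto simp: bit_sym_def split: if_splits)
  then show ?thesis using ylen lenY by auto
qed

lemma var_code_decode:
  assumes "\<tau> < B" "j < B" "p < B" "s < B"
  shows "var_code B g \<tau> j p s mod B = s" "var_code B g \<tau> j p s div B mod B = p"
    "var_code B g \<tau> j p s div B div B mod B = j" "var_code B g \<tau> j p s div B div B div B mod B = \<tau>"
    "var_code B g \<tau> j p s div B div B div B div B = g"
proof -
  have d: "(x * B + y) div B = x" "(x * B + y) mod B = y" if "y < B" for x y
    using that by simp_all
  show "var_code B g \<tau> j p s mod B = s" "var_code B g \<tau> j p s div B mod B = p"
    "var_code B g \<tau> j p s div B div B mod B = j" "var_code B g \<tau> j p s div B div B div B mod B = \<tau>"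
    "var_code B g \<tau> j p s div B div B div B div B = g"
    unfolding var_code_def by (simp_all only: d assms)
qed

text \<open>A bound, depending on the machine alone, for all numbers that come from its tables; sums
  stand in for maxima.\<close>

definition code_bound :: "tm => nat" where
  "code_bound M = codes M * (syms M + 1) + syms M + tapes M + states M + 5 + (\<Sum>d<codes M. code_q M d) +
     (\<Sum>d<codes M. \<Sum>j<tapes M. code_write M d j + code_shift M d j)"

lemma code_bound:
  "d < codes M ==> code_q M d < code_bound M"
  "d < codes M ==> j < tapes M ==> code_write M d j < code_bound M"
  "d < codes M ==> j < tapes M ==> code_shift M d j < code_bound M"
  "d < codes M ==> s < syms M ==> d * syms M + s < code_bound M"
proof -
  show "d < codes M ==> code_q M d < code_bound M"
    using member_le_sum[of d "{..<codes M}" "code_q M"] by (simp add: code_bound_def)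
  have "code_write M d j + code_shift M d j \<le> (\<Sum>d<codes M. \<Sum>j<tapes M. code_write M d j + code_shift M d j)"
    if "d < codes M" "j < tapes M"
    using member_le_sum[of d "{..<codes M}" "\<lambda>d. \<Sum>j<tapes M. code_write M d j + code_shift M d j"]
      member_le_sum[of j "{..<tapes M}" "\<lambda>j. code_write M d j + code_shift M d j"] that by simp
  then show "d < codes M ==> j < tapes M ==> code_write M d j < code_bound M"
    "d < codes M ==> j < tapes M ==> code_shift M d j < code_bound M"
    by (auto simp: code_bound_def)
  assume "d < codes M" "s < syms M"
  then have "d * syms M + s < (d + 1) * (syms M + 1)" by simp
  also have "\<dots> \<le> codes M * (syms M + 1)" using \<open>d < codes M\<close> by (intro mult_right_mono) auto
  finally show "d * syms M + s < code_bound M" by (simp add: code_bound_def)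
qed

lemma var_code_less:
  assumes "\<tau> < B" "j < B" "p < B" "s < B" "g < 5"
  shows "var_code B g \<tau> j p s < 5 * B ^ 4"
proof -
  have step: "x * B + y < X * B" if "x < X" "y < B" for x X y
    using that mult_le_mono1[of "x + 1" X B] by simp
  have "var_code B g \<tau> j p s < (((5 * B) * B) * B) * B"
    unfolding var_code_def by (intro step assms)
  then show ?thesis by (simp add: power_def numeral_eq_Suc algebra_simps)
qed

lemma code_bounds:
  assumes P: "P = 2 * T + 2 * length x + Y + 5" and B: "B = P + code_bound M"
  shows "0 < B" "1 < B" "2 < B"
    "\<tau> < T ==> \<tau> < B" "\<tau> < T ==> \<tau> + 1 < B" "T < B" "T + 1 < B"
    "j < tapes M ==> j < B" "j < tapes M ==> j + 1 < B" "tapes M < B" "tapes M - 1 < B"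
    "p < P ==> p < B" "p < P ==> p + 1 < B" "s < syms M ==> s < B" "d < codes M ==> d < B"
    "d < codes M ==> code_q M d < B" "d < codes M ==> j < tapes M ==> code_write M d j < B"
    "d < codes M ==> s < syms M ==> d * syms M + s < B"
    "d < codes M ==> j < tapes M ==> p + 1 < P ==> p + code_shift M d j - 1 < B"
    "init_sym x T p < B"
proof -
  show "0 < B" "1 < B" "2 < B" "\<tau> < T ==> \<tau> < B" "\<tau> < T ==> \<tau> + 1 < B" "T < B" "T + 1 < B"
    using B P by auto
  show "j < tapes M ==> j < B" "j < tapes M ==> j + 1 < B" "tapes M < B" "tapes M - 1 < B"
    "p < P ==> p < B" "p < P ==> p + 1 < B" "s < syms M ==> s < B" "d < codes M ==> d < B"
    using B by (auto simp: code_bound_def trans_less_add1)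
  show "init_sym x T p < B" using B P by (simp add: init_sym_def)
  assume d: "d < codes M"
  note c = code_bound[of d M, OF d]
  show "code_q M d < B" using c(1) B by simp
  show "j < tapes M ==> code_write M d j < B" using c(2)[of j] B by simp
  show "s < syms M ==> d * syms M + s < B" using c(4)[of s] B by simp
  show "j < tapes M ==> p + 1 < P ==> p + code_shift M d j - 1 < B" using c(3)[of j] B by linarith
qed

text \<open>There are five tags and four digits below \<open>B\<close>, and each variable has two
  literals.\<close>

lemma horn_less:
  assumes "horn M Y T P B x a b c" and P: "P = 2 * T + 2 * length x + Y + 5" and B: "B = P + code_bound M"
    and wf: "wf_tm M"
  shows "a < 10 * B ^ 4 \<and> b < 10 * B ^ 4 \<and> c < 10 * B ^ 4"
proof -
  note B0 = code_bounds(1-3)[OF P B] and Bt = code_bounds(4-7)[OF P B] and Bj = code_bounds(8-11)[OF P B]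
    and Bp = code_bounds(12-13)[OF P B] and Bs = code_bounds(14)[OF P B] and Bd = code_bounds(15)[OF P B]
    and Bc = code_bounds(16-19)[OF P B] and Bi = code_bounds(20)[OF P B]
  have pos: "2 * v + 1 < 10 * B ^ 4" and neg: "2 * v < 10 * B ^ 4" if "v < 5 * B ^ 4" for v
    using that by simp_all
  have five: "(0::nat) < 5" "(1::nat) < 5" "(2::nat) < 5" "(3::nat) < 5" "(4::nat) < 5" by simp_all
  note I = B0 Bt Bj Bp Bs Bd Bc Bi five
  from assms(1) show ?thesis
  proof cases
    case (move_head \<tau> d j p)
    have "p < P" using move_head by simp
    then show ?thesis unfolding move_head(1-3) using move_head(4-)
      by (intro conjI pos neg var_code_less; blast intro: I)
  next
    case (guess_cell p)
    then show ?thesis unfolding guess_cell(1-3) by (intro conjI pos neg var_code_less; blast intro: I)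
  qed (simp only:, intro conjI pos neg var_code_less; blast intro: I)+
qed

text \<open>The model consists of exactly the true facts of the accepting run. It is defined on
  numbers by decoding their digits, and \<open>B\<close> exceeds every digit that occurs in a
  clause.\<close>

lemma accept_imp_horn_sat:
  assumes wf: "wf_tm M" and y: "length y \<le> Y" and acc: "computes_within M (pair_words x y) [True] t" "t \<le> T"
    and P: "P = 2 * T + 2 * length x + Y + 5" and B: "B = P + code_bound M"
  shows "\<exists>\<alpha>. clause_sat \<alpha> (horn M Y T P B x)"
proof -
  interpret tm_run M "pair_words x y" by unfold_locales (rule wf)
  have k: "tapes M \<ge> 1" using wf by (simp add: wf_tm_def)
  define holds where "holds g \<tau> j p s \<longleftrightarrow> (if g = 0 then s = qs \<tau>
     else if g = 1 then int p = pos \<tau> j + int T + 1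
     else if g = 2 then s = cells \<tau> j (int p - int T - 1)
     else if g = 3 then s = cells \<tau> j (pos \<tau> j) else s = code \<tau> j)" for g \<tau> j p s :: nat
  define \<alpha> where "\<alpha> v = holds (v div B div B div B div B) (v div B div B div B mod B) (v div B div B mod B)
     (v div B mod B) (v mod B)" for v
  have A: "\<alpha> (var_code B g \<tau> j p s) = holds g \<tau> j p s" if "\<tau> < B" "j < B" "p < B" "s < B" for g \<tau> j p s
    unfolding \<alpha>_def var_code_decode[OF that] ..
  note B0 = code_bounds(1-3)[OF P B] and Bt = code_bounds(4-7)[OF P B] and Bj = code_bounds(8-11)[OF P B]
    and Bp = code_bounds(12-13)[OF P B] and Bs = code_bounds(14)[OF P B] and Bd = code_bounds(15)[OF P B]
    and Bc = code_bounds(16-19)[OF P B] and Bi = code_bounds(20)[OF P B]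
  have sat: "lit_true \<alpha> a \<or> lit_true \<alpha> b \<or> lit_true \<alpha> c" if "horn M Y T P B x a b c" for a b c
    using that
  proof cases
    case (state_code \<tau> q)
    show ?thesis unfolding state_code(1-3) lit_true_simps
      using A[of \<tau> 0 0 q 0] A[of \<tau> 0 0 q 4] state_code Bt Bd B0 by (simp add: holds_def)
  next
    case (read_cell \<tau> j p s)
    have "\<alpha> (var_code B 1 \<tau> j p 0) ==> \<alpha> (var_code B 2 \<tau> j p s) ==> \<alpha> (var_code B 3 \<tau> j 0 s)"
      using A[of \<tau> j p 0 1] A[of \<tau> j p s 2] A[of \<tau> j 0 s 3] read_cell Bt Bj Bp Bs B0 by (simp add: holds_def)
    then show ?thesis unfolding read_cell(1-3) lit_true_simps by blast
  next
    case (code_reads \<tau> j d s)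
    have "\<alpha> (var_code B 4 \<tau> j 0 d) ==> \<alpha> (var_code B 3 \<tau> j 0 s) ==> \<alpha> (var_code B 4 \<tau> (j + 1) 0 (d * syms M + s))"
      using A[of \<tau> j 0 d 4] A[of \<tau> j 0 s 3] A[of \<tau> "j + 1" 0 "d * syms M + s" 4] code_reads Bt Bj Bd Bc Bs B0
      by (simp add: holds_def)
    then show ?thesis unfolding code_reads(1-3) lit_true_simps by blast
  next
    case (next_state \<tau> d)
    have "\<alpha> (var_code B 0 (\<tau> + 1) 0 0 (code_q M d))" if "\<alpha> (var_code B 4 \<tau> (tapes M) 0 d)"
    proof -
      have "d = code \<tau> (tapes M)"
        using that A[of \<tau> "tapes M" 0 d 4] next_state Bt Bj Bd B0 by (simp add: holds_def)
      then have "code_q M d = qs (\<tau> + 1)"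
        using next_state step(1)[of \<tau>] by (simp add: code_q_def table_def coded_delta)
      then show ?thesis using A[of "\<tau> + 1" 0 0 "code_q M d" 0] next_state(4,5) Bt(2)[of \<tau>] Bc(1)[of d] B0 by (simp add: holds_def)
    qed
    then show ?thesis unfolding next_state(1-3) lit_true_simps by blast
  next
    case (write_cell \<tau> d j p)
    have "\<alpha> (var_code B 2 (\<tau> + 1) j p (code_write M d j))"
      if "\<alpha> (var_code B 4 \<tau> (tapes M) 0 d)" "\<alpha> (var_code B 1 \<tau> j p 0)"
    proof -
      have d: "d = code \<tau> (tapes M)" "int p - int T - 1 = pos \<tau> j"
        using that A[of \<tau> "tapes M" 0 d 4] A[of \<tau> j p 0 1] write_cell Bt Bj Bd Bp B0 by (simp_all add: holds_def)
      then have "code_write M d j = cells (\<tau> + 1) j (int p - int T - 1)"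
        using code_write_shift(1)[of j M d] step(2)[of j \<tau>] write_cell by (simp add: coded_delta)
      then show ?thesis using A[of "\<tau> + 1" j p "code_write M d j" 2] write_cell(4-) Bt(2)[of \<tau>] Bj(1)[of j] Bp(1)[of p] Bc(2)[of d j]
        by (simp add: holds_def)
    qed
    then show ?thesis unfolding write_cell(1-3) lit_true_simps by blast
  next
    case (move_head \<tau> d j p)
    have p: "p < P" using move_head by simp
    have "\<alpha> (var_code B 1 (\<tau> + 1) j (p + code_shift M d j - 1) 0)"
      if "\<alpha> (var_code B 4 \<tau> (tapes M) 0 d)" "\<alpha> (var_code B 1 \<tau> j p 0)"
    proof -
      have d: "d = code \<tau> (tapes M)" "int p - int T - 1 = pos \<tau> j"
        using that A[of \<tau> "tapes M" 0 d 4] A[of \<tau> j p 0 1] move_head Bt Bj Bd Bp[OF p] B0 by (simp_all add: holds_def)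
      then have "int (p + code_shift M d j - 1) = pos (\<tau> + 1) j + int T + 1"
        using code_write_shift(2)[of j M d] step(3)[of j \<tau>] move_head by (simp add: coded_delta)
      then show ?thesis using A[of "\<tau> + 1" j "p + code_shift M d j - 1" 0 1] move_head(4-) Bt(2)[of \<tau>] Bj(1)[of j] Bc(4)[of d j p] B0
        by (simp add: holds_def)
    qed
    then show ?thesis unfolding move_head(1-3) lit_true_simps by blast
  next
    case (keep_cell \<tau> j p p' s)
    have "\<alpha> (var_code B 2 (\<tau> + 1) j p' s)"
      if "\<alpha> (var_code B 1 \<tau> j p 0)" "\<alpha> (var_code B 2 \<tau> j p' s)"
    proof -
      have "int p - int T - 1 = pos \<tau> j" "s = cells \<tau> j (int p' - int T - 1)"
        using that A[of \<tau> j p 0 1] A[of \<tau> j p' s 2] keep_cell Bt Bj Bp Bs B0 by (simp_all add: holds_def)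
      then have "s = cells (\<tau> + 1) j (int p' - int T - 1)"
        using step(2)[of j \<tau>] keep_cell by auto
      then show ?thesis using A[of "\<tau> + 1" j p' s 2] keep_cell Bt Bj Bp Bs by (simp add: holds_def)
    qed
    then show ?thesis unfolding keep_cell(1-3) lit_true_simps by blast
  next
    case (guess_cell p)
    define i where "i = p - (T + 1)"
    have i: "int p - int T - 1 = int i" "2 * length x < i" using guess_cell by (auto simp: i_def)
    have "cells 0 0 (int p - int T - 1) \<in> {0, 1, 2}"
      unfolding init_cells(1) i(1) pair_words_cell using i(2) by (auto simp: bit_sym_def)
    then have "\<alpha> (var_code B 2 0 0 p 1) \<or> \<alpha> (var_code B 2 0 0 p 2) \<or> \<alpha> (var_code B 2 0 0 p 0)"
      using A[of 0 0 p 1 2] A[of 0 0 p 2 2] A[of 0 0 p 0 2] guess_cell B0 Bp by (auto simp: holds_def)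
    then show ?thesis unfolding guess_cell(1-3) lit_true_simps .
  next
    case (blank_cell p)
    define i where "i = p - (T + 1)"
    have i: "int p - int T - 1 = int i" "int (p + 1) - int T - 1 = int (i + 1)" "2 * length x < i"
      using blank_cell by (auto simp: i_def)
    have "cells 0 0 (int (p + 1) - int T - 1) = 0" if "cells 0 0 (int p - int T - 1) = 0"
      using that i(3) unfolding init_cells(1) i(1,2) pair_words_cell by (auto simp: bit_sym_def split: if_splits)
    then have "\<alpha> (var_code B 2 0 0 p 0) ==> \<alpha> (var_code B 2 0 0 (p + 1) 0)"
      using A[of 0 0 p 0 2] A[of 0 0 "p + 1" 0 2] blank_cell B0 Bp by (simp add: holds_def)
    then show ?thesis unfolding blank_cell(1-3) lit_true_simps by blast
  next
    case start_state
    show ?thesis unfolding start_state lit_true_simps using A[of 0 0 0 0 0] init[of 0] k B0 by (simp add: holds_def)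
  next
    case (start_head j)
    show ?thesis unfolding start_head(1-3) lit_true_simps
      using A[of 0 j "T + 1" 0 1] init[OF start_head(4)] start_head Bj Bt B0 by (simp add: holds_def)
  next
    case (start_blank j p)
    show ?thesis unfolding start_blank(1-3) lit_true_simps
      using A[of 0 j p 0 2] init_cells(2)[OF start_blank(4,5)] start_blank Bj Bp B0 by (simp add: holds_def)
  next
    case (start_input p)
    have "cells 0 0 (int p - int T - 1) = init_sym x T p"
    proof (cases "T + 1 \<le> p")
      case True
      define i where "i = p - (T + 1)"
      have eq: "int p - int T - 1 = int i" using True by (simp add: i_def)
      have "i < 2 * length x \<or> i = 2 * length x \<or> 2 * length x + 1 + length y \<le> i"
        using True start_input(5) y by (auto simp: i_def)
      moreover have "i < 2 * length x ==> bit_at x (i div 2) = x ! (i div 2)" by (auto simp: bit_at_def)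
      moreover have "\<not> p < T + 1" using True by simp
      ultimately show ?thesis unfolding init_cells(1) eq pair_words_cell init_sym_def i_def[symmetric]
        by (elim disjE) simp_all
    next
      case False
      then show ?thesis unfolding init_cells(1) by (simp add: init_sym_def tape_of_def)
    qed
    then show ?thesis unfolding start_input(1-3) lit_true_simps
      using A[of 0 0 p "init_sym x T p" 2] start_input B0 Bp Bi by (simp add: holds_def)
  next
    case no_reject
    have "cells T (tapes M - 1) 0 = 2" using output_cell[OF acc] by (simp add: bit_sym_def)
    then have "\<not> \<alpha> (var_code B 2 T (tapes M - 1) (T + 1) 1)"
      using A[of T "tapes M - 1" "T + 1" 1 2] Bt Bj B0 by (simp add: holds_def)
    then show ?thesis unfolding no_reject(1-3) lit_true_simps by blast
  qed
  then show ?thesis unfolding clause_sat_def by blast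
qed

subsection \<open>NP-hardness\<close>

text \<open>Every triple of literals is a candidate clause. Where \<open>H\<close> fails, the
  complementary literals 0 and 1 give a tautology, so the number of clauses is fixed and no list of
  clauses has to be computed.\<close>

definition clause_lit :: "nat => (nat => nat => nat => bool) => nat => nat => nat" where
  "clause_lit L H i r = (if H (i mod L) (i div L mod L) (i div L div L mod L)
     then if r = 0 then i mod L else if r = 1 then i div L mod L else i div L div L mod L
     else if r = 0 then 0 else 1)"

lemma clause_lit_less: "L \<ge> 2 ==> clause_lit L H i r < L"
  by (auto simp: clause_lit_def)

lemma sat3_clause_lit:
  assumes L: "L \<ge> 2" and H: "\<And>a b c. H a b c ==> a < L \<and> b < L \<and> c < L"
  shows "sat3 (L ^ 3) (clause_lit L H) \<longleftrightarrow> (\<exists>\<alpha>. clause_sat \<alpha> H)"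
proof
  assume "sat3 (L ^ 3) (clause_lit L H)"
  then obtain \<alpha> where \<alpha>: "\<And>i. i < L ^ 3 ==> \<exists>r<3. lit_true \<alpha> (clause_lit L H i r)" unfolding sat3_def by blast
  have "lit_true \<alpha> a \<or> lit_true \<alpha> b \<or> lit_true \<alpha> c" if "H a b c" for a b c
  proof -
    have l: "a < L" "b < L" "c < L" using H[OF that] by auto
    define i where "i = (c * L + b) * L + a"
    have d: "i mod L = a" "i div L mod L = b" "i div L div L mod L = c" using l by (simp_all add: i_def)
    have "c * L + b < L * L" using l mult_le_mono1[of "c + 1" L L] by simp
    then have "i < L * L * L" unfolding i_def using l mult_le_mono1[of "c * L + b + 1" "L * L" L] by simp
    then have "i < L ^ 3" by (simp add: power3_eq_cube)
    then obtain r where r: "r < 3" "lit_true \<alpha> (clause_lit L H i r)" using \<alpha> by blast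
    then show ?thesis unfolding clause_lit_def d using that by (auto split: if_splits)
  qed
  then show "\<exists>\<alpha>. clause_sat \<alpha> H" unfolding clause_sat_def by blast
next
  assume "\<exists>\<alpha>. clause_sat \<alpha> H"
  then obtain \<alpha> where \<alpha>: "clause_sat \<alpha> H" by blast
  have triv: "lit_true \<alpha> 0 \<or> lit_true \<alpha> 1" by (simp add: lit_true_def)
  have "\<exists>r<3. lit_true \<alpha> (clause_lit L H i r)" for i
  proof (cases "H (i mod L) (i div L mod L) (i div L div L mod L)")
    case True
    then have "lit_true \<alpha> (clause_lit L H i 0) \<or> lit_true \<alpha> (clause_lit L H i 1) \<or> lit_true \<alpha> (clause_lit L H i 2)"
      using clause_satD[OF \<alpha> True] by (simp add: clause_lit_def)
    moreover have "(0::nat) < 3" "(1::nat) < 3" "(2::nat) < 3" by simp_all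
    ultimately show ?thesis by blast
  next
    case False
    then have "lit_true \<alpha> (clause_lit L H i 0) \<or> lit_true \<alpha> (clause_lit L H i 1)"
      using triv by (simp add: clause_lit_def)
    moreover have "(0::nat) < 3" "(1::nat) < 3" by simp_all
    ultimately show ?thesis by blast
  qed
  then show "sat3 (L ^ 3) (clause_lit L H)" unfolding sat3_def by blast
qed

lemma def_table' [def_intros]: "definable b f ==> definable b (\<lambda>R \<sigma>. table c g (f R \<sigma>))"
  unfolding table_def by (rule def_table)

lemma def_horn:
  assumes "definable 1 (\<lambda>R \<sigma>. Y R)" "definable 1 (\<lambda>R \<sigma>. T R)" "definable 1 (\<lambda>R \<sigma>. P R)" "definable 1 (\<lambda>R \<sigma>. B R)"
  shows "definableP 1 (\<lambda>R \<sigma>. horn M (Y R) (T R) (P R) (B R) (R 0) (\<sigma> 0) (\<sigma> 1) (\<sigma> 2))"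
  unfolding horn_iff horn_formula_def var_code_def init_sym_def code_q_def code_write_def code_shift_def
  by (intro def_intros assms zero_less_one)

theorem hom_cycle_NP_hard:
  assumes k: "k \<ge> 2"
  shows "NP_hard_on enc_graph (radius_graphs (k + 1)) (hom_exists (cycle_graph (2 * k + 1)))"
  unfolding NP_hard_on_def
proof
  fix L assume "L \<in> class_NP"
  then obtain R c where R: "R \<in> class_P"
    and L: "\<And>x. x \<in> L \<longleftrightarrow> (\<exists>y. length y \<le> length x ^ c + c \<and> pair_words x y \<in> R)"
    unfolding class_NP_def by auto
  obtain M d where wf: "wf_tm M" and M: "\<And>z. computes_within M z [z \<in> R] (length z ^ d + d)"
    using R unfolding class_P_def poly_time_computable_def by auto
  define Y where "Y x = length x ^ c + c" for x :: "bool list"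
  \<comment> \<open>The running time on the longest pair of input and certificate.\<close>
  define T where "T x = (2 * length x + 1 + Y x) ^ d + d" for x
  define P where "P x = 2 * T x + 2 * length x + Y x + 5" for x
  define B where "B x = P x + code_bound M" for x
  define V where "V x = 5 * B x ^ 4" for x
  define H where "H x = horn M (Y x) (T x) (P x) (B x) x" for x
  define lit where "lit x = clause_lit (2 * V x) (H x)" for x
  define m where "m x = (2 * V x) ^ 3" for x
  define G where "G x = cnf_graph k (V x) (m x) (lit x)" for x
  have V: "2 * V x \<ge> 2" for x by (simp add: V_def B_def P_def)
  have lit_less: "\<forall>j<m x. \<forall>i<3. lit x j i < 2 * V x" for x
    using clause_lit_less[OF V] by (simp add: lit_def)
  have len: "length (pair_words x y) = 2 * length x + 1 + length y" for x y
    by (induction x) (auto simp: pair_words_def)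
  have "x \<in> L \<longleftrightarrow> (\<exists>\<alpha>. clause_sat \<alpha> (H x))" for x
  proof
    assume "x \<in> L"
    then obtain y where y: "length y \<le> Y x" "pair_words x y \<in> R" using L unfolding Y_def by blast
    have "length (pair_words x y) ^ d + d \<le> T x"
      unfolding T_def len using y(1) by (intro add_mono power_mono) auto
    then show "\<exists>\<alpha>. clause_sat \<alpha> (H x)"
      using accept_imp_horn_sat[OF wf y(1), of x _ "T x" "P x" "B x"] M[of "pair_words x y"] y(2)
      unfolding H_def by (simp add: P_def B_def)
  next
    assume "\<exists>\<alpha>. clause_sat \<alpha> (H x)"
    then obtain \<alpha> where "clause_sat \<alpha> (horn M (Y x) (T x) (P x) (B x) x)" unfolding H_def by blast
    from horn_sat_imp_accept[OF wf this P_def] obtain y where y: "length y \<le> Y x"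
      "\<forall>b t. computes_within M (pair_words x y) [b] t \<and> t \<le> T x \<longrightarrow> b" by blast
    have "length (pair_words x y) ^ d + d \<le> T x"
      unfolding T_def len using y(1) by (intro add_mono power_mono) auto
    then have "pair_words x y \<in> R" using y(2) M[of "pair_words x y"] by blast
    then show "x \<in> L" using L y(1) unfolding Y_def by blast
  qed
  moreover have "sat3 (m x) (lit x) \<longleftrightarrow> (\<exists>\<alpha>. clause_sat \<alpha> (H x))" for x
    unfolding m_def lit_def
    by (rule sat3_clause_lit[OF V]) (use horn_less[OF _ P_def B_def wf] in \<open>auto simp: H_def V_def\<close>)
  moreover have "hom_exists (cycle_graph (2 * k + 1)) (G x) \<longleftrightarrow> sat3 (m x) (lit x)" for x
    unfolding G_def by (rule cnf_graph_hom_iff[OF k lit_less])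
  moreover have "G x \<in> radius_graphs (k + 1)" for x
    unfolding G_def by (rule cnf_graph_radius[OF k lit_less])
  moreover have "poly_time_computable (\<lambda>x. enc_graph (G x))"
  proof -
    have dY: "definable 1 (\<lambda>R \<sigma>. Y (R 0))" unfolding Y_def by (intro def_intros zero_less_one)
    have dT: "definable 1 (\<lambda>R \<sigma>. T (R 0))" unfolding T_def by (intro def_intros zero_less_one dY)
    have dP: "definable 1 (\<lambda>R \<sigma>. P (R 0))" unfolding P_def by (intro def_intros zero_less_one dY dT)
    have dB: "definable 1 (\<lambda>R \<sigma>. B (R 0))" unfolding B_def by (intro def_intros dP)
    have dV: "definable 1 (\<lambda>R \<sigma>. V (R 0))" unfolding V_def by (intro def_intros dB)
    have dm: "definable 1 (\<lambda>R \<sigma>. m (R 0))" unfolding m_def by (intro def_intros dV)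
    have dH: "definableP 1 (\<lambda>R \<sigma>. H (R 0) (\<sigma> 0) (\<sigma> 1) (\<sigma> 2))"
      unfolding H_def by (rule def_horn[OF dY dT dP dB])
    note dH' = def_comp3[of 1 "\<lambda>R a b c. of_bool (H (R 0) a b c)", OF dH]
    have dlit: "definable 1 (\<lambda>R \<sigma>. lit (R 0) (\<sigma> 0) (\<sigma> 1))"
      unfolding lit_def clause_lit_def by (intro def_intros dH' dV)
    have dN: "definable 1 (\<lambda>R \<sigma>. cnf_verts k (V (R 0)) (m (R 0)))" by (rule def_cnf_verts[OF dV dm])
    have "definable 1 (\<lambda>R \<sigma>. cnf_verts k (V (R 0)) (m (R 0)) + 1 + cnf_verts k (V (R 0)) (m (R 0)) * cnf_verts k (V (R 0)) (m (R 0)))"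
      by (intro def_intros dN)
    from definable_poly_time[OF this def_cnf_bit[OF dV dm dlit, of k]] show ?thesis
      by (simp add: G_def enc_cnf_graph)
  qed
  ultimately show "\<exists>f. poly_time_computable f \<and> (\<forall>x. \<exists>I\<in>radius_graphs (k + 1). f x = enc_graph I \<and>
      (x \<in> L) = hom_exists (cycle_graph (2 * k + 1)) I)"
    by (intro exI[of _ "\<lambda>x. enc_graph (G x)"]) blast
qed

section \<open>Sparsification\<close>

text \<open>
  Formulas are families of sets of literals. If many members of size \<open>s\<close> contain the heart \<open>H\<close>, then
  an assignment satisfies either the heart or all petals \<open>C - H\<close>, and adding the heart or the petals
  subsumes all these members.
\<close>

definition petals :: "nat set set => nat set => nat => nat set set" where
  "petals F H s = {C - H | C. C \<in> F \<and> H \<subseteq> C \<and> card C = s}"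

definition refine :: "nat set set => nat set set => nat set set" where
  "refine F N = N \<union> {C \<in> F. \<not> (\<exists>D\<in>N. D \<subseteq> C)}"

definition hits :: "nat set => nat set set => bool" where
  "hits A F \<longleftrightarrow> (\<forall>C\<in>F. C \<inter> A \<noteq> {})"

lemma hits_branch: "hits A F \<longleftrightarrow> hits A (refine F {H}) \<or> hits A (refine F (petals F H s))"
proof
  assume A: "hits A F"
  show "hits A (refine F {H}) \<or> hits A (refine F (petals F H s))"
  proof (cases "H \<inter> A = {}")
    case True
    have "C \<inter> A \<noteq> {}" if C: "C \<in> refine F (petals F H s)" for C
    proof (cases "C \<in> F")
      case False
      then obtain D where "D \<in> F" "C = D - H" using C by (auto simp: refine_def petals_def)
      moreover have "D \<inter> A \<noteq> {}" using A \<open>D \<in> F\<close> by (simp add: hits_def)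
      ultimately show ?thesis using True by blast
    qed (use A in \<open>simp add: hits_def\<close>)
    then show ?thesis by (simp add: hits_def)
  next
    case False
    then show ?thesis using A by (auto simp: hits_def refine_def)
  qed
next
  have "hits A (refine F N) ==> hits A F" for N
    unfolding hits_def refine_def by blast
  then show "hits A (refine F {H}) \<or> hits A (refine F (petals F H s)) ==> hits A F" by blast
qed

definition members :: "nat set set => nat set => nat => nat set set" where
  "members F H s = {C \<in> F. H \<subseteq> C \<and> card C = s}"

definition family :: "nat => nat set set => bool" where
  "family U F \<longleftrightarrow> (\<forall>C\<in>F. C \<subseteq> {..<U} \<and> 1 \<le> card C \<and> card C \<le> 3)"

definition sparse_inv :: "nat => nat => nat set set => bool" where
  "sparse_inv U t F \<longleftrightarrow> family U F \<and> (\<forall>C\<in>F. \<forall>D\<in>F. C \<subseteq> D \<longrightarrow> C = D) \<and> (\<forall>l. card (members F {l} 2) \<le> 2 * t)"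

text \<open>A unit weighs 4t and subsumes at most 2t pairs, so each added unit yields at least 2t;
  each added pair yields 1. Triples weigh nothing, so their loss is harmless. The bound 6tU on the
  potential limits how long a branch of the search can be.\<close>

definition potential :: "nat => nat set set => nat" where
  "potential t F = 4 * t * card (members F {} 1) + card (members F {} 2)"

lemma finite_family: "family U F ==> finite F"
  by (rule finite_subset[of _ "Pow {..<U}"]) (auto simp: family_def)

lemma finite_members: "family U F ==> finite (members F H s)"
  using finite_family[of U F] by (simp add: members_def)

lemma card_pairs_le:
  assumes "family U F" "\<And>l. card (members F {l} s) \<le> d" "s \<ge> 1"
  shows "card (members F {} s) \<le> U * d"
proof -
  have "members F {} s \<subseteq> (\<Union>l<U. members F {l} s)"
  proof
    fix C assume C: "C \<in> members F {} s"
    then have "C \<noteq> {}" "C \<subseteq> {..<U}" using assms(1,3) by (auto simp: members_def family_def)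
    then show "C \<in> (\<Union>l<U. members F {l} s)" using C by (auto simp: members_def)
  qed
  then have "card (members F {} s) \<le> card (\<Union>l<U. members F {l} s)"
    using assms(1) by (intro card_mono) (auto intro: finite_members)
  also have "\<dots> \<le> (\<Sum>l<U. card (members F {l} s))" by (rule card_UN_le) simp
  also have "\<dots> \<le> (\<Sum>l<U. d)" by (rule sum_mono) (rule assms(2))
  finally show ?thesis by simp
qed

lemma card_units_le:
  assumes "family U F" shows "card (members F {} 1) \<le> U"
proof -
  have "members F {} 1 \<subseteq> (\<lambda>l. {l}) ` {..<U}"
    using assms by (auto simp: members_def family_def card_1_singleton_iff)
  then have "card (members F {} 1) \<le> card ((\<lambda>l. {l}) ` {..<U})" by (intro card_mono) auto
  also have "\<dots> \<le> U" using card_image_le[of "{..<U}" "\<lambda>l. {l}"] by simp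
  finally show ?thesis .
qed

lemma potential_le:
  assumes "sparse_inv U t F" shows "potential t F \<le> 6 * t * U"
proof -
  have F: "family U F" using assms by (simp add: sparse_inv_def)
  have "card (members F {} 2) \<le> U * (2 * t)"
    by (rule card_pairs_le[OF F]) (use assms in \<open>auto simp: sparse_inv_def\<close>)
  moreover have "4 * t * card (members F {} 1) \<le> 4 * t * U" by (rule mult_le_mono2[OF card_units_le[OF F]])
  ultimately have "potential t F \<le> 4 * t * U + U * (2 * t)" unfolding potential_def by linarith
  then show ?thesis by (simp add: algebra_simps)
qed

text \<open>The new sets are proper subsets of old ones and all have the same size.\<close>

definition extension :: "nat set set => nat set set => nat => bool" where
  "extension F N s \<longleftrightarrow> (\<forall>D\<in>N. card D = s \<and> (\<exists>C\<in>F. D \<subset> C))"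

lemma refine_family:
  assumes "family U F" "extension F N s" "s \<ge> 1"
  shows "family U (refine F N)"
  unfolding family_def
proof
  fix C assume C: "C \<in> refine F N"
  show "C \<subseteq> {..<U} \<and> 1 \<le> card C \<and> card C \<le> 3"
  proof (cases "C \<in> N")
    case True
    then obtain E where E: "E \<in> F" "C \<subset> E" "card C = s" using assms(2) by (auto simp: extension_def)
    then have "E \<subseteq> {..<U}" "card E \<le> 3" using assms(1) by (auto simp: family_def)
    moreover from this have "finite E" using finite_subset by blast
    then have "card C \<le> card E" using E by (intro card_mono) auto
    ultimately show ?thesis using E assms(3) by auto
  next
    case False
    then show ?thesis using C assms(1) by (auto simp: refine_def family_def)
  qed
qed

text \<open>New sets have equal size, so none lies strictly inside another. An old set inside a new
  one would also lie strictly inside an old superset of the latter.\<close>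

lemma refine_antichain:
  assumes F: "family U F" "\<forall>C\<in>F. \<forall>D\<in>F. C \<subseteq> D \<longrightarrow> C = D" and N: "extension F N s" and s: "s \<ge> 1"
  shows "\<forall>C\<in>refine F N. \<forall>D\<in>refine F N. C \<subseteq> D \<longrightarrow> C = D"
proof (intro ballI impI)
  fix C D assume C: "C \<in> refine F N" and D: "D \<in> refine F N" and sub: "C \<subseteq> D"
  have "family U (refine F N)" using refine_family[OF F(1) N s] .
  then have fin: "finite D" using D by (auto simp: family_def intro: finite_subset)
  show "C = D"
  proof (cases "D \<in> N")
    case True
    then obtain E where E: "E \<in> F" "D \<subset> E" "card D = s" using N by (auto simp: extension_def)
    show ?thesis
    proof (cases "C \<in> N")
      case True
      then have "card C = card D" using N E by (simp add: extension_def)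
      then show ?thesis using sub fin by (metis card_subset_eq)
    next
      case False
      then have "C \<in> F" using C by (simp add: refine_def)
      moreover have "C \<subseteq> E" using sub E(2) by simp
      ultimately have "C = E" using F(2)[rule_format, of C E] E(1) by simp
      then show ?thesis using sub E(2) by simp
    qed
  next
    case False
    then have "D \<in> F" "\<not> (\<exists>E\<in>N. E \<subseteq> D)" using D by (simp_all add: refine_def)
    moreover from this have "C \<in> F" using C sub by (auto simp: refine_def)
    ultimately show ?thesis using F(2)[rule_format, of C D] sub by simp
  qed
qed

lemma extension_new:
  assumes "\<forall>C\<in>F. \<forall>D\<in>F. C \<subseteq> D \<longrightarrow> C = D" "extension F N s"
  shows "N \<inter> F = {}"
proof -
  have "D \<notin> F" if D: "D \<in> N" for D
  proof
    assume "D \<in> F"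
    obtain C where "C \<in> F" "D \<subset> C" using assms(2) D unfolding extension_def by auto
    then show False using assms(1)[rule_format, of D C] \<open>D \<in> F\<close> by (auto simp: psubset_eq)
  qed
  then show ?thesis by blast
qed

lemma refine_units:
  assumes inv: "sparse_inv U t F" and N: "extension F N 1" and fin: "finite N"
  shows "sparse_inv U t (refine F N) \<and> potential t F + 2 * t * card N \<le> potential t (refine F N)"
proof -
  have F: "family U F" and anti: "\<forall>C\<in>F. \<forall>D\<in>F. C \<subseteq> D \<longrightarrow> C = D"
    and deg: "\<And>l. card (members F {l} 2) \<le> 2 * t" using inv by (auto simp: sparse_inv_def)
  let ?G = "refine F N"
  have G: "family U ?G" by (rule refine_family[OF F N]) simp
  have new: "N \<inter> F = {}" by (rule extension_new[OF anti N])
  have N1: "\<And>D. D \<in> N ==> \<exists>l. D = {l}" using N by (auto simp: extension_def card_1_singleton_iff)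
  have sub: "members ?G {l} 2 \<subseteq> members F {l} 2" for l
    using N by (auto simp: members_def refine_def extension_def)
  have deg': "card (members ?G {l} 2) \<le> 2 * t" for l
    by (rule order_trans[OF card_mono[OF finite_members[OF F] sub] deg])
  have units: "members ?G {} 1 = members F {} 1 \<union> N"
  proof -
    have "C \<in> members ?G {} 1" if C: "C \<in> members F {} 1" for C
    proof -
      obtain l where l: "C = {l}" "C \<in> F" using C by (auto simp: members_def card_1_singleton_iff)
      have "\<not> D \<subseteq> C" if D: "D \<in> N" for D
      proof
        assume "D \<subseteq> C"
        then have "D = C" using N1[OF D] l(1) by auto
        then show False using new D l(2) by blast
      qed
      then show ?thesis using C by (auto simp: members_def refine_def)
    qed
    moreover have "card D = 1" if "D \<in> N" for D using N that by (simp add: extension_def)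
    ultimately show ?thesis by (auto simp: members_def refine_def)
  qed
  have "card (members ?G {} 1) = card (members F {} 1) + card N"
  proof -
    have "members F {} 1 \<inter> N = {}" using new by (auto simp: members_def)
    then show ?thesis using card_Un_disjoint[OF finite_members[OF F] fin] by (simp only: units)
  qed
  moreover have "card (members F {} 2) \<le> card (members ?G {} 2) + 2 * t * card N"
  proof -
    \<comment> \<open>A pair that disappears contains one of the new units, and each unit lies in at
      most 2t pairs.\<close>
    have "members F {} 2 \<subseteq> members ?G {} 2 \<union> (\<Union>D\<in>N. members F D 2)"
      by (auto simp: members_def refine_def)
    then have "card (members F {} 2) \<le> card (members ?G {} 2 \<union> (\<Union>D\<in>N. members F D 2))"
      using finite_members[OF F] finite_members[OF G] fin by (intro card_mono) auto
    also have "\<dots> \<le> card (members ?G {} 2) + card (\<Union>D\<in>N. members F D 2)" by (rule card_Un_le)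
    also have "card (\<Union>D\<in>N. members F D 2) \<le> (\<Sum>D\<in>N. card (members F D 2))" by (rule card_UN_le[OF fin])
    also have "\<dots> \<le> (\<Sum>D\<in>N. 2 * t)" 
    proof (rule sum_mono)
      fix D assume "D \<in> N"
      then obtain l where "D = {l}" using N1 by blast
      then show "card (members F D 2) \<le> 2 * t" using deg[of l] by simp
    qed
    finally show ?thesis by (simp add: mult.commute)
  qed
  ultimately have "potential t F + 2 * t * card N \<le> potential t ?G"
    unfolding potential_def by (simp add: algebra_simps)
  then show ?thesis using G deg' refine_antichain[OF F anti N] by (simp add: sparse_inv_def)
qed

text \<open>New pairs subsume triples only: an old set of size at most two above a new pair would
  equal it, but new sets are not in the family.\<close>

lemma refine_pairs:
  assumes inv: "sparse_inv U t F" and N: "extension F N 2" and fin: "finite N"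
    and deg: "\<And>l. card (members F {l} 2) + card {D \<in> N. l \<in> D} \<le> 2 * t"
  shows "sparse_inv U t (refine F N) \<and> potential t F + card N \<le> potential t (refine F N)"
proof -
  have F: "family U F" and anti: "\<forall>C\<in>F. \<forall>D\<in>F. C \<subseteq> D \<longrightarrow> C = D" using inv by (auto simp: sparse_inv_def)
  let ?G = "refine F N"
  have G: "family U ?G" by (rule refine_family[OF F N]) simp
  have new: "N \<inter> F = {}" by (rule extension_new[OF anti N])
  have small: "\<not> (\<exists>D\<in>N. D \<subseteq> C)" if "C \<in> F" "card C \<le> 2" for C
  proof
    assume "\<exists>D\<in>N. D \<subseteq> C"
    then obtain D where D: "D \<in> N" "D \<subseteq> C" by blast
    have "finite C" using that F by (auto simp: family_def intro: finite_subset)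
    moreover have "card D = 2" using D N by (simp add: extension_def)
    ultimately have "D = C" using that D card_mono[of C D] card_subset_eq[of C D] by auto
    then show False using D that new by blast
  qed
  have pairs: "members ?G H 2 = members F H 2 \<union> {D \<in> N. H \<subseteq> D}" for H
  proof -
    have "C \<in> members ?G H 2" if "C \<in> members F H 2" for C
      using that small[of C] by (simp add: members_def refine_def)
    moreover have "card D = 2" if "D \<in> N" for D using N that by (simp add: extension_def)
    ultimately show ?thesis by (auto simp: members_def refine_def)
  qed
  have units: "members ?G {} 1 = members F {} 1"
  proof -
    have "C \<in> members ?G {} 1" if "C \<in> members F {} 1" for C
      using that small[of C] by (simp add: members_def refine_def)
    moreover have "card D \<noteq> 1" if "D \<in> N" for D using N that by (simp add: extension_def)
    ultimately show ?thesis by (auto simp: members_def refine_def)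
  qed
  have "card (members ?G {l} 2) \<le> 2 * t" for l
    using deg[of l] card_Un_le[of "members F {l} 2" "{D \<in> N. l \<in> D}"] by (simp add: pairs)
  moreover have "card (members ?G {} 2) = card (members F {} 2) + card N"
  proof -
    have "members F {} 2 \<inter> N = {}" using new by (auto simp: members_def)
    then show ?thesis using card_Un_disjoint[OF finite_members[OF F] fin] by (simp add: pairs)
  qed
  ultimately show ?thesis
    using G refine_antichain[OF F anti N] unfolding sparse_inv_def potential_def units by simp
qed

text \<open>
  The three kinds of flowers, in the order in which they are eliminated: \<open>lo\<close> and \<open>lo'\<close> bound the
  number of members of a chosen flower from below, and \<open>t\<close> bounds the flowers that are not chosen
  any more.
\<close>

definition good_flower :: "nat => nat => nat => nat set set => nat set => nat => bool" where
  "good_flower t lo lo' F H s \<longleftrightarrow>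
     card H = 1 \<and> s = 2 \<and> lo \<le> card (members F H s) \<or>
     card H = 2 \<and> s = 3 \<and> lo \<le> card (members F H s) \<and> (\<forall>l. card (members F {l} 2) < t) \<or>
     card H = 1 \<and> s = 3 \<and> lo' \<le> card (members F H s) \<and> (\<forall>l. card (members F {l} 2) < t) \<and>
       (\<forall>H. card H = 2 \<longrightarrow> card (members F H 3) < t)"

lemma card_petals: "finite H ==> card (petals F H s) = card (members F H s)"
proof -
  have "petals F H s = (\<lambda>C. C - H) ` members F H s" by (auto simp: petals_def members_def)
  moreover have "inj_on (\<lambda>C. C - H) (members F H s)" by (auto simp: inj_on_def members_def)
  ultimately show ?thesis by (simp add: card_image)
qed

lemma extension_petals:
  assumes "family U F" "finite H" "H \<noteq> {}" "card H < s"
  shows "extension F (petals F H s) (s - card H)" "finite (petals F H s)"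
proof -
  have "card (C - H) = s - card H" if "C \<in> F" "H \<subseteq> C" "card C = s" for C
    using that assms by (simp add: card_Diff_subset)
  then show "extension F (petals F H s) (s - card H)"
    using assms unfolding extension_def petals_def by blast
  have "petals F H s = (\<lambda>C. C - H) ` members F H s" by (auto simp: petals_def members_def)
  then show "finite (petals F H s)" using finite_members[OF assms(1)] by simp
qed

lemma extension_heart:
  assumes "members F H s \<noteq> {}" "card H < s"
  shows "extension F {H} (card H)"
  using assms by (auto simp: extension_def members_def)

text \<open>If the petals are units, each of the at least lo of them gains 2t. If they are pairs,
  each of the at least lo' of them gains 1, and the absence of the earlier kinds of flowers keeps
  the pair degrees within 2t. The heart is one new set and gains at least 1.\<close>

lemma flower_step:
  assumes inv: "sparse_inv U t F" and fl: "good_flower t lo lo' F H s" and pos: "1 \<le> t" "1 \<le> lo" "1 \<le> lo'"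
  shows "sparse_inv U t (refine F {H}) \<and> potential t F + 1 \<le> potential t (refine F {H})"
    "sparse_inv U t (refine F (petals F H s)) \<and>
      potential t F + min (2 * t * lo) lo' \<le> potential t (refine F (petals F H s))"
proof -
  have F: "family U F" using inv by (simp add: sparse_inv_def)
  have H: "card H = 1 \<or> card H = 2" "card H < s" using fl by (auto simp: good_flower_def)
  then have finH: "finite H" "H \<noteq> {}" by (auto intro: card_ge_0_finite)
  have "card (members F H s) \<noteq> 0" using fl pos by (auto simp: good_flower_def)
  then have ne: "members F H s \<noteq> {}" by auto
  note heart = extension_heart[OF ne H(2)]
  note pet = extension_petals[OF F finH H(2)]
  note cp = card_petals[OF finH(1), of F s]
  consider (1) "card H = 1" "s = 2" "lo \<le> card (members F H s)"
    | (2) "card H = 2" "s = 3" "lo \<le> card (members F H s)" "\<forall>l. card (members F {l} 2) < t"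
    | (3) "card H = 1" "s = 3" "lo' \<le> card (members F H s)" "\<forall>l. card (members F {l} 2) < t"
      "\<forall>H. card H = 2 \<longrightarrow> card (members F H 3) < t"
    using fl unfolding good_flower_def by blast
  then have "(sparse_inv U t (refine F {H}) \<and> potential t F + 1 \<le> potential t (refine F {H})) \<and>
    (sparse_inv U t (refine F (petals F H s)) \<and>
      potential t F + min (2 * t * lo) lo' \<le> potential t (refine F (petals F H s)))"
  proof cases
    case 1
    have h: "sparse_inv U t (refine F {H}) \<and> potential t F + 2 * t * card {H} \<le> potential t (refine F {H})"
      by (rule refine_units[OF inv]) (use heart 1 in auto)
    have p: "sparse_inv U t (refine F (petals F H s)) \<and>
        potential t F + 2 * t * card (petals F H s) \<le> potential t (refine F (petals F H s))"
      by (rule refine_units[OF inv]) (use pet 1 in auto)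
    have "lo \<le> card (petals F H s)" using 1 cp by simp
    then have "min (2 * t * lo) lo' \<le> 2 * t * card (petals F H s)"
      by (intro order_trans[OF min.cobounded1] mult_le_mono2)
    then show ?thesis using h p pos by (auto intro: order_trans[OF add_left_mono])
  next
    case 2
    have h: "sparse_inv U t (refine F {H}) \<and> potential t F + card {H} \<le> potential t (refine F {H})"
    proof (rule refine_pairs[OF inv])
      show "extension F {H} 2" using heart 2 by simp
      fix l
      have "card {D \<in> {H}. l \<in> D} \<le> card {H}" by (rule card_mono) auto
      then show "card (members F {l} 2) + card {D \<in> {H}. l \<in> D} \<le> 2 * t"
        using 2(4) pos by (auto dest: spec[of _ l])
    qed simp
    have p: "sparse_inv U t (refine F (petals F H s)) \<and>
        potential t F + 2 * t * card (petals F H s) \<le> potential t (refine F (petals F H s))"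
      by (rule refine_units[OF inv]) (use pet 2 in auto)
    have "lo \<le> card (petals F H s)" using 2 cp by simp
    then have "min (2 * t * lo) lo' \<le> 2 * t * card (petals F H s)"
      by (intro order_trans[OF min.cobounded1] mult_le_mono2)
    then show ?thesis using h p by (auto intro: order_trans[OF add_left_mono])
  next
    case 3
    have h: "sparse_inv U t (refine F {H}) \<and> potential t F + 2 * t * card {H} \<le> potential t (refine F {H})"
      by (rule refine_units[OF inv]) (use heart 3 in auto)
    have p: "sparse_inv U t (refine F (petals F H s)) \<and>
        potential t F + card (petals F H s) \<le> potential t (refine F (petals F H s))"
    proof (rule refine_pairs[OF inv])
      show "extension F (petals F H s) 2" "finite (petals F H s)" using pet 3 by auto
      fix m
      obtain l where l: "H = {l}" using 3 by (auto simp: card_1_singleton_iff)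
      \<comment> \<open>For m different from l, a petal through m comes from a triple containing
        both m and l, and fewer than t triples do.\<close>
      have "card {D \<in> petals F H s. m \<in> D} \<le> t"
      proof (cases "m = l")
        case True
        then have "{D \<in> petals F H s. m \<in> D} = {}" using l by (auto simp: petals_def)
        then show ?thesis by (metis card.empty le0)
      next
        case False
        have "{D \<in> petals F H s. m \<in> D} \<subseteq> (\<lambda>C. C - H) ` members F {l, m} 3"
          using l 3 by (auto simp: petals_def members_def)
        then have "card {D \<in> petals F H s. m \<in> D} \<le> card ((\<lambda>C. C - H) ` members F {l, m} 3)"
          using finite_members[OF F] by (intro card_mono) auto
        also have "\<dots> \<le> card (members F {l, m} 3)" using finite_members[OF F] by (intro card_image_le)
        also have "\<dots> \<le> t" using 3(5) False by (metis card_2_iff less_imp_le)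
        finally show ?thesis .
      qed
      then show "card (members F {m} 2) + card {D \<in> petals F H s. m \<in> D} \<le> 2 * t"
        using 3(4)[rule_format, of m] by simp
    qed
    then show ?thesis using h 3 cp pos by auto
  qed
  then show "sparse_inv U t (refine F {H}) \<and> potential t F + 1 \<le> potential t (refine F {H})"
    "sparse_inv U t (refine F (petals F H s)) \<and>
      potential t F + min (2 * t * lo) lo' \<le> potential t (refine F (petals F H s))" by auto
qed

lemma card_sparse_family:
  assumes "family U F" "\<And>l. card (members F {l} 2) \<le> d" "\<And>l. card (members F {l} 3) \<le> d'"
  shows "card F \<le> U * (1 + d + d')"
proof -
  have "F \<subseteq> members F {} 1 \<union> members F {} 2 \<union> members F {} 3"
  proof
    fix C assume "C \<in> F"
    then have "card C = 1 \<or> card C = 2 \<or> card C = 3" using assms(1) by (force simp: family_def)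
    then show "C \<in> members F {} 1 \<union> members F {} 2 \<union> members F {} 3" using \<open>C \<in> F\<close> by (auto simp: members_def)
  qed
  then have "card F \<le> card (members F {} 1 \<union> members F {} 2 \<union> members F {} 3)"
    using finite_members[OF assms(1)] by (intro card_mono) auto
  also have "\<dots> \<le> card (members F {} 1) + card (members F {} 2) + card (members F {} 3)"
    by (meson add_right_mono card_Un_le order_trans)
  also have "\<dots> \<le> U + U * d + U * d'"
    using card_units_le[OF assms(1)] card_pairs_le[OF assms(1,2)] card_pairs_le[OF assms(1,3)]
    by (intro add_mono) auto
  finally show ?thesis by (simp add: algebra_simps)
qed

subsection \<open>Choosing a flower\<close>

text \<open>
  A family over \<open>{..<U}\<close> is given by the predicate \<open>m a b c \<longleftrightarrow> {a, b, c} \<in> F\<close>. Members are counted as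
  ordered triples, i.e. up to a factor between \<open>1\<close> and \<open>27\<close>.
\<close>

definition card3 :: "nat => nat => nat => nat" where
  "card3 a b c = (if a = b then if b = c then 1 else 2 else if a = c \<or> b = c then 2 else 3)"

lemma card3: "card {a, b, c} = card3 a b c"
  by (auto simp: card3_def card_insert_if)

definition subset3 :: "nat => nat => nat => nat => nat => bool" where
  "subset3 l l' a b c \<longleftrightarrow> (l = a \<or> l = b \<or> l = c) \<and> (l' = a \<or> l' = b \<or> l' = c)"

lemma subset3: "{l, l'} \<subseteq> {a, b, c} \<longleftrightarrow> subset3 l l' a b c"
  by (auto simp: subset3_def)

definition triple_count :: "nat => (nat => nat => nat => bool) => nat => nat => nat => nat" where
  "triple_count U m l l' s = (\<Sum>a<U. \<Sum>b<U. \<Sum>c<U. of_bool (m a b c \<and> subset3 l l' a b c \<and> card3 a b c = s))"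

text \<open>The base-\<open>U\<close> digits of f are the kind and the two elements of the heart,
  equal for a singleton. Counting overshoots by a factor of at most 27, so a positive test
  guarantees \<open>lo\<close> or \<open>lo'\<close> members, while a negative one still bounds
  their number by 27 times the threshold.\<close>

definition is_flower :: "nat => nat => nat => (nat => nat => nat => bool) => nat => bool" where
  "is_flower U lo lo' m f \<longleftrightarrow>
     f div U div U = 0 \<and> f div U mod U = f mod U \<and> 27 * lo \<le> triple_count U m (f div U mod U) (f mod U) 2 \<or>
     f div U div U = 1 \<and> f div U mod U \<noteq> f mod U \<and> 27 * lo \<le> triple_count U m (f div U mod U) (f mod U) 3 \<or>
     f div U div U = 2 \<and> f div U mod U = f mod U \<and> 27 * lo' \<le> triple_count U m (f div U mod U) (f mod U) 3"

definition has_flower :: "nat => nat => nat => (nat => nat => nat => bool) => bool" where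
  "has_flower U lo lo' m \<longleftrightarrow> (\<exists>f<3 * U * U. is_flower U lo lo' m f)"

text \<open>Minimisation as a definable sum. The kind is the leading digit, so with the smallest
  index the earlier kinds are absent, as \<open>good_flower\<close> demands.\<close>

definition first_flower :: "nat => nat => nat => (nat => nat => nat => bool) => nat" where
  "first_flower U lo lo' m = (\<Sum>f<3 * U * U. of_bool (\<forall>g<f + 1. \<not> is_flower U lo lo' m g))"

lemma sum_of_bool_first:
  assumes "f < n" "P f" "\<And>g. g < f ==> \<not> P g"
  shows "(\<Sum>i<n. of_bool (\<forall>g<i + 1. \<not> P g) :: nat) = f"
proof -
  have "{i. i < n \<and> (\<forall>g<i + 1. \<not> P g)} = {..<f}"
    using assms by (auto simp: less_Suc_eq_le) (meson linorder_not_less)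
  then show ?thesis by (simp add: of_bool_def sum.If_cases Int_def lessThan_def flip: sum.inter_filter)
qed

lemma triple_count_bounds:
  assumes F: "family U F" and m: "\<And>a b c. a < U ==> b < U ==> c < U ==> m a b c \<longleftrightarrow> {a, b, c} \<in> F"
    and s: "s \<ge> 1" "s \<le> 3"
  shows "card (members F {l, l'} s) \<le> triple_count U m l l' s" "triple_count U m l l' s \<le> 27 * card (members F {l, l'} s)"
proof -
  define T where "T = {(a, b, c). a < U \<and> b < U \<and> c < U \<and> {a, b, c} \<in> members F {l, l'} s}"
  have finT: "finite T" by (rule finite_subset[of _ "{..<U} \<times> {..<U} \<times> {..<U}"]) (auto simp: T_def)
  have "triple_count U m l l' s = (\<Sum>(a, b, c)\<in>{..<U} \<times> {..<U} \<times> {..<U}. of_bool ((a, b, c) \<in> T))"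
    unfolding triple_count_def sum.cartesian_product[symmetric]
  proof (intro sum.cong refl)
    fix a b c assume abc: "a \<in> {..<U}" "b \<in> {..<U}" "c \<in> {..<U}"
    then have "((a, b, c) \<in> T) = (m a b c \<and> subset3 l l' a b c \<and> card3 a b c = s)"
      using m[of a b c] by (simp only: T_def members_def mem_Collect_eq case_prod_conv subset3 card3 lessThan_iff simp_thms)
    then show "of_bool (m a b c \<and> subset3 l l' a b c \<and> card3 a b c = s) = (of_bool ((a, b, c) \<in> T) :: nat)"
      by simp
  qed
  also have "\<dots> = card T"
  proof -
    have "({..<U} \<times> {..<U} \<times> {..<U}) \<inter> {x. x \<in> T} = T" by (auto simp: T_def)
    then show ?thesis by (simp add: split_beta of_bool_def sum.If_cases)
  qed
  finally have count: "triple_count U m l l' s = card T" .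
  have img: "(\<lambda>(a, b, c). {a, b, c}) ` T = members F {l, l'} s"
  proof
    show "members F {l, l'} s \<subseteq> (\<lambda>(a, b, c). {a, b, c}) ` T"
    proof
      fix C assume C: "C \<in> members F {l, l'} s"
      have sub: "C \<subseteq> {..<U}" and "card C = 1 \<or> card C = 2 \<or> card C = 3"
        using C F s by (auto simp: members_def family_def)
      then obtain a b c where abc: "C = {a, b, c}"
        by (metis card_1_singleton_iff card_2_iff card_3_iff insert_absorb2 One_nat_def)
      then show "C \<in> (\<lambda>(a, b, c). {a, b, c}) ` T" using C sub by (auto simp: T_def intro!: image_eqI[of _ _ "(a, b, c)"])
    qed
  qed (auto simp: T_def)
  show "card (members F {l, l'} s) \<le> triple_count U m l l' s"
    unfolding count img[symmetric] by (rule card_image_le[OF finT])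
  have "T \<subseteq> (\<Union>C\<in>members F {l, l'} s. C \<times> C \<times> C)" by (auto simp: T_def)
  then have "card T \<le> card (\<Union>C\<in>members F {l, l'} s. C \<times> C \<times> C)"
    using F by (intro card_mono finite_UN_I finite_members[OF F])
      (auto simp: members_def family_def intro!: finite_cartesian_product intro: finite_subset)
  also have "\<dots> \<le> (\<Sum>C\<in>members F {l, l'} s. card (C \<times> C \<times> C))" by (rule card_UN_le[OF finite_members[OF F]])
  also have "\<dots> \<le> (\<Sum>C\<in>members F {l, l'} s. 27)"
  proof (rule sum_mono)
    fix C assume "C \<in> members F {l, l'} s"
    then have "card C \<le> 3" using s by (simp add: members_def)
    then have "card C * (card C * card C) \<le> 3 * (3 * 3)" by (intro mult_le_mono)
    then show "card (C \<times> C \<times> C) \<le> 27" by (simp add: card_cartesian_product)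
  qed
  finally show "triple_count U m l l' s \<le> 27 * card (members F {l, l'} s)" unfolding count by simp
qed

lemma digit_less: "x < X ==> y < B ==> x * B + y < X * B" for x X y B :: nat
proof -
  assume "x < X" "y < B"
  then have "(x + 1) * B \<le> X * B" by (intro mult_le_mono1) simp
  then show ?thesis using \<open>y < B\<close> unfolding add_mult_distrib by linarith
qed

lemma flower_index:
  fixes l l' t U :: nat
  assumes "l < U" "l' < U" "t < 3"
  shows "(t * U + l) * U + l' < 3 * U * U" "((t * U + l) * U + l') div U div U = t"
    "((t * U + l) * U + l') div U mod U = l" "((t * U + l) * U + l') mod U = l'"
proof -
  show "(t * U + l) * U + l' < 3 * U * U" using assms by (intro digit_less)
qed (use assms in simp_all)

lemma first_flower_good:
  assumes F: "family U F" and m: "\<And>a b c. a < U ==> b < U ==> c < U ==> m a b c \<longleftrightarrow> {a, b, c} \<in> F"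
    and fl: "has_flower U lo lo' m" and pos: "1 \<le> lo"
  defines "f \<equiv> first_flower U lo lo' m"
  shows "good_flower (27 * lo) lo lo' F {f div U mod U, f mod U} (if f div U div U = 0 then 2 else 3)"
proof -
  define f' where "f' = (LEAST f. is_flower U lo lo' m f)"
  obtain g where g: "g < 3 * U * U" "is_flower U lo lo' m g" using fl by (auto simp: has_flower_def)
  have f': "is_flower U lo lo' m f'" unfolding f'_def by (rule LeastI[of _ g]) (rule g)
  have min: "\<not> is_flower U lo lo' m g" if "g < f'" for g using that not_less_Least unfolding f'_def by blast
  have "f' \<le> g" unfolding f'_def by (rule Least_le) (rule g)
  then have less: "f' < 3 * U * U" using g by simp
  have f: "f = f'" unfolding f_def first_flower_def using sum_of_bool_first[of f' "3 * U * U" "is_flower U lo lo' m"] less f' min by blast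
  have U: "0 < U" using less by (cases U) auto
  define l l' t where "l = f div U mod U" and "l' = f mod U" and "t = f div U div U"
  have ll: "l < U" "l' < U" using U by (auto simp: l_def l'_def)
  have ft: "f = (t * U + l) * U + l'" by (simp add: l_def l'_def t_def)
  note count = triple_count_bounds[OF F m]
  have out: "members F H s = {}" if "\<not> H \<subseteq> {..<U}" for H s using that F by (auto simp: members_def family_def)
  \<comment> \<open>A flower of kind 0 would have a smaller index.\<close>
  have no0: "card (members F {x} 2) < 27 * lo" if "t \<noteq> 0" for x
  proof (cases "x < U")
    case True
    have "(0 * U + x) * U + x < f'"
    proof -
      have "x * U + x < U * U" by (rule digit_less) (use True in auto)
      also have "\<dots> \<le> t * U * U" using that by simp
      finally show ?thesis unfolding f[symmetric] ft by (simp add: algebra_simps)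
    qed
    then have "\<not> is_flower U lo lo' m ((0 * U + x) * U + x)" by (rule min)
    then have "triple_count U m x x 2 < 27 * lo"
      unfolding is_flower_def flower_index[OF True True, of 0, simplified] using True by simp
    then show ?thesis using count(1)[where l = x and l' = x and s = 2] by simp
  next
    case False
    then show ?thesis using out[of "{x}" 2] pos by simp
  qed
  have no1: "card (members F H 3) < 27 * lo" if t: "t \<noteq> 0" "t \<noteq> 1" and H: "card H = 2" for H
  proof (cases "H \<subseteq> {..<U}")
    case True
    obtain x y where xy: "H = {x, y}" "x \<noteq> y" using H by (auto simp: card_2_iff)
    then have xU: "x < U" "y < U" using True by auto
    have "(1 * U + x) * U + y < f'"
    proof -
      have "1 * U + x < 2 * U" using xU by simp
      then have "(1 * U + x) * U + y < 2 * U * U" using digit_less xU(2) by blast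
      also have "\<dots> \<le> t * U * U" using t by (intro mult_le_mono1) auto
      finally show ?thesis unfolding f[symmetric] ft by (simp add: algebra_simps)
    qed
    then have "\<not> is_flower U lo lo' m ((1 * U + x) * U + y)" by (rule min)
    then have "triple_count U m x y 3 < 27 * lo"
      unfolding is_flower_def flower_index[OF xU, of 1, simplified] using xU xy flower_index[OF xU, of 1] by simp
    then show ?thesis using count(1)[where l = x and l' = y and s = 3] xy by simp
  next
    case False
    then show ?thesis using out[of H 3] pos by simp
  qed
  have "is_flower U lo lo' m f" using f' f by simp
  then consider "t = 0" "l = l'" "27 * lo \<le> triple_count U m l l' 2"
    | "t = 1" "l \<noteq> l'" "27 * lo \<le> triple_count U m l l' 3" | "t = 2" "l = l'" "27 * lo' \<le> triple_count U m l l' 3"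
    unfolding is_flower_def l_def[symmetric] l'_def[symmetric] t_def[symmetric] by blast
  then have "good_flower (27 * lo) lo lo' F {l, l'} (if t = 0 then 2 else 3)"
  proof cases
    case 1
    then show ?thesis using count(2)[where l = l and l' = l' and s = 2] by (simp add: good_flower_def)
  next
    case 2
    then show ?thesis using count(2)[where l = l and l' = l' and s = 3] no0 by (simp add: good_flower_def)
  next
    case 3
    then show ?thesis using count(2)[where l = l and l' = l' and s = 3] no0 no1 by (simp add: good_flower_def)
  qed
  then show ?thesis by (simp add: l_def l'_def t_def)
qed

lemma no_flower_sparse:
  assumes F: "family U F" and m: "\<And>a b c. a < U ==> b < U ==> c < U ==> m a b c \<longleftrightarrow> {a, b, c} \<in> F"
    and fl: "\<not> has_flower U lo lo' m"
  shows "card F \<le> U * (1 + 27 * lo + 27 * lo')"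
proof (rule card_sparse_family[OF F])
  fix l
  note count = triple_count_bounds[OF F m]
  have out: "members F {l} s = {}" if "\<not> l < U" for s using that F by (auto simp: members_def family_def)
  show "card (members F {l} 2) \<le> 27 * lo"
  proof (cases "l < U")
    case True
    have "\<not> is_flower U lo lo' m ((0 * U + l) * U + l)"
      using fl flower_index(1)[OF True True, of 0] unfolding has_flower_def by auto
    then have "triple_count U m l l 2 < 27 * lo"
      unfolding is_flower_def flower_index[OF True True, of 0, simplified] using True by simp
    then show ?thesis using count(1)[where l = l and l' = l and s = 2] by simp
  qed (use out in simp)
  show "card (members F {l} 3) \<le> 27 * lo'"
  proof (cases "l < U")
    case True
    have "\<not> is_flower U lo lo' m ((2 * U + l) * U + l)"
      using fl flower_index(1)[OF True True, of 2] unfolding has_flower_def by auto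
    then have "triple_count U m l l 3 < 27 * lo'"
      unfolding is_flower_def using flower_index[OF True True, of 2] by simp
    then show ?thesis using count(1)[where l = l and l' = l and s = 3] by simp
  qed (use out in simp)
qed

subsection \<open>The two branches as predicates\<close>

definition heart_bit :: "nat => (nat => nat => nat => bool) => nat => nat => nat => nat => bool" where
  "heart_bit U m f a b c \<longleftrightarrow>
     subset3 (f div U mod U) (f mod U) a b c \<and> (a = f div U mod U \<or> a = f mod U) \<and>
       (b = f div U mod U \<or> b = f mod U) \<and> (c = f div U mod U \<or> c = f mod U) \<or>
     m a b c \<and> \<not> subset3 (f div U mod U) (f mod U) a b c"

text \<open>The set equation {a, b, c} = {x, y, z} - H is written out elementwise, as only
  arithmetical conditions are definable.\<close>

definition petal_bit :: "nat => (nat => nat => nat => bool) => nat => nat => nat => nat => bool" where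
  "petal_bit U m f a b c \<longleftrightarrow> (\<exists>x<U. \<exists>y<U. \<exists>z<U. m x y z \<and> card3 x y z = (if f div U div U = 0 then 2 else 3) \<and>
     subset3 (f div U mod U) (f mod U) x y z \<and>
     (a = x \<or> a = y \<or> a = z) \<and> (b = x \<or> b = y \<or> b = z) \<and> (c = x \<or> c = y \<or> c = z) \<and>
     a \<noteq> f div U mod U \<and> a \<noteq> f mod U \<and> b \<noteq> f div U mod U \<and> b \<noteq> f mod U \<and> c \<noteq> f div U mod U \<and> c \<noteq> f mod U \<and>
     (x = a \<or> x = b \<or> x = c \<or> x = f div U mod U \<or> x = f mod U) \<and>
     (y = a \<or> y = b \<or> y = c \<or> y = f div U mod U \<or> y = f mod U) \<and>
     (z = a \<or> z = b \<or> z = c \<or> z = f div U mod U \<or> z = f mod U))"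

definition petals_bit :: "nat => (nat => nat => nat => bool) => nat => nat => nat => nat => bool" where
  "petals_bit U m f a b c \<longleftrightarrow> petal_bit U m f a b c \<or> m a b c \<and>
     \<not> (\<exists>x<U. \<exists>y<U. \<exists>z<U. petal_bit U m f x y z \<and> (x = a \<or> x = b \<or> x = c) \<and> (y = a \<or> y = b \<or> y = c) \<and> (z = a \<or> z = b \<or> z = c))"

lemma heart_bit:
  assumes "m a b c \<longleftrightarrow> {a, b, c} \<in> F"
  shows "heart_bit U m f a b c \<longleftrightarrow> {a, b, c} \<in> refine F {{f div U mod U, f mod U}}"
proof -
  define l l' where "l = f div U mod U" and "l' = f mod U"
  have "{a, b, c} = {l, l'} \<longleftrightarrow> subset3 l l' a b c \<and> (a = l \<or> a = l') \<and> (b = l \<or> b = l') \<and> (c = l \<or> c = l')"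
    unfolding subset3[symmetric] by blast
  then show ?thesis
    unfolding heart_bit_def refine_def l_def[symmetric] l'_def[symmetric] assms subset3[symmetric] by auto
qed

lemma obtain_triple:
  assumes "family U F" "C \<in> F"
  obtains a b c where "C = {a, b, c}" "a < U" "b < U" "c < U"
proof -
  have sub: "C \<subseteq> {..<U}" and "card C = 1 \<or> card C = 2 \<or> card C = 3"
    using assms by (force simp: family_def)+
  then obtain a b c where "C = {a, b, c}"
    by (metis card_1_singleton_iff card_2_iff card_3_iff insert_absorb2 One_nat_def)
  then show ?thesis using sub that by auto
qed

lemma petal_bit:
  assumes F: "family U F" and m: "\<And>a b c. a < U ==> b < U ==> c < U ==> m a b c \<longleftrightarrow> {a, b, c} \<in> F"
  shows "petal_bit U m f a b c \<longleftrightarrow> {a, b, c} \<in> petals F {f div U mod U, f mod U} (if f div U div U = 0 then 2 else 3)"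
proof -
  define l l' s where "l = f div U mod U" and "l' = f mod U" and "s = (if f div U div U = 0 then 2 else 3 :: nat)"
  have eq: "(a = x \<or> a = y \<or> a = z) \<and> (b = x \<or> b = y \<or> b = z) \<and> (c = x \<or> c = y \<or> c = z) \<and>
     a \<noteq> l \<and> a \<noteq> l' \<and> b \<noteq> l \<and> b \<noteq> l' \<and> c \<noteq> l \<and> c \<noteq> l' \<and>
     (x = a \<or> x = b \<or> x = c \<or> x = l \<or> x = l') \<and> (y = a \<or> y = b \<or> y = c \<or> y = l \<or> y = l') \<and>
     (z = a \<or> z = b \<or> z = c \<or> z = l \<or> z = l') \<longleftrightarrow> {a, b, c} = {x, y, z} - {l, l'}" for x y z
    unfolding set_eq_subset Diff_subset_conv by auto
  have "petal_bit U m f a b c \<longleftrightarrow> (\<exists>x<U. \<exists>y<U. \<exists>z<U. {x, y, z} \<in> F \<and> card {x, y, z} = s \<and> {l, l'} \<subseteq> {x, y, z} \<and>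
      {a, b, c} = {x, y, z} - {l, l'})"
    unfolding petal_bit_def l_def[symmetric] l'_def[symmetric] s_def[symmetric] eq
    by (simp only: m card3 subset3 cong: conj_cong)
  also have "\<dots> \<longleftrightarrow> {a, b, c} \<in> petals F {l, l'} s"
  proof
    assume "{a, b, c} \<in> petals F {l, l'} s"
    then obtain C where C: "C \<in> F" "{l, l'} \<subseteq> C" "card C = s" "{a, b, c} = C - {l, l'}" by (auto simp: petals_def)
    obtain x y z where "C = {x, y, z}" "x < U" "y < U" "z < U" using obtain_triple[OF F C(1)] by metis
    then show "\<exists>x<U. \<exists>y<U. \<exists>z<U. {x, y, z} \<in> F \<and> card {x, y, z} = s \<and> {l, l'} \<subseteq> {x, y, z} \<and>
      {a, b, c} = {x, y, z} - {l, l'}" using C by blast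
  qed (unfold petals_def, blast)
  finally show ?thesis by (simp only: l_def l'_def s_def)
qed

text \<open>That the petals form a family makes each of them nonempty, hence of the form {x, y, z},
  and the search over triples finds it.\<close>

lemma petals_bit:
  assumes F: "family U F" and m: "\<And>a b c. a < U ==> b < U ==> c < U ==> m a b c \<longleftrightarrow> {a, b, c} \<in> F"
    and abc: "a < U" "b < U" "c < U"
    and pet: "family U (petals F {f div U mod U, f mod U} (if f div U div U = 0 then 2 else 3))"
  shows "petals_bit U m f a b c \<longleftrightarrow>
    {a, b, c} \<in> refine F (petals F {f div U mod U, f mod U} (if f div U div U = 0 then 2 else 3))"
proof -
  define N where "N = petals F {f div U mod U, f mod U} (if f div U div U = 0 then 2 else 3)"
  have pb: "petal_bit U m f x y z \<longleftrightarrow> {x, y, z} \<in> N" for x y z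
    unfolding N_def by (rule petal_bit[OF F m])
  have "(\<exists>x<U. \<exists>y<U. \<exists>z<U. petal_bit U m f x y z \<and> (x = a \<or> x = b \<or> x = c) \<and> (y = a \<or> y = b \<or> y = c) \<and> (z = a \<or> z = b \<or> z = c))
      \<longleftrightarrow> (\<exists>D\<in>N. D \<subseteq> {a, b, c})" (is "?L \<longleftrightarrow> ?R")
  proof
    assume ?R
    then obtain D where D: "D \<in> N" "D \<subseteq> {a, b, c}" by blast
    obtain x y z where xyz: "D = {x, y, z}" "x < U" "y < U" "z < U"
      using obtain_triple[OF pet[folded N_def] D(1)] by metis
    have e: "petal_bit U m f x y z" "x = a \<or> x = b \<or> x = c" "y = a \<or> y = b \<or> y = c" "z = a \<or> z = b \<or> z = c"
      using D pb[of x y z] unfolding xyz(1) by simp_all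
    show ?L
      by (rule exI[of _ x], rule conjI[OF xyz(2)], rule exI[of _ y], rule conjI[OF xyz(3)],
          rule exI[of _ z], rule conjI[OF xyz(4)]) (intro conjI e)
  next
    assume ?L
    then obtain x y z where "petal_bit U m f x y z" "x = a \<or> x = b \<or> x = c" "y = a \<or> y = b \<or> y = c" "z = a \<or> z = b \<or> z = c"
      by (elim exE conjE)
    then have "{x, y, z} \<in> N" "{x, y, z} \<subseteq> {a, b, c}" using pb[of x y z] by simp_all
    then show ?R by (rule bexI[rotated])
  qed
  then show ?thesis
    unfolding petals_bit_def refine_def N_def[symmetric] by (simp add: pb m[OF abc])
qed

subsection \<open>Families as words\<close>

definition block :: "nat => nat set set => bool list" where
  "block U F = map (\<lambda>i. {i mod U, i div U mod U, i div U div U} \<in> F) [0..<U * U * U]"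

lemma length_block [simp]: "length (block U F) = U * U * U"
  by (simp add: block_def)

lemma triple_index:
  fixes a b c U :: nat
  assumes "a < U" "b < U" "c < U"
  shows "(c * U + b) * U + a < U * U * U" "((c * U + b) * U + a) mod U = a"
    "((c * U + b) * U + a) div U mod U = b" "((c * U + b) * U + a) div U div U = c"
  using assms by (simp_all add: digit_less)

lemma triple_digits:
  fixes i U :: nat
  assumes "i < U * U * U"
  shows "i mod U < U" "i div U mod U < U" "i div U div U < U"
    "(i div U div U * U + i div U mod U) * U + i mod U = i"
proof -
  have "0 < U" using assms by (cases U) auto
  then show "i mod U < U" "i div U mod U < U" by simp_all
  show "i div U div U < U" using assms by (simp add: less_mult_imp_div_less)
qed simp

lemma bit_at_block:
  assumes "a < U" "b < U" "c < U"
  shows "bit_at (block U F @ w) ((c * U + b) * U + a) \<longleftrightarrow> {a, b, c} \<in> F"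
  using triple_index[OF assms] by (simp add: bit_at_def nth_append block_def)

lemma blockI:
  assumes "\<And>a b c. a < U ==> b < U ==> c < U ==> P ((c * U + b) * U + a) \<longleftrightarrow> {a, b, c} \<in> F"
  shows "map P [0..<U * U * U] = block U F"
  unfolding block_def
proof (rule map_cong[OF refl])
  fix i assume "i \<in> set [0..<U * U * U]"
  then have i: "i < U * U * U" by simp
  show "P i \<longleftrightarrow> {i mod U, i div U mod U, i div U div U} \<in> F"
    using assms[OF triple_digits(1-3)[OF i]] unfolding triple_digits(4)[OF i] .
qed

subsection \<open>Formulas with few clauses\<close>

text \<open>The variables \<open>n, n + 1, n + 2\<close> are dummies, which have to be false.\<close>

definition dummy_sat :: "nat => nat set set => bool" where
  "dummy_sat n F \<longleftrightarrow> (\<exists>\<alpha>. hits {l. lit_true \<alpha> l} F \<and> (\<forall>j<3. \<not> \<alpha> (n + j)))"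

lemma dummy_sat_branch: "dummy_sat n F \<longleftrightarrow> dummy_sat n (refine F {H}) \<or> dummy_sat n (refine F (petals F H s))"
  unfolding dummy_sat_def using hits_branch[of _ F H s] by blast

text \<open>The position of hit number j, counted from 0: exactly the positions before it have at
  most j hits up to and including themselves. With too few hits the value is
  \<open>B\<close>.\<close>

definition select :: "nat => (nat => bool) => nat => nat" where
  "select B P j = (\<Sum>t<B. of_bool ((\<Sum>i<t + 1. of_bool (P i)) \<le> j))"

lemma select_rank:
  assumes "t < B" "P t"
  shows "select B P (\<Sum>i<t. of_bool (P i)) = t"
proof -
  define r where "r t = (\<Sum>i<t. of_bool (P i) :: nat)" for t
  have mono: "r a \<le> r b" if "a \<le> b" for a b unfolding r_def using that by (intro sum_mono2) auto
  have "r (t' + 1) \<le> r t \<longleftrightarrow> t' < t" for t'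
  proof
    assume le: "r (t' + 1) \<le> r t"
    show "t' < t"
    proof (rule ccontr)
      assume "\<not> t' < t"
      then have "r (t + 1) \<le> r (t' + 1)" by (intro mono) simp
      moreover have "r (t + 1) = r t + 1" using assms by (simp add: r_def)
      ultimately show False using le by simp
    qed
  next
    assume "t' < t"
    then show "r (t' + 1) \<le> r t" by (intro mono) simp
  qed
  then have "{t' \<in> {..<B}. r (t' + 1) \<le> r t} = {t' \<in> {..<B}. t' < t}" by (simp only:)
  also have "\<dots> = {..<t}" using assms by auto
  finally have "{t' \<in> {..<B}. r (t' + 1) \<le> r t} = {..<t}" .
  then have "card {t' \<in> {..<B}. r (t' + 1) \<le> r t} = t" by simp
  then show ?thesis
    unfolding select_def r_def[symmetric] by (simp add: of_bool_def sum.If_cases Int_def)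
qed

text \<open>Using all U^3 triples as clauses would give a graph of cubic size. Only the hits are
  enumerated, behind three clauses that make the dummies false, and surplus clauses are tautologies.
  So the number of clauses can be fixed in advance as a linear function of n.\<close>

definition leaf_lit :: "nat => (nat => bool) => nat => nat => nat" where
  "leaf_lit n P j r = (let U = 2 * (n + 3); t = select (U * U * U) P (j - 3) in
     if j < 3 then 2 * (n + j)
     else if t < U * U * U \<and> P t then if r = 0 then t mod U else if r = 1 then t div U mod U else t div U div U
     else if r = 0 then 0 else 1)"

lemma leaf_lit_less: "leaf_lit n P j r < 2 * (n + 3)"
proof -
  define U where "U = 2 * (n + 3)"
  define t where "t = select (U * U * U) P (j - 3)"
  show ?thesis
  proof (cases "\<not> j < 3 \<and> t < U * U * U \<and> P t")
    case True
    then show ?thesis using triple_digits(1-3)[of t U]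
      unfolding leaf_lit_def Let_def U_def[symmetric] t_def[symmetric] by simp
  next
    case False
    then have "leaf_lit n P j r = (if j < 3 then 2 * (n + j) else if r = 0 then 0 else 1)"
      unfolding leaf_lit_def Let_def U_def[symmetric] t_def[symmetric] by auto
    then show ?thesis by simp
  qed
qed

lemma card_bits_le:
  assumes "family U F"
  shows "card {i. i < U * U * U \<and> {i mod U, i div U mod U, i div U div U} \<in> F} \<le> 27 * card F"
proof -
  let ?S = "{i. i < U * U * U \<and> {i mod U, i div U mod U, i div U div U} \<in> F}"
  let ?f = "\<lambda>(a, b, c). (c * U + b) * U + a"
  have fin: "finite F" using finite_family[OF assms] .
  have finC: "finite C" if "C \<in> F" for C using assms that by (auto simp: family_def intro: finite_subset)
  have "?S \<subseteq> (\<Union>C\<in>F. ?f ` (C \<times> C \<times> C))"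
  proof
    fix i assume i: "i \<in> ?S"
    let ?C = "{i mod U, i div U mod U, i div U div U}"
    from i have conj: "i < U * U * U \<and> ?C \<in> F" by (rule CollectD)
    have "?f (i mod U, i div U mod U, i div U div U) = i"
      unfolding prod.case by (rule triple_digits(4)[OF conj[THEN conjunct1]])
    moreover have "(i mod U, i div U mod U, i div U div U) \<in> ?C \<times> ?C \<times> ?C" by (intro SigmaI insertI1 insertI2)
    ultimately have "i \<in> ?f ` (?C \<times> ?C \<times> ?C)" by (metis (no_types, lifting) imageI)
    then show "i \<in> (\<Union>C\<in>F. ?f ` (C \<times> C \<times> C))" by (rule UN_I[OF conj[THEN conjunct2]])
  qed
  then have "card ?S \<le> card (\<Union>C\<in>F. ?f ` (C \<times> C \<times> C))" using fin finC by (intro card_mono) auto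
  also have "\<dots> \<le> (\<Sum>C\<in>F. card (?f ` (C \<times> C \<times> C)))" by (rule card_UN_le[OF fin])
  also have "\<dots> \<le> (\<Sum>C\<in>F. 27)"
  proof (rule sum_mono)
    fix C assume C: "C \<in> F"
    have "card (?f ` (C \<times> C \<times> C)) \<le> card (C \<times> C \<times> C)" using finC[OF C] by (intro card_image_le) auto
    also have "\<dots> = card C * (card C * card C)" by (simp add: card_cartesian_product)
    also have "\<dots> \<le> 3 * (3 * 3)" using assms C by (intro mult_le_mono) (auto simp: family_def)
    finally show "card (?f ` (C \<times> C \<times> C)) \<le> 27" by simp
  qed
  finally show ?thesis by simp
qed

lemma leaf_sat:
  assumes F: "family U F" and U: "U = 2 * (n + 3)" and c: "27 * card F \<le> c"
    and P: "\<And>i. i < U * U * U ==> P i \<longleftrightarrow> {i mod U, i div U mod U, i div U div U} \<in> F"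
  shows "sat3 (c + 3) (leaf_lit n P) \<longleftrightarrow> dummy_sat n F"
proof -
  have lit: "leaf_lit n P j r = (if j < 3 then 2 * (n + j)
     else if select (U * U * U) P (j - 3) < U * U * U \<and> P (select (U * U * U) P (j - 3))
       then if r = 0 then select (U * U * U) P (j - 3) mod U else if r = 1 then select (U * U * U) P (j - 3) div U mod U
         else select (U * U * U) P (j - 3) div U div U
     else if r = 0 then 0 else 1)" for j r
    unfolding leaf_lit_def Let_def U ..
  have three: "(\<exists>r<3. Q r) \<longleftrightarrow> Q 0 \<or> Q 1 \<or> Q (2::nat)" for Q
    unfolding numeral_3_eq_3 Ex_less_Suc numeral_2_eq_2 One_nat_def by blast
  have dummy: "lit_true \<alpha> (2 * v) \<longleftrightarrow> \<not> \<alpha> v" for \<alpha> v by (simp add: lit_true_def)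
  show ?thesis
  proof
    assume "sat3 (c + 3) (leaf_lit n P)"
    then obtain \<alpha> where \<alpha>: "\<And>j. j < c + 3 ==> \<exists>r<3. lit_true \<alpha> (leaf_lit n P j r)" unfolding sat3_def by blast
    have "\<not> \<alpha> (n + j)" if j: "j < 3" for j
    proof -
      have "leaf_lit n P j r = 2 * (n + j)" for r using j unfolding leaf_lit_def Let_def by simp
      moreover obtain r where "lit_true \<alpha> (leaf_lit n P j r)" using \<alpha>[of j] j by auto
      ultimately have "lit_true \<alpha> (2 * (n + j))" by (simp only:)
      then show ?thesis by (simp only: dummy not_False_eq_True)
    qed
    moreover have "C \<inter> {l. lit_true \<alpha> l} \<noteq> {}" if C: "C \<in> F" for C
    proof -
      obtain x y z where xyz: "C = {x, y, z}" "x < U" "y < U" "z < U" using obtain_triple[OF F C] by metis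
      define t where "t = (z * U + y) * U + x"
      have t: "t < U * U * U" "t mod U = x" "t div U mod U = y" "t div U div U = z"
        using triple_index[OF xyz(2-4)] by (simp_all add: t_def)
      then have Pt: "P t" using P[of t] C xyz(1) by simp
      \<comment> \<open>The rank of t among the hits. It is below c, because each member of F has at
        most 27 indices.\<close>
      define j where "j = (\<Sum>i<t. of_bool (P i) :: nat)"
      have "j = card {i \<in> {..<t}. P i}" by (simp add: j_def of_bool_def sum.If_cases Int_def)
      also have "\<dots> < card {i. i < U * U * U \<and> {i mod U, i div U mod U, i div U div U} \<in> F}"
      proof (rule psubset_card_mono)
        let ?S = "{i. i < U * U * U \<and> {i mod U, i div U mod U, i div U div U} \<in> F}"
        show "finite ?S" by simp
        have S: "i \<in> ?S \<longleftrightarrow> i < U * U * U \<and> P i" for i using P by blast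
        show "{i \<in> {..<t}. P i} \<subset> ?S"
        proof
          show "{i \<in> {..<t}. P i} \<subseteq> ?S"
          proof
            fix i assume "i \<in> {i \<in> {..<t}. P i}"
            then show "i \<in> ?S" unfolding S using t(1) by auto
          qed
          have "t \<in> ?S" unfolding S using t(1) Pt by blast
          moreover have "t \<notin> {i \<in> {..<t}. P i}" by simp
          ultimately show "{i \<in> {..<t}. P i} \<noteq> ?S" by blast
        qed
      qed
      also have "\<dots> \<le> c" using card_bits_le[OF F] c by simp
      finally have "j + 3 < c + 3" by simp
      from \<alpha>[OF this] obtain r where r: "r < 3" "lit_true \<alpha> (leaf_lit n P (j + 3) r)" by blast
      have "select (U * U * U) P (j + 3 - 3) = t" using select_rank[of t "U * U * U" P] t(1) Pt by (simp add: j_def)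
      then have "leaf_lit n P (j + 3) r \<in> C" unfolding lit using t Pt xyz(1) by simp
      then show ?thesis using r by blast
    qed
    ultimately show "dummy_sat n F" unfolding dummy_sat_def hits_def by blast
  next
    assume "dummy_sat n F"
    then obtain \<alpha> where \<alpha>: "\<And>C. C \<in> F ==> C \<inter> {l. lit_true \<alpha> l} \<noteq> {}" "\<And>j. j < 3 ==> \<not> \<alpha> (n + j)"
      unfolding dummy_sat_def hits_def by blast
    have "\<exists>r<3. lit_true \<alpha> (leaf_lit n P j r)" for j
    proof (cases "j < 3")
      case True
      then have "leaf_lit n P j 0 = 2 * (n + j)" unfolding leaf_lit_def Let_def by simp
      then have "lit_true \<alpha> (leaf_lit n P j 0)" using \<alpha>(2)[OF True] by (simp only: dummy not_False_eq_True)
      then show ?thesis by (intro exI[of _ 0]) simp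
    next
      case False
      define t where "t = select (U * U * U) P (j - 3)"
      show ?thesis
      proof (cases "t < U * U * U \<and> P t")
        case True
        then have "{t mod U, t div U mod U, t div U div U} \<in> F" using P by blast
        from \<alpha>(1)[OF this] obtain l where l: "l \<in> {t mod U, t div U mod U, t div U div U}" "lit_true \<alpha> l" by blast
        have "leaf_lit n P j 0 = t mod U" "leaf_lit n P j 1 = t div U mod U" "leaf_lit n P j 2 = t div U div U"
          using True False unfolding lit t_def[symmetric] by simp_all
        then show ?thesis using l unfolding three by (metis insertE singletonD)
      next
        case nt: False
        have "lit_true \<alpha> 0 \<or> lit_true \<alpha> 1" by (simp add: lit_true_def)
        moreover have "leaf_lit n P j 0 = 0" "leaf_lit n P j 1 = 1"
          using nt False unfolding lit t_def[symmetric] by auto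
        ultimately show ?thesis unfolding three by metis
      qed
    qed
    then show "sat3 (c + 3) (leaf_lit n P)" unfolding sat3_def by blast
  qed
qed

subsection \<open>The initial family\<close>

fun lit_num :: "literal => nat" where
  "lit_num (b, v) = 2 * v + of_bool b"

text \<open>Short clauses are padded in all possible ways with positive dummy literals, which are
  false; three dummies suffice even for the empty clause. As there are only triples, the invariant
  holds trivially.\<close>

definition start_family :: "nat => cnf => nat set set" where
  "start_family n F = {D. D \<subseteq> {..<2 * (n + 3)} \<and> card D = 3 \<and>
     (\<exists>C\<in>set F. lit_num ` set C \<subseteq> D \<and> (\<forall>l\<in>D. l \<in> lit_num ` set C \<or> 2 * n \<le> l \<and> l mod 2 = 1))}"

lemma start_family_inv: "sparse_inv (2 * (n + 3)) t (start_family n F)"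
proof -
  have "members (start_family n F) H 2 = {}" for H by (auto simp: members_def start_family_def)
  moreover have "C = D" if "C \<in> start_family n F" "D \<in> start_family n F" "C \<subseteq> D" for C D
  proof -
    have "finite D" "card C = card D" using that by (auto simp: start_family_def intro: finite_subset)
    then show ?thesis using that(3) by (metis card_subset_eq)
  qed
  ultimately show ?thesis by (auto simp: sparse_inv_def family_def start_family_def)
qed

lemma start_family_sat:
  assumes "(n, F) \<in> sat3_instances"
  shows "satisfiable F \<longleftrightarrow> dummy_sat n (start_family n F)"
proof -
  have inst: "length C \<le> 3" "\<And>b v. (b, v) \<in> set C ==> v < n" if "C \<in> set F" for C
    using assms that by (auto simp: sat3_instances_def)
  have lt: "lit_true \<alpha> (lit_num (b, v)) \<longleftrightarrow> \<alpha> v = b" for \<alpha> b v by (auto simp: lit_true_def)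
  show ?thesis
  proof
    assume "satisfiable F"
    then obtain a where a: "\<And>C. C \<in> set F ==> \<exists>(b, v)\<in>set C. a v = b" unfolding satisfiable_def by blast
    define \<alpha> where "\<alpha> v = (v < n \<and> a v)" for v
    have "D \<inter> {l. lit_true \<alpha> l} \<noteq> {}" if D: "D \<in> start_family n F" for D
    proof -
      obtain C where C: "C \<in> set F" "lit_num ` set C \<subseteq> D" using D by (auto simp: start_family_def)
      obtain b v where bv: "(b, v) \<in> set C" "a v = b" using a[OF C(1)] by auto
      then have "lit_true \<alpha> (lit_num (b, v))" unfolding lt using inst(2)[OF C(1)] by (auto simp: \<alpha>_def)
      moreover have "lit_num (b, v) \<in> D" using C(2) bv(1) by blast
      ultimately show ?thesis by blast
    qed
    then show "dummy_sat n (start_family n F)"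
      unfolding dummy_sat_def hits_def by (intro exI[of _ \<alpha>]) (auto simp: \<alpha>_def)
  next
    assume "dummy_sat n (start_family n F)"
    then obtain \<alpha> where \<alpha>: "\<And>D. D \<in> start_family n F ==> D \<inter> {l. lit_true \<alpha> l} \<noteq> {}" "\<And>j. j < 3 ==> \<not> \<alpha> (n + j)"
      unfolding dummy_sat_def hits_def by blast
    have "\<exists>(b, v)\<in>set C. \<alpha> v = b" if C: "C \<in> set F" for C
    proof -
      define A where "A = lit_num ` set C"
      \<comment> \<open>The three positive dummy literals, from which the missing elements are
        taken.\<close>
      define E :: "nat set" where "E = {2 * n + 1, 2 * n + 3, 2 * n + 5}"
      have AU: "A \<subseteq> {..<2 * n}" using inst(2)[OF C] by (fastforce simp: A_def of_bool_def)
      have "card A \<le> card (set C)" unfolding A_def by (rule card_image_le) simp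
      then have cA: "card A \<le> 3" using inst(1)[OF C] card_length[of C] by linarith
      have cE: "card E = 3" by (simp add: E_def)
      obtain E' where E': "E' \<subseteq> E" "card E' = 3 - card A" using obtain_subset_with_card_n[of "3 - card A" E] cE by auto
      have "\<And>x. x \<in> E ==> 2 * n < x" by (auto simp: E_def)
      then have disj: "A \<inter> E' = {}" using AU E' by fastforce
      have "finite A" "finite E'" using AU E' by (auto intro: finite_subset simp: E_def)
      then have "card (A \<union> E') = 3" using disj E' cA by (simp add: card_Un_disjoint)
      moreover have "A \<union> E' \<subseteq> {..<2 * (n + 3)}" using AU E' by (auto simp: E_def)
      moreover have dE: "2 * n \<le> l \<and> l mod 2 = 1" if "l \<in> E'" for l
      proof -
        have "l = 2 * n + 1 \<or> l = 2 * n + 3 \<or> l = 2 * n + 5" using that E' by (auto simp: E_def)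
        then show ?thesis by presburger
      qed
      ultimately have "A \<union> E' \<in> start_family n F"
        using C unfolding start_family_def A_def by blast
      from \<alpha>(1)[OF this] obtain l where l: "l \<in> A \<union> E'" "lit_true \<alpha> l" by blast
      have "l \<notin> E'"
      proof
        assume "l \<in> E'"
        then have "l = 2 * (n + 0) + 1 \<or> l = 2 * (n + 1) + 1 \<or> l = 2 * (n + 2) + 1" using E' by (auto simp: E_def)
        then consider "l = 2 * (n + 0) + 1" | "l = 2 * (n + 1) + 1" | "l = 2 * (n + 2) + 1" by blast
        then have "\<exists>j. j < 3 \<and> l = 2 * (n + j) + 1" by cases (rule exI, rule conjI[rotated], assumption, simp)+
        then obtain j where "j < 3" "l = 2 * (n + j) + 1" by blast
        then show False using l(2) \<alpha>(2)[of j] by (simp only: lit_true_simps)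
      qed
      with l(1) have "l \<in> lit_num ` set C" unfolding A_def by blast
      then obtain p where p: "p \<in> set C" "l = lit_num p" by blast
      obtain b v where bv: "p = (b, v)" by force
      have "\<alpha> v = b" using l(2) unfolding p(2) bv lt .
      then show ?thesis using p(1) unfolding bv by blast
    qed
    then show "satisfiable F" unfolding satisfiable_def by blast
  qed
qed

subsection \<open>Definability of the branches\<close>

lemma def_card3: "definable b f ==> definable b g ==> definable b h ==> definable b (\<lambda>R \<sigma>. card3 (f R \<sigma>) (g R \<sigma>) (h R \<sigma>))"
  unfolding card3_def by (intro def_intros)

lemma def_subset3:
  "definable b f ==> definable b f' ==> definable b g ==> definable b g' ==> definable b g'' ==>
    definableP b (\<lambda>R \<sigma>. subset3 (f R \<sigma>) (f' R \<sigma>) (g R \<sigma>) (g' R \<sigma>) (g'' R \<sigma>))"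
  unfolding subset3_def by (intro def_intros)

lemma def_branches:
  assumes U: "definable b (\<lambda>R \<sigma>. U R)" and m: "definableP b (\<lambda>R \<sigma>. m R (\<sigma> 0) (\<sigma> 1) (\<sigma> 2))"
  shows "definableP b (\<lambda>R \<sigma>. has_flower (U R) lo lo' (m R))"
    "definableP b (\<lambda>R \<sigma>. heart_bit (U R) (m R) (first_flower (U R) lo lo' (m R)) (\<sigma> 0) (\<sigma> 1) (\<sigma> 2))"
    "definableP b (\<lambda>R \<sigma>. petals_bit (U R) (m R) (first_flower (U R) lo lo' (m R)) (\<sigma> 0) (\<sigma> 1) (\<sigma> 2))"
proof -
  note m' = def_comp3[of b "\<lambda>R a b c. of_bool (m R a b c)", OF m]
  have tc: "definable b (\<lambda>R \<sigma>. triple_count (U R) (m R) (\<sigma> 0) (\<sigma> 1) (\<sigma> 2))"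
    unfolding triple_count_def by (intro def_intros U m' def_card3 def_subset3)
  note tc' = def_comp3[of b "\<lambda>R. triple_count (U R) (m R)", OF tc]
  have fl: "definableP b (\<lambda>R \<sigma>. is_flower (U R) lo lo' (m R) (\<sigma> 0))"
    unfolding is_flower_def by (intro def_intros U tc')
  note fl' = def_comp1[of b "\<lambda>R f. of_bool (is_flower (U R) lo lo' (m R) f)", OF fl]
  show "definableP b (\<lambda>R \<sigma>. has_flower (U R) lo lo' (m R))"
    unfolding has_flower_def by (intro def_intros U fl')
  have ff: "definable b (\<lambda>R \<sigma>. first_flower (U R) lo lo' (m R))"
    unfolding first_flower_def by (intro def_intros U fl')
  show "definableP b (\<lambda>R \<sigma>. heart_bit (U R) (m R) (first_flower (U R) lo lo' (m R)) (\<sigma> 0) (\<sigma> 1) (\<sigma> 2))"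
    unfolding heart_bit_def by (intro def_intros U ff m' def_subset3)
  have pb: "definableP b (\<lambda>R \<sigma>. petal_bit (U R) (m R) (first_flower (U R) lo lo' (m R)) (\<sigma> 0) (\<sigma> 1) (\<sigma> 2))"
    unfolding petal_bit_def by (intro def_intros U ff m' def_subset3 def_card3)
  note pb' = def_comp3[of b "\<lambda>R a b c. of_bool (petal_bit (U R) (m R) (first_flower (U R) lo lo' (m R)) a b c)", OF pb]
  show "definableP b (\<lambda>R \<sigma>. petals_bit (U R) (m R) (first_flower (U R) lo lo' (m R)) (\<sigma> 0) (\<sigma> 1) (\<sigma> 2))"
    unfolding petals_bit_def by (intro def_intros U pb' m')
qed

lemma def_leaf_lit:
  assumes n: "definable b (\<lambda>R \<sigma>. n R)" and P: "definableP b (\<lambda>R \<sigma>. P R (\<sigma> 0))"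
  shows "definable b (\<lambda>R \<sigma>. leaf_lit (n R) (P R) (\<sigma> 0) (\<sigma> 1))"
proof -
  note P' = def_comp1[of b "\<lambda>R i. of_bool (P R i)", OF P]
  have sel: "definable b (\<lambda>R \<sigma>. select (2 * (n R + 3) * (2 * (n R + 3)) * (2 * (n R + 3))) (P R) (\<sigma> 0))"
    unfolding select_def by (intro def_intros n P')
  note sel' = def_comp1[of b "\<lambda>R. select (2 * (n R + 3) * (2 * (n R + 3)) * (2 * (n R + 3))) (P R)", OF sel]
  show ?thesis unfolding leaf_lit_def Let_def by (intro def_intros n P' sel')
qed

section \<open>Turing machines as subroutines\<close>

text \<open>
  The simulated machine keeps its state in register \<open>7\<close>. Its tape number \<open>j\<close> is split at the head:
  register \<open>left_reg j\<close> holds the cells to the left of the head and \<open>right_reg j\<close> the others. A tape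
  symbol \<open>a\<close> is stored as \<open>a + 1\<close>, and all cells that are not stored are blank.
\<close>

definition left_reg :: "nat => nat" where "left_reg j = 8 + 2 * j"
definition right_reg :: "nat => nat" where "right_reg j = 9 + 2 * j"

lemma tape_reg_simps [simp]:
  "left_reg i = left_reg j \<longleftrightarrow> i = j" "right_reg i = right_reg j \<longleftrightarrow> i = j"
  "left_reg i \<noteq> right_reg j" "right_reg i \<noteq> left_reg j"
proof -
  show "left_reg i \<noteq> right_reg j" unfolding left_reg_def right_reg_def by presburger
  show "right_reg i \<noteq> left_reg j" unfolding left_reg_def right_reg_def by presburger
qed (simp_all add: left_reg_def right_reg_def)

definition cell :: "nat list => nat => nat" where
  "cell xs i = (if i < length xs then xs ! i - 1 else 0)"

lemma cell_simps [simp]: "cell [] i = 0" "cell (x # xs) 0 = x - 1" "cell (x # xs) (Suc i) = cell xs i"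
  by (simp_all add: cell_def)

lemma cell_tl: "cell (tl xs) i = cell xs (Suc i)"
  by (cases xs) auto

lemma cell_peek: "cell xs 0 = peek xs - 1"
  by (cases xs) auto

definition tape_rep :: "nat => nat => tape => nat list => nat list => bool" where
  "tape_rep n B T l r \<longleftrightarrow> (\<forall>i. fst T (snd T + int i) = cell r i) \<and> (\<forall>i. fst T (snd T - 1 - int i) = cell l i) \<and>
     set l \<subseteq> {1..n} \<and> set r \<subseteq> {1..n} \<and> length l + length r \<le> B"

text \<open>Empty stacks stand for blanks, so \<open>Move_Left\<close> supplies the code 1 of a
  blank if necessary. At most two more cells become stored in a step, namely when both stacks are
  empty.\<close>

fun act_stacks :: "nat \<times> move => nat list \<times> nat list => nat list \<times> nat list" where
  "act_stacks (a, Stay) (l, r) = (l, Suc a # tl r)"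
| "act_stacks (a, Move_Right) (l, r) = (Suc a # l, tl r)"
| "act_stacks (a, Move_Left) (l, r) = (tl l, (if peek l = 0 then 1 else peek l) # Suc a # tl r)"

lemma set_tl: "set xs \<subseteq> A ==> set (tl xs) \<subseteq> A"
  by (cases xs) auto

lemma tape_rep_act:
  assumes rep: "tape_rep n B T l r" and a: "fst a < n"
  shows "tape_rep n (B + 2) (act a T) (fst (act_stacks a (l, r))) (snd (act_stacks a (l, r)))"
proof -
  obtain t h where T: "T = (t, h)" by force
  obtain x d where x: "a = (x, d)" by force
  have R: "t (h + int i) = cell r i" and L: "t (h - 1 - int i) = cell l i" for i
    using rep by (simp_all add: tape_rep_def T)
  have sets: "set l \<subseteq> {1..n}" "set r \<subseteq> {1..n}" "length l + length r \<le> B" using rep by (simp_all add: tape_rep_def)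
  have R': "t (h + (1 + int i)) = cell (tl r) i" for i using R[of "Suc i"] by (simp add: cell_tl)
  have L': "t (h - 2 - int i) = cell (tl l) i" for i using L[of "Suc i"] by (simp add: cell_tl algebra_simps)
  note tls = set_tl[OF sets(1)] set_tl[OF sets(2)]
  show ?thesis
  proof (cases d)
    case Stay
    have "(t(h := x)) (h + int i) = cell (Suc x # tl r) i" for i by (cases i) (auto simp: R')
    moreover have "(t(h := x)) (h - 1 - int i) = cell l i" for i by (simp add: L)
    ultimately show ?thesis using sets tls a unfolding tape_rep_def T x Stay by auto
  next
    case Move_Right
    have "(t(h := x)) (h + 1 + int i) = cell (tl r) i" for i using R'[of i] by (simp add: add.assoc)
    moreover have "(t(h := x)) (h + 1 - 1 - int i) = cell (Suc x # l) i" for i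
    proof (cases i)
      case (Suc j)
      then show ?thesis using L[of j] by (simp add: algebra_simps)
    qed simp
    ultimately show ?thesis using sets tls a unfolding tape_rep_def T x Move_Right by auto
  next
    case Move_Left
    define y where "y = (if peek l = 0 then 1 else peek l)"
    have y: "y - 1 = cell l 0" by (auto simp: y_def cell_peek)
    have yn: "y \<in> {1..n}" using sets(1) a by (cases l) (auto simp: y_def)
    have "(t(h := x)) (h - 1 + int i) = cell (y # Suc x # tl r) i" for i
    proof (cases i)
      case 0
      then show ?thesis using L[of 0] y by simp
    next
      case (Suc j)
      then show ?thesis
      proof (cases j)
        case (Suc j')
        then show ?thesis using R'[of j'] \<open>i = Suc j\<close> by (simp add: algebra_simps)
      qed (use \<open>i = Suc j\<close> in simp)
    qed
    moreover have "(t(h := x)) (h - 1 - 1 - int i) = cell (tl l) i" for i using L'[of i] by simp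
    ultimately show ?thesis using sets tls a yn unfolding tape_rep_def T x Move_Left by (auto simp: y_def[symmetric])
  qed
qed

definition act_com :: "nat => nat \<times> move => com" where
  "act_com j a = (case a of (x, d) => Seq (Pop (right_reg j)) (case d of
     Stay => Push (right_reg j) (Suc x)
   | Move_Right => Push (left_reg j) (Suc x)
   | Move_Left => Seq (Push (right_reg j) (Suc x)) (Switch (left_reg j)
       (\<lambda>y. Seq (Pop (left_reg j)) (Push (right_reg j) (if y = 0 then 1 else y))))))"

lemma run_act_com:
  "run (act_com j a) s 10 (s(left_reg j := fst (act_stacks a (s (left_reg j), s (right_reg j))),
     right_reg j := snd (act_stacks a (s (left_reg j), s (right_reg j)))))"
proof -
  obtain x d where a: "a = (x, d)" by force
  let ?l = "left_reg j" and ?r = "right_reg j"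
  define s1 where "s1 = s(?r := tl (s ?r))"
  have 1: "run (Pop ?r) s 1 s1" unfolding s1_def by (rule run_Pop)
  show ?thesis
  proof (cases d)
    case Stay
    have "run (act_com j a) s (1 + 1 + 2) (s1(?r := Suc x # s1 ?r))"
      unfolding act_com_def a Stay prod.case move.case by (rule run_Seq[OF 1 run_Push])
    then have "run (act_com j a) s 10 (s1(?r := Suc x # s1 ?r))" by (rule run_weaken) simp
    then show ?thesis by (rule run_cong) (simp add: s1_def a Stay)
  next
    case Move_Right
    have "run (act_com j a) s (1 + 1 + 2) (s1(?l := Suc x # s1 ?l))"
      unfolding act_com_def a Move_Right prod.case move.case by (rule run_Seq[OF 1 run_Push])
    then have "run (act_com j a) s 10 (s1(?l := Suc x # s1 ?l))" by (rule run_weaken) simp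
    then show ?thesis by (rule run_cong) (auto simp: s1_def a Move_Right)
  next
    case Move_Left
    define s2 where "s2 = s1(?r := Suc x # s1 ?r)"
    define s3 where "s3 = s2(?l := tl (s2 ?l))"
    have 2: "run (Push ?r (Suc x)) s1 2 s2" unfolding s2_def by (rule run_Push)
    have 3: "run (Pop ?l) s2 1 s3" unfolding s3_def by (rule run_Pop)
    have 4: "run (Switch ?l (\<lambda>y. Seq (Pop ?l) (Push ?r (if y = 0 then 1 else y)))) s2 (1 + (1 + 1 + 2))
        (s3(?r := (if peek (s2 ?l) = 0 then 1 else peek (s2 ?l)) # s3 ?r))"
      by (rule run_Switch, rule run_Seq[OF 3], rule run_Push)
    have "run (act_com j a) s (1 + 1 + (1 + 2 + (1 + (1 + 1 + 2))))
        (s3(?r := (if peek (s2 ?l) = 0 then 1 else peek (s2 ?l)) # s3 ?r))"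
      unfolding act_com_def a Move_Left prod.case move.case by (rule run_Seq[OF 1 run_Seq[OF 2 4]])
    then have "run (act_com j a) s 10 (s3(?r := (if peek (s2 ?l) = 0 then 1 else peek (s2 ?l)) # s3 ?r))"
      by (rule run_weaken) simp
    then show ?thesis by (rule run_cong) (auto simp: s1_def s2_def s3_def a Move_Left)
  qed
qed

fun acts_com :: "nat => (nat \<times> move) list => com" where
  "acts_com j [] = Skip"
| "acts_com j (a # as) = Seq (act_com j a) (acts_com (Suc j) as)"

lemma run_acts_com:
  assumes "length as = length ts" "fst ` set as \<subseteq> {..<n}"
    "\<forall>i<length ts. tape_rep n B (ts ! i) (s (left_reg (j + i))) (s (right_reg (j + i)))"
  shows "\<exists>s'. run (acts_com j as) s (11 * length as + 1) s' \<and>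
    (\<forall>i<length ts. tape_rep n (B + 2) (map2 act as ts ! i) (s' (left_reg (j + i))) (s' (right_reg (j + i)))) \<and>
    (\<forall>r. r < left_reg j \<or> left_reg (j + length ts) \<le> r \<longrightarrow> s' r = s r)"
  using assms
proof (induction as arbitrary: ts j s)
  case Nil
  then show ?case using run_Skip[of s] by auto
next
  case (Cons a as)
  obtain T ts' where ts: "ts = T # ts'" using Cons.prems(1) by (cases ts) auto
  let ?p = "act_stacks a (s (left_reg j), s (right_reg j))"
  define s1 where "s1 = s(left_reg j := fst ?p, right_reg j := snd ?p)"
  have 1: "run (act_com j a) s 10 s1" unfolding s1_def by (rule run_act_com)
  have rep: "tape_rep n B (ts' ! i) (s (left_reg (Suc j + i))) (s (right_reg (Suc j + i)))" if "i < length ts'" for i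
    using Cons.prems(3)[rule_format, of "Suc i"] that by (simp add: ts)
  have rep1: "tape_rep n B (ts' ! i) (s1 (left_reg (Suc j + i))) (s1 (right_reg (Suc j + i)))" if "i < length ts'" for i
    using rep[OF that] by (simp add: s1_def)
  have "\<exists>s'. run (acts_com (Suc j) as) s1 (11 * length as + 1) s' \<and>
    (\<forall>i<length ts'. tape_rep n (B + 2) (map2 act as ts' ! i) (s' (left_reg (Suc j + i))) (s' (right_reg (Suc j + i)))) \<and>
    (\<forall>r. r < left_reg (Suc j) \<or> left_reg (Suc j + length ts') \<le> r \<longrightarrow> s' r = s1 r)"
    by (rule Cons.IH) (use Cons.prems rep1 in \<open>auto simp: ts\<close>)
  then obtain s' where s': "run (acts_com (Suc j) as) s1 (11 * length as + 1) s'"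
    "\<And>i. i < length ts' ==> tape_rep n (B + 2) (map2 act as ts' ! i) (s' (left_reg (Suc j + i))) (s' (right_reg (Suc j + i)))"
    "\<And>r. r < left_reg (Suc j) \<or> left_reg (Suc j + length ts') \<le> r ==> s' r = s1 r"
    by blast
  have keep: "s' (left_reg j) = fst ?p" "s' (right_reg j) = snd ?p"
    using s'(3)[of "left_reg j"] s'(3)[of "right_reg j"] by (simp_all add: s1_def left_reg_def right_reg_def)
  have "tape_rep n (B + 2) (map2 act (a # as) ts ! i) (s' (left_reg (j + i))) (s' (right_reg (j + i)))"
    if i: "i < length ts" for i
  proof (cases i)
    case 0
    have "tape_rep n B T (s (left_reg j)) (s (right_reg j))" using Cons.prems(3)[rule_format, of 0] by (simp add: ts)
    from tape_rep_act[OF this, of a] show ?thesis using Cons.prems(2) by (simp add: 0 ts keep)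
  next
    case (Suc i')
    then show ?thesis using s'(2)[of i'] i by (simp add: ts)
  qed
  moreover have "s' r = s r" if "r < left_reg j \<or> left_reg (j + length ts) \<le> r" for r
    using s'(3)[of r] that by (auto simp: s1_def ts left_reg_def right_reg_def)
  moreover have "run (acts_com j (a # as)) s (11 * length (a # as) + 1) s'"
    using run_Seq[OF 1 s'(1)] by simp
  ultimately show ?case by blast
qed

text \<open>Symbols are collected from the last tape to the first, so that the accumulator is in
  tape order. An empty stack reads as 0, the blank, just like the stored code 1.\<close>

fun with_reads :: "nat => nat list => (nat list => com) => com" where
  "with_reads 0 acc f = f acc"
| "with_reads (Suc j) acc f = Switch (right_reg j) (\<lambda>a. with_reads j ((a - 1) # acc) f)"

lemma run_with_reads:
  "run (f (map (\<lambda>j. peek (s (right_reg j)) - 1) [0..<j] @ acc)) s t s' ==> run (with_reads j acc f) s (j + t) s'"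
proof (induction j arbitrary: acc)
  case (Suc j)
  have "run (with_reads j ((peek (s (right_reg j)) - 1) # acc) f) s (j + t) s'"
    by (rule Suc.IH) (use Suc.prems in simp)
  then have "run (with_reads (Suc j) acc f) s (1 + (j + t)) s'" by (simp add: run_Switch[simplified])
  then show ?case by simp
qed simp

lemma wf_with_reads:
  "(\<And>rs. length rs = j + length acc ==> wf_com n S (f rs)) ==> left_reg j \<le> n ==> wf_com n S (with_reads j acc f)"
  by (induction j arbitrary: acc) (auto simp: left_reg_def right_reg_def)

text \<open>The guard makes every branch well formed, also for the symbols and states of the
  surrounding program that \<open>M\<close> does not have.\<close>

definition step_com :: "tm => com" where
  "step_com M = Switch 7 (\<lambda>q. with_reads (tapes M) [] (\<lambda>rs.
     if q - 1 < states M \<and> set rs \<subseteq> {..<syms M} then case delta M (q - 1) rs of (q', as) =>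
       Seq (Pop 7) (Seq (Push 7 (Suc q')) (acts_com 0 as)) else Skip))"

definition config_rep :: "tm => nat => config => regs => bool" where
  "config_rep M B C s \<longleftrightarrow> fst C \<le> states M \<and> s 7 = [Suc (fst C)] \<and> length (snd C) = tapes M \<and>
     (\<forall>i<tapes M. tape_rep (syms M) B (snd C ! i) (s (left_reg i)) (s (right_reg i)))"

lemma run_step_com:
  assumes M: "wf_tm M" and rep: "config_rep M B C s" and q: "fst C < states M"
  shows "\<exists>s'. run (step_com M) s (12 * tapes M + 7) s' \<and> config_rep M (B + 2) (tm_step M C) s' \<and>
    (\<forall>r. r < 7 \<or> left_reg (tapes M) \<le> r \<longrightarrow> s' r = s r)"
proof -
  obtain q ts where C: "C = (q, ts)" by force
  have len: "length ts = tapes M" and s7: "s 7 = [Suc q]" and q: "q < states M"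
    and reps: "\<And>i. i < tapes M ==> tape_rep (syms M) B (ts ! i) (s (left_reg i)) (s (right_reg i))"
    using rep q by (auto simp: config_rep_def C)
  define rs where "rs = map (\<lambda>(t, h). t h) ts"
  have head: "rs ! i = peek (s (right_reg i)) - 1" if "i < tapes M" for i
  proof -
    have "fst (ts ! i) (snd (ts ! i) + int 0) = cell (s (right_reg i)) 0" using reps[OF that] unfolding tape_rep_def by blast
    then show ?thesis using that len by (simp add: rs_def cell_peek split: prod.split) (metis fst_conv snd_conv)
  qed
  have rs_eq: "map (\<lambda>j. peek (s (right_reg j)) - 1) [0..<tapes M] @ [] = rs"
    by (rule nth_equalityI) (use head len in \<open>auto simp: rs_def\<close>)
  have "rs ! i < syms M" if "i < tapes M" for i
    using reps[OF that] head[OF that] M by (cases "s (right_reg i)") (auto simp: tape_rep_def wf_tm_def)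
  moreover have rs1: "length rs = tapes M" using len by (simp add: rs_def)
  ultimately have "x < syms M" if "x \<in> set rs" for x using that by (metis in_set_conv_nth)
  with rs1 have rs: "length rs = tapes M" "set rs \<subseteq> {..<syms M}" by auto
  obtain q' as where d: "delta M q rs = (q', as)" by force
  have as: "q' \<le> states M" "length as = tapes M" "fst ` set as \<subseteq> {..<syms M}"
    using M q rs d unfolding wf_tm_def by blast+
  have step: "tm_step M C = (q', map2 act as ts)" using q d by (simp add: C rs_def)
  define s1 where "s1 = s(7 := [Suc q'])"
  have r7: "left_reg i \<noteq> 7" "right_reg i \<noteq> 7" for i by (simp_all add: left_reg_def right_reg_def)
  have "\<exists>s'. run (acts_com 0 as) s1 (11 * length as + 1) s' \<and>
    (\<forall>i<length ts. tape_rep (syms M) (B + 2) (map2 act as ts ! i) (s' (left_reg (0 + i))) (s' (right_reg (0 + i)))) \<and>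
    (\<forall>r. r < left_reg 0 \<or> left_reg (0 + length ts) \<le> r \<longrightarrow> s' r = s1 r)"
    by (rule run_acts_com) (use as len reps r7 in \<open>auto simp: s1_def\<close>)
  then obtain s' where s': "run (acts_com 0 as) s1 (11 * tapes M + 1) s'"
    "\<And>i. i < tapes M ==> tape_rep (syms M) (B + 2) (map2 act as ts ! i) (s' (left_reg i)) (s' (right_reg i))"
    "\<And>r. r < left_reg 0 \<or> left_reg (tapes M) \<le> r ==> s' r = s1 r"
    unfolding add_0 len as(2) by blast
  have pop: "run (Pop 7) s 1 (s(7 := []))" using run_Pop[of 7 s] s7 by simp
  have push: "run (Push 7 (Suc q')) (s(7 := [])) 2 s1" using run_Push[of 7 "Suc q'" "s(7 := [])"] by (simp add: s1_def)
  define body where "body rs = (if peek (s 7) - 1 < states M \<and> set rs \<subseteq> {..<syms M} then case delta M (peek (s 7) - 1) rs of (q', as) =>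
       Seq (Pop 7) (Seq (Push 7 (Suc q')) (acts_com 0 as)) else Skip)" for rs
  have "body rs = Seq (Pop 7) (Seq (Push 7 (Suc q')) (acts_com 0 as))" using q rs d s7 by (simp add: body_def)
  then have "run (body rs) s (1 + 1 + (1 + 2 + (11 * tapes M + 1))) s'"
    using run_Seq[OF pop run_Seq[OF push s'(1)]] by simp
  then have "run (with_reads (tapes M) [] body) s (tapes M + (1 + 1 + (1 + 2 + (11 * tapes M + 1)))) s'"
    by (intro run_with_reads) (simp only: rs_eq)
  then have "run (step_com M) s (1 + (tapes M + (1 + 1 + (1 + 2 + (11 * tapes M + 1))))) s'"
    unfolding step_com_def body_def by (rule run_Switch)
  then have "run (step_com M) s (12 * tapes M + 7) s'" by (rule run_weaken) simp
  moreover have "s' 7 = [Suc q']" using s'(3)[of 7] by (simp add: s1_def left_reg_def)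
  then have "config_rep M (B + 2) (tm_step M C) s'" using s'(2) as len by (simp add: config_rep_def step)
  moreover have "s' r = s r" if "r < 7 \<or> left_reg (tapes M) \<le> r" for r
    using s'(3)[of r] that by (auto simp: s1_def left_reg_def)
  ultimately show ?thesis by blast
qed

definition machine_loop :: "tm => com" where
  "machine_loop M = While 7 (\<lambda>q. q \<noteq> Suc (states M)) (step_com M)"

lemma run_machine_loop:
  assumes M: "wf_tm M"
  shows "config_rep M B C s ==> (tm_step M ^^ t) C = (states M, ts) ==>
    \<exists>s'. run (machine_loop M) s (t * (12 * tapes M + 8) + 1) s' \<and> config_rep M (B + 2 * t) (states M, ts) s' \<and>
    (\<forall>r. r < 7 \<or> left_reg (tapes M) \<le> r \<longrightarrow> s' r = s r)"
proof (induction t arbitrary: B C s)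
  case 0
  then have "\<not> peek (s 7) \<noteq> Suc (states M)" by (simp add: config_rep_def)
  from run_While_False[of "\<lambda>q. q \<noteq> Suc (states M)" s 7, OF this, of "step_com M"] 0 show ?case
    unfolding machine_loop_def by auto
next
  case (Suc t)
  show ?case
  proof (cases "fst C < states M")
    case True
    obtain s1 where s1: "run (step_com M) s (12 * tapes M + 7) s1" "config_rep M (B + 2) (tm_step M C) s1"
      "\<And>r. r < 7 \<or> left_reg (tapes M) \<le> r ==> s1 r = s r"
      using run_step_com[OF M Suc.prems(1) True] by blast
    have "(tm_step M ^^ t) (tm_step M C) = (states M, ts)" using Suc.prems(2) by (simp add: funpow_swap1)
    from Suc.IH[OF s1(2) this] obtain s' where s': "run (machine_loop M) s1 (t * (12 * tapes M + 8) + 1) s'"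
      "config_rep M (B + 2 + 2 * t) (states M, ts) s'" "\<And>r. r < 7 \<or> left_reg (tapes M) \<le> r ==> s' r = s1 r"
      by blast
    have "peek (s 7) \<noteq> Suc (states M)" using Suc.prems(1) True by (simp add: config_rep_def)
    from run_While_True[of "\<lambda>q. q \<noteq> Suc (states M)" s 7, OF this s1(1) s'(1)[unfolded machine_loop_def]]
    have "run (machine_loop M) s (Suc t * (12 * tapes M + 8) + 1) s'"
      unfolding machine_loop_def by (rule run_weaken) simp
    then show ?thesis using s'(2,3) s1(3) by (intro exI[of _ s']) (auto simp: algebra_simps)
  next
    case False
    obtain q ts0 where C: "C = (q, ts0)" by force
    have q: "q = states M" using False Suc.prems(1) by (simp add: config_rep_def C)
    have halt: "(tm_step M ^^ t) (states M, ts0) = (states M, ts0)" for t by (induction t) auto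
    have ts: "ts0 = ts" using Suc.prems(2) halt[of "Suc t"] by (simp only: C q prod.inject)
    have "\<not> peek (s 7) \<noteq> Suc (states M)" using Suc.prems(1) by (simp add: config_rep_def C q)
    from run_While_False[of "\<lambda>q. q \<noteq> Suc (states M)" s 7, OF this, of "step_com M"]
    have "run (machine_loop M) s (Suc t * (12 * tapes M + 8) + 1) s"
      unfolding machine_loop_def by (rule run_weaken) simp
    moreover have "config_rep M (B + 2 * Suc t) (states M, ts) s"
      using Suc.prems(1) unfolding config_rep_def C q ts tape_rep_def by fastforce
    ultimately show ?thesis by blast
  qed
qed

section \<open>Loading the input and collecting the answer\<close>

definition transfer :: "(nat => nat) => nat => nat => com" where
  "transfer f r u = While r nonempty (Switch r (\<lambda>a. Seq (Pop r) (Push u (f a))))"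

lemma run_transfer:
  "0 \<notin> set (s r) ==> r \<noteq> u ==> run (transfer f r u) s (6 * length (s r) + 1) (s(r := [], u := rev (map f (s r)) @ s u))"
proof (induction "s r" arbitrary: s)
  case Nil
  then show ?case using run_While_False[of nonempty s r] by (simp add: transfer_def fun_upd_idem)
next
  case (Cons a xs)
  define s1 where "s1 = s(r := xs, u := f a # s u)"
  have a: "a \<noteq> 0" using Cons by (metis list.set_intros(1))
  have 1: "run (Seq (Pop r) (Push u (f a))) s (1 + 1 + 2) s1"
    using run_Seq[OF run_Pop[of r s] run_Push[of u "f a"]] Cons.prems by (simp add: s1_def flip: Cons.hyps(2))
  have 2: "run (Switch r (\<lambda>a. Seq (Pop r) (Push u (f a)))) s (1 + (1 + 1 + 2)) s1"
    by (rule run_Switch) (use 1 in \<open>simp flip: Cons.hyps(2)\<close>)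
  have 3: "run (transfer f r u) s1 (6 * length xs + 1) (s(r := [], u := rev (map f (a # xs)) @ s u))"
    using Cons.hyps(1)[of s1] Cons.prems by (simp add: s1_def fun_upd_twist flip: Cons.hyps(2))
  have "run (transfer f r u) s (1 + (1 + (1 + 1 + 2)) + (6 * length xs + 1)) (s(r := [], u := rev (map f (a # xs)) @ s u))"
    unfolding transfer_def
    by (rule run_While_True[OF _ 2]) (use 3 a in \<open>auto simp: transfer_def simp flip: Cons.hyps(2)\<close>)
  then show ?case unfolding Cons.hyps(2)[symmetric] by (rule run_weaken) simp
qed

text \<open>The head may stop anywhere, so the answer is looked for on both halves of the output
  tape: the code 3 of True occurs there iff the answer is True.\<close>

definition scan :: "nat => com" where
  "scan r = While r nonempty (Switch r (\<lambda>a. Seq (Pop r)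
     (if a = 3 then Switch 4 (\<lambda>f. if f = 0 then Push 4 2 else Skip) else Skip)))"

lemma run_scan:
  "0 \<notin> set (s r) ==> r \<noteq> 4 ==> s 4 = (if b then [2] else []) ==>
    run (scan r) s (7 * length (s r) + 1) (s(r := [], 4 := if b \<or> 3 \<in> set (s r) then [2] else []))"
proof (induction "s r" arbitrary: s b)
  case Nil
  have eq: "s = s(r := [], 4 := if b \<or> 3 \<in> set (s r) then [2] else [])"
    using Nil.prems(3) Nil.hyps[symmetric] by (auto simp: fun_eq_iff)
  have "run (scan r) s (7 * length (s r) + 1) s" unfolding scan_def
    by (rule run_weaken[OF run_While_False[of nonempty s r]]) (simp_all add: Nil.hyps[symmetric])
  then show ?case by (rule run_cong) (rule eq)
next
  case (Cons a xs)
  define s1 where "s1 = s(r := xs)"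
  define s2 where "s2 = s1(4 := if b \<or> a = 3 then [2] else [])"
  have a: "a \<noteq> 0" using Cons by (metis list.set_intros(1))
  have pop: "run (Pop r) s 1 s1" using run_Pop[of r s] by (simp add: s1_def flip: Cons.hyps(2))
  have s4: "s1 4 = (if b then [2] else [])" using Cons.prems by (simp add: s1_def)
  have "run (if a = 3 then Switch 4 (\<lambda>f. if f = 0 then Push 4 2 else Skip) else Skip) s1 3 s2"
  proof (cases "a = 3 \<and> \<not> b")
    case True
    have "run (Push 4 2) s1 2 s2" using run_Push[of 4 2 s1] True s4 by (simp add: s2_def)
    then have "run (if peek (s1 4) = 0 then Push 4 2 else Skip) s1 2 s2" using s4 True by simp
    from run_Switch[of "\<lambda>f. if f = 0 then Push 4 2 else Skip" s1 4, OF this]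
    have "run (Switch 4 (\<lambda>f. if f = 0 then Push 4 2 else Skip)) s1 3 s2" by (rule run_weaken) simp
    then show ?thesis using True by simp
  next
    case False
    have s2: "s2 = s1" using False s4 by (auto simp: s2_def fun_eq_iff)
    have "run (if peek (s1 4) = 0 then Push 4 2 else Skip) s1 1 s1" if "a = 3"
      using False s4 that run_Skip[of s1] by simp
    from run_weaken[OF run_Switch[of "\<lambda>f. if f = 0 then Push 4 2 else Skip" s1 4, OF this], of 3]
      run_weaken[OF run_Skip[of s1], of 3]
    show ?thesis by (auto simp: s2)
  qed
  from run_Seq[OF pop this] have "run (Switch r (\<lambda>a. Seq (Pop r)
     (if a = 3 then Switch 4 (\<lambda>f. if f = 0 then Push 4 2 else Skip) else Skip))) s (1 + (1 + 1 + 3)) s2"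
    by (intro run_Switch) (simp flip: Cons.hyps(2))
  moreover have "run (scan r) s2 (7 * length (s2 r) + 1) (s2(r := [], 4 := if (b \<or> a = 3) \<or> 3 \<in> set (s2 r) then [2] else []))"
    by (rule Cons.hyps(1)) (use Cons.prems in \<open>auto simp: s1_def s2_def simp flip: Cons.hyps(2)\<close>)
  ultimately have "run (scan r) s (1 + (1 + (1 + 1 + 3)) + (7 * length (s2 r) + 1))
      (s2(r := [], 4 := if (b \<or> a = 3) \<or> 3 \<in> set (s2 r) then [2] else []))"
    unfolding scan_def using a by (intro run_While_True) (simp_all flip: Cons.hyps(2))
  then have "run (scan r) s (7 * length (s r) + 1) (s2(r := [], 4 := if (b \<or> a = 3) \<or> 3 \<in> set (s2 r) then [2] else []))"
    by (rule run_weaken) (use Cons.prems in \<open>simp add: s1_def s2_def flip: Cons.hyps(2)\<close>)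
  then show ?case
    by (rule run_cong) (use Cons.prems in \<open>auto simp: s1_def s2_def fun_eq_iff simp flip: Cons.hyps(2)\<close>)
qed

fun clear_regs :: "nat => nat => com" where
  "clear_regs a 0 = Skip"
| "clear_regs a (Suc m) = Seq (clear a) (clear_regs (Suc a) m)"

lemma run_clear_regs:
  "(\<And>r. a \<le> r ==> r < a + m ==> 0 \<notin> set (s r) \<and> length (s r) \<le> B) ==>
    run (clear_regs a m) s (m * (2 * B + 2) + 1) (\<lambda>r. if a \<le> r \<and> r < a + m then [] else s r)"
proof (induction m arbitrary: a s)
  case 0
  have "(\<lambda>r. if a \<le> r \<and> r < a + 0 then [] else s r) = s" by (auto simp: fun_eq_iff)
  then show ?case using run_Skip[of s] by simp
next
  case (Suc m)
  have 1: "run (clear a) s (2 * B + 1) (s(a := []))"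
    using Suc.prems[of a] by (intro run_weaken[OF run_clear]) auto
  have 2: "run (clear_regs (Suc a) m) (s(a := [])) (m * (2 * B + 2) + 1)
      (\<lambda>r. if Suc a \<le> r \<and> r < Suc a + m then [] else (s(a := [])) r)"
    by (rule Suc.IH) (use Suc.prems in auto)
  have "run (clear_regs a (Suc m)) s (Suc m * (2 * B + 2) + 1)
      (\<lambda>r. if Suc a \<le> r \<and> r < Suc a + m then [] else (s(a := [])) r)"
    unfolding clear_regs.simps by (rule run_weaken[OF run_Seq[OF 1 2]]) simp
  then show ?case by (rule run_cong) (auto simp: fun_eq_iff)
qed

text \<open>The word arrives in register 5. It is reversed twice on its way to register 9, which is
  \<open>right_reg 0\<close>, and recoded from bit symbols to stored symbols; state 0 is stored as
  1. The simulation registers are emptied at the end, so that calls can be repeated.\<close>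

definition call :: "tm => com" where
  "call M = Seq (move 5 8) (Seq (transfer (\<lambda>a. if a = 1 then 2 else 3) 8 9) (Seq (Push 7 1) (Seq (machine_loop M)
     (Seq (scan (left_reg (tapes M - 1))) (Seq (scan (right_reg (tapes M - 1))) (clear_regs 7 (1 + 2 * tapes M)))))))"

lemma wf_clear_regs: "a + m \<le> n ==> wf_com n S (clear_regs a m)"
  by (induction m arbitrary: a) (auto simp: wf_clear)

lemma wf_act_com: "left_reg (Suc j) \<le> n ==> Suc (fst a) < S ==> wf_com n S (act_com j a)"
  by (auto simp: act_com_def left_reg_def right_reg_def split: prod.split move.split)

lemma wf_acts_com: "left_reg (j + length as) \<le> n ==> \<forall>a\<in>set as. Suc (fst a) < S ==> wf_com n S (acts_com j as)"
proof (induction as arbitrary: j)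
  case (Cons a as)
  have "wf_com n S (act_com j a)" by (rule wf_act_com) (use Cons.prems in \<open>auto simp: left_reg_def\<close>)
  moreover have "wf_com n S (acts_com (Suc j) as)" by (rule Cons.IH) (use Cons.prems in \<open>auto simp: left_reg_def\<close>)
  ultimately show ?case by simp
qed simp

lemma wf_call:
  assumes M: "wf_tm M" and n: "n \<ge> left_reg (tapes M)" and S: "S \<ge> 4" "S \<ge> syms M + 2" "S \<ge> states M + 2"
  shows "wf_com n S (call M)"
proof -
  have k: "tapes M \<ge> 1" using M by (simp add: wf_tm_def)
  have n10: "n \<ge> 10" using n k by (simp add: left_reg_def)
  have "wf_com n S (step_com M)"
    unfolding step_com_def wf_com.simps
  proof (intro conjI allI impI wf_with_reads n)
    fix q and rs :: "nat list" assume "length rs = tapes M + length []"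
    then have len: "length rs = tapes M" by simp
    show "wf_com n S (if q - 1 < states M \<and> set rs \<subseteq> {..<syms M} then case delta M (q - 1) rs of (q', as) =>
       Seq (Pop 7) (Seq (Push 7 (Suc q')) (acts_com 0 as)) else Skip)"
    proof (cases "q - 1 < states M \<and> set rs \<subseteq> {..<syms M}")
      case True
      obtain q' as where d: "delta M (q - 1) rs = (q', as)" by force
      have as: "q' \<le> states M" "length as = tapes M" "fst ` set as \<subseteq> {..<syms M}"
        using M True len d unfolding wf_tm_def by blast+
      have "wf_com n S (acts_com 0 as)" by (rule wf_acts_com) (use as n S in auto)
      then show ?thesis using True d as n10 S by simp
    next
      case False
      show ?thesis unfolding if_not_P[OF False] by simp
    qed
  qed (use n10 in simp)
  moreover have "left_reg (tapes M - 1) < n" "right_reg (tapes M - 1) < n"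
    using n k by (simp_all add: left_reg_def right_reg_def)
  moreover have "7 + (1 + 2 * tapes M) \<le> n" using n by (simp add: left_reg_def)
  ultimately show ?thesis using n10 S
    by (simp add: call_def machine_loop_def transfer_def scan_def wf_move wf_clear_regs del: clear_regs.simps)
qed

lemma output_symbol:
  assumes rep: "tape_rep n B T l r" and T: "fst T = tape_of [b]"
  shows "3 \<in> set l \<union> set r \<longleftrightarrow> b"
proof -
  have "3 \<in> set l \<union> set r \<longleftrightarrow> (\<exists>i. cell l i = 2 \<or> cell r i = 2)"
  proof
    assume "3 \<in> set l \<union> set r"
    then obtain i where "i < length l \<and> l ! i = 3 \<or> i < length r \<and> r ! i = 3" by (metis Un_iff in_set_conv_nth)
    then have "cell l i = 2 \<or> cell r i = 2" by (auto simp: cell_def)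
    then show "\<exists>i. cell l i = 2 \<or> cell r i = 2" by blast
  next
    assume "\<exists>i. cell l i = 2 \<or> cell r i = 2"
    then obtain i where "cell l i = 2 \<or> cell r i = 2" by blast
    then have "i < length l \<and> l ! i = 3 \<or> i < length r \<and> r ! i = 3" by (auto simp: cell_def split: if_splits)
    then show "3 \<in> set l \<union> set r" by (metis UnCI nth_mem)
  qed
  also have "\<dots> \<longleftrightarrow> (\<exists>z. fst T z = 2)"
  proof
    assume "\<exists>i. cell l i = 2 \<or> cell r i = 2"
    then show "\<exists>z. fst T z = 2" using rep unfolding tape_rep_def by metis
  next
    assume "\<exists>z. fst T z = 2"
    then obtain z where z: "fst T z = 2" by blast
    show "\<exists>i. cell l i = 2 \<or> cell r i = 2"
    proof (cases "snd T \<le> z")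
      case True
      then have "z = snd T + int (nat (z - snd T))" by simp
      then show ?thesis using z rep unfolding tape_rep_def by metis
    next
      case False
      then have "z = snd T - 1 - int (nat (snd T - 1 - z))" by simp
      then show ?thesis using z rep unfolding tape_rep_def by metis
    qed
  qed
  also have "\<dots> \<longleftrightarrow> b"
  proof
    assume "\<exists>z. fst T z = 2"
    then show b unfolding T tape_of_def by (auto split: if_splits)
  next
    assume b
    then have "fst T 0 = 2" unfolding T tape_of_def by simp
    then show "\<exists>z. fst T z = 2" by blast
  qed
  finally show ?thesis .
qed

theorem run_call:
  assumes M: "wf_tm M" and comp: "computes_within M w [b] t" and s5: "s 5 = map bit_sym w"
    and s4: "s 4 = []" and high: "\<forall>r\<ge>7. s r = []"
  shows "run (call M) s (100 * (tapes M + 1) * (t + length w + 1)) (s(5 := [], 4 := if b then [2] else []))"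
proof -
  define k where "k = tapes M"
  have k: "k \<ge> 1" using M by (simp add: wf_tm_def k_def)
  obtain ts where ts: "(tm_step M ^^ t) (init_config M w) = (states M, ts)" "fst (last ts) = tape_of [b]"
    using comp unfolding computes_within_def by blast
  define s1 where "s1 = s(5 := [], 8 := rev (map bit_sym w))"
  define s2 where "s2 = s(5 := [], 9 := map (\<lambda>x. if x then 3 else 2) w)"
  define s3 where "s3 = s2(7 := [1])"
  have pos: "0 \<notin> set (map bit_sym w)" by (auto simp: bit_sym_def)
  have e1: "run (move 5 8) s (6 * length w + 1) s1"
    using run_move[of s 5 8] s5 pos high by (simp add: s1_def)
  have "map (\<lambda>a. if a = 1 then 2 else 3) (map bit_sym w) = map (\<lambda>x. if x then 3 else (2::nat)) w" by (auto simp: bit_sym_def)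
  then have e2: "run (transfer (\<lambda>a. if a = 1 then 2 else 3) 8 9) s1 (6 * length w + 1) s2"
    using run_transfer[of s1 8 9 "\<lambda>a. if a = 1 then 2 else 3"] pos high
    by (intro run_cong[OF run_weaken[OF run_transfer]]) (auto simp: s1_def s2_def rev_map fun_eq_iff)
  have e3: "run (Push 7 1) s2 2 s3" using run_Push[of 7 1 s2] high by (simp add: s2_def s3_def)
  have "config_rep M (length w) (init_config M w) s3"
    unfolding config_rep_def
  proof (intro conjI allI impI)
    fix i assume i: "i < tapes M"
    have n3: "syms M \<ge> 3" using M by (simp add: wf_tm_def)
    show "tape_rep (syms M) (length w) (snd (init_config M w) ! i) (s3 (left_reg i)) (s3 (right_reg i))"
    proof (cases i)
      case 0
      have "s3 (left_reg i) = []" "s3 (right_reg i) = map (\<lambda>x. if x then 3 else 2) w"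
        using high by (simp_all add: 0 s3_def s2_def left_reg_def right_reg_def)
      then show ?thesis using n3 by (auto simp: tape_rep_def init_config_def 0 tape_of_def cell_def)
    next
      case (Suc i')
      have "s3 (left_reg i) = []" "s3 (right_reg i) = []"
        using high by (simp_all add: Suc s3_def s2_def left_reg_def right_reg_def)
      then show ?thesis using i by (auto simp: tape_rep_def init_config_def Suc)
    qed
  qed (use M in \<open>auto simp: init_config_def s3_def wf_tm_def\<close>)
  from run_machine_loop[OF M this ts(1)] obtain s4 where
    e4: "run (machine_loop M) s3 (t * (12 * k + 8) + 1) s4" and rep: "config_rep M (length w + 2 * t) (states M, ts) s4"
    and frame: "\<And>r. r < 7 \<or> left_reg k \<le> r ==> s4 r = s3 r"
    unfolding k_def by blast
  define B where "B = length w + 2 * t"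
  define l where "l = s4 (left_reg (k - 1))"
  define r where "r = s4 (right_reg (k - 1))"
  have reps: "tape_rep (syms M) B (ts ! i) (s4 (left_reg i)) (s4 (right_reg i))" if "i < k" for i
    using rep that unfolding config_rep_def B_def k_def by simp
  have "length ts = k" using rep by (simp add: config_rep_def k_def)
  then have "last ts = ts ! (k - 1)" using k by (subst last_conv_nth) auto
  then have out: "3 \<in> set l \<union> set r \<longleftrightarrow> b"
    using output_symbol[OF reps[of "k - 1"]] ts(2) k unfolding l_def r_def by simp
  have lr: "0 \<notin> set l" "0 \<notin> set r" "length l \<le> B" "length r \<le> B"
    using reps[of "k - 1"] k unfolding tape_rep_def l_def r_def by auto
  define s5 where "s5 = s4(left_reg (k - 1) := [], 4 := if 3 \<in> set l then [2] else [])"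
  define s6 where "s6 = s5(right_reg (k - 1) := [], 4 := if b then [2] else [])"
  have ne4: "left_reg (k - 1) \<noteq> 4" "right_reg (k - 1) \<noteq> 4" by (simp_all add: left_reg_def right_reg_def)
  have s44: "s4 4 = []" using frame[of 4] assms(4) by (simp add: s3_def s2_def)
  have e5: "run (scan (left_reg (k - 1))) s4 (7 * B + 1) s5"
    using run_scan[of s4 "left_reg (k - 1)" False] lr ne4 s44
    by (intro run_weaken[OF run_cong[OF run_scan[of s4 "left_reg (k - 1)" False]]]) (auto simp: s5_def l_def)
  have "s5 (right_reg (k - 1)) = r" using ne4 by (simp add: s5_def r_def)
  then have e6: "run (scan (right_reg (k - 1))) s5 (7 * B + 1) s6"
    using lr ne4 out
    by (intro run_weaken[OF run_cong[OF run_scan[of s5 "right_reg (k - 1)" "3 \<in> set l"]]]) (auto simp: s5_def s6_def)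
  have regs: "0 \<notin> set (s6 x) \<and> length (s6 x) \<le> B + 1" if x: "7 \<le> x" "x < 7 + (1 + 2 * k)" for x
  proof (cases "x = 7")
    case True
    have "s6 7 = s4 7" by (simp add: s6_def s5_def left_reg_def right_reg_def)
    then show ?thesis using rep True by (simp add: config_rep_def)
  next
    case False
    then have "\<exists>i<k. x = left_reg i \<or> x = right_reg i"
      using x unfolding left_reg_def right_reg_def by presburger
    then obtain i where i: "i < k" "x = left_reg i \<or> x = right_reg i" by blast
    have "s6 x = [] \<or> s6 x = s4 x" using x by (simp add: s6_def s5_def)
    then show ?thesis using reps[OF i(1)] i(2) unfolding tape_rep_def by auto
  qed
  have e7: "run (clear_regs 7 (1 + 2 * k)) s6 ((1 + 2 * k) * (2 * (B + 1) + 2) + 1)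
      (\<lambda>r. if 7 \<le> r \<and> r < 7 + (1 + 2 * k) then [] else s6 r)"
    by (rule run_clear_regs) (use regs in auto)
  have final: "(\<lambda>r. if 7 \<le> r \<and> r < 7 + (1 + 2 * k) then [] else s6 r) = s(5 := [], 4 := if b then [2] else [])"
  proof
    fix x
    show "(if 7 \<le> x \<and> x < 7 + (1 + 2 * k) then [] else s6 x) = (s(5 := [], 4 := if b then [2] else [])) x"
    proof (cases "7 \<le> x \<and> x < 7 + (1 + 2 * k)")
      case True
      then show ?thesis using high by simp
    next
      case False
      then have x: "x < 7 \<or> left_reg k \<le> x" by (auto simp: left_reg_def)
      then have "x \<noteq> left_reg (k - 1)" "x \<noteq> right_reg (k - 1)" using k by (auto simp: left_reg_def right_reg_def)
      then have "s6 x = (if x = 4 then if b then [2] else [] else s3 x)" using frame[OF x] by (simp add: s6_def s5_def)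
      moreover have "s3 x = (s(5 := [])) x" using x k by (auto simp: s3_def s2_def left_reg_def)
      ultimately show ?thesis unfolding if_not_P[OF False] by auto
    qed
  qed
  have "run (call M) s (1 + (6 * length w + 1) + (1 + (6 * length w + 1) + (1 + 2 + (1 + (t * (12 * k + 8) + 1) +
      (1 + (7 * B + 1) + (1 + (7 * B + 1) + ((1 + 2 * k) * (2 * (B + 1) + 2) + 1))))))) (s(5 := [], 4 := if b then [2] else []))"
    unfolding call_def k_def[symmetric]
    by (rule run_Seq[OF e1 run_Seq[OF e2 run_Seq[OF e3 run_Seq[OF e4 run_Seq[OF e5 run_Seq[OF e6 e7[unfolded final]]]]]]])
  then show ?thesis
    by (rule run_weaken) (simp add: B_def k_def[symmetric] algebra_simps)
qed

section \<open>An algorithm for 3-SAT\<close>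

subsection \<open>Registers holding words\<close>

definition mem :: "bool list list => regs" where
  "mem xs r = (if r < length xs then map bit_sym (xs ! r) else [])"

definition words :: "bool list list => nat => bool list" where
  "words xs r = (if r < length xs then xs ! r else [])"

text \<open>The seven program registers: 0 the input and the final answer, 1 the number of variables
  in unary, 2 the current clause, 3 the worklist, 4 a flag, 5 the graph passed to the subroutine, 6
  the current literal.\<close>

definition fits :: "nat => bool list list => bool" where
  "fits B xs \<longleftrightarrow> length xs = 7 \<and> (\<forall>y\<in>set xs. length y \<le> B)"

definition assigner :: "com => (nat => nat) => nat => (bool list list => bool list) => bool" where
  "assigner c p r f \<longleftrightarrow> (\<forall>B xs. fits B xs \<longrightarrow> run c (mem xs) (p B) (mem (xs[r := f xs])))"

definition assignable :: "nat => (bool list list => bool list) => bool" where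
  "assignable r f \<longleftrightarrow> (\<exists>c p N. polyb p \<and> mono p \<and> (\<forall>n\<ge>N. \<forall>S\<ge>3. wf_com n S c) \<and> assigner c p r f)"

lemma mem_update: "r < length xs ==> (mem xs)(r := map bit_sym y) = mem (xs[r := y])"
  by (auto simp: mem_def fun_eq_iff nth_list_update)

lemma bit_sym_eq_2: "bit_sym b = 2 \<longleftrightarrow> b"
  by (simp add: bit_sym_def)

lemma pos_regs_mem: "pos_regs (mem xs)"
  by (auto simp: pos_regs_def mem_def bit_sym_def)

lemma reg_bits_mem: "reg_bits (mem xs) = words xs"
  by (auto simp: fun_eq_iff reg_bits_def mem_def words_def bit_sym_eq_2 comp_def)

lemma assignableI:
  assumes "definable 7 l" "definableP 7 P" "r < 7"
    "\<And>xs. length xs = 7 ==> f xs = map (\<lambda>i. P (words xs) (case_nat i (\<lambda>_. 0))) [0..<l (words xs) (\<lambda>_. 0)]"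
  shows "assignable r f"
proof -
  obtain c p N where c: "polyb p" "mono p" "\<forall>n\<ge>N. \<forall>S\<ge>3. wf_com n S c"
    "\<And>s M. (\<forall>r\<ge>7. s r = []) \<and> pos_regs s \<and> (\<forall>r<7. length (s r) \<le> M) ==>
      run c s (p M) (s(r := map (\<lambda>i. bit_sym (P (reg_bits s) (case_nat i (\<lambda>_. 0))))
        [0..<l (reg_bits s) (\<lambda>_. 0)])) \<and> l (reg_bits s) (\<lambda>_. 0) \<le> p M"
    using assign_exists[OF assms(1-3)] by blast
  have "assigner c p r f"
    unfolding assigner_def
  proof (intro allI impI)
    fix B xs assume fits: "fits B xs"
    then have len: "length xs = 7" by (simp add: fits_def)
    have "(\<forall>r\<ge>7. mem xs r = []) \<and> pos_regs (mem xs) \<and> (\<forall>r<7. length (mem xs r) \<le> B)"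
      using fits pos_regs_mem by (auto simp: mem_def fits_def)
    from c(4)[OF this] have "run c (mem xs) (p B) ((mem xs)(r := map bit_sym (f xs)))"
      by (simp add: reg_bits_mem assms(4)[OF len] comp_def)
    then show "run c (mem xs) (p B) (mem (xs[r := f xs]))" using mem_update len assms(3) by simp
  qed
  then show ?thesis using c unfolding assignable_def by blast
qed

lemma assigner_clear: "r < 7 ==> assigner (clear r) (\<lambda>B. 2 * B + 1) r (\<lambda>_. [])"
  unfolding assigner_def
proof (intro allI impI)
  fix B xs assume r: "r < 7" and fits: "fits B xs"
  have "run (clear r) (mem xs) (2 * length (mem xs r) + 1) ((mem xs)(r := []))"
    by (rule run_clear) (use pos_regs_mem in \<open>simp add: pos_regs_def\<close>)
  moreover have "length (mem xs r) \<le> B" using fits r by (auto simp: mem_def fits_def)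
  ultimately have "run (clear r) (mem xs) (2 * B + 1) ((mem xs)(r := map bit_sym []))" by (auto elim: run_weaken)
  then show "run (clear r) (mem xs) (2 * B + 1) (mem (xs[r := []]))"
    using mem_update[of r xs "[]"] fits r by (simp add: fits_def)
qed

lemma assigner_mono: "assigner c p r f ==> (\<And>B. p B \<le> q B) ==> assigner c q r f"
  unfolding assigner_def using run_weaken by meson

lemma assignerD: "assigner c p r f ==> fits B xs ==> xs[r := f xs] = ys ==> run c (mem xs) (p B) (mem ys)"
  unfolding assigner_def by blast

lemma run_Pop_mem: "r < length xs ==> xs[r := tl (xs ! r)] = ys ==> run (Pop r) (mem xs) 1 (mem ys)"
  using run_Pop[of r "mem xs"] mem_update[of r xs "tl (xs ! r)"] by (simp add: mem_def map_tl)

lemma run_Push_mem: "r < length xs ==> xs[r := True # xs ! r] = ys ==> run (Push r 2) (mem xs) 2 (mem ys)"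
  using run_Push[of r 2 "mem xs"] mem_update[of r xs "True # xs ! r"] by (simp add: mem_def bit_sym_def)

lemma peek_mem: "r < length xs ==> peek (mem xs r) = (case xs ! r of [] => 0 | b # _ => bit_sym b)"
  by (auto simp: mem_def split: list.split)

subsection \<open>Operations on families\<close>

definition num_lits :: "nat => nat" where
  "num_lits n = 2 * (n + 3)"

definition block_size :: "nat => nat" where
  "block_size n = num_lits n * num_lits n * num_lits n"

definition mark :: "nat => nat set => bool list" where
  "mark n A = map (\<lambda>l. l \<in> A) [0..<num_lits n]"

definition padded :: "nat => bool list => nat => bool" where
  "padded n C l \<longleftrightarrow> bit_at C l \<or> 2 * n \<le> l \<and> l mod 2 = 1"

definition clause_bit :: "nat => bool list => nat => nat => nat => bool" where
  "clause_bit n C a b c \<longleftrightarrow> card3 a b c = 3 \<and> (\<forall>l<num_lits n. bit_at C l \<longrightarrow> l = a \<or> l = b \<or> l = c) \<and>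
     padded n C a \<and> padded n C b \<and> padded n C c"

definition add_clause :: "nat => bool list => bool list => bool list" where
  "add_clause n C W = map (\<lambda>i. bit_at W i \<or> clause_bit n C (i mod num_lits n) (i div num_lits n mod num_lits n)
     (i div num_lits n div num_lits n)) [0..<block_size n]"

definition entry :: "nat => bool list => nat => nat => nat => bool" where
  "entry U W a b c \<longleftrightarrow> bit_at W ((c * U + b) * U + a)"

text \<open>With t = 27 * lo, the threshold 54 * lo * lo is 2 * t * lo, so both terms of the minimum
  in \<open>flower_step\<close> agree.\<close>

definition flower :: "nat => nat => bool list => bool" where
  "flower lo n W \<longleftrightarrow> has_flower (num_lits n) lo (54 * lo * lo) (entry (num_lits n) W)"

definition the_flower :: "nat => nat => bool list => nat" where
  "the_flower lo n W = first_flower (num_lits n) lo (54 * lo * lo) (entry (num_lits n) W)"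

text \<open>The first block of the worklist is replaced by two, hence the rest moves up by one
  block.\<close>

definition branch_bit :: "nat => nat => bool list => nat => bool" where
  "branch_bit lo n W i \<longleftrightarrow>
     (if i < block_size n then heart_bit (num_lits n) (entry (num_lits n) W) (the_flower lo n W)
        (i mod num_lits n) (i div num_lits n mod num_lits n) (i div num_lits n div num_lits n)
      else if i < block_size n + block_size n then petals_bit (num_lits n) (entry (num_lits n) W) (the_flower lo n W)
        ((i - block_size n) mod num_lits n) ((i - block_size n) div num_lits n mod num_lits n)
        ((i - block_size n) div num_lits n div num_lits n)
      else bit_at W (i - block_size n))"

definition branch :: "nat => nat => bool list => bool list" where
  "branch lo n W = map (branch_bit lo n W) [0..<block_size n + length W]"

text \<open>27 times the bound of \<open>no_flower_sparse\<close>, since a set of at most three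
  literals occurs under at most 27 indices of a block. It is linear in n.\<close>

definition leaf_clauses :: "nat => nat => nat" where
  "leaf_clauses lo n = 27 * (num_lits n * (1 + 27 * lo + 27 * (54 * lo * lo)))"

definition leaf_graph :: "nat => nat => nat => bool list => nat pair_pre_digraph" where
  "leaf_graph k lo n W = cnf_graph k (n + 3) (leaf_clauses lo n + 3) (leaf_lit n (bit_at W))"

lemma block_size_pos: "0 < block_size n"
  by (simp add: block_size_def num_lits_def)

lemma map_upt_add: "map f [0..<m + n] = map f [0..<m] @ map (\<lambda>i. f (i + m)) [0..<n]"
  by (rule nth_equalityI) (auto simp: nth_append)

lemma bit_at_mark: "bit_at (mark n A) l \<longleftrightarrow> l < num_lits n \<and> l \<in> A"
  by (auto simp: bit_at_def mark_def)

lemma entry_block: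
  "a < U ==> b < U ==> c < U ==> entry U (block U F @ w) a b c \<longleftrightarrow> {a, b, c} \<in> F"
  unfolding entry_def by (rule bit_at_block)

lemma add_clause_block:
  assumes C: "\<And>b v. (b, v) \<in> set C ==> v < n"
  shows "add_clause n (mark n (lit_num ` set C)) (block (num_lits n) (start_family n F)) =
    block (num_lits n) (start_family n (F @ [C]))"
  unfolding add_clause_def block_size_def
proof (rule blockI)
  define U where "U = num_lits n"
  let ?C = "mark n (lit_num ` set C)"
  fix a b c assume abc: "a < num_lits n" "b < num_lits n" "c < num_lits n"
  let ?i = "(c * num_lits n + b) * num_lits n + a"
  note dig = triple_index(2-4)[OF abc]
  have "l < 2 * n" if "l \<in> lit_num ` set C" for l using that C by (fastforce simp: of_bool_def)
  then have Cl: "l < U" if "l \<in> lit_num ` set C" for l using that unfolding U_def num_lits_def by fastforce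
  have bit: "bit_at ?C l \<longleftrightarrow> l \<in> lit_num ` set C" for l using Cl by (auto simp: bit_at_mark U_def)
  have "{a, b, c} \<in> start_family n (F @ [C]) \<longleftrightarrow> {a, b, c} \<in> start_family n F \<or>
      ({a, b, c} \<subseteq> {..<2 * (n + 3)} \<and> card {a, b, c} = 3 \<and> lit_num ` set C \<subseteq> {a, b, c} \<and>
       (\<forall>l\<in>{a, b, c}. l \<in> lit_num ` set C \<or> 2 * n \<le> l \<and> l mod 2 = 1))"
  proof -
    have ex: "(\<exists>x\<in>set (F @ [C]). Q x) \<longleftrightarrow> (\<exists>x\<in>set F. Q x) \<or> Q C" for Q by auto
    show ?thesis unfolding start_family_def mem_Collect_eq ex by (simp only: conj_disj_distribL)
  qed
  also have "({a, b, c} \<subseteq> {..<2 * (n + 3)} \<and> card {a, b, c} = 3 \<and> lit_num ` set C \<subseteq> {a, b, c} \<and>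
       (\<forall>l\<in>{a, b, c}. l \<in> lit_num ` set C \<or> 2 * n \<le> l \<and> l mod 2 = 1)) \<longleftrightarrow> clause_bit n ?C a b c"
  proof -
    have "{a, b, c} \<subseteq> {..<2 * (n + 3)}" using abc by (simp add: num_lits_def)
    moreover have "lit_num ` set C \<subseteq> {a, b, c} \<longleftrightarrow> (\<forall>l<num_lits n. bit_at ?C l \<longrightarrow> l = a \<or> l = b \<or> l = c)"
      unfolding bit using Cl unfolding U_def by blast
    moreover have "(\<forall>l\<in>{a, b, c}. R l) \<longleftrightarrow> R a \<and> R b \<and> R c" for R by auto
    ultimately show ?thesis unfolding clause_bit_def padded_def bit card3 by (simp only: simp_thms)
  qed
  also have "{a, b, c} \<in> start_family n F \<longleftrightarrow> bit_at (block (num_lits n) (start_family n F)) ?i"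
    using bit_at_block[OF abc, of "start_family n F" "[]"] by simp
  finally show "(bit_at (block (num_lits n) (start_family n F)) ?i \<or>
      clause_bit n ?C (?i mod num_lits n) (?i div num_lits n mod num_lits n) (?i div num_lits n div num_lits n)) \<longleftrightarrow>
      {a, b, c} \<in> start_family n (F @ [C])"
    unfolding dig by blast
qed

lemma branch_block:
  assumes inv: "sparse_inv (num_lits n) (27 * lo) F" and fl: "flower lo n (block (num_lits n) F @ w)" and lo: "1 \<le> lo"
  shows "\<exists>H s. good_flower (27 * lo) lo (54 * lo * lo) F H s \<and> branch lo n (block (num_lits n) F @ w) =
    block (num_lits n) (refine F {H}) @ block (num_lits n) (refine F (petals F H s)) @ w"
proof -
  define U where "U = num_lits n"
  define W where "W = block U F @ w"
  define f where "f = the_flower lo n W"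
  define H where "H = {f div U mod U, f mod U}"
  define s :: nat where "s = (if f div U div U = 0 then 2 else 3)"
  have F: "family U F" using inv by (simp add: sparse_inv_def U_def)
  have m: "a < U ==> b < U ==> c < U ==> entry U W a b c \<longleftrightarrow> {a, b, c} \<in> F" for a b c
    unfolding W_def by (rule entry_block)
  have good: "good_flower (27 * lo) lo (54 * lo * lo) F H s"
    using first_flower_good[of U F "entry U W" lo "54 * lo * lo", OF F m] fl lo
    unfolding flower_def U_def[symmetric] W_def[symmetric] H_def s_def f_def the_flower_def by blast
  have "sparse_inv U (27 * lo) (refine F (petals F H s))"
    using flower_step(2)[OF inv good] lo by (simp add: U_def)
  then have pet: "family U (petals F H s)" by (auto simp: sparse_inv_def family_def refine_def)
  have len: "length W = block_size n + length w" by (simp add: W_def block_size_def U_def)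
  have digits: "a < U ==> b < U ==> c < U ==> (c * U + b) * U + a < block_size n" for a b c
    using triple_index(1)[of a U b c] by (simp add: block_size_def U_def)
  have 1: "map (branch_bit lo n W) [0..<block_size n] = block U (refine F {H})"
    unfolding block_size_def U_def[symmetric]
  proof (rule blockI)
    fix a b c assume abc: "a < U" "b < U" "c < U"
    show "branch_bit lo n W ((c * U + b) * U + a) \<longleftrightarrow> {a, b, c} \<in> refine F {H}"
      unfolding branch_bit_def U_def[symmetric] f_def[symmetric] if_P[OF digits[OF abc]] triple_index[OF abc] H_def
      by (rule heart_bit[of "entry U W" a b c F U f, OF m[OF abc]])
  qed
  have 2: "map (\<lambda>i. branch_bit lo n W (i + block_size n)) [0..<block_size n] = block U (refine F (petals F H s))"
    unfolding block_size_def[of n] U_def[symmetric]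
  proof (rule blockI)
    fix a b c assume abc: "a < U" "b < U" "c < U"
    have "branch_bit lo n W ((c * U + b) * U + a + block_size n) \<longleftrightarrow> petals_bit U (entry U W) f a b c"
      unfolding branch_bit_def U_def[symmetric] f_def[symmetric] add_diff_cancel_right' triple_index[OF abc]
      using digits[OF abc] by simp
    also have "\<dots> \<longleftrightarrow> {a, b, c} \<in> refine F (petals F H s)"
      unfolding H_def s_def by (rule petals_bit[OF F m abc pet[unfolded H_def s_def]])
    finally show "branch_bit lo n W ((c * U + b) * U + a + U * U * U) \<longleftrightarrow> {a, b, c} \<in> refine F (petals F H s)"
      by (simp add: block_size_def U_def)
  qed
  have 3: "map (\<lambda>i. branch_bit lo n W (i + block_size n + block_size n)) [0..<length w] = w"
    by (rule nth_equalityI) (auto simp: branch_bit_def bit_at_def len, auto simp: W_def nth_append block_size_def U_def)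
  have "branch lo n W = block U (refine F {H}) @ block U (refine F (petals F H s)) @ w"
    unfolding branch_def len map_upt_add 1 2 using 3 by (simp add: add.assoc)
  then show ?thesis using good unfolding W_def U_def by blast
qed

lemma leaf_graph_hom:
  assumes inv: "sparse_inv (num_lits n) t F" and fl: "\<not> flower lo n (block (num_lits n) F @ w)" and k: "k \<ge> 2"
  shows "hom_exists (cycle_graph (2 * k + 1)) (leaf_graph k lo n (block (num_lits n) F @ w)) \<longleftrightarrow> dummy_sat n F"
proof -
  let ?U = "num_lits n" and ?W = "block (num_lits n) F @ w"
  have F: "family ?U F" using inv by (simp add: sparse_inv_def)
  have "card F \<le> ?U * (1 + 27 * lo + 27 * (54 * lo * lo))"
    by (rule no_flower_sparse[of ?U F "entry ?U ?W", OF F entry_block]) (use fl in \<open>auto simp: flower_def\<close>)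
  then have c: "27 * card F \<le> leaf_clauses lo n" unfolding leaf_clauses_def by (rule mult_le_mono2)
  have P: "bit_at ?W i \<longleftrightarrow> {i mod ?U, i div ?U mod ?U, i div ?U div ?U} \<in> F" if "i < ?U * ?U * ?U" for i
    using bit_at_block[OF triple_digits(1-3)[OF that], of F w] unfolding triple_digits(4)[OF that] .
  have "hom_exists (cycle_graph (2 * k + 1)) (leaf_graph k lo n ?W) \<longleftrightarrow> sat3 (leaf_clauses lo n + 3) (leaf_lit n (bit_at ?W))"
    unfolding leaf_graph_def by (rule cnf_graph_hom_iff[OF k]) (intro allI impI leaf_lit_less)
  also have "\<dots> \<longleftrightarrow> dummy_sat n F" by (rule leaf_sat[OF F num_lits_def c P])
  finally show ?thesis .
qed

subsection \<open>Definability of the operations\<close>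

lemma def_num_lits: "definable b (\<lambda>R \<sigma>. f R) ==> definable b (\<lambda>R \<sigma>. num_lits (f R))"
  unfolding num_lits_def by (intro def_intros)

lemma def_block_size: "definable b (\<lambda>R \<sigma>. f R) ==> definable b (\<lambda>R \<sigma>. block_size (f R))"
  unfolding block_size_def by (intro def_intros def_num_lits)

lemma def_n: "definable 7 (\<lambda>R \<sigma>. length (R 1))"
  by (intro def_intros) simp

lemmas def_U = def_num_lits[OF def_n]
lemmas def_B = def_block_size[OF def_n]

lemma def_entry: "definableP 7 (\<lambda>R \<sigma>. entry (num_lits (length (R 1))) (R 3) (\<sigma> 0) (\<sigma> 1) (\<sigma> 2))"
  unfolding entry_def by (intro def_intros def_U) simp

lemma assignable_zero: "assignable 3 (\<lambda>xs. block (num_lits (length (xs ! 1))) {})"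
proof (rule assignableI[of "\<lambda>R \<sigma>. block_size (length (R 1))" "\<lambda>R \<sigma>. 0 < (0::nat)"])
  show "definableP 7 (\<lambda>R \<sigma>. 0 < (0::nat))" by (intro def_intros)
  show "definable 7 (\<lambda>R \<sigma>. block_size (length (R 1)))" by (rule def_B)
qed (auto simp: words_def block_def block_size_def)

lemma assignable_mark_empty: "assignable 2 (\<lambda>xs. mark (length (xs ! 1)) {})"
proof (rule assignableI[of "\<lambda>R \<sigma>. num_lits (length (R 1))" "\<lambda>R \<sigma>. 0 < (0::nat)"])
  show "definableP 7 (\<lambda>R \<sigma>. 0 < (0::nat))" by (intro def_intros)
  show "definable 7 (\<lambda>R \<sigma>. num_lits (length (R 1)))" by (rule def_U)
qed (auto simp: words_def mark_def)

lemma assignable_add_clause: "assignable 3 (\<lambda>xs. add_clause (length (xs ! 1)) (xs ! 2) (xs ! 3))"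
proof (rule assignableI[of "\<lambda>R \<sigma>. block_size (length (R 1))" "\<lambda>R \<sigma>. bit_at (R 3) (\<sigma> 0) \<or>
    clause_bit (length (R 1)) (R 2) (\<sigma> 0 mod num_lits (length (R 1)))
      (\<sigma> 0 div num_lits (length (R 1)) mod num_lits (length (R 1)))
      (\<sigma> 0 div num_lits (length (R 1)) div num_lits (length (R 1)))"])
  show "definableP 7 (\<lambda>R \<sigma>. bit_at (R 3) (\<sigma> 0) \<or>
    clause_bit (length (R 1)) (R 2) (\<sigma> 0 mod num_lits (length (R 1)))
      (\<sigma> 0 div num_lits (length (R 1)) mod num_lits (length (R 1)))
      (\<sigma> 0 div num_lits (length (R 1)) div num_lits (length (R 1))))"
    unfolding clause_bit_def padded_def by (intro def_intros def_card3 def_U def_n) simp_all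
  show "definable 7 (\<lambda>R \<sigma>. block_size (length (R 1)))" by (rule def_B)
qed (auto simp: words_def add_clause_def)

lemma assignable_literal:
  "assignable 2 (\<lambda>xs. map (\<lambda>i. bit_at (xs ! 2) i \<or> i = length (xs ! 6)) [0..<num_lits (length (xs ! 1))])"
proof (rule assignableI[of "\<lambda>R \<sigma>. num_lits (length (R 1))" "\<lambda>R \<sigma>. bit_at (R 2) (\<sigma> 0) \<or> \<sigma> 0 = length (R 6)"])
  show "definableP 7 (\<lambda>R \<sigma>. bit_at (R 2) (\<sigma> 0) \<or> \<sigma> 0 = length (R 6))" by (intro def_intros) simp_all
  show "definable 7 (\<lambda>R \<sigma>. num_lits (length (R 1)))" by (rule def_U)
qed (auto simp: words_def)

lemma assignable_flower: "assignable 4 (\<lambda>xs. [flower lo (length (xs ! 1)) (xs ! 3)])"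
proof (rule assignableI[of "\<lambda>R \<sigma>. 1" "\<lambda>R \<sigma>. flower lo (length (R 1)) (R 3)"])
  show "definableP 7 (\<lambda>R \<sigma>. flower lo (length (R 1)) (R 3))"
    unfolding flower_def by (rule def_branches(1)[OF def_U def_entry])
qed (auto simp: words_def intro: def_intros)

lemma assignable_branch: "assignable 3 (\<lambda>xs. branch lo (length (xs ! 1)) (xs ! 3))"
proof (rule assignableI[of "\<lambda>R \<sigma>. block_size (length (R 1)) + length (R 3)" "\<lambda>R \<sigma>. branch_bit lo (length (R 1)) (R 3) (\<sigma> 0)"])
  note hb = def_branches(2)[OF def_U def_entry, of lo "54 * lo * lo", folded the_flower_def]
  note pb = def_branches(3)[OF def_U def_entry, of lo "54 * lo * lo", folded the_flower_def]
  note hb' = def_comp3[of 7 "\<lambda>R a b c. of_bool (heart_bit (num_lits (length (R 1))) (entry (num_lits (length (R 1))) (R 3))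
    (the_flower lo (length (R 1)) (R 3)) a b c)", OF hb]
  note pb' = def_comp3[of 7 "\<lambda>R a b c. of_bool (petals_bit (num_lits (length (R 1))) (entry (num_lits (length (R 1))) (R 3))
    (the_flower lo (length (R 1)) (R 3)) a b c)", OF pb]
  have eq: "branch_bit lo n W i \<longleftrightarrow>
     (i < block_size n \<and> heart_bit (num_lits n) (entry (num_lits n) W) (the_flower lo n W)
        (i mod num_lits n) (i div num_lits n mod num_lits n) (i div num_lits n div num_lits n)) \<or>
     (block_size n \<le> i \<and> i < block_size n + block_size n \<and> petals_bit (num_lits n) (entry (num_lits n) W) (the_flower lo n W)
        ((i - block_size n) mod num_lits n) ((i - block_size n) div num_lits n mod num_lits n)
        ((i - block_size n) div num_lits n div num_lits n)) \<or>
     (block_size n + block_size n \<le> i \<and> bit_at W (i - block_size n))" for n W i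
    by (simp add: branch_bit_def)
  show "definableP 7 (\<lambda>R \<sigma>. branch_bit lo (length (R 1)) (R 3) (\<sigma> 0))"
    unfolding eq by (intro def_intros hb' pb' def_U def_B) simp_all
  show "definable 7 (\<lambda>R \<sigma>. block_size (length (R 1)) + length (R 3))" by (intro def_intros def_B) simp
qed (auto simp: words_def branch_def)

lemma assignable_graph: "assignable 5 (\<lambda>xs. enc_graph (leaf_graph k lo (length (xs ! 1)) (xs ! 3)))"
proof -
  have V: "definable 7 (\<lambda>R \<sigma>. length (R 1) + 3)" by (intro def_intros) simp
  have m: "definable 7 (\<lambda>R \<sigma>. leaf_clauses lo (length (R 1)) + 3)"
    unfolding leaf_clauses_def by (intro def_intros def_U)
  have "definableP 7 (\<lambda>R \<sigma>. bit_at (R 3) (\<sigma> 0))" by (intro def_intros) simp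
  from def_leaf_lit[of 7 "\<lambda>R. length (R 1)" "\<lambda>R. bit_at (R 3)", OF def_n this]
  have lit: "definable 7 (\<lambda>R \<sigma>. leaf_lit (length (R 1)) (bit_at (R 3)) (\<sigma> 0) (\<sigma> 1))" .
  note v = def_cnf_verts(1)[OF V m, of k]
  show ?thesis
  proof (rule assignableI[of "\<lambda>R \<sigma>. cnf_verts k (length (R 1) + 3) (leaf_clauses lo (length (R 1)) + 3) + 1 +
      cnf_verts k (length (R 1) + 3) (leaf_clauses lo (length (R 1)) + 3) * cnf_verts k (length (R 1) + 3) (leaf_clauses lo (length (R 1)) + 3)"
      "\<lambda>R \<sigma>. cnf_bit k (length (R 1) + 3) (leaf_clauses lo (length (R 1)) + 3) (leaf_lit (length (R 1)) (bit_at (R 3))) (\<sigma> 0)"])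
    show "definableP 7 (\<lambda>R \<sigma>. cnf_bit k (length (R 1) + 3) (leaf_clauses lo (length (R 1)) + 3) (leaf_lit (length (R 1)) (bit_at (R 3))) (\<sigma> 0))"
      by (rule def_cnf_bit[OF V m, of "\<lambda>R. leaf_lit (length (R 1)) (bit_at (R 3))", OF lit])
    show "definable 7 (\<lambda>R \<sigma>. cnf_verts k (length (R 1) + 3) (leaf_clauses lo (length (R 1)) + 3) + 1 +
      cnf_verts k (length (R 1) + 3) (leaf_clauses lo (length (R 1)) + 3) * cnf_verts k (length (R 1) + 3) (leaf_clauses lo (length (R 1)) + 3))"
      by (intro def_intros v)
  qed (simp_all add: words_def leaf_graph_def enc_cnf_graph)
qed

lemma assignable_drop: "assignable 3 (\<lambda>xs. drop (block_size (length (xs ! 1))) (xs ! 3))"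
proof (rule assignableI[of "\<lambda>R \<sigma>. length (R 3) - block_size (length (R 1))" "\<lambda>R \<sigma>. bit_at (R 3) (\<sigma> 0 + block_size (length (R 1)))"])
  show "definableP 7 (\<lambda>R \<sigma>. bit_at (R 3) (\<sigma> 0 + block_size (length (R 1))))" by (intro def_intros def_B) simp
  show "definable 7 (\<lambda>R \<sigma>. length (R 3) - block_size (length (R 1)))" by (intro def_intros def_B) simp
qed (auto simp: words_def bit_at_def add.commute intro: nth_equalityI)

lemma assignable_out: "assignable 0 (\<lambda>xs. [bit_at (xs ! 4) 0])"
proof (rule assignableI[of "\<lambda>R \<sigma>. 1" "\<lambda>R \<sigma>. bit_at (R 4) 0"])
  show "definableP 7 (\<lambda>R \<sigma>. bit_at (R 4) 0)" by (intro def_intros) simp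
qed (auto simp: words_def intro: def_intros)

subsection \<open>The program\<close>

definition graph_length :: "nat => nat => nat => nat" where
  "graph_length k lo n = cnf_verts k (n + 3) (leaf_clauses lo n + 3) + 1 +
     cnf_verts k (n + 3) (leaf_clauses lo n + 3) * cnf_verts k (n + 3) (leaf_clauses lo n + 3)"

lemma length_enc_leaf_graph: "length (enc_graph (leaf_graph k lo n W)) = graph_length k lo n"
  by (simp add: leaf_graph_def enc_cnf_graph graph_length_def)

text \<open>One time bound serves all leaves, because all leaf graphs for the same n have the same
  number of vertices.\<close>

definition hom_solver :: "tm => nat => nat => nat => nat => bool" where
  "hom_solver M k lo n \<tau> \<longleftrightarrow> (\<forall>W. computes_within M (enc_graph (leaf_graph k lo n W))
     [hom_exists (cycle_graph (2 * k + 1)) (leaf_graph k lo n W)] \<tau>)"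

text \<open>The bound of \<open>potential_le\<close> for t = 27 * lo.\<close>

definition depth :: "nat => nat => nat" where
  "depth lo n = 6 * (27 * lo) * num_lits n"

definition roomy :: "nat => nat => nat => nat => bool" where
  "roomy k lo n B \<longleftrightarrow> n \<le> B \<and> 1 \<le> B \<and> num_lits n \<le> B \<and> (depth lo n + 2) * block_size n \<le> B \<and> graph_length k lo n \<le> B"

text \<open>N r bounds the nodes of a search tree with r left to gain: the heart gains at least 1
  and the petals at least 54 * lo * lo.\<close>

definition node_bound :: "nat => (nat => nat) => bool" where
  "node_bound lo N \<longleftrightarrow> (\<forall>r. 1 \<le> N r) \<and> (\<forall>r\<ge>54 * lo * lo. 1 + N (r - 1) + N (r - 54 * lo * lo) \<le> N r)"

definition parse_state :: "nat => bool list => bool list => bool list => bool list => bool list list" where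
  "parse_state n y C W V = [y, replicate n True, C, W, [], [], V]"

definition search_state :: "nat => bool list => bool list => bool list list" where
  "search_state n W f = [[], replicate n True, mark n {}, W, f, [], []]"

lemma length_mark [simp]: "length (mark n A) = num_lits n"
  by (simp add: mark_def)

lemma length_block_num_lits: "length (block (num_lits n) F) = block_size n"
  by (simp add: block_size_def)

text \<open>The compiled operations are known only to exist, so they are fixed here together with a
  common time bound.\<close>

locale sparsifier =
  fixes k lo :: nat and M :: tm and p :: "nat => nat"
    and c_zero c_mark c_clause c_literal c_flower c_branch c_graph c_drop c_out :: com
  assumes k: "k \<ge> 2" and lo: "1 \<le> lo" and M: "wf_tm M" and p: "\<And>B. 2 * B + 1 \<le> p B"
    and zero: "assigner c_zero p 3 (\<lambda>xs. block (num_lits (length (xs ! 1))) {})"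
    and mark: "assigner c_mark p 2 (\<lambda>xs. mark (length (xs ! 1)) {})"
    and clause: "assigner c_clause p 3 (\<lambda>xs. add_clause (length (xs ! 1)) (xs ! 2) (xs ! 3))"
    and literal: "assigner c_literal p 2 (\<lambda>xs. map (\<lambda>i. bit_at (xs ! 2) i \<or> i = length (xs ! 6)) [0..<num_lits (length (xs ! 1))])"
    and flower: "assigner c_flower p 4 (\<lambda>xs. [flower lo (length (xs ! 1)) (xs ! 3)])"
    and branch: "assigner c_branch p 3 (\<lambda>xs. branch lo (length (xs ! 1)) (xs ! 3))"
    and graph: "assigner c_graph p 5 (\<lambda>xs. enc_graph (leaf_graph k lo (length (xs ! 1)) (xs ! 3)))"
    and drop: "assigner c_drop p 3 (\<lambda>xs. drop (block_size (length (xs ! 1))) (xs ! 3))"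
    and out: "assigner c_out p 0 (\<lambda>xs. [bit_at (xs ! 4) 0])"
begin

text \<open>Register 6 counts up to \<open>lit_num (b, v)\<close> in unary, one for a positive sign
  and two for each unit of v; \<open>c_literal\<close> then sets the bit with this number.\<close>

definition literal_com :: com where
  "literal_com = Seq (Pop 0) (Seq (Switch 0 (\<lambda>a. if a = 2 then Push 6 2 else Skip)) (Seq (Pop 0)
     (Seq (While 0 (\<lambda>a. a = 2) (Seq (Pop 0) (Seq (Push 6 2) (Push 6 2)))) (Seq (Pop 0) (Seq c_literal (clear 6))))))"

definition clause_com :: com where
  "clause_com = Seq (Pop 0) (Seq c_clause c_mark)"

definition parse :: com where
  "parse = While 0 nonempty (Switch 0 (\<lambda>a. if a = 2 then literal_com else clause_com))"

text \<open>After a successful leaf the worklist is emptied, which ends the search and leaves the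
  flag set; after a failure only the first family is discarded. The flag is popped before the call
  because \<open>run_call\<close> expects register 4 to be empty.\<close>

definition node_com :: com where
  "node_com = Seq c_flower (Switch 4 (\<lambda>f. if f = 2 then c_branch else
     Seq c_graph (Seq (Pop 4) (Seq (call M) (Switch 4 (\<lambda>f. if f = 2 then clear 3 else c_drop))))))"

definition search :: com where
  "search = While 3 nonempty node_com"

definition program :: com where
  "program = Seq (While 0 (\<lambda>a. a = 2) (Seq (Pop 0) (Push 1 2))) (Seq (Pop 0) (Seq c_zero (Seq c_mark (Seq parse (Seq search c_out)))))"

definition parse_cost :: "nat => nat" where
  "parse_cost B = 20 + 8 * B + 2 * p B"

definition node_cost :: "nat => nat => nat" where
  "node_cost B \<tau> = 3 * p B + 10 + 100 * (tapes M + 1) * (\<tau> + B + 1)"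

lemma clear: "r < 7 ==> assigner (clear r) p r (\<lambda>_. [])"
  by (rule assigner_mono[OF assigner_clear p])

text \<open>The parsing lemmas take the run of the remaining loop as a premise, because a run of
  \<open>While\<close> is extended at its front.\<close>

lemma parse_step:
  assumes "y \<noteq> []" "run (if hd y then literal_com else clause_com) (mem (parse_state n y C W V)) t s1" "run parse s1 T s'"
    "t + 2 \<le> t'"
  shows "run parse (mem (parse_state n y C W V)) (t' + T) s'"
proof -
  obtain b z where y: "y = b # z" using assms(1) by (cases y) auto
  have pk: "peek (mem (parse_state n y C W V) 0) = bit_sym b" by (simp add: peek_mem parse_state_def y)
  have "run (Switch 0 (\<lambda>a. if a = 2 then literal_com else clause_com)) (mem (parse_state n y C W V)) (1 + t) s1"
    by (rule run_Switch) (unfold pk bit_sym_eq_2, use assms(2) y in simp)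
  from run_While_True[of nonempty "mem (parse_state n y C W V)" 0, OF _ this assms(3)[unfolded parse_def]]
  have "run parse (mem (parse_state n y C W V)) (1 + (1 + t) + T) s'"
    unfolding parse_def by (simp add: pk bit_sym_def)
  then show ?thesis by (rule run_weaken) (use assms(4) in simp)
qed

lemma parse_literal:
  assumes v: "v < n" and B: "length y + v + 3 \<le> B" "roomy k lo n B" "length W \<le> B"
    and rest: "run parse (mem (parse_state n y (mark n (insert (lit_num (b, v)) A)) W [])) T s'"
  shows "run parse (mem (parse_state n (enc_literal (b, v) @ y) (mark n A) W [])) (parse_cost B + T) s'"
proof -
  let ?C = "mark n A"
  have U: "n \<le> B" "num_lits n \<le> B" "2 * v + 1 < num_lits n" using B(2) v by (auto simp: roomy_def num_lits_def)
  have 1: "run (Pop 0) (mem (parse_state n (enc_literal (b, v) @ y) ?C W [])) 1 (mem (parse_state n (b # replicate v True @ False # y) ?C W []))"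
    by (rule run_Pop_mem) (simp_all add: parse_state_def)
  define V where "V i = replicate (2 * (v - i) + of_bool b) True" for i
  have "run (if b then Push 6 2 else Skip) (mem (parse_state n (b # replicate v True @ False # y) ?C W [])) 2
      (mem (parse_state n (b # replicate v True @ False # y) ?C W (V v)))"
  proof (cases b)
    case True
    have "run (Push 6 2) (mem (parse_state n (b # replicate v True @ False # y) ?C W [])) 2
      (mem (parse_state n (b # replicate v True @ False # y) ?C W (V v)))"
      by (rule run_Push_mem) (simp_all add: parse_state_def V_def True)
    then show ?thesis using True by simp
  next
    case False
    then show ?thesis by (auto simp: V_def intro: run_weaken[OF run_Skip])
  qed
  then have 2: "run (Switch 0 (\<lambda>a. if a = 2 then Push 6 2 else Skip)) (mem (parse_state n (b # replicate v True @ False # y) ?C W [])) (1 + 2)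
      (mem (parse_state n (b # replicate v True @ False # y) ?C W (V v)))"
    by (intro run_Switch) (simp add: peek_mem parse_state_def bit_sym_eq_2)
  have 3: "run (Pop 0) (mem (parse_state n (b # replicate v True @ False # y) ?C W (V v))) 1
      (mem (parse_state n (replicate v True @ False # y) ?C W (V v)))"
    by (rule run_Pop_mem) (simp_all add: parse_state_def)
  define st where "st i = mem (parse_state n (replicate i True @ False # y) ?C W (V i))" for i
  have 4: "run (While 0 (\<lambda>a. a = 2) (Seq (Pop 0) (Seq (Push 6 2) (Push 6 2)))) (st v) (v * (7 + 1) + 1) (st 0)"
  proof (rule run_counted_loop)
    fix i assume i: "i < v"
    have a: "run (Pop 0) (st (Suc i)) 1 (mem (parse_state n (replicate i True @ False # y) ?C W (V (Suc i))))"
      unfolding st_def by (rule run_Pop_mem) (simp_all add: parse_state_def)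
    have b: "run (Push 6 2) (mem (parse_state n (replicate i True @ False # y) ?C W (V (Suc i)))) 2
        (mem (parse_state n (replicate i True @ False # y) ?C W (True # V (Suc i))))"
      by (rule run_Push_mem) (simp_all add: parse_state_def)
    have "V i = True # True # V (Suc i)" using i unfolding V_def replicate_Suc[symmetric] by (intro arg_cong2[of _ _ _ _ replicate]) auto
    then have c: "run (Push 6 2) (mem (parse_state n (replicate i True @ False # y) ?C W (True # V (Suc i)))) 2 (st i)"
      unfolding st_def by (intro run_Push_mem) (simp_all add: parse_state_def)
    show "run (Seq (Pop 0) (Seq (Push 6 2) (Push 6 2))) (st (Suc i)) 7 (st i)"
      by (rule run_weaken[OF run_Seq[OF a run_Seq[OF b c]]]) simp
    show "peek (st (Suc i) 0) = 2" unfolding st_def by (simp add: peek_mem parse_state_def bit_sym_def)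
  next
    show "peek (st 0 0) \<noteq> 2" unfolding st_def by (simp add: peek_mem parse_state_def bit_sym_def)
  qed
  have 5: "run (Pop 0) (st 0) 1 (mem (parse_state n y ?C W (V 0)))"
    unfolding st_def by (rule run_Pop_mem) (simp_all add: parse_state_def)
  have lenV: "length (V 0) = lit_num (b, v)" by (simp add: V_def)
  have "fits B (parse_state n y ?C W (V 0))" using B U by (auto simp: fits_def parse_state_def V_def)
  then have 6: "run c_literal (mem (parse_state n y ?C W (V 0))) (p B) (mem (parse_state n y (mark n (insert (lit_num (b, v)) A)) W (V 0)))"
  proof (rule assignerD[OF literal])
    have "map (\<lambda>i. bit_at (mark n A) i \<or> i = length (V 0)) [0..<num_lits n] = mark n (insert (lit_num (b, v)) A)"
      unfolding lenV by (auto simp: mark_def bit_at_def)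
    then show "(parse_state n y ?C W (V 0))[2 := map (\<lambda>i. bit_at (parse_state n y ?C W (V 0) ! 2) i \<or> i = length (parse_state n y ?C W (V 0) ! 6))
        [0..<num_lits (length (parse_state n y ?C W (V 0) ! 1))]] = parse_state n y (mark n (insert (lit_num (b, v)) A)) W (V 0)"
      by (simp add: parse_state_def)
  qed
  have f7: "fits B (parse_state n y (mark n (insert (lit_num (b, v)) A)) W (V 0))" using B U by (auto simp: fits_def parse_state_def V_def)
  have 7: "run (clear 6) (mem (parse_state n y (mark n (insert (lit_num (b, v)) A)) W (V 0))) (p B)
      (mem (parse_state n y (mark n (insert (lit_num (b, v)) A)) W []))"
    by (rule assignerD[OF clear[of 6] f7]) (simp_all add: parse_state_def)
  have "run literal_com (mem (parse_state n (enc_literal (b, v) @ y) ?C W []))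
      (1 + 1 + (1 + (1 + 2) + (1 + 1 + (1 + (v * (7 + 1) + 1) + (1 + 1 + (1 + p B + p B))))))
      (mem (parse_state n y (mark n (insert (lit_num (b, v)) A)) W []))"
    unfolding literal_com_def
    by (rule run_Seq[OF 1 run_Seq[OF 2 run_Seq[OF 3 run_Seq[OF 4[unfolded st_def[of v]] run_Seq[OF 5 run_Seq[OF 6 7]]]]]])
  then show ?thesis
    by (intro parse_step[OF _ _ rest]) (use B in \<open>auto simp: parse_cost_def\<close>)
qed

lemma parse_clause_end:
  assumes B: "length y + 3 \<le> B" "roomy k lo n B" and C: "\<And>b v. (b, v) \<in> set C ==> v < n"
    and rest: "run parse (mem (parse_state n y (mark n {}) (block (num_lits n) (start_family n (F @ [C]))) [])) T s'"
  shows "run parse (mem (parse_state n (False # y) (mark n (lit_num ` set C)) (block (num_lits n) (start_family n F)) []))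
    (parse_cost B + T) s'"
proof -
  let ?C = "mark n (lit_num ` set C)" and ?W = "block (num_lits n) (start_family n F)"
  let ?W' = "block (num_lits n) (start_family n (F @ [C]))"
  have bl: "block_size n \<le> B" using B(2) by (simp add: roomy_def)
  have U: "n \<le> B" "num_lits n \<le> B" "length ?W \<le> B" "length ?W' \<le> B"
    using B(2) bl unfolding length_block_num_lits by (auto simp: roomy_def)
  have 1: "run (Pop 0) (mem (parse_state n (False # y) ?C ?W [])) 1 (mem (parse_state n y ?C ?W []))"
    by (rule run_Pop_mem) (simp_all add: parse_state_def)
  have f: "fits B (parse_state n y ?C ?W [])" "fits B (parse_state n y ?C ?W' [])"
    using B U by (auto simp: fits_def parse_state_def simp del: length_block)
  have 2: "run c_clause (mem (parse_state n y ?C ?W [])) (p B) (mem (parse_state n y ?C ?W' []))"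
    by (rule assignerD[OF clause f(1)]) (simp add: parse_state_def add_clause_block[OF C])
  have 3: "run c_mark (mem (parse_state n y ?C ?W' [])) (p B) (mem (parse_state n y (mark n {}) ?W' []))"
    by (rule assignerD[OF mark f(2)]) (simp add: parse_state_def)
  have "run clause_com (mem (parse_state n (False # y) ?C ?W [])) (1 + 1 + (1 + p B + p B)) (mem (parse_state n y (mark n {}) ?W' []))"
    unfolding clause_com_def by (rule run_Seq[OF 1 run_Seq[OF 2 3]])
  then show ?thesis by (intro parse_step[OF _ _ rest]) (auto simp: parse_cost_def)
qed

lemma parse_clause:
  assumes B: "length (concat (map enc_literal C') @ False # y) + n + 3 \<le> B" "roomy k lo n B"
    and C: "\<And>b v. (b, v) \<in> set C ==> v < n" "set C' \<subseteq> set C" "lit_num ` set C = A \<union> lit_num ` set C'"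
    and rest: "run parse (mem (parse_state n y (mark n {}) (block (num_lits n) (start_family n (F @ [C]))) [])) T s'"
  shows "run parse (mem (parse_state n (concat (map enc_literal C') @ False # y) (mark n A) (block (num_lits n) (start_family n F)) []))
    ((length C' + 1) * parse_cost B + T) s'"
  using B(1) C(2,3)
proof (induction C' arbitrary: A)
  case Nil
  have A: "A = lit_num ` set C" using Nil by simp
  have "run parse (mem (parse_state n (False # y) (mark n A) (block (num_lits n) (start_family n F)) [])) (parse_cost B + T) s'"
    unfolding A by (rule parse_clause_end[OF _ B(2) C(1) rest]) (use Nil in auto)
  then show ?case by simp
next
  case (Cons l C')
  obtain b v where l: "l = (b, v)" by force
  have v: "v < n" using C(1)[of b v] Cons.prems l by auto
  have "run parse (mem (parse_state n (concat (map enc_literal C') @ False # y) (mark n (insert (lit_num (b, v)) A))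
      (block (num_lits n) (start_family n F)) [])) ((length C' + 1) * parse_cost B + T) s'"
    by (rule Cons.IH) (use Cons.prems l in \<open>auto simp del: lit_num.simps\<close>)
  moreover have "length (block (num_lits n) (start_family n F)) \<le> B"
    unfolding length_block_num_lits using B(2) by (simp add: roomy_def)
  moreover have "length (concat (map enc_literal C') @ False # y) + v + 3 \<le> B" using Cons.prems v by (simp add: l)
  ultimately have "run parse (mem (parse_state n (enc_literal (b, v) @ concat (map enc_literal C') @ False # y) (mark n A)
      (block (num_lits n) (start_family n F)) [])) (parse_cost B + ((length C' + 1) * parse_cost B + T)) s'"
    using parse_literal[OF v _ B(2)] by blast
  then show ?case by (simp add: l add.assoc)
qed

lemma parse_formula:
  assumes B: "length (concat (map enc_clause F')) + n + 3 \<le> B" "roomy k lo n B"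
    and F: "\<And>C b v. C \<in> set F' ==> (b, v) \<in> set C ==> v < n"
  shows "run parse (mem (parse_state n (concat (map enc_clause F')) (mark n {}) (block (num_lits n) (start_family n F)) []))
    (length (concat (map enc_clause F')) * parse_cost B + 1)
    (mem (parse_state n [] (mark n {}) (block (num_lits n) (start_family n (F @ F'))) []))"
  using B(1) F
proof (induction F' arbitrary: F)
  case Nil
  have "\<not> nonempty (peek (mem (parse_state n [] (mark n {}) (block (num_lits n) (start_family n F)) []) 0))"
    by (simp add: peek_mem parse_state_def)
  from run_While_False[of nonempty "mem (parse_state n [] (mark n {}) (block (num_lits n) (start_family n F)) [])" 0, OF this]
  show ?case by (simp add: parse_def)
next
  case (Cons C F')
  let ?y = "concat (map enc_clause F')"
  have "run parse (mem (parse_state n ?y (mark n {}) (block (num_lits n) (start_family n (F @ [C]))) []))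
    (length ?y * parse_cost B + 1) (mem (parse_state n [] (mark n {}) (block (num_lits n) (start_family n ((F @ [C]) @ F'))) []))"
  proof (rule Cons.IH)
    show "length ?y + n + 3 \<le> B" using Cons.prems(1) by simp
    fix C' b v assume "C' \<in> set F'" "(b, v) \<in> set C'"
    then show "v < n" using Cons.prems(2)[of C' b v] by simp
  qed
  then have "run parse (mem (parse_state n (concat (map enc_literal C) @ False # ?y) (mark n {}) (block (num_lits n) (start_family n F)) []))
    ((length C + 1) * parse_cost B + (length ?y * parse_cost B + 1))
    (mem (parse_state n [] (mark n {}) (block (num_lits n) (start_family n ((F @ [C]) @ F'))) []))"
    by (intro parse_clause[OF _ B(2)]) (use Cons.prems in \<open>auto simp: enc_clause_def[of C]\<close>)
  moreover have "(length C + 1) * parse_cost B + (length ?y * parse_cost B + 1) \<le> length (concat (map enc_clause (C # F'))) * parse_cost B + 1"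
  proof -
    have "length C \<le> length (concat (map enc_literal C))" by (induction C) auto
    then have "length C + 1 + length ?y \<le> length (concat (map enc_clause (C # F')))" by (simp add: enc_clause_def[of C])
    from mult_le_mono1[OF this, of "parse_cost B"] show ?thesis unfolding add_mult_distrib by linarith
  qed
  ultimately have "run parse (mem (parse_state n (concat (map enc_literal C) @ False # ?y) (mark n {}) (block (num_lits n) (start_family n F)) []))
    (length (concat (map enc_clause (C # F'))) * parse_cost B + 1)
    (mem (parse_state n [] (mark n {}) (block (num_lits n) (start_family n ((F @ [C]) @ F'))) []))"
    by (rule run_weaken)
  moreover have "concat (map enc_literal C) @ False # ?y = concat (map enc_clause (C # F'))" by (simp add: enc_clause_def[of C])
  ultimately show ?case by (simp only: append_assoc append_Cons append_Nil)
qed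

lemma search_fits:
  assumes "roomy k lo n B" "length W \<le> B" "length f \<le> 1" "length g \<le> B"
  shows "fits B [[], replicate n True, mark n {}, W, f, g, []]"
  using assms by (auto simp: fits_def roomy_def)

lemma run_branch_node:
  assumes B: "roomy k lo n B" "length W \<le> B" "length f \<le> 1" and fl: "flower lo n W"
  shows "run node_com (mem (search_state n W f)) (node_cost B \<tau>) (mem (search_state n (branch lo n W) [True]))"
proof -
  have 1: "run c_flower (mem (search_state n W f)) (p B) (mem (search_state n W [True]))"
    by (rule assignerD[OF flower, of B]) (use search_fits[OF B] fl in \<open>simp_all add: search_state_def\<close>)
  have "run c_branch (mem (search_state n W [True])) (p B) (mem (search_state n (branch lo n W) [True]))"
    by (rule assignerD[OF branch, of B]) (use search_fits[OF B(1,2)] in \<open>simp_all add: search_state_def\<close>)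
  then have 2: "run (Switch 4 (\<lambda>f. if f = 2 then c_branch else
     Seq c_graph (Seq (Pop 4) (Seq (call M) (Switch 4 (\<lambda>f. if f = 2 then clear 3 else c_drop))))))
     (mem (search_state n W [True])) (1 + p B) (mem (search_state n (branch lo n W) [True]))"
    by (intro run_Switch) (simp add: peek_mem search_state_def bit_sym_def)
  show ?thesis unfolding node_com_def by (rule run_weaken[OF run_Seq[OF 1 2]]) (simp add: node_cost_def)
qed

lemma run_leaf_node:
  assumes B: "roomy k lo n B" "length W \<le> B" "length f \<le> 1" and fl: "\<not> flower lo n W" and M_ok: "hom_solver M k lo n \<tau>"
    and b: "b \<longleftrightarrow> hom_exists (cycle_graph (2 * k + 1)) (leaf_graph k lo n W)"
  shows "run node_com (mem (search_state n W f)) (node_cost B \<tau>)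
    (mem (search_state n (if b then [] else drop (block_size n) W) (if b then [True] else [])))"
proof -
  define G where "G = enc_graph (leaf_graph k lo n W)"
  have lenG: "length G \<le> B" using B(1) by (simp add: G_def length_enc_leaf_graph roomy_def)
  let ?xs = "\<lambda>f g. [[], replicate n True, mark n {}, W, f, g, []]"
  have 1: "run c_flower (mem (search_state n W f)) (p B) (mem (search_state n W [False]))"
    by (rule assignerD[OF flower, of B]) (use search_fits[OF B] fl in \<open>simp_all add: search_state_def\<close>)
  have 2: "run c_graph (mem (search_state n W [False])) (p B) (mem (?xs [False] G))"
    by (rule assignerD[OF graph, of B]) (use search_fits[OF B(1,2)] in \<open>simp_all add: search_state_def G_def\<close>)
  have 3: "run (Pop 4) (mem (?xs [False] G)) 1 (mem (?xs [] G))" by (rule run_Pop_mem) simp_all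
  have comp: "computes_within M G [b] \<tau>" using M_ok unfolding hom_solver_def G_def b by blast
  have "run (call M) (mem (?xs [] G)) (100 * (tapes M + 1) * (\<tau> + length G + 1))
      ((mem (?xs [] G))(5 := [], 4 := if b then [2] else []))"
    by (rule run_call[OF M comp]) (simp_all add: mem_def)
  moreover have "(mem (?xs [] G))(5 := [], 4 := if b then [2] else []) = mem (search_state n W (if b then [True] else []))"
    using mem_update[of 5 "?xs [] G" "[]"] mem_update[of 4 "?xs [] []" "if b then [True] else []"]
    by (simp add: search_state_def bit_sym_def split: if_splits)
  ultimately have "run (call M) (mem (?xs [] G)) (100 * (tapes M + 1) * (\<tau> + length G + 1)) (mem (search_state n W (if b then [True] else [])))"
    by simp
  then have 4: "run (call M) (mem (?xs [] G)) (100 * (tapes M + 1) * (\<tau> + B + 1)) (mem (search_state n W (if b then [True] else [])))"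
    by (rule run_weaken) (use lenG in \<open>intro mult_le_mono2, simp\<close>)
  have fits: "fits B (search_state n W (if b then [True] else []))" using search_fits[OF B(1,2)] by (simp add: search_state_def)
  have "run (if b then clear 3 else c_drop) (mem (search_state n W (if b then [True] else []))) (p B)
      (mem (search_state n (if b then [] else drop (block_size n) W) (if b then [True] else [])))"
  proof (cases b)
    case True
    then show ?thesis using assignerD[OF clear[of 3] fits] by (simp add: search_state_def)
  next
    case False
    then show ?thesis using assignerD[OF drop fits] by (simp add: search_state_def)
  qed
  then have 5: "run (Switch 4 (\<lambda>f. if f = 2 then clear 3 else c_drop)) (mem (search_state n W (if b then [True] else []))) (1 + p B)
      (mem (search_state n (if b then [] else drop (block_size n) W) (if b then [True] else [])))"
    by (intro run_Switch) (cases b; simp add: peek_mem search_state_def bit_sym_def)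
  have "run (Seq c_graph (Seq (Pop 4) (Seq (call M) (Switch 4 (\<lambda>f. if f = 2 then clear 3 else c_drop))))) (mem (search_state n W [False]))
      (1 + p B + (1 + 1 + (1 + 100 * (tapes M + 1) * (\<tau> + B + 1) + (1 + p B))))
      (mem (search_state n (if b then [] else drop (block_size n) W) (if b then [True] else [])))"
    by (rule run_Seq[OF 2 run_Seq[OF 3 run_Seq[OF 4 5]]])
  then have 6: "run (Switch 4 (\<lambda>f. if f = 2 then c_branch else
     Seq c_graph (Seq (Pop 4) (Seq (call M) (Switch 4 (\<lambda>f. if f = 2 then clear 3 else c_drop))))))
     (mem (search_state n W [False])) (1 + (1 + p B + (1 + 1 + (1 + 100 * (tapes M + 1) * (\<tau> + B + 1) + (1 + p B)))))
     (mem (search_state n (if b then [] else drop (block_size n) W) (if b then [True] else [])))"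
    by (intro run_Switch) (simp add: peek_mem search_state_def bit_sym_def)
  show ?thesis unfolding node_com_def by (rule run_weaken[OF run_Seq[OF 1 6]]) (simp add: node_cost_def)
qed

lemma search_step:
  assumes "W \<noteq> []" "run node_com (mem (search_state n W f)) t s1" "run search s1 T s'"
  shows "run search (mem (search_state n W f)) (1 + t + T) s'"
proof -
  have "nonempty (peek (mem (search_state n W f) 3))"
    using assms(1) by (cases W) (auto simp: peek_mem search_state_def bit_sym_def)
  from run_While_True[of nonempty "mem (search_state n W f)" 3, OF this assms(2) assms(3)[unfolded search_def]]
  show ?thesis unfolding search_def .
qed

text \<open>
  The worklist contains at most one pending sibling for each level, and the remaining depth \<open>r\<close>
  of a family is bounded because the potential is.
\<close>

lemma run_search:
  assumes M_ok: "hom_solver M k lo n \<tau>" and B: "roomy k lo n B" and N: "node_bound lo N"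
    and inv: "sparse_inv (num_lits n) (27 * lo) F" and pot: "depth lo n \<le> potential (27 * lo) F + r" and r: "r \<le> depth lo n"
    and w: "length w \<le> (depth lo n - r) * block_size n" and f: "length f \<le> 1"
  shows "(dummy_sat n F \<longrightarrow> run search (mem (search_state n (block (num_lits n) F @ w) f)) (N r * (node_cost B \<tau> + 1) + 1)
      (mem (search_state n [] [True]))) \<and>
    (\<not> dummy_sat n F \<longrightarrow> (\<forall>T s'. run search (mem (search_state n w [])) T s' \<longrightarrow>
      run search (mem (search_state n (block (num_lits n) F @ w) f)) (N r * (node_cost B \<tau> + 1) + T) s'))"
  using inv pot r w f
proof (induction r arbitrary: F w f rule: less_induct)
  case (less r)
  define Q where "Q = node_cost B \<tau> + 1"
  define U where "U = num_lits n"
  define W where "W = block U F @ w"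
  define g where "g = 54 * lo * lo"
  have lenW: "length W = block_size n + length w" by (simp add: W_def U_def block_size_def)
  then have W: "W \<noteq> []" using block_size_pos[of n] by (cases W) auto
  have "(depth lo n - r) * block_size n \<le> depth lo n * block_size n" by (rule mult_le_mono1) simp
  then have WB: "length W \<le> B" using less.prems(4) B unfolding lenW roomy_def add_mult_distrib by linarith
  have N1: "Q \<le> N r * Q" for r using N by (simp add: node_bound_def)
  show ?case
  proof (cases "flower lo n W")
    case True
    obtain H s where H: "good_flower (27 * lo) lo g F H s"
      "branch lo n W = block U (refine F {H}) @ block U (refine F (petals F H s)) @ w"
      using branch_block[OF less.prems(1), of w] True lo unfolding W_def U_def g_def by blast
    define FH where "FH = refine F {H}"
    define FP where "FP = refine F (petals F H s)"
    have g1: "1 \<le> g" using lo by (simp add: g_def)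
    have stepH: "sparse_inv U (27 * lo) FH" "potential (27 * lo) F + 1 \<le> potential (27 * lo) FH"
      using flower_step(1)[OF less.prems(1) H(1) _ lo g1] lo by (simp_all add: FH_def U_def)
    have "sparse_inv U (27 * lo) FP" "potential (27 * lo) F + min (2 * (27 * lo) * lo) g \<le> potential (27 * lo) FP"
      using flower_step(2)[OF less.prems(1) H(1) _ lo g1] lo by (simp_all add: FP_def U_def)
    then have stepP: "sparse_inv U (27 * lo) FP" "potential (27 * lo) F + g \<le> potential (27 * lo) FP"
      by (simp_all add: g_def)
    have leH: "potential (27 * lo) FH \<le> depth lo n" and leP: "potential (27 * lo) FP \<le> depth lo n"
      using potential_le[OF stepH(1)] potential_le[OF stepP(1)] by (simp_all add: depth_def U_def)
    \<comment> \<open>Both refined families still obey the maximal potential, so r is at least the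
      gain of either branch and the recurrence of \<open>node_bound\<close> applies.\<close>
    have r1: "1 \<le> r" "g \<le> r" using stepH(2) stepP(2) leH leP less.prems(2) by linarith+
    have Nr: "1 + N (r - 1) + N (r - g) \<le> N r" using N r1(2) by (simp add: node_bound_def g_def)
    from mult_le_mono1[OF this, of Q] have NQ: "Q + N (r - 1) * Q + N (r - g) * Q \<le> N r * Q" by (simp add: add_mult_distrib)
    have node: "run node_com (mem (search_state n W f)) (node_cost B \<tau>) (mem (search_state n (block U FH @ block U FP @ w) [True]))"
      using run_branch_node[OF B WB less.prems(5) True] unfolding H(2) FH_def FP_def .
    have step: "run search (mem (search_state n W f)) (Q + T) s'"
      if "run search (mem (search_state n (block U FH @ block U FP @ w) [True])) T s'" for T s'
      using search_step[OF W node that] by (simp add: Q_def)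
    \<comment> \<open>While the heart is explored, the petal family waits in the one extra block
      allowed by the smaller remaining depth.\<close>
    have "length (block U FP @ w) \<le> (depth lo n - (r - 1)) * block_size n"
    proof -
      have "depth lo n - (r - 1) = 1 + (depth lo n - r)" using r1 less.prems(3) by simp
      then show ?thesis using less.prems(4) by (simp add: U_def block_size_def)
    qed
    then have IH: "(dummy_sat n FH \<longrightarrow> run search (mem (search_state n (block U FH @ block U FP @ w) [True])) (N (r - 1) * Q + 1)
        (mem (search_state n [] [True]))) \<and>
      (\<not> dummy_sat n FH \<longrightarrow> (\<forall>T s'. run search (mem (search_state n (block U FP @ w) [])) T s' \<longrightarrow>
        run search (mem (search_state n (block U FH @ block U FP @ w) [True])) (N (r - 1) * Q + T) s'))"
      unfolding Q_def U_def
      by (intro less.IH) (use r1 stepH less.prems in \<open>auto simp: U_def\<close>)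
    have "(depth lo n - r) * block_size n \<le> (depth lo n - (r - g)) * block_size n" by (rule mult_le_mono1) simp
    then have wg: "length w \<le> (depth lo n - (r - g)) * block_size n" using less.prems(4) by linarith
    have IP: "(dummy_sat n FP \<longrightarrow> run search (mem (search_state n (block U FP @ w) [])) (N (r - g) * Q + 1)
        (mem (search_state n [] [True]))) \<and>
      (\<not> dummy_sat n FP \<longrightarrow> (\<forall>T s'. run search (mem (search_state n w [])) T s' \<longrightarrow>
        run search (mem (search_state n (block U FP @ w) [])) (N (r - g) * Q + T) s'))"
      unfolding Q_def U_def
      by (intro less.IH) (use r1 g1 stepP less.prems wg in \<open>auto simp: U_def\<close>)
    have sat: "dummy_sat n F \<longleftrightarrow> dummy_sat n FH \<or> dummy_sat n FP"
      unfolding FH_def FP_def by (rule dummy_sat_branch)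
    show ?thesis unfolding Q_def[symmetric] U_def[symmetric] W_def[symmetric]
    proof (intro conjI impI allI)
      assume "dummy_sat n F"
      show "run search (mem (search_state n W f)) (N r * Q + 1) (mem (search_state n [] [True]))"
      proof (cases "dummy_sat n FH")
        case True
        then have "run search (mem (search_state n W f)) (Q + (N (r - 1) * Q + 1)) (mem (search_state n [] [True]))"
          using IH step by blast
        then show ?thesis by (rule run_weaken) (use NQ in linarith)
      next
        case False
        then have "dummy_sat n FP" using \<open>dummy_sat n F\<close> sat by blast
        then have "run search (mem (search_state n W f)) (Q + (N (r - 1) * Q + (N (r - g) * Q + 1))) (mem (search_state n [] [True]))"
          using IH IP step False by blast
        then show ?thesis by (rule run_weaken) (use NQ in linarith)
      qed
    next
      fix T s' assume "\<not> dummy_sat n F" and T: "run search (mem (search_state n w [])) T s'"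
      then have "\<not> dummy_sat n FH" "\<not> dummy_sat n FP" using sat by blast+
      then have "run search (mem (search_state n W f)) (Q + (N (r - 1) * Q + (N (r - g) * Q + T))) s'"
        using IH IP step T by blast
      then show "run search (mem (search_state n W f)) (N r * Q + T) s'" by (rule run_weaken) (use NQ in linarith)
    qed
  next
    case False
    have b: "dummy_sat n F \<longleftrightarrow> hom_exists (cycle_graph (2 * k + 1)) (leaf_graph k lo n W)"
      using leaf_graph_hom[OF less.prems(1) _ k, of lo w] False by (simp add: W_def U_def)
    have dr: "drop (block_size n) W = w" by (simp add: W_def U_def block_size_def)
    have node: "run node_com (mem (search_state n W f)) (node_cost B \<tau>)
        (mem (search_state n (if dummy_sat n F then [] else w) (if dummy_sat n F then [True] else [])))"
      using run_leaf_node[OF B WB less.prems(5) False M_ok b] unfolding dr .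
    show ?thesis unfolding Q_def[symmetric] U_def[symmetric] W_def[symmetric]
    proof (intro conjI impI allI)
      assume sat: "dummy_sat n F"
      have "\<not> nonempty (peek (mem (search_state n [] [True]) 3))" by (simp add: peek_mem search_state_def)
      from run_While_False[of nonempty "mem (search_state n [] [True])" 3, OF this] have "run search (mem (search_state n [] [True])) 1 (mem (search_state n [] [True]))"
        by (simp add: search_def)
      then have "run search (mem (search_state n W f)) (1 + node_cost B \<tau> + 1) (mem (search_state n [] [True]))"
        by (intro search_step[OF W]) (use node sat in auto)
      then show "run search (mem (search_state n W f)) (N r * Q + 1) (mem (search_state n [] [True]))"
        by (rule run_weaken) (use N1[of r] in \<open>simp add: Q_def\<close>)
    next
      fix T s' assume sat: "\<not> dummy_sat n F" and "run search (mem (search_state n w [])) T s'"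
      then have "run search (mem (search_state n W f)) (1 + node_cost B \<tau> + T) s'"
        by (intro search_step[OF W]) (use node in auto)
      then show "run search (mem (search_state n W f)) (N r * Q + T) s'"
        by (rule run_weaken) (use N1[of r] in \<open>simp add: Q_def\<close>)
    qed
  qed
qed

lemma run_program:
  assumes inst: "(n, F) \<in> sat3_instances" and M_ok: "hom_solver M k lo n \<tau>" and N: "node_bound lo N"
    and B: "roomy k lo n B" "length (enc_cnf (n, F)) + 3 \<le> B"
  shows "\<exists>s'. run program (input_regs (enc_cnf (n, F)))
    (20 + 6 * B + 3 * p B + B * parse_cost B + N (depth lo n) * (node_cost B \<tau> + 1)) s' \<and> s' 0 = map bit_sym [satisfiable F]"
proof -
  define y where "y = concat (map enc_clause F)"
  define st where "st i = mem [replicate i True @ False # y, replicate (n - i) True, [], [], [], [], []]" for i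
  have x: "enc_cnf (n, F) = replicate n True @ False # y" by (simp add: y_def)
  have init: "input_regs (enc_cnf (n, F)) = st n"
    unfolding x st_def by (auto simp: fun_eq_iff input_regs_def mem_def nth_Cons' split: if_splits)
  have By: "length y + n + 4 \<le> B" using B(2) unfolding x by simp
  have 1: "run (While 0 (\<lambda>a. a = 2) (Seq (Pop 0) (Push 1 2))) (st n) (n * (4 + 1) + 1) (st 0)"
  proof (rule run_counted_loop)
    fix i assume i: "i < n"
    have a: "run (Pop 0) (st (Suc i)) 1 (mem [replicate i True @ False # y, replicate (n - Suc i) True, [], [], [], [], []])"
      unfolding st_def by (rule run_Pop_mem) simp_all
    have "n - i = Suc (n - Suc i)" using i by simp
    then have b: "run (Push 1 2) (mem [replicate i True @ False # y, replicate (n - Suc i) True, [], [], [], [], []]) 2 (st i)"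
      unfolding st_def by (intro run_Push_mem) simp_all
    show "run (Seq (Pop 0) (Push 1 2)) (st (Suc i)) 4 (st i)" by (rule run_weaken[OF run_Seq[OF a b]]) simp
    show "peek (st (Suc i) 0) = 2" unfolding st_def by (simp add: peek_mem bit_sym_def)
  next
    show "peek (st 0 0) \<noteq> 2" unfolding st_def by (simp add: peek_mem bit_sym_def)
  qed
  have 2: "run (Pop 0) (st 0) 1 (mem (parse_state n y [] [] []))"
    unfolding st_def parse_state_def by (rule run_Pop_mem) simp_all
  define W0 where "W0 = block (num_lits n) (start_family n [])"
  have W0: "W0 = block (num_lits n) {}" by (simp add: W0_def start_family_def)
  have "block_size n \<le> B" using B(1) by (simp add: roomy_def)
  then have lenW0: "length W0 \<le> B" unfolding W0 length_block_num_lits .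
  have nB: "n \<le> B" "num_lits n \<le> B" using B(1) by (auto simp: roomy_def)
  have "fits B (parse_state n y [] [] [])" using By nB by (auto simp: fits_def parse_state_def)
  then have 3: "run c_zero (mem (parse_state n y [] [] [])) (p B) (mem (parse_state n y [] W0 []))"
    by (rule assignerD[OF zero]) (simp add: parse_state_def W0)
  have "fits B (parse_state n y [] W0 [])" using By nB lenW0 by (auto simp: fits_def parse_state_def)
  then have 4: "run c_mark (mem (parse_state n y [] W0 [])) (p B) (mem (parse_state n y (mark n {}) W0 []))"
    by (rule assignerD[OF mark]) (simp add: parse_state_def)
  define F0 where "F0 = start_family n F"
  have "run parse (mem (parse_state n y (mark n {}) W0 [])) (length y * parse_cost B + 1)
      (mem (parse_state n [] (mark n {}) (block (num_lits n) (start_family n ([] @ F))) []))"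
    unfolding y_def W0_def
    by (rule parse_formula[OF _ B(1)]) (use By inst in \<open>auto simp: y_def sat3_instances_def\<close>)
  then have 5: "run parse (mem (parse_state n y (mark n {}) W0 [])) (length y * parse_cost B + 1)
      (mem (search_state n (block (num_lits n) F0 @ []) []))"
    by (simp add: parse_state_def search_state_def F0_def)
  define b where "b = dummy_sat n F0"
  have b: "b \<longleftrightarrow> satisfiable F" using start_family_sat[OF inst] by (simp add: b_def F0_def)
  let ?N = "N (depth lo n) * (node_cost B \<tau> + 1)"
  have S: "(dummy_sat n F0 \<longrightarrow> run search (mem (search_state n (block (num_lits n) F0 @ []) [])) (?N + 1) (mem (search_state n [] [True]))) \<and>
    (\<not> dummy_sat n F0 \<longrightarrow> (\<forall>T s'. run search (mem (search_state n [] [])) T s' \<longrightarrow>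
      run search (mem (search_state n (block (num_lits n) F0 @ []) [])) (?N + T) s'))"
    by (rule run_search[OF M_ok B(1) N]) (use start_family_inv[of n "27 * lo" F] in \<open>auto simp: F0_def num_lits_def\<close>)
  have E: "run search (mem (search_state n [] [])) 1 (mem (search_state n [] []))"
  proof -
    have "\<not> nonempty (peek (mem (search_state n [] []) 3))" by (simp add: peek_mem search_state_def)
    from run_While_False[of nonempty "mem (search_state n [] [])" 3, OF this] show ?thesis by (simp add: search_def)
  qed
  have 6: "run search (mem (search_state n (block (num_lits n) F0 @ []) [])) (?N + 1)
      (mem (search_state n [] (if b then [True] else [])))"
  proof (cases "dummy_sat n F0")
    case True
    with S show ?thesis by (simp only: b_def if_True simp_thms)
  next
    case False
    with S E have "run search (mem (search_state n (block (num_lits n) F0 @ []) [])) (?N + 1) (mem (search_state n [] []))" by blast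
    with False show ?thesis by (simp only: b_def if_False)
  qed
  define xs where "xs = (search_state n [] (if b then [True] else []))[0 := [b]]"
  have "fits B (search_state n [] (if b then [True] else []))"
    unfolding search_state_def by (rule search_fits[OF B(1)]) auto
  then have 7: "run c_out (mem (search_state n [] (if b then [True] else []))) (p B) (mem xs)"
    by (rule assignerD[OF out]) (simp add: xs_def search_state_def bit_at_def)
  have "run program (st n) (1 + (n * (4 + 1) + 1) + (1 + 1 + (1 + p B + (1 + p B + (1 + (length y * parse_cost B + 1) + (1 + (?N + 1) + p B)))))) (mem xs)"
    unfolding program_def
    by (rule run_Seq[OF 1 run_Seq[OF 2 run_Seq[OF 3 run_Seq[OF 4 run_Seq[OF 5 run_Seq[OF 6 7]]]]]])
  moreover have "1 + (n * (4 + 1) + 1) + (1 + 1 + (1 + p B + (1 + p B + (1 + (length y * parse_cost B + 1) + (1 + (?N + 1) + p B)))))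
      \<le> 20 + 6 * B + 3 * p B + B * parse_cost B + ?N"
  proof -
    have "length y * parse_cost B \<le> B * parse_cost B" by (rule mult_le_mono1) (use By in simp)
    moreover have "1 + (n * (4 + 1) + 1) + (1 + 1 + (1 + q + (1 + q + (1 + (a + 1) + (1 + (d + 1) + q))))) \<le> 20 + 6 * B + 3 * q + b + d"
      if "a \<le> b" for a b q d :: nat using that nB(1) by simp
    ultimately show ?thesis by blast
  qed
  ultimately have "run program (st n) (20 + 6 * B + 3 * p B + B * parse_cost B + ?N) (mem xs)" by (rule run_weaken)
  moreover have "mem xs 0 = map bit_sym [satisfiable F]" by (simp add: xs_def search_state_def mem_def b)
  ultimately show ?thesis unfolding init by blast
qed

end

lemma polyb_room:
  "polyb (\<lambda>l. l + 4 + num_lits l + (depth lo l + 2) * block_size l + graph_length k lo l)"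
  unfolding num_lits_def depth_def block_size_def graph_length_def cnf_verts_def col_verts_def leaf_clauses_def
  by (intro polyb_intros)

lemma roomy_mono:
  assumes "n \<le> l"
  shows "roomy k lo n (l + 4 + num_lits l + (depth lo l + 2) * block_size l + graph_length k lo l)"
proof -
  have U: "num_lits n \<le> num_lits l" using assms by (simp add: num_lits_def)
  have d: "depth lo n \<le> depth lo l" unfolding depth_def by (rule mult_le_mono2[OF U])
  have b: "block_size n \<le> block_size l" unfolding block_size_def by (intro mult_le_mono U)
  have "(depth lo n + 2) * block_size n \<le> (depth lo l + 2) * block_size l" by (intro mult_le_mono b) (use d in simp)
  moreover have "leaf_clauses lo n \<le> leaf_clauses lo l" unfolding leaf_clauses_def by (intro mult_le_mono U order.refl)
  then have "cnf_verts k (n + 3) (leaf_clauses lo n + 3) \<le> cnf_verts k (l + 3) (leaf_clauses lo l + 3)"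
    unfolding cnf_verts_def col_verts_def using assms by (intro mult_le_mono2) simp
  then have "graph_length k lo n \<le> graph_length k lo l"
    unfolding graph_length_def by (intro add_mono mult_le_mono order.refl)
  ultimately show ?thesis using U assms unfolding roomy_def by linarith
qed

text \<open>The machine is fixed before \<open>\<tau>\<close> and \<open>N\<close>, so a time bound
  for the subroutine that varies with n can be inserted afterwards.\<close>

theorem sparsified_sat:
  assumes k: "k \<ge> 2" and lo: "1 \<le> lo" and M: "wf_tm M"
  shows "\<exists>M' P. wf_tm M' \<and> polyb P \<and> (\<forall>n F \<tau> N. (n, F) \<in> sat3_instances \<and> hom_solver M k lo n \<tau> \<and> node_bound lo N \<longrightarrow>
    computes_within M' (enc_cnf (n, F)) [satisfiable F] (N (depth lo n) * (\<tau> + 1) * P (length (enc_cnf (n, F)))))"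
proof -
  obtain c1 p1 n1 where 1: "polyb p1" "mono p1" "\<forall>n\<ge>n1. \<forall>S\<ge>3. wf_com n S c1" "assigner c1 p1 3 (\<lambda>xs. block (num_lits (length (xs ! 1))) {})"
    using assignable_zero unfolding assignable_def by blast
  obtain c2 p2 n2 where 2: "polyb p2" "mono p2" "\<forall>n\<ge>n2. \<forall>S\<ge>3. wf_com n S c2" "assigner c2 p2 2 (\<lambda>xs. mark (length (xs ! 1)) {})"
    using assignable_mark_empty unfolding assignable_def by blast
  obtain c3 p3 n3 where 3: "polyb p3" "mono p3" "\<forall>n\<ge>n3. \<forall>S\<ge>3. wf_com n S c3"
    "assigner c3 p3 3 (\<lambda>xs. add_clause (length (xs ! 1)) (xs ! 2) (xs ! 3))"
    using assignable_add_clause unfolding assignable_def by blast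
  obtain c4 p4 n4 where 4: "polyb p4" "mono p4" "\<forall>n\<ge>n4. \<forall>S\<ge>3. wf_com n S c4"
    "assigner c4 p4 2 (\<lambda>xs. map (\<lambda>i. bit_at (xs ! 2) i \<or> i = length (xs ! 6)) [0..<num_lits (length (xs ! 1))])"
    using assignable_literal unfolding assignable_def by blast
  obtain c5 p5 n5 where 5: "polyb p5" "mono p5" "\<forall>n\<ge>n5. \<forall>S\<ge>3. wf_com n S c5"
    "assigner c5 p5 4 (\<lambda>xs. [flower lo (length (xs ! 1)) (xs ! 3)])"
    using assignable_flower[of lo] unfolding assignable_def by blast
  obtain c6 p6 n6 where 6: "polyb p6" "mono p6" "\<forall>n\<ge>n6. \<forall>S\<ge>3. wf_com n S c6"
    "assigner c6 p6 3 (\<lambda>xs. branch lo (length (xs ! 1)) (xs ! 3))"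
    using assignable_branch[of lo] unfolding assignable_def by blast
  obtain c7 p7 n7 where 7: "polyb p7" "mono p7" "\<forall>n\<ge>n7. \<forall>S\<ge>3. wf_com n S c7"
    "assigner c7 p7 5 (\<lambda>xs. enc_graph (leaf_graph k lo (length (xs ! 1)) (xs ! 3)))"
    using assignable_graph[of k lo] unfolding assignable_def by blast
  obtain c8 p8 n8 where 8: "polyb p8" "mono p8" "\<forall>n\<ge>n8. \<forall>S\<ge>3. wf_com n S c8"
    "assigner c8 p8 3 (\<lambda>xs. drop (block_size (length (xs ! 1))) (xs ! 3))"
    using assignable_drop unfolding assignable_def by blast
  obtain c9 p9 n9 where 9: "polyb p9" "mono p9" "\<forall>n\<ge>n9. \<forall>S\<ge>3. wf_com n S c9" "assigner c9 p9 0 (\<lambda>xs. [bit_at (xs ! 4) 0])"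
    using assignable_out unfolding assignable_def by blast
  define p where "p B = p1 B + p2 B + p3 B + p4 B + p5 B + p6 B + p7 B + p8 B + p9 B + 2 * B + 1" for B
  have pp: "polyb p" unfolding p_def by (intro polyb_intros 1 2 3 4 5 6 7 8 9)
  interpret S: sparsifier k lo M p c1 c2 c3 c4 c5 c6 c7 c8 c9
  proof
    show "assigner c1 p 3 (\<lambda>xs. block (num_lits (length (xs ! 1))) {})" by (rule assigner_mono[OF 1(4)]) (simp add: p_def)
    show "assigner c2 p 2 (\<lambda>xs. mark (length (xs ! 1)) {})" by (rule assigner_mono[OF 2(4)]) (simp add: p_def)
    show "assigner c3 p 3 (\<lambda>xs. add_clause (length (xs ! 1)) (xs ! 2) (xs ! 3))" by (rule assigner_mono[OF 3(4)]) (simp add: p_def)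
    show "assigner c4 p 2 (\<lambda>xs. map (\<lambda>i. bit_at (xs ! 2) i \<or> i = length (xs ! 6)) [0..<num_lits (length (xs ! 1))])"
      by (rule assigner_mono[OF 4(4)]) (simp add: p_def)
    show "assigner c5 p 4 (\<lambda>xs. [flower lo (length (xs ! 1)) (xs ! 3)])" by (rule assigner_mono[OF 5(4)]) (simp add: p_def)
    show "assigner c6 p 3 (\<lambda>xs. branch lo (length (xs ! 1)) (xs ! 3))" by (rule assigner_mono[OF 6(4)]) (simp add: p_def)
    show "assigner c7 p 5 (\<lambda>xs. enc_graph (leaf_graph k lo (length (xs ! 1)) (xs ! 3)))" by (rule assigner_mono[OF 7(4)]) (simp add: p_def)
    show "assigner c8 p 3 (\<lambda>xs. drop (block_size (length (xs ! 1))) (xs ! 3))" by (rule assigner_mono[OF 8(4)]) (simp add: p_def)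
    show "assigner c9 p 0 (\<lambda>xs. [bit_at (xs ! 4) 0])" by (rule assigner_mono[OF 9(4)]) (simp add: p_def)
    show "2 * B + 1 \<le> p B" for B by (simp add: p_def)
  qed (use k lo M in auto)
  define n0 where "n0 = n1 + n2 + n3 + n4 + n5 + n6 + n7 + n8 + n9 + left_reg (tapes M) + 10"
  define S0 where "S0 = syms M + states M + 4"
  have S0: "S0 \<ge> 3" by (simp add: S0_def)
  have call: "wf_com n0 S0 (call M)" by (rule wf_call[OF M]) (simp_all add: n0_def S0_def)
  have wfs: "wf_com n0 S0 c1" "wf_com n0 S0 c2" "wf_com n0 S0 c3" "wf_com n0 S0 c4" "wf_com n0 S0 c5" "wf_com n0 S0 c6"
    "wf_com n0 S0 c7" "wf_com n0 S0 c8" "wf_com n0 S0 c9"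
    using 1(3) 2(3) 3(3) 4(3) 5(3) 6(3) 7(3) 8(3) 9(3) S0 by (simp_all add: n0_def)
  have n10: "10 \<le> n0" by (simp add: n0_def)
  have "wf_com n0 S0 S.program"
    using wfs call n10 S0
    by (simp add: S.program_def S.parse_def S.literal_com_def S.clause_com_def S.search_def S.node_com_def wf_clear)
  from com_to_tm[OF this _ S0] have "\<exists>M'. wf_tm M' \<and> (\<forall>x y t s'. run S.program (input_regs x) t s' \<and> s' 0 = map bit_sym y \<longrightarrow>
      computes_within M' x y (t + length y + 1))"
    using n10 by simp
  then obtain M' where M': "wf_tm M'"
    "\<And>x y t s'. run S.program (input_regs x) t s' ==> s' 0 = map bit_sym y ==> computes_within M' x y (t + length y + 1)"
    by blast
  define A where "A B = 22 + 6 * B + 3 * p B + B * (20 + 8 * B + 2 * p B)" for B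
  define E where "E B = 3 * p B + 11 + 100 * (tapes M + 1) * (B + 2)" for B
  define room where "room l = l + 4 + num_lits l + (depth lo l + 2) * block_size l + graph_length k lo l" for l
  have room: "polyb room" unfolding room_def by (rule polyb_room)
  have "polyb (\<lambda>B. A B + E B)" unfolding A_def E_def by (intro polyb_intros pp)
  from polyb_compose[OF this room] have P: "polyb (\<lambda>l. A (room l) + E (room l))" .
  have "computes_within M' (enc_cnf (n, F)) [satisfiable F]
      (N (depth lo n) * (\<tau> + 1) * (A (room (length (enc_cnf (n, F)))) + E (room (length (enc_cnf (n, F))))))"
    if inst: "(n, F) \<in> sat3_instances" and ok: "hom_solver M k lo n \<tau>" and N: "node_bound lo N" for n F \<tau> N
  proof -
    define B where "B = room (length (enc_cnf (n, F)))"
    have "roomy k lo n B" unfolding B_def room_def by (rule roomy_mono) simp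
    moreover have "length (enc_cnf (n, F)) + 3 \<le> B" by (simp add: B_def room_def)
    ultimately obtain s' where s': "run S.program (input_regs (enc_cnf (n, F)))
      (20 + 6 * B + 3 * p B + B * S.parse_cost B + N (depth lo n) * (S.node_cost B \<tau> + 1)) s'" "s' 0 = map bit_sym [satisfiable F]"
      using S.run_program[OF inst ok N] by blast
    define X where "X = N (depth lo n) * (\<tau> + 1)"
    have "1 \<le> N (depth lo n)" using N by (simp add: node_bound_def)
    then have X: "1 \<le> X" by (simp add: X_def)
    have "\<tau> + B + 1 \<le> (\<tau> + 1) * (B + 2)" by (simp add: algebra_simps)
    then have "100 * (tapes M + 1) * (\<tau> + B + 1) \<le> 100 * (tapes M + 1) * ((\<tau> + 1) * (B + 2))" by (rule mult_le_mono2)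
    moreover have "3 * p B + 11 \<le> (\<tau> + 1) * (3 * p B + 11)" by simp
    ultimately have "S.node_cost B \<tau> + 1 \<le> (\<tau> + 1) * E B"
      unfolding S.node_cost_def E_def by (simp add: algebra_simps)
    from mult_le_mono2[OF this, of "N (depth lo n)"] have "N (depth lo n) * (S.node_cost B \<tau> + 1) \<le> X * E B"
      by (simp only: X_def mult.assoc)
    moreover have "20 + 6 * B + 3 * p B + B * S.parse_cost B + 2 = A B" by (simp add: A_def S.parse_cost_def)
    moreover have "A B \<le> X * A B" using X by simp
    ultimately have "20 + 6 * B + 3 * p B + B * S.parse_cost B + N (depth lo n) * (S.node_cost B \<tau> + 1) + length [satisfiable F] + 1 \<le> X * (A B + E B)"
      unfolding add_mult_distrib2 list.size by linarith
    from computes_within_mono[OF M'(2)[OF s'] this] show ?thesis by (simp only: X_def B_def)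
  qed
  then show ?thesis using M'(1) P by blast
qed

section \<open>The Exponential Time Hypothesis\<close>

text \<open>The recurrence is solved by 2 * exp (r * y) - 1 provided that exp (-y) + exp (-g * y)
  \<le> 1. With y of order 1 / lo, the depth times y stays constant per variable while g * y grows
  like lo, so a large lo works.\<close>

lemma node_bound_exists:
  assumes "\<epsilon> > (0::real)"
  shows "\<exists>lo N. 1 \<le> lo \<and> node_bound lo N \<and> (\<forall>n. real (N (depth lo n)) \<le> 2 * 2 powr (\<epsilon> * real (n + 3)))"
proof -
  \<comment> \<open>The denominator 6 makes \<open>depth lo n * y\<close> equal to \<epsilon> * (n +
    3) * ln 2.\<close>
  define a where "a = \<epsilon> * ln 2 / 6"
  have a: "a > 0" using assms by (simp add: a_def)
  \<comment> \<open>This size makes the quadratic Taylor term (a * L)^2 / 2 of exp (a * L) at least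
    54 * L / a, which is 1 / y.\<close>
  obtain lo0 :: nat where lo0: "108 / a ^ 3 \<le> real lo0" using real_arch_simple by blast
  define lo where "lo = lo0 + 1"
  define L where "L = real lo"
  have L: "L \<ge> 1" "108 / a ^ 3 \<le> L" using lo0 by (simp_all add: L_def lo_def)
  define y where "y = a / (54 * L)"
  have y: "y > 0" using a L by (simp add: y_def)
  define g where "g = 54 * lo * lo"
  have gy: "real g * y = a * L" using L by (simp add: g_def y_def L_def)
  \<comment> \<open>The two exponentials are bounded by 1 / (1 + y) and y / (1 + y).\<close>
  have key: "exp (- y) + exp (- (a * L)) \<le> 1"
  proof -
    have "108 \<le> L * a ^ 3" using L(2) a by (simp add: field_simps)
    then have "108 * L \<le> L * a ^ 3 * L" using L by (intro mult_right_mono) auto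
    then have "54 * L / a \<le> (a * L)\<^sup>2 / 2" using a by (simp add: field_simps power2_eq_square power3_eq_cube)
    moreover have "1 + a * L + (a * L)\<^sup>2 / 2 \<le> exp (a * L)" by (rule exp_lower_Taylor_quadratic) (use a L in simp)
    moreover have "0 \<le> a * L" using a L by simp
    ultimately have "1 + 54 * L / a \<le> exp (a * L)" by linarith
    moreover have "1 + 54 * L / a = (1 + y) / y" using a L by (simp add: y_def field_simps)
    ultimately have "(1 + y) / y \<le> exp (a * L)" by simp
    then have "inverse (exp (a * L)) \<le> inverse ((1 + y) / y)" by (rule le_imp_inverse_le) (use y in simp)
    then have "exp (- (a * L)) \<le> y / (1 + y)" by (simp add: exp_minus)
    moreover have "inverse (exp y) \<le> inverse (1 + y)" by (rule le_imp_inverse_le[OF exp_ge_add_one_self]) (use y in simp)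
    then have "exp (- y) \<le> 1 / (1 + y)" by (simp add: exp_minus inverse_eq_divide)
    moreover have "1 / (1 + y) + y / (1 + y) = 1" using y by (simp add: field_simps)
    ultimately show ?thesis by linarith
  qed
  \<comment> \<open>The factor 2 and the -1 absorb the summand 1 of the recurrence: 1 + (2A - 1) +
    (2B - 1) = 2(A + B) - 1.\<close>
  define N where "N r = nat \<lfloor>2 * exp (real r * y) - 1\<rfloor>" for r
  have ge1: "1 \<le> exp (real r * y)" for r using y by simp
  have Nr: "real (N r) \<le> 2 * exp (real r * y) - 1" for r
    unfolding N_def by (rule of_nat_floor) (use ge1[of r] in linarith)
  have "1 \<le> N r" for r
  proof -
    have "real 1 \<le> 2 * exp (real r * y) - 1" using ge1[of r] by simp
    then show ?thesis unfolding N_def by (rule le_nat_floor)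
  qed
  moreover have "1 + N (r - 1) + N (r - g) \<le> N r" if r: "r \<ge> g" for r
  proof -
    have "1 \<le> g" by (simp add: g_def lo_def)
    then have "real (r - 1) * y = real r * y + - y" "real (r - g) * y = real r * y + - (a * L)"
      using r gy[symmetric] by (simp_all add: of_nat_diff algebra_simps)
    then have "exp (real (r - 1) * y) + exp (real (r - g) * y) = exp (real r * y) * (exp (- y) + exp (- (a * L)))"
      by (simp only: exp_add distrib_left)
    also have "\<dots> \<le> exp (real r * y) * 1" by (rule mult_left_mono[OF key]) simp
    finally have "real (1 + N (r - 1) + N (r - g)) \<le> 2 * exp (real r * y) - 1"
      using Nr[of "r - 1"] Nr[of "r - g"] by simp
    then show ?thesis unfolding N_def[of r] by (rule le_nat_floor)
  qed
  ultimately have "node_bound lo N" unfolding node_bound_def g_def by blast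
  moreover have "real (N (depth lo n)) \<le> 2 * 2 powr (\<epsilon> * real (n + 3))" for n
  proof -
    have "real (depth lo n) * y = \<epsilon> * real (n + 3) * ln 2"
      using L by (simp add: depth_def num_lits_def y_def a_def L_def field_simps)
    then have "exp (real (depth lo n) * y) = 2 powr (\<epsilon> * real (n + 3))" by (simp add: powr_def)
    then show ?thesis using Nr[of "depth lo n"] by simp
  qed
  ultimately show ?thesis by (intro exI[of _ lo] exI[of _ N]) (simp add: lo_def)
qed

text \<open>One half of the exponent absorbs f and the other half the polynomial factor; the
  finitely many exceptional n go into the constant.\<close>

lemma subexp_le_exp:
  fixes f T :: "nat => real"
  assumes f: "f \<in> o(\<lambda>n. real n)" and T: "T \<in> O(\<lambda>n. 2 powr f n * real n ^ c)" and \<epsilon>: "\<epsilon> > 0"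
  shows "\<exists>C\<ge>0. \<forall>n. T n \<le> C * 2 powr (\<epsilon> * real n)"
proof -
  define s where "s = \<epsilon> / 2 * ln 2"
  have s: "s > 0" using \<epsilon> by (simp add: s_def)
  have e1: "eventually (\<lambda>n. \<bar>f n\<bar> \<le> \<epsilon> / 2 * \<bar>real n\<bar>) sequentially"
    using landau_o.smallD[OF f, of "\<epsilon> / 2"] \<epsilon> by simp
  have lim: "filterlim (\<lambda>n. s * real n) at_top sequentially"
    by (rule filterlim_tendsto_pos_mult_at_top[OF tendsto_const s filterlim_real_sequentially])
  have "((\<lambda>n. (s * real n) ^ c / exp (s * real n)) \<longlongrightarrow> 0) sequentially"
    by (rule filterlim_compose[OF tendsto_power_div_exp_0 lim])
  then have e2: "eventually (\<lambda>n. (s * real n) ^ c / exp (s * real n) < 1) sequentially"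
    by (rule order_tendstoD) simp
  obtain C0 where C0: "C0 > 0" "eventually (\<lambda>n. norm (T n) \<le> C0 * norm (2 powr f n * real n ^ c)) sequentially"
    using landau_o.bigE[OF T] by blast
  define C1 where "C1 = C0 / s ^ c"
  have "eventually (\<lambda>n. \<bar>T n\<bar> \<le> C1 * 2 powr (\<epsilon> * real n)) sequentially"
    using e1 e2 C0(2)
  proof eventually_elim
    case (elim n)
    have "2 powr f n \<le> 2 powr (\<epsilon> / 2 * real n)" using elim(1) by (intro powr_mono) auto
    moreover have "real n ^ c \<le> exp (s * real n) / s ^ c"
      using elim(2) s by (simp add: power_mult_distrib field_simps)
    ultimately have "2 powr f n * real n ^ c \<le> 2 powr (\<epsilon> / 2 * real n) * (exp (s * real n) / s ^ c)"
      by (intro mult_mono) auto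
    also have "exp (s * real n) = 2 powr (\<epsilon> / 2 * real n)" by (simp add: powr_def s_def mult_ac)
    also have "2 powr (\<epsilon> / 2 * real n) * (2 powr (\<epsilon> / 2 * real n) / s ^ c) = 2 powr (\<epsilon> * real n) / s ^ c"
      by (simp add: powr_add[symmetric])
    finally have "C0 * (2 powr f n * real n ^ c) \<le> C0 * (2 powr (\<epsilon> * real n) / s ^ c)"
      using C0(1) by (intro mult_left_mono) auto
    moreover have "\<bar>T n\<bar> \<le> C0 * (2 powr f n * real n ^ c)" using elim(3) by (simp add: abs_mult)
    ultimately show ?case by (simp add: C1_def)
  qed
  then obtain n0 where n0: "\<And>n. n \<ge> n0 ==> \<bar>T n\<bar> \<le> C1 * 2 powr (\<epsilon> * real n)" by (auto simp: eventually_sequentially)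
  define C where "C = C1 + (\<Sum>n<n0. \<bar>T n\<bar>)"
  have C1: "C1 \<ge> 0" using C0(1) s by (simp add: C1_def)
  have S0: "0 \<le> (\<Sum>n<n0. \<bar>T n\<bar>)" by (rule sum_nonneg) simp
  have "T n \<le> C * 2 powr (\<epsilon> * real n)" for n
  proof (cases "n < n0")
    case True
    have "\<bar>T n\<bar> \<le> (\<Sum>n<n0. \<bar>T n\<bar>)" by (rule member_le_sum) (use True in auto)
    then have "T n \<le> C" using C1 by (simp add: C_def)
    also have "\<dots> \<le> C * 2 powr (\<epsilon> * real n)"       using mult_left_mono[of 1 "2 powr (\<epsilon> * real n)" C] C1 S0 \<epsilon> by (simp add: C_def ge_one_powr_ge_zero)
    finally show ?thesis .
  next
    case False
    have "C1 * 2 powr (\<epsilon> * real n) \<le> C * 2 powr (\<epsilon> * real n)" using S0 by (intro mult_right_mono) (auto simp: C_def)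
    moreover have "\<bar>T n\<bar> \<le> C1 * 2 powr (\<epsilon> * real n)" using n0[of n] False by simp
    ultimately show ?thesis by linarith
  qed
  moreover have "C \<ge> 0" using C1 S0 by (simp add: C_def)
  ultimately show ?thesis by blast
qed

text \<open>Linearity is the purpose of sparsification: time subexponential in the number of
  vertices becomes subexponential in the number of variables.\<close>

lemma leaf_graph_verts_linear: "\<exists>K\<ge>1. \<forall>n. cnf_verts k (n + 3) (leaf_clauses lo n + 3) \<le> K * (n + 1)"
proof -
  define E where "E = 1 + 27 * lo + 27 * (54 * lo * lo)"
  have "cnf_verts k (n + 3) (leaf_clauses lo n + 3) = 4 * k * (2 * n + 432 * E * n + 1296 * E + 34)" for n
    unfolding cnf_verts_def col_verts_def leaf_clauses_def E_def[symmetric] num_lits_def by (simp add: algebra_simps)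
  also have "\<And>n. 4 * k * (2 * n + 432 * E * n + 1296 * E + 34) \<le> 4 * k * ((1296 * E + 34) * (n + 1))"
    by (intro mult_le_mono2) (simp add: algebra_simps)
  finally have le: "cnf_verts k (n + 3) (leaf_clauses lo n + 3) \<le> 4 * k * ((1296 * E + 34) * (n + 1))" for n .
  have "cnf_verts k (n + 3) (leaf_clauses lo n + 3) \<le> (4 * k * (1296 * E + 34) + 1) * (n + 1)" for n
    using le[of n] unfolding add_mult_distrib mult.assoc by linarith
  then show ?thesis by (intro exI[of _ "4 * k * (1296 * E + 34) + 1"]) auto
qed

text \<open>The hypothesis measures formulas by variables and clauses, the program by the length of
  an encoding with unary indices; the two are polynomially related.\<close>

lemma length_enc_cnf:
  assumes "(n, F) \<in> sat3_instances"
  shows "length (enc_cnf (n, F)) + 2 \<le> 20 * (n + length F + 1) ^ 2"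
proof -
  have lit: "length (concat (map enc_literal C)) \<le> length C * (n + 2)" if "\<forall>(b, v)\<in>set C. v < n" for C
    using that by (induction C) auto
  have cl: "length (enc_clause C) \<le> 3 * n + 7" if C: "C \<in> set F" for C
  proof -
    have "length C \<le> 3" "\<forall>(b, v)\<in>set C. v < n" using assms C by (auto simp: sat3_instances_def)
    then have "length (concat (map enc_literal C)) \<le> 3 * (n + 2)" using lit[of C] mult_le_mono1[of "length C" 3 "n + 2"] by linarith
    then show ?thesis by (simp add: enc_clause_def)
  qed
  have "length (concat (map enc_clause F)) \<le> length F * (3 * n + 7)"
    using cl by (induction F) (auto simp: add_mono)
  then have "length (enc_cnf (n, F)) + 2 \<le> n + 3 + length F * (3 * n + 7)" by simp
  also have "\<dots> \<le> 20 * (n + length F + 1) ^ 2" by (simp add: power2_eq_square algebra_simps)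
  finally show ?thesis .
qed

text \<open>One half of \<delta> pays for the number of nodes of the search and the other half for a
  call at a leaf. The order of choices matters: lo depends on \<delta>, the number K of vertices per
  variable on lo, and the accuracy \<epsilon> on K.\<close>

theorem subexp_hom_cycle_imp_not_ETH:
  assumes k: "k \<ge> 2"
    and sub: "subexp_solvable enc_graph (radius_graphs (k + 1)) (hom_exists (cycle_graph (2 * k + 1))) num_verts"
  shows "\<not> ETH"
proof -
  obtain f c T M where f: "f \<in> o(\<lambda>n. real n)" and T: "T \<in> O(\<lambda>n. 2 powr f n * real n ^ c)" and M: "wf_tm M"
    and solve: "\<And>I. I \<in> radius_graphs (k + 1) ==> \<exists>t. real t \<le> T (num_verts I) \<and>
      computes_within M (enc_graph I) [hom_exists (cycle_graph (2 * k + 1)) I] t"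
    using sub unfolding subexp_solvable_def solvable_in_time_def by blast
  have "\<exists>c. solvable_in_time enc_cnf sat3_instances (\<lambda>(n, F). satisfiable F)
       (\<lambda>(n, F). real c * 2 powr (\<delta> * real n) * real (n + length F + 1) ^ c)" if \<delta>: "\<delta> > 0" for \<delta> :: real
  proof -
    obtain lo N where lo: "1 \<le> lo" and N: "node_bound lo N" "\<And>n. real (N (depth lo n)) \<le> 2 * 2 powr (\<delta> / 2 * real (n + 3))"
      using node_bound_exists[of "\<delta> / 2"] \<delta> by auto
    obtain K where K: "K \<ge> 1" "\<And>n. cnf_verts k (n + 3) (leaf_clauses lo n + 3) \<le> K * (n + 1)"
      using leaf_graph_verts_linear by blast
    define \<epsilon> where "\<epsilon> = \<delta> / (2 * real K)"
    have \<epsilon>: "\<epsilon> > 0" "\<epsilon> * real K = \<delta> / 2" using \<delta> K(1) by (simp_all add: \<epsilon>_def)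
    obtain C where C: "C \<ge> 0" "\<And>n. T n \<le> C * 2 powr (\<epsilon> * real n)" using subexp_le_exp[OF f T \<epsilon>(1)] by blast
    obtain M' P where M': "wf_tm M'" "polyb P" and alg: "\<And>n F \<tau> N. (n, F) \<in> sat3_instances ==> hom_solver M k lo n \<tau> ==>
      node_bound lo N ==> computes_within M' (enc_cnf (n, F)) [satisfiable F] (N (depth lo n) * (\<tau> + 1) * P (length (enc_cnf (n, F))))"
      using sparsified_sat[OF k lo M] by blast
    obtain d where d: "\<And>l. P l \<le> (l + 2) ^ d" using M'(2) unfolding polyb_def by blast
    \<comment> \<open>The bound C * 2 powr (\<epsilon> * N) at N = K * (n + 1) vertices, where
      \<epsilon> * K = \<delta> / 2.\<close>
    define \<tau> where "\<tau> n = nat \<lfloor>C * 2 powr (\<delta> / 2 * real (n + 1))\<rfloor>" for n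
    have \<tau>: "real (\<tau> n) \<le> C * 2 powr (\<delta> / 2 * real (n + 1))" for n using C(1) by (simp add: \<tau>_def)
    have ok: "hom_solver M k lo n (\<tau> n)" for n
      unfolding hom_solver_def
    proof
      fix W
      have "leaf_graph k lo n W \<in> radius_graphs (k + 1)"
        unfolding leaf_graph_def by (rule cnf_graph_radius[OF k]) (intro allI impI leaf_lit_less)
      from solve[OF this] obtain t where t: "real t \<le> T (num_verts (leaf_graph k lo n W))"
        "computes_within M (enc_graph (leaf_graph k lo n W)) [hom_exists (cycle_graph (2 * k + 1)) (leaf_graph k lo n W)] t" by blast
      have "real (num_verts (leaf_graph k lo n W)) \<le> real (K * (n + 1))"
        unfolding leaf_graph_def num_verts_cnf_graph of_nat_le_iff by (rule K(2))
      then have "\<epsilon> * real (num_verts (leaf_graph k lo n W)) \<le> \<epsilon> * real (K * (n + 1))" using \<epsilon>(1) by (intro mult_left_mono) auto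
      also have "\<dots> = \<delta> / 2 * real (n + 1)" unfolding \<epsilon>(2)[symmetric] by (simp only: of_nat_mult mult.assoc)
      finally have "C * 2 powr (\<epsilon> * real (num_verts (leaf_graph k lo n W))) \<le> C * 2 powr (\<delta> / 2 * real (n + 1))"
        using C(1) by (intro mult_left_mono powr_mono) auto
      then have "real t \<le> C * 2 powr (\<delta> / 2 * real (n + 1))" using t(1) C(2)[of "num_verts (leaf_graph k lo n W)"] by linarith
      then have "t \<le> \<tau> n" unfolding \<tau>_def by (rule le_nat_floor)
      then show "computes_within M (enc_graph (leaf_graph k lo n W)) [hom_exists (cycle_graph (2 * k + 1)) (leaf_graph k lo n W)] (\<tau> n)"
        using computes_within_mono t(2) by blast
    qed
    define R where "R = 2 * (C + 1) * 2 powr (2 * \<delta>) * 20 ^ d"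
    obtain c0 :: nat where c0: "R \<le> real c0" using real_arch_simple by blast
    define c' where "c' = max c0 (2 * d)"
    have "real (N (depth lo n) * (\<tau> n + 1) * P (length (enc_cnf (n, F)))) \<le> real c' * 2 powr (\<delta> * real n) * real (n + length F + 1) ^ c'"
      if inst: "(n, F) \<in> sat3_instances" for n F
    proof -
      define s where "s = n + length F + 1"
      have "P (length (enc_cnf (n, F))) \<le> (length (enc_cnf (n, F)) + 2) ^ d" by (rule d)
      also have "\<dots> \<le> (20 * s ^ 2) ^ d" unfolding s_def by (intro power_mono length_enc_cnf[OF inst]) simp
      finally have "real (P (length (enc_cnf (n, F)))) \<le> real ((20 * s ^ 2) ^ d)" unfolding of_nat_le_iff .
      then have Ps: "real (P (length (enc_cnf (n, F)))) \<le> 20 ^ d * real s ^ (2 * d)" by (simp add: power_mult_distrib power_mult)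
      have "1 \<le> 2 powr (\<delta> / 2 * real (n + 1))" using \<delta> by (intro ge_one_powr_ge_zero) auto
      then have "real (\<tau> n + 1) \<le> (C + 1) * 2 powr (\<delta> / 2 * real (n + 1))" using \<tau>[of n] by (simp add: algebra_simps)
      then have "real (N (depth lo n)) * real (\<tau> n + 1) \<le> (2 * 2 powr (\<delta> / 2 * real (n + 3))) * ((C + 1) * 2 powr (\<delta> / 2 * real (n + 1)))"
        using N(2)[of n] by (intro mult_mono) auto
      also have "\<dots> = 2 * (C + 1) * (2 powr (\<delta> / 2 * real (n + 3)) * 2 powr (\<delta> / 2 * real (n + 1)))" by (simp only: mult_ac)
      \<comment> \<open>The additive constants 3 and 1 in the exponents contribute the factor 2 powr
        (2 * \<delta>).\<close>
      also have "2 powr (\<delta> / 2 * real (n + 3)) * 2 powr (\<delta> / 2 * real (n + 1)) = 2 powr (2 * \<delta>) * 2 powr (\<delta> * real n)"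
      proof -
        have "\<delta> / 2 * real (n + 3) + \<delta> / 2 * real (n + 1) = 2 * \<delta> + \<delta> * real n" by (simp add: field_simps)
        then show ?thesis by (simp only: powr_add[symmetric])
      qed
      finally have NT: "real (N (depth lo n)) * real (\<tau> n + 1) \<le> 2 * (C + 1) * (2 powr (2 * \<delta>) * 2 powr (\<delta> * real n))" .
      have "real (N (depth lo n)) * real (\<tau> n + 1) * real (P (length (enc_cnf (n, F)))) \<le>
          (2 * (C + 1) * (2 powr (2 * \<delta>) * 2 powr (\<delta> * real n))) * (20 ^ d * real s ^ (2 * d))"
        by (rule mult_mono[OF NT Ps]) (use C(1) in auto)
      also have "\<dots> = R * 2 powr (\<delta> * real n) * real s ^ (2 * d)" by (simp add: R_def)
      also have "\<dots> \<le> real c' * 2 powr (\<delta> * real n) * real s ^ c'"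
      proof (intro mult_mono)
        show "R \<le> real c'" using c0 by (simp add: c'_def)
        show "real s ^ (2 * d) \<le> real s ^ c'" by (rule power_increasing) (simp_all add: c'_def s_def)
      qed auto
      finally show ?thesis by (simp only: of_nat_mult s_def)
    qed
    then have "solvable_in_time enc_cnf sat3_instances (\<lambda>(n, F). satisfiable F)
       (\<lambda>(n, F). real c' * 2 powr (\<delta> * real n) * real (n + length F + 1) ^ c')"
      unfolding solvable_in_time_def using M'(1) alg[OF _ ok N(1)] by (intro exI[of _ M']) fast
    then show ?thesis ..
  qed
  then show ?thesis unfolding ETH_def by blast
qed

lemma NP_hard_on_mono: "NP_hard_on enc D Q ==> D \<subseteq> D' ==> NP_hard_on enc D' Q"
  unfolding NP_hard_on_def by (meson subsetD)

lemma subexp_solvable_antimono: "subexp_solvable enc D Q size_of ==> D' \<subseteq> D ==> subexp_solvable enc D' Q size_of"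
  unfolding subexp_solvable_def solvable_in_time_def by (meson subsetD)

theorem theorem3:
  fixes k :: nat
  assumes "k \<ge> 2"
  shows "NP_hard_on enc_graph (radius_graphs (k + 1)) (hom_exists (cycle_graph (2 * k + 1)))
    \<and> NP_hard_on enc_graph (diameter_at_most_graphs (2 * k + 2)) (hom_exists (cycle_graph (2 * k + 1)))
    \<and> (ETH \<longrightarrow>
        \<not> subexp_solvable enc_graph (radius_graphs (k + 1))
            (hom_exists (cycle_graph (2 * k + 1))) num_verts
        \<and> \<not> subexp_solvable enc_graph (diameter_at_most_graphs (2 * k + 2))
            (hom_exists (cycle_graph (2 * k + 1))) num_verts)"
proof -
  have sub: "radius_graphs (k + 1) \<subseteq> diameter_at_most_graphs (2 * k + 2)"
    using radius_subset_diameter[of "k + 1"] by simp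
  note hard = hom_cycle_NP_hard[OF assms]
  note eth = subexp_hom_cycle_imp_not_ETH[OF assms]
  show ?thesis
    using hard NP_hard_on_mono[OF hard sub] eth subexp_solvable_antimono[OF _ sub] by blast
qed

end
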